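(* The pair $(G_{\rm CP},\mathcal D_{\rm CP})$ is a finite centerless $3$-transposition group. The generating set $\mathcal D_{\rm CP}$ is one conjugacy class of size $306936$. Its diagram (the graph on $\mathcal D_{\rm CP}$ in which adjacency means that the product has order $3$) has degree $275264$; the commuting codiagram (the graph on $\mathcal D_{\rm CP}$ in which distinct commuting elements are adjacent) has degree $31671$.
   Context: Code and loop. $I$ is a set with $|I|=24$; $\mathcal C\subseteq\mathbb F_2^I$ is the extended binary Golay code (words identified with supports); $\mathbf 1$ is the all-one word; octads are the words of weight $8$. $P$ is Parker's loop: the Moufang loop with a central element $-1$ of order $2$ and a surjective homomorphism $P\to\mathcal C$, $d\mapsto\bar d$, with kernel $\{\pm1\}$, such that $d^2=(-1)^{|\bar d|/4}$, $de=(-1)^{|\bar d\cap\bar e|/2}ed$, $(de)f=(-1)^{|\bar d\cap\bar e\cap\bar f|}d(ef)$. $-d$ means $(-1)d$. $\Omega\in P$ is a fixed lift of $\mathbf 1$ (it is central of order two). Algebra. $\mathbb E=\mathbb Q(\omega)$ with $\omega$ a primitive cube root of unity, $\mu_3=\{1,\omega,\omega^2\}$, $\vartheta=\omega-\bar\omega=\sqrt{-3}$. $A=U\oplus W$, where $U$ has $\mathbb E$-basis $u_i$ ($i\in I$) and $W$ is the $\mathbb E$-space spanned by symbols $x_d$ ($d\in P$, $\bar d$ an octad) subject only to $x_{-d}=-x_d$. The product $*$ is commutative and conjugate-bilinear, $(\alpha x+\beta y)*z=\bar\alpha(x*z)+\bar\beta(y*z)$, and is determined by: $128u_i*u_i=-81u_i+15\sum_{j\ne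 i}u_j$; $128u_i*u_j=15u_i+15u_j-\sum_{k\notin\{i,j\}}u_k$ ($i\ne j$); $16u_i*x_d=3x_d$ if $i\in\bar d$ and $=-x_d$ if $i\notin\bar d$; $2x_d*x_d=3\sum_{i\in\bar d}u_i-\sum_{i\notin\bar d}u_i$; and for $d\ne\pm f$: $2x_d*x_f=x_{df}$ if $|\bar d\cap\bar f|=4$, $=\vartheta x_{df\Omega}$ if $\bar d\cap\bar f=\varnothing$, $=0$ if $|\bar d\cap\bar f|=2$. The Hermitian form (linear in the first variable) has $(u_i,u_j)=\frac18\delta_{ij}$, $U\perp W$, $(x_d,x_d)=1$, $(x_d,x_{-d})=-1$, $(x_d,x_f)=0$ if $\bar d\ne\bar f$. Roots. For $r\in A$ put $\tau_r(x)=x*r-(r,x)r$ and $[r]=\mu_3r$ (the ray of $r$). The basic roots are $r_i=-7u_i+\sum_{j\ne i}u_j$ ($i\in I$). For an octad $O$ let $X=I\setminus O$, $B_O=\{c\in\mathcal C:c\cap O=\varnothing\}$ (dimension $5$), $B_O^*=\operatorname{Hom}(B_O,\{\pm1\})$; choose a lift $o\in P$ of $O$ and a homomorphism $b\mapsto q_b$ from $B_O$ to $P$ with $\bar q_b=b$ and $q_X=\Omega o$ (these exist). The octadic roots over $O$ are, for $\chi\in B_O^*$, $$r_{O,\chi}=\tfrac12\Big(-\sum_{i\in O}u_i+\sum_{i\in X}u_i+\vartheta\chi(X)x_o+\sum_{b\in B_O\setminus\{0,X\}}\chi(b)x_{q_b}\Big).$$ For each 2-subset $p\subset I$ choose one pair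 of octads $F,F'$ with $F\cap F'=p$; the duadic roots over $p$ are the $1024$ products $r_{F,\chi}*r_{F',\chi'}$ ($\chi\in B_F^*$, $\chi'\in B_{F'}^*$). $\mathcal R$ is the set of rays of all basic, octadic and duadic roots; $|\mathcal R|=306936$. Group. Each $\tau_r$ with $[r]\in\mathcal R$ is a conjugate-linear involutory algebra automorphism of $A$ permuting $\mathcal R$; since $\tau_{\lambda r}=\lambda^2\tau_r$ for $\lambda\in\mu_3$, the induced permutation $d_{[r]}$ of $\mathcal R$ depends only on $[r]$. $\mathcal D_{\rm CP}=\{d_{[r]}:[r]\in\mathcal R\}$ and $G_{\rm CP}=\langle\mathcal D_{\rm CP}\rangle\le\operatorname{Sym}(\mathcal R)$. A $3$-transposition group is a pair consisting of a group and a generating conjugation-closed set of involutions any two of which have product of order at most $3$. *)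

theory Defs
  imports "HOL-Analysis.Analysis" "HOL-Algebra.Bij" "HOL-Algebra.Generated_Groups"
    "HOL-Algebra.Multiplicative_Group"
begin

section \<open>Groups generated by 3-transpositions\<close>

text \<open>
  The library order \<^const>\<open>group.ord\<close> is \<open>0\<close> for elements of infinite order, so
  ``order at most 3'' has to exclude \<open>0\<close>.
\<close>

definition three_transposition_group :: "('g, 'b) monoid_scheme \<Rightarrow> 'g set \<Rightarrow> bool" where
  "three_transposition_group G D \<longleftrightarrow>
     group G \<and> D \<subseteq> carrier G \<and> generate G D = carrier G \<and>
     (\<forall>g\<in>carrier G. \<forall>d\<in>D. g \<otimes>\<^bsub>G\<^esub> d \<otimes>\<^bsub>G\<^esub> inv\<^bsub>G\<^esub> g \<in> D) \<and>
     (\<forall>d\<in>D. group.ord G d = 2) \<and>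
     (\<forall>d\<in>D. \<forall>e\<in>D. group.ord G (d \<otimes>\<^bsub>G\<^esub> e) \<in> {1, 2, 3})"

definition group_center :: "('g, 'b) monoid_scheme \<Rightarrow> 'g set" where
  "group_center G = {z \<in> carrier G. \<forall>g\<in>carrier G. z \<otimes>\<^bsub>G\<^esub> g = g \<otimes>\<^bsub>G\<^esub> z}"

definition conjugacy_class :: "('g, 'b) monoid_scheme \<Rightarrow> 'g \<Rightarrow> 'g set" where
  "conjugacy_class G d = {g \<otimes>\<^bsub>G\<^esub> d \<otimes>\<^bsub>G\<^esub> inv\<^bsub>G\<^esub> g | g. g \<in> carrier G}"

definition diagram :: "('g, 'b) monoid_scheme \<Rightarrow> 'g set \<Rightarrow> ('g \<times> 'g) set" where
  "diagram G D = {(d, e) \<in> D \<times> D. group.ord G (d \<otimes>\<^bsub>G\<^esub> e) = 3}"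

definition commuting_codiagram :: "('g, 'b) monoid_scheme \<Rightarrow> 'g set \<Rightarrow> ('g \<times> 'g) set" where
  "commuting_codiagram G D =
     {(d, e) \<in> D \<times> D. d \<noteq> e \<and> d \<otimes>\<^bsub>G\<^esub> e = e \<otimes>\<^bsub>G\<^esub> d}"

definition graph_has_degree :: "'v set \<Rightarrow> ('v \<times> 'v) set \<Rightarrow> nat \<Rightarrow> bool" where
  "graph_has_degree V E k \<longleftrightarrow>
     (\<forall>v\<in>V. finite {w. (v, w) \<in> E} \<and> card {w. (v, w) \<in> E} = k)"


section \<open>The Golay code and Parker's loop\<close>

text \<open>
  The extended binary Golay code is, up to equivalence, the unique binary linear
  \<open>[24, 12, 8]\<close> code.  The coordinate set is the universe of the finite type \<open>'i\<close>; words of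
  \<open>\<bbbF>\<^sub>2\<^sup>I\<close> are identified with their supports, so addition is symmetric difference, and
  dimension 12 means \<open>2\<^sup>1\<^sup>2\<close> words.
\<close>

locale golay_code =
  fixes C :: "'i::finite set set"
  assumes card_index: "CARD('i) = 24"
    and zero_word: "{} \<in> C"
    and add_closed: "\<And>c d. c \<in> C \<Longrightarrow> d \<in> C \<Longrightarrow> sym_diff c d \<in> C"
    and card_code: "card C = 2 ^ 12"
    and min_weight: "Min (card ` (C - {{}})) = 8"
begin

definition octad :: "'i set \<Rightarrow> bool" where
  "octad K \<longleftrightarrow> K \<in> C \<and> card K = 8"

end

text \<open>
  A loop is a quasigroup with unit.  Any one of the four classical Moufang identities implies the
  other three.
\<close>

locale moufang_loop =
  fixes mult :: "'p \<Rightarrow> 'p \<Rightarrow> 'p" (infixl \<open>\<diamondop>\<close> 70)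
    and unit :: 'p (\<open>\<e>\<close>)
  assumes unit_left: "\<e> \<diamondop> d = d"
    and unit_right: "d \<diamondop> \<e> = d"
    and left_division: "\<exists>!y. d \<diamondop> y = e"
    and right_division: "\<exists>!y. y \<diamondop> d = e"
    and moufang: "c \<diamondop> (d \<diamondop> (c \<diamondop> e)) = ((c \<diamondop> d) \<diamondop> c) \<diamondop> e"
begin

definition central :: "'p \<Rightarrow> bool" where
  "central c \<longleftrightarrow> (\<forall>d. c \<diamondop> d = d \<diamondop> c) \<and>
     (\<forall>d e. (c \<diamondop> d) \<diamondop> e = c \<diamondop> (d \<diamondop> e) \<and> (d \<diamondop> c) \<diamondop> e = d \<diamondop> (c \<diamondop> e)
          \<and> (d \<diamondop> e) \<diamondop> c = d \<diamondop> (e \<diamondop> c))"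

end

text \<open>
  The loop has \<open>2\<^sup>1\<^sup>3\<close> elements; its underlying type is taken to be finite only so that it can index
  coordinate vectors below.  The element \<open>m1\<close> is \<open>-1\<close>.
\<close>

locale parker_loop = golay_code C + moufang_loop mult unit
  for C :: "'i::finite set set"
    and mult :: "'p::finite \<Rightarrow> 'p \<Rightarrow> 'p" (infixl \<open>\<diamondop>\<close> 70)
    and unit :: 'p (\<open>\<e>\<close>) +
  fixes m1 :: 'p and bar :: "'p \<Rightarrow> 'i set"
  assumes m1_central: "central m1"
    and m1_order: "m1 \<noteq> \<e>" "m1 \<diamondop> m1 = \<e>"
    and bar_mult: "bar (d \<diamondop> e) = sym_diff (bar d) (bar e)"
    and bar_range: "range bar = C"
    and bar_kernel: "{d. bar d = {}} = {\<e>, m1}"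
    and squaring: "d \<diamondop> d = (if even (card (bar d) div 4) then \<e> else m1)"
    and commuting: "d \<diamondop> e = (if even (card (bar d \<inter> bar e) div 2) then \<e> else m1) \<diamondop> (e \<diamondop> d)"
    and associating: "(d \<diamondop> e) \<diamondop> f =
           (if even (card (bar d \<inter> bar e \<inter> bar f)) then \<e> else m1) \<diamondop> (d \<diamondop> (e \<diamondop> f))"
begin

definition neg :: "'p \<Rightarrow> 'p" where
  "neg d = m1 \<diamondop> d"

end


section \<open>The algebra\<close>

text \<open>
  Vectors are coordinate functions on \<open>'i + 'p\<close>.  The space \<open>W\<close>, spanned by symbols \<open>x\<^sub>d\<close> subject
  only to \<open>x\<^sub>-\<^sub>d = - x\<^sub>d\<close>, is realized as the space of odd functions on the set of lifts of octads, with
  \<open>x\<^sub>d\<close> the function that is \<open>1\<close> at \<open>d\<close>, \<open>-1\<close> at \<open>-d\<close> and zero elsewhere.  A vector of \<open>A\<close> with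
  coordinates \<open>v\<close> thus equals
  \<open>(\<Sum>i. v\<^sub>i u\<^sub>i) + 1/2 (\<Sum>d. v\<^sub>d x\<^sub>d)\<close>, the last sum being over all lifts \<open>d\<close> of octads, two for each
  octad.  This is the origin of the factors \<open>1/2\<close> and \<open>1/4\<close> in the product and in the form.
\<close>

locale parker_algebra = parker_loop C mult unit m1 bar
  for C :: "'i::finite set set"
    and mult :: "'p::finite \<Rightarrow> 'p \<Rightarrow> 'p" (infixl \<open>\<diamondop>\<close> 70)
    and unit :: 'p (\<open>\<e>\<close>)
    and m1 :: 'p and bar :: "'p \<Rightarrow> 'i set" +
  fixes \<omega> :: complex and \<Omega> :: 'p
  assumes omega_root: "\<omega> ^ 3 = 1" "\<omega> \<noteq> 1"
    and bar_Omega: "bar \<Omega> = UNIV"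
begin

definition base_field :: "complex set" where
  "base_field = {of_rat a + of_rat b * \<omega> | a b. True}"

definition theta :: complex (\<open>\<theta>\<close>) where
  "\<theta> = \<omega> - cnj \<omega>"

definition lifts :: "'p set" where
  "lifts = {d. octad (bar d)}"

definition alg :: "(complex ^ ('i + 'p)) set" where
  "alg = {v. (\<forall>k. v $ k \<in> base_field) \<and> (\<forall>d. v $ Inr (neg d) = - (v $ Inr d))
           \<and> (\<forall>d. d \<notin> lifts \<longrightarrow> v $ Inr d = 0)}"

definition u_vec :: "'i \<Rightarrow> complex ^ ('i + 'p)" where
  "u_vec i = axis (Inl i) 1"

definition x_vec :: "'p \<Rightarrow> complex ^ ('i + 'p)" where
  "x_vec d = axis (Inr d) 1 - axis (Inr (neg d)) 1"

definition prod_uu :: "'i \<Rightarrow> 'i \<Rightarrow> complex ^ ('i + 'p)" where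
  "prod_uu i j = (1 / 128) *s
     (if i = j then (-81) *s u_vec i + 15 *s (\<Sum>k\<in>-{i}. u_vec k)
      else 15 *s u_vec i + 15 *s u_vec j - (\<Sum>k\<in>-{i, j}. u_vec k))"

definition prod_ux :: "'i \<Rightarrow> 'p \<Rightarrow> complex ^ ('i + 'p)" where
  "prod_ux i d = (1 / 16) *s (if i \<in> bar d then 3 *s x_vec d else - x_vec d)"

definition prod_xx :: "'p \<Rightarrow> 'p \<Rightarrow> complex ^ ('i + 'p)" where
  "prod_xx d f = (1 / 2) *s
     (if f = d then 3 *s (\<Sum>i\<in>bar d. u_vec i) - (\<Sum>i\<in>-bar d. u_vec i)
      else if f = neg d then - (3 *s (\<Sum>i\<in>bar d. u_vec i) - (\<Sum>i\<in>-bar d. u_vec i))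
      else if card (bar d \<inter> bar f) = 4 then x_vec (d \<diamondop> f)
      else if bar d \<inter> bar f = {} then \<theta> *s x_vec ((d \<diamondop> f) \<diamondop> \<Omega>)
      else 0)"

definition star :: "complex ^ ('i + 'p) \<Rightarrow> complex ^ ('i + 'p) \<Rightarrow> complex ^ ('i + 'p)"
    (infixl \<open>\<star>\<close> 70) where
  "v \<star> w =
     (\<Sum>i\<in>UNIV. \<Sum>j\<in>UNIV. cnj (v $ Inl i * w $ Inl j) *s prod_uu i j)
     + (\<Sum>i\<in>UNIV. \<Sum>d\<in>lifts.
          (1 / 2 * cnj (v $ Inl i * w $ Inr d + v $ Inr d * w $ Inl i)) *s prod_ux i d)
     + (\<Sum>d\<in>lifts. \<Sum>f\<in>lifts. (1 / 4 * cnj (v $ Inr d * w $ Inr f)) *s prod_xx d f)"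

definition herm :: "complex ^ ('i + 'p) \<Rightarrow> complex ^ ('i + 'p) \<Rightarrow> complex" where
  "herm v w = 1 / 8 * (\<Sum>i\<in>UNIV. v $ Inl i * cnj (w $ Inl i))
            + 1 / 2 * (\<Sum>d\<in>lifts. v $ Inr d * cnj (w $ Inr d))"

definition tau :: "complex ^ ('i + 'p) \<Rightarrow> complex ^ ('i + 'p) \<Rightarrow> complex ^ ('i + 'p)" where
  "tau r v = v \<star> r - herm r v *s r"

definition ray :: "complex ^ ('i + 'p) \<Rightarrow> (complex ^ ('i + 'p)) set" where
  "ray r = {c *s r | c. c \<in> {1, \<omega>, \<omega> ^ 2}}"

text \<open>
  The expansion of a vector in the generators, and the defining rules of the product and of the
  Hermitian form, as a check of the explicit formulas above.
\<close>

lemma neg_neg: "neg (neg d) = d"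
  using m1_central m1_order(2) unit_left unfolding neg_def central_def by metis

lemma neg_neq: "neg d \<noteq> d"
  unfolding neg_def using m1_order(1) unit_left right_division by metis

lemma bar_neg: "bar (neg d) = bar d"
proof -
  have "bar m1 = {}" using bar_kernel by blast
  then show ?thesis by (simp add: neg_def bar_mult)
qed

lemma mult_neg: "d \<diamondop> neg f = neg (d \<diamondop> f)" "neg d \<diamondop> f = neg (d \<diamondop> f)"
  using m1_central unfolding neg_def central_def by metis+

lemma x_vec_neg: "x_vec (neg d) = - x_vec d"
  by (simp add: x_vec_def neg_neg)

lemma lifts_neg: "neg d \<in> lifts \<longleftrightarrow> d \<in> lifts"
  by (simp add: lifts_def bar_neg)

lemma prod_ux_neg: "prod_ux i (neg d) = - prod_ux i d"
  by (simp add: prod_ux_def bar_neg x_vec_neg vec_eq_iff)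

lemma prod_xx_neg: "prod_xx d (neg f) = - prod_xx d f"
proof -
  have e: "neg f = d \<longleftrightarrow> f = neg d" "neg f = neg d \<longleftrightarrow> f = d"
    using neg_neg by metis+
  show ?thesis
    using neg_neq[of d] by (auto simp: prod_xx_def e bar_neg mult_neg x_vec_neg vec_eq_iff)
qed

lemma prod_xx_neg_left: "prod_xx (neg d) f = - prod_xx d f"
  using neg_neq[of d]
  by (auto simp: prod_xx_def bar_neg mult_neg x_vec_neg neg_neg vec_eq_iff)

lemma u_vec_nth [simp]: "u_vec i $ Inl j = (if i = j then 1 else 0)" "u_vec i $ Inr d = 0"
  by (auto simp: u_vec_def axis_def)

lemma x_vec_Inl [simp]: "x_vec d $ Inl j = 0"
  by (simp add: x_vec_def axis_def)

lemma x_vec_Inr: "x_vec d $ Inr f = (if f = d then 1 else 0) - (if f = neg d then 1 else 0)"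
  by (auto simp: x_vec_def axis_def)

lemma cnj_x_vec [simp]: "cnj (x_vec d $ Inr f) = x_vec d $ Inr f"
  by (simp add: x_vec_Inr)

lemma sum_x_vec:
  fixes h :: "'p \<Rightarrow> complex"
  assumes "d \<in> lifts" "h (neg d) = - h d"
  shows "(\<Sum>f\<in>lifts. x_vec d $ Inr f * h f) = 2 * h d"
proof -
  have "(\<Sum>f\<in>lifts. x_vec d $ Inr f * h f)
      = (\<Sum>f\<in>lifts. (if f = d then h f else 0)) - (\<Sum>f\<in>lifts. (if f = neg d then h f else 0))"
    unfolding sum_subtractf[symmetric] by (rule sum.cong) (auto simp: x_vec_Inr)
  also have "\<dots> = 2 * h d"
    using assms by (simp add: lifts_neg)
  finally show ?thesis .
qed

lemma star_nth: "(v \<star> w) $ k =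
     (\<Sum>i\<in>UNIV. \<Sum>j\<in>UNIV. cnj (v $ Inl i) * cnj (w $ Inl j) * prod_uu i j $ k)
     + (\<Sum>i\<in>UNIV. \<Sum>d\<in>lifts.
          1 / 2 * (cnj (v $ Inl i) * cnj (w $ Inr d) + cnj (v $ Inr d) * cnj (w $ Inl i))
            * prod_ux i d $ k)
     + (\<Sum>d\<in>lifts. \<Sum>f\<in>lifts. 1 / 4 * (cnj (v $ Inr d) * cnj (w $ Inr f)) * prod_xx d f $ k)"
  by (simp add: star_def)

lemma star_add: "(v + w) \<star> z = v \<star> z + w \<star> z"
proof -
  have "((v + w) \<star> z) $ k = (v \<star> z) $ k + (w \<star> z) $ k" for k
    unfolding star_nth
    apply (simp only: vector_add_component complex_cnj_add ring_distribs sum.distrib)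
    apply (simp only: ac_simps)
    done
  then show ?thesis by (simp add: vec_eq_iff)
qed

lemma star_scale: "(a *s v) \<star> z = cnj a *s (v \<star> z)"
proof -
  have "((a *s v) \<star> z) $ k = cnj a * (v \<star> z) $ k" for k
    unfolding star_nth
    apply (simp only: vector_smult_component complex_cnj_mult ring_distribs sum_distrib_left
        sum.distrib)
    apply (simp only: ac_simps)
    done
  then show ?thesis by (simp add: vec_eq_iff)
qed

lemma star_conj_linear: "(a *s v + b *s w) \<star> z = cnj a *s (v \<star> z) + cnj b *s (w \<star> z)"
  by (simp add: star_add star_scale)

lemma prod_uu_commute: "prod_uu i j = prod_uu j i"
  by (simp add: prod_uu_def insert_commute add.commute)

lemma prod_xx_commute:
  assumes "d \<in> lifts" "f \<in> lifts"
  shows "prod_xx d f = prod_xx f d"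
proof -
  have e: "f = neg d \<longleftrightarrow> d = neg f" using neg_neg by metis
  have c: "d \<diamondop> f = f \<diamondop> d" if "card (bar d \<inter> bar f) = 4 \<or> bar d \<inter> bar f = {}"
    using that commuting[of d f] unit_left by auto
  show ?thesis
    unfolding prod_xx_def using c by (auto simp: e bar_neg Int_commute)
qed

lemma star_commute: "v \<star> w = w \<star> v"
proof -
  have 1: "(\<Sum>i\<in>UNIV. \<Sum>j\<in>UNIV. cnj (v $ Inl i) * cnj (w $ Inl j) * prod_uu i j $ k)
      = (\<Sum>i\<in>UNIV. \<Sum>j\<in>UNIV. cnj (w $ Inl i) * cnj (v $ Inl j) * prod_uu i j $ k)" for k
    by (subst sum.swap) (intro sum.cong refl, simp add: prod_uu_commute mult.commute)
  have 2: "(\<Sum>d\<in>lifts. \<Sum>f\<in>lifts. 1 / 4 * (cnj (v $ Inr d) * cnj (w $ Inr f)) * prod_xx d f $ k)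
      = (\<Sum>d\<in>lifts. \<Sum>f\<in>lifts. 1 / 4 * (cnj (w $ Inr d) * cnj (v $ Inr f)) * prod_xx d f $ k)"
    for k
    by (subst sum.swap) (intro sum.cong refl, simp add: prod_xx_commute mult.commute)
  show ?thesis
    unfolding vec_eq_iff star_nth 1 2 by (simp add: algebra_simps)
qed

lemma sum_u_vec: "(\<Sum>k\<in>UNIV. u_vec i $ Inl k * h k) = h i"
proof -
  have "(\<Sum>k\<in>UNIV. u_vec i $ Inl k * h k) = (\<Sum>k\<in>UNIV. if i = k then h k else 0)"
    by (intro sum.cong refl) simp
  then show ?thesis by simp
qed

lemma cnj_u_vec [simp]: "cnj (u_vec i $ k) = u_vec i $ k"
  by (simp add: u_vec_def axis_def)

lemma star_u_u: "u_vec i \<star> u_vec j = prod_uu i j"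
proof -
  have "(u_vec i \<star> u_vec j) $ k = prod_uu i j $ k" for k
  proof -
    have "(u_vec i \<star> u_vec j) $ k
        = (\<Sum>i'\<in>UNIV. \<Sum>j'\<in>UNIV. u_vec i $ Inl i' * u_vec j $ Inl j' * prod_uu i' j' $ k)"
      unfolding star_nth cnj_u_vec u_vec_nth(2) by simp
    also have "\<dots> = prod_uu i j $ k"
      by (simp only: mult.assoc sum_distrib_left [symmetric] sum_u_vec)
    finally show ?thesis .
  qed
  then show ?thesis by (simp add: vec_eq_iff)
qed

lemma star_u_x:
  assumes "d \<in> lifts"
  shows "u_vec i \<star> x_vec d = prod_ux i d"
proof -
  have "(u_vec i \<star> x_vec d) $ k = prod_ux i d $ k" for k
  proof -
    have "(u_vec i \<star> x_vec d) $ k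
        = (\<Sum>i'\<in>UNIV. if i = i' then 1 / 2 * (\<Sum>f\<in>lifts. x_vec d $ Inr f * prod_ux i' f $ k) else 0)"
    proof -
      have "(\<Sum>f\<in>lifts. 1 / 2 * (cnj (u_vec i $ Inl i') * cnj (x_vec d $ Inr f)
              + cnj (u_vec i $ Inr f) * cnj (x_vec d $ Inl i')) * prod_ux i' f $ k)
          = (if i = i' then 1 / 2 * (\<Sum>f\<in>lifts. x_vec d $ Inr f * prod_ux i' f $ k) else 0)" for i'
        by (simp add: sum_distrib_left)
      then show ?thesis unfolding star_nth by simp
    qed
    also have "\<dots> = 1 / 2 * (\<Sum>f\<in>lifts. x_vec d $ Inr f * prod_ux i f $ k)"
      by simp
    also have "\<dots> = prod_ux i d $ k"
      by (subst sum_x_vec) (use assms in \<open>auto simp: prod_ux_neg\<close>)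
    finally show ?thesis .
  qed
  then show ?thesis by (simp add: vec_eq_iff)
qed

lemma star_x_x:
  assumes "d \<in> lifts" "f \<in> lifts"
  shows "x_vec d \<star> x_vec f = prod_xx d f"
proof -
  have "(x_vec d \<star> x_vec f) $ k = prod_xx d f $ k" for k
  proof -
    have "(x_vec d \<star> x_vec f) $ k = (\<Sum>d'\<in>lifts. 1 / 4 * (x_vec d $ Inr d'
            * (\<Sum>f'\<in>lifts. x_vec f $ Inr f' * prod_xx d' f' $ k)))"
      unfolding star_nth by (simp add: sum_distrib_left mult.assoc)
    also have "\<dots> = (\<Sum>d'\<in>lifts. 1 / 4 * (x_vec d $ Inr d' * (2 * prod_xx d' f $ k)))"
      by (intro sum.cong refl, subst sum_x_vec) (use assms in \<open>auto simp: prod_xx_neg\<close>)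
    also have "\<dots> = 1 / 4 * (\<Sum>d'\<in>lifts. x_vec d $ Inr d' * (2 * prod_xx d' f $ k))"
      by (simp only: sum_distrib_left)
    also have "\<dots> = prod_xx d f $ k"
      by (subst sum_x_vec) (use assms in \<open>auto simp: prod_xx_neg_left\<close>)
    finally show ?thesis .
  qed
  then show ?thesis by (simp add: vec_eq_iff)
qed

lemma herm_u_u: "herm (u_vec i) (u_vec j) = (if i = j then 1 / 8 else 0)"
  unfolding herm_def cnj_u_vec sum_u_vec by simp

lemma herm_u_x: "herm (u_vec i) (x_vec d) = 0" "herm (x_vec d) (u_vec i) = 0"
  by (simp_all add: herm_def)

lemma herm_x_x:
  assumes "d \<in> lifts"
  shows "herm (x_vec d) (x_vec f) = (if f = d then 1 else if f = neg d then -1 else 0)"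
proof -
  have e: "neg d = neg f \<longleftrightarrow> d = f" "d = neg f \<longleftrightarrow> f = neg d" "neg d = f \<longleftrightarrow> f = neg d"
    "d = f \<longleftrightarrow> f = d"
    using neg_neg by metis+
  have odd: "x_vec f $ Inr (neg d) = - x_vec f $ Inr d"
    by (simp add: x_vec_Inr e)
  have "(\<Sum>e\<in>lifts. x_vec d $ Inr e * cnj (x_vec f $ Inr e)) = 2 * x_vec f $ Inr d"
    unfolding cnj_x_vec using assms odd by (rule sum_x_vec)
  then have "herm (x_vec d) (x_vec f) = x_vec f $ Inr d"
    unfolding herm_def by simp
  also have "\<dots> = (if f = d then 1 else if f = neg d then -1 else 0)"
    using neg_neq[of d] by (auto simp: x_vec_Inr e)
  finally show ?thesis .
qed

lemma alg_expansion:
  assumes "v \<in> alg"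
  shows "v = (\<Sum>i\<in>UNIV. v $ Inl i *s u_vec i) + (1 / 2) *s (\<Sum>d\<in>lifts. v $ Inr d *s x_vec d)"
proof -
  have odd: "v $ Inr (neg d) = - v $ Inr d" and zero: "d \<notin> lifts \<Longrightarrow> v $ Inr d = 0" for d
    using assms by (auto simp: alg_def)
  have 1: "(\<Sum>i\<in>UNIV. v $ Inl i * u_vec i $ Inl j) = v $ Inl j" for j
  proof -
    have "(\<Sum>i\<in>UNIV. v $ Inl i * u_vec i $ Inl j) = (\<Sum>i\<in>UNIV. if i = j then v $ Inl i else 0)"
      by (intro sum.cong refl) simp
    then show ?thesis by simp
  qed
  have 2: "(\<Sum>d\<in>lifts. v $ Inr d * x_vec d $ Inr f) = 2 * v $ Inr f" for f
  proof (cases "f \<in> lifts")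
    case True
    have e: "x_vec d $ Inr f = x_vec f $ Inr d" for d
      using neg_neg[of d] neg_neg[of f] by (auto simp: x_vec_Inr)
    have "(\<Sum>d\<in>lifts. v $ Inr d * x_vec d $ Inr f) = (\<Sum>d\<in>lifts. x_vec f $ Inr d * v $ Inr d)"
      by (simp only: e mult.commute)
    also have "\<dots> = 2 * v $ Inr f"
      using True odd by (rule sum_x_vec)
    finally show ?thesis .
  next
    case False
    have "f \<noteq> d \<and> f \<noteq> neg d" if "d \<in> lifts" for d
      using that False lifts_neg by metis
    then show ?thesis
      using zero[OF False] by (simp add: x_vec_Inr)
  qed
  show ?thesis
    unfolding vec_eq_iff
  proof
    fix k
    show "v $ k = ((\<Sum>i\<in>UNIV. v $ Inl i *s u_vec i)
        + (1 / 2) *s (\<Sum>d\<in>lifts. v $ Inr d *s x_vec d)) $ k"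
    proof (cases k)
      case (Inl j)
      then show ?thesis
        by (simp only: vector_add_component vector_smult_component sum_component 1 x_vec_Inl) simp
    next
      case (Inr f)
      then show ?thesis
        by (simp only: vector_add_component vector_smult_component sum_component 2 u_vec_nth) simp
    qed
  qed
qed

end


section \<open>Roots and the transposition group\<close>

text \<open>
  The choices made in the construction are parameters: \<open>lift K\<close> is the chosen lift of the octad
  \<open>K\<close>, \<open>q K\<close> the chosen homomorphism on \<open>B\<^sub>K = disjoint_words K\<close>, and
  \<open>F p\<close>, \<open>F' p\<close> the chosen pair of octads meeting in the 2-subset \<open>p\<close>.
\<close>

definition (in golay_code) disjoint_words :: "'i set \<Rightarrow> 'i set set" where
  "disjoint_words K = {c \<in> C. c \<inter> K = {}}"

definition (in golay_code) dual :: "'i set \<Rightarrow> ('i set \<Rightarrow> complex) set" where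
  "dual K = {\<psi> \<in> disjoint_words K \<rightarrow>\<^sub>E {1, -1}.
     \<forall>b\<in>disjoint_words K. \<forall>c\<in>disjoint_words K. \<psi> (sym_diff b c) = \<psi> b * \<psi> c}"

locale parker_roots = parker_algebra C mult unit m1 bar \<omega> \<Omega>
  for C :: "'i::finite set set"
    and mult :: "'p::finite \<Rightarrow> 'p \<Rightarrow> 'p" (infixl \<open>\<diamondop>\<close> 70)
    and unit :: 'p (\<open>\<e>\<close>)
    and m1 :: 'p and bar :: "'p \<Rightarrow> 'i set"
    and \<omega> :: complex and \<Omega> :: 'p +
  fixes lift :: "'i set \<Rightarrow> 'p" and q :: "'i set \<Rightarrow> 'i set \<Rightarrow> 'p"
    and F :: "'i set \<Rightarrow> 'i set" and F' :: "'i set \<Rightarrow> 'i set"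
  assumes bar_lift: "octad K \<Longrightarrow> bar (lift K) = K"
    and bar_q: "octad K \<Longrightarrow> b \<in> disjoint_words K \<Longrightarrow> bar (q K b) = b"
    and q_hom: "octad K \<Longrightarrow> b \<in> disjoint_words K \<Longrightarrow> c \<in> disjoint_words K \<Longrightarrow>
           q K (sym_diff b c) = q K b \<diamondop> q K c"
    and q_compl: "octad K \<Longrightarrow> q K (- K) = \<Omega> \<diamondop> lift K"
    and octad_F: "card p = 2 \<Longrightarrow> octad (F p)"
    and octad_F': "card p = 2 \<Longrightarrow> octad (F' p)"
    and inter_F: "card p = 2 \<Longrightarrow> F p \<inter> F' p = p"
begin

definition basic_root :: "'i \<Rightarrow> complex ^ ('i + 'p)" where
  "basic_root i = (-7) *s u_vec i + (\<Sum>j\<in>-{i}. u_vec j)"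

definition octadic_root :: "'i set \<Rightarrow> ('i set \<Rightarrow> complex) \<Rightarrow> complex ^ ('i + 'p)" where
  "octadic_root K \<psi> = (1 / 2) *s
     (- (\<Sum>i\<in>K. u_vec i) + (\<Sum>i\<in>-K. u_vec i) + (\<theta> * \<psi> (- K)) *s x_vec (lift K)
      + (\<Sum>b\<in>disjoint_words K - {{}, - K}. \<psi> b *s x_vec (q K b)))"

definition roots :: "(complex ^ ('i + 'p)) set" where
  "roots = {basic_root i | i. True}
     \<union> {octadic_root K \<psi> | K \<psi>. octad K \<and> \<psi> \<in> dual K}
     \<union> {octadic_root (F p) \<psi> \<star> octadic_root (F' p) \<psi>' | p \<psi> \<psi>'.
          card p = 2 \<and> \<psi> \<in> dual (F p) \<and> \<psi>' \<in> dual (F' p)}"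

definition root_rays :: "(complex ^ ('i + 'p)) set set" where
  "root_rays = ray ` roots"

definition ray_perm ::
    "complex ^ ('i + 'p) \<Rightarrow> (complex ^ ('i + 'p)) set \<Rightarrow> (complex ^ ('i + 'p)) set" where
  "ray_perm r = (\<lambda>s\<in>root_rays. tau r ` s)"

definition D_CP :: "((complex ^ ('i + 'p)) set \<Rightarrow> (complex ^ ('i + 'p)) set) set" where
  "D_CP = {ray_perm r | r. r \<in> alg \<and> ray r \<in> root_rays}"

text \<open>
  \<open>Sym(R)\<close> is the library group of bijections of \<open>R\<close> (undefined outside \<open>R\<close>).
\<close>

definition G_CP :: "((complex ^ ('i + 'p)) set \<Rightarrow> (complex ^ ('i + 'p)) set) monoid" where
  "G_CP = (BijGroup root_rays)\<lparr>carrier := generate (BijGroup root_rays) D_CP\<rparr>"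

end

end

theory Submission
  imports Defs
begin

text \<open>
  The map $\tau_r$ of a basic root is diagonal.  For an octad $K$ and a homomorphic section $s$ of
  Parker's loop over the words disjoint from $K$, the map $\tau$ of the octadic root of $s$ is
  computed on all generators according to the size of the intersection with $K$.  It exchanges the
  basic roots off $K$ with octadic roots and satisfies a braid relation with them; the
  multiplicativity on the remaining generators is reduced by the symmetry of
  $(x * y, z)$ to character sums over the words disjoint from $K$, so $\tau$ is a conjugate-linear
  automorphism.

  Products $\tau_{\chi s} \tau_s$ with $\chi(-K) = 1$ permute the basic roots, hence are monomial and
  permute the octadic roots.  Together with the inner products of octadic roots this shows that the
  roots are permuted up to cube roots of unity, that orthogonal roots satisfy
  $\tau_r s = s * r = \tau_s r$, and that all other pairs of roots commute.  All roots are conjugate to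
  a basic root $r_i$, whose inner product with a root is nonzero exactly if the support ($I$, an octad
  or a pair) of the root contains $i$; this gives all the counts.
\<close>


text \<open>The code is given only by its parameters, so the Steiner system, double evenness and
  self-duality have to be derived, and the structure of the words disjoint from an octad comes from
  orthogonality of point characters instead of coordinates. The obstacle in proving multiplicativity
  is size: over an octad meeting \<open>K\<close> in two points the image of a generator is a sum
  over all of \<open>B K\<close>, and a product of two such sums has about a thousand terms. Besides
  Gauss sums, what makes this tractable is a weight argument: the basic roots at points of
  \<open>K\<close> act diagonally on generators and on their images alike, so most triples of
  generators give zero on both sides. Orthogonal octadic roots over octads meeting in 0 or 4 points
  need a detour. Changing the section by a suitable character makes the inner product a cube root of
  unity; the changed map then fixes the second root up to a scalar, so the original map sends it to
  its image under a monomial product, up to a scalar. These scalars are the reason for working with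
  rays.\<close>

section \<open>Symmetric differences and signs of intersections\<close>

definition sd :: "'a set => 'a set => 'a set" (infixl \<open>+^\<close> 65) where
 "A +^ B = sym_diff A B"
lemma msqb [simp]: "x : A +^ B \<longleftrightarrow> (x : A) ~= (x : B)"
 by (auto simp: sd_def)
lemma scqa: "A +^ B = B +^ A"
 and sd_assoc: "(A +^ B) +^ D = A +^ (B +^ D)"
 and sd_left_commute: "A +^ (B +^ D) = B +^ (A +^ D)"
 and sd_self [simp]: "A +^ A = {}"
 and sd_cancel [simp]: "A +^ (A +^ B) = B"
 and sd_empty [simp]: "A +^ {} = A" "{} +^ A = A"
 and sd_UNIV [simp]: "A +^ UNIV = - A" "UNIV +^ A = - A"
 and Int_sd: "A Int (B +^ D) = (A Int B) +^ (A Int D)"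
 and sd_Int: "(B +^ D) Int A = (B Int A) +^ (D Int A)"
 by (auto simp: sd_def)
lemmas sd_ac = sd_assoc scqa sd_left_commute
lemma seeq [simp]: "A +^ B = {} \<longleftrightarrow> A = B"
 by (auto simp: sd_def)
lemma siq [simp]: "A +^ B = A +^ D \<longleftrightarrow> B = D"
 by (metis sd_cancel)
lemma csqa:
 fixes A B :: "'a::finite set"
 shows "card (A +^ B) + 2 * card (A Int B) = card A + card B"
proof -
 have "card (A +^ B) = card (A - B) + card (B - A)"
 unfolding sd_def by (rule card_Un_disjoint) auto
 moreover have "card A = card (A - B) + card (A Int B)" for A B :: "'a set"
 proof -
 have "card ((A - B) Un (A Int B)) = card (A - B) + card (A Int B)"
 by (rule card_Un_disjoint) auto
 then show ?thesis by (simp add: Un_Diff_Int)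
 qed
 from this[of A B] this[of B A] calculation show ?thesis by (simp add: Int_commute)
qed
lemma cIsq:
 fixes A B :: "'a::finite set"
 shows "card (A Int (B +^ D)) + 2 * card (A Int B Int D) = card (A Int B) + card (A Int D)"
proof -
 have "A Int B Int (A Int D) = A Int B Int D" by auto
 then show ?thesis using csqa[of "A Int B" "A Int D"] by (simp add: Int_sd)
qed
lemma csq:
 fixes A B :: "'a::finite set"
 shows "card A = card (A Int B) + card (A Int - B)"
proof -
 have "card ((A Int B) Un (A Int - B)) = card (A Int B) + card (A Int - B)"
 by (rule card_Un_disjoint) auto
 moreover have "(A Int B) Un (A Int - B) = A" by auto
 ultimately show ?thesis by simp
qed
lemma cCq:
 fixes A :: "'a::finite set"
 shows "card (- A) = CARD('a) - card A"
 by (simp add: Compl_eq_Diff_UNIV card_Diff_subset)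
text \<open>
 Signs attached to words: \<open>sQ\<close>, \<open>sT\<close>, \<open>sW\<close> are the commutator, the associator and the squaring
 map of the loop; on doubly even words they obey the multiplicative rules below.
\<close>
definition sT :: "'a set => 'a set => 'a set => complex" where
 "sT A B D = (-1) ^ card (A Int B Int D)"
definition sQ :: "'a set => 'a set => complex" where
 "sQ A B = (-1) ^ (card (A Int B) div 2)"
definition sW :: "'a set => complex" where
 "sW A = (-1) ^ (card A div 4)"
definition pt :: "'a => 'a set => complex" where
 "pt x A = (if x : A then - 1 else 1)"
text \<open>Cardinality identities are kept with a summand \<open>2 * m\<close> on one side, which
  avoids truncated subtraction. That summand disappears in the sign, so additivity modulo 2 turns
  into multiplicativity.\<close>

lemma mpeq:
 assumes "n + 2 * m = k + l" shows "(-1::complex) ^ n = (-1) ^ k*(-1) ^ l"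
proof -
 have "(-1::complex) ^ n = (-1) ^ (n + 2 * m)" by (simp add: power_add power_mult)
 then show ?thesis by (simp add: assms power_add)
qed
lemma mpsq [simp]: "(-1::complex) ^ n*(-1) ^ n = 1"
 by (simp flip: power_mult_distrib)
lemma sT_sq [simp]: "sT A B D * sT A B D = 1" and sQ_sq [simp]: "sQ A B * sQ A B = 1"
 and sW_sq [simp]: "sW A * sW A = 1" and pt_sq [simp]: "pt x A * pt x A = 1"
 by (simp_all add: sT_def sQ_def sW_def pt_def)
lemma sslqa [simp]: "sT A B D*(sT A B D * z) = z" and sQ_sq_left [simp]: "sQ A B*(sQ A B * z) = z"
 and sW_sq_left [simp]: "sW A*(sW A * z) = z" and pt_sq_left [simp]: "pt x A*(pt x A * z) = z"
 by (simp_all flip: mult.assoc)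
lemma csqd [simp]: "cnj (sT A B D) = sT A B D" "cnj (sQ A B) = sQ A B" "cnj (sW A) = sW A"
 "cnj (pt x A) = pt x A"
 by (simp_all add: sT_def sQ_def sW_def pt_def)
lemma scqc: "sT A B D = 1 | sT A B D = - 1" and sQ_cases: "sQ A B = 1 | sQ A B = - 1"
 and pt_cases: "pt x A = 1 | pt x A = - 1"
 by (auto simp: sT_def sQ_def pt_def minus_one_power_iff)
lemma spq: "sT A B D = sT B A D" "sT A B D = sT A D B"
 by (simp_all add: sT_def Int_ac)
lemma scqf: "sQ A B = sQ B A"
 by (simp add: sQ_def Int_commute)
lemma sT_sd:
 fixes A B :: "'a::finite set"
 shows "sT A B (D +^ E) = sT A B D * sT A B E"
 "sT A (D +^ E) B = sT A D B * sT A E B"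
 "sT (D +^ E) A B = sT D A B * sT E A B"
proof -
 have 1: "sT A B (D +^ E) = sT A B D * sT A B E" for A B D E :: "'a set"
 unfolding sT_def by (rule mpeq[OF cIsq])
 then show "sT A B (D +^ E) = sT A B D * sT A B E" .
 show "sT A (D +^ E) B = sT A D B * sT A E B" "sT (D +^ E) A B = sT D A B * sT E A B"
 using 1 by (metis spq)+
qed
lemma seqb [simp]: "sT {} A B = 1" "sT A {} B = 1" "sT A B {} = 1"
 and sQ_empty [simp]: "sQ {} A = 1" "sQ A {} = 1" and pt_empty [simp]: "pt x {} = 1"
 and sW_empty [simp]: "sW {} = 1"
 by (simp_all add: sT_def sQ_def pt_def sW_def)
lemma pt_sd: "pt x (A +^ B) = pt x A * pt x B"
 by (auto simp: pt_def)
lemma sQ_sd: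
 fixes A B D :: "'a::finite set"
 assumes "even (card (A Int B))" "even (card (A Int D))"
 shows "sQ A (B +^ D) = sQ A B * sQ A D * sT A B D"
proof -
 have "even (card (A Int (B +^ D)))" using cIsq[of A B D] assms by presburger
 then have "card (A Int (B +^ D)) div 2 + 2 * card (A Int B Int D)
 = (card (A Int B) div 2 + card (A Int D) div 2) + card (A Int B Int D)"
 using cIsq[of A B D] assms by presburger
 from mpeq[OF this] show ?thesis by (simp add: sQ_def sT_def power_add)
qed
lemma sW_sd:
 fixes A B :: "'a::finite set"
 assumes "4 dvd card A" "4 dvd card B" "even (card (A Int B))"
 shows "sW (A +^ B) = sW A * sW B * sQ A B"
proof -
 obtain a b i where e: "card A = 4 * a" "card B = 4 * b" "card (A Int B) = 2 * i"
 using assms by (auto elim!: dvdE)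
 then have "card (A +^ B) = 4*(a + b - i)" "i <= a + b" using csqa[of A B] by linarith+
 then have "card (A +^ B) div 4 + 2*(card (A Int B) div 2)
 = (card A div 4 + card B div 4) + card (A Int B) div 2"
 using e by simp
 from mpeq[OF this] show ?thesis by (simp add: sW_def sQ_def power_add)
qed

section \<open>The Golay code from its parameters: octads, self-duality, weights\<close>

context golay_code begin
lemma scq: "c : C ==> d : C ==> c +^ d : C"
 unfolding sd_def by (rule add_closed)
lemma min8: assumes "c : C" "c ~= {}" shows "8 <= card c"
proof -
 have "card c : card ` (C - {{}})" using assms by auto
 then have "Min (card ` (C - {{}})) <= card c" by (intro Min_le) auto
 then show ?thesis using min_weight by simp
qed
lemma octadD: "octad K ==> K : C" "octad K ==> card K = 8"
 by (auto simp: octad_def)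
lemma weq: assumes "c : C" "d : C" "card (c +^ d) < 8" shows "c = d"
 using min8[OF scq[OF assms(1,2)]] assms(3) by force
lemma oeqa: assumes "octad K" "octad H" "5 <= card (K Int H)" shows "K = H"
 using assms csqa[of K H] by (intro weq) (auto simp: octad_def)
lemma oIlq: assumes "octad K" "octad H" "K ~= H" shows "card (K Int H) <= 4"
 using oeqa[OF assms(1,2)] assms(3) by linarith
text \<open>Steiner property S(5,8,24). Puncturing at a point \<open>z\<close> of \<open>S\<close>
  gives a perfect 3-error-correcting code: 2^12 disjoint balls with 1 + 23 + 253 + 1771 = 2^11
  members each fill all 2^23 subsets of the other points. Decoding the 4-set \<open>S - {z}\<close>
  produces the octad.\<close>

lemma oeq: assumes S: "card (S :: 'i set) = 5" shows "EX K. octad K & S <= K"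
proof -
 obtain z where z: "z : S" using S by fastforce
 define U where "U = (UNIV :: 'i set) - {z}"
 have cU: "card U = 23" unfolding U_def using card_index by (simp add: card_Diff_subset)
 define E where "E = {e. e <= U & card e <= 3}"
 have "E = (UN k:{..3}. {e. e <= U & card e = k})" unfolding E_def by auto
 also have "card ... = (SUM k:{..3}. card {e. e <= U & card e = k})"
 by (rule card_UN_disjoint) auto
 also have "... = (SUM k:{..3}. 23 choose k)"
 by (intro sum.cong refl) (simp add: n_subsets cU)
 also have "... = 2 ^ 11"
 proof -
 have "{..3::nat} = {0, 1, 2, 3}" by auto
 then show ?thesis by (simp add: binomial_fact' fact_numeral)
 qed
 finally have cE: "card E = 2 ^ 11" .
 define f where "f = (%(c, e). (c - {z}) +^ e)"
 have inj: "inj_on f (C \<times> E)"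
 proof (rule inj_onI, clarify)
 fix c e c' e' assume c: "c : C" "c' : C" and e: "e : E" "e' : E" and eq: "f (c, e) = f (c', e')"
 have "c +^ c' <= insert z (e +^ e')"
 proof
 fix x assume "x : c +^ c'"
 moreover have "x : (c - {z}) +^ e \<longleftrightarrow> x : (c' - {z}) +^ e'" using eq by (simp add: f_def)
 ultimately show "x : insert z (e +^ e')" by auto
 qed
 then have "card (c +^ c') <= card (insert z (e +^ e'))" by (intro card_mono) auto
 also have "... <= Suc (card (e +^ e'))" by (simp add: card_insert_if)
 also have "... <= Suc (3 + 3)" using csqa[of e e'] e by (simp add: E_def)
 finally have "c = c'" using c by (intro weq) auto
 then show "c = c' & e = e'" using eq by (simp add: f_def)
 qed
 have sub: "f ` (C \<times> E) <= Pow U" by (auto simp: f_def E_def U_def)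
 have "card (f ` (C \<times> E)) = card (Pow U)"
 using card_image[OF inj] by (simp add: card_cartesian_product card_code cE card_Pow cU)
 then have img: "f ` (C \<times> E) = Pow U" using sub by (simp add: card_subset_eq)
 have "S - {z} : Pow U" by (auto simp: U_def)
 then have "S - {z} : f ` (C \<times> E)" using img by simp
 then obtain c e where c: "c : C" and e: "e : E" and eq: "S - {z} = (c - {z}) +^ e"
 by (auto simp: f_def)
 have c4: "card (S - {z}) = 4" using S z by simp
 have e3: "card e <= 3" using e by (simp add: E_def)
 have ee: "e = (c - {z}) +^ (S - {z})" using eq by (simp add: sd_ac)
 have ne: "c ~= {}" using c4 e3 ee by auto
 have cc: "card e + 2 * card ((c - {z}) Int (S - {z})) = card (c - {z}) + 4"
 using csqa[of "c - {z}" "S - {z}"] c4 ee by simp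
 have le: "card ((c - {z}) Int (S - {z})) <= 4" using c4 by (metis card_mono finite inf_le2)
 have c8: "8 <= card c" using min8 c ne by blast
 have "card c <= Suc (card (c - {z}))"
 using card_Suc_Diff1[of c z] by (cases "z : c") auto
 \<comment> \<open>In \<open>cc\<close> the left side is at most 3 + 8 and the right side at least 7
   + 4, so all the bounds are attained.\<close>
 then have i4: "card ((c - {z}) Int (S - {z})) = 4" and c7: "card (c - {z}) = 7"
 using cc le e3 c8 by linarith+
 have "z : c" using c7 c8 by (cases "z : c") auto
 moreover have "(c - {z}) Int (S - {z}) = S - {z}" using i4 c4 by (metis card_subset_eq finite inf_le2)
 ultimately have "S <= c" by blast
 moreover have "card c = 8" using c7 c8 \<open>z : c\<close> by (simp add: card_Diff_singleton_if)
 ultimately show ?thesis using c by (auto simp: octad_def)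
qed
lemma oIeq:
 assumes "octad K" "octad H" "K ~= H" "T <= K" "T <= H" "card T = 4"
 shows "K Int H = T"
proof -
 have "T <= K Int H" using assms by auto
 moreover have "card (K Int H) <= card T" using oIlq assms by simp
 ultimately show ?thesis by (metis card_seteq finite)
qed
text \<open>The octads through four points of \<open>K\<close> cut the complement of \<open>K\<close> into at most four pieces.\<close>
lemma tpq:
 assumes K: "octad K" and T: "T <= K" "card T = 4" and N: "N Int K = {}" "4 < card N"
 obtains k l H where "k : N" "l : N" "k ~= l" "octad H" "T <= H" "k : H" "l : H" "H ~= K"
proof -
 have "EX H. octad H & insert k T <= H" if "k : N" for k
 using that T N by (intro oeq) (auto simp: card_insert_if)
 then obtain h where h: "!!k. k : N ==> octad (h k) & insert k T <= h k" by metis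
 have ne: "h k ~= K" if "k : N" for k using h[OF that] that N by auto
 have i4: "h k Int K = T" if "k : N" for k
 using oIeq[of "h k" K T] h[OF that] ne[OF that] K T by auto
 have c4: "card (h k - K) = 4" if "k : N" for k
 using h[OF that] i4[OF that] T by (simp add: card_Diff_subset_Int octadD)
 have "~ inj_on h N"
 proof
 assume inj: "inj_on h N"
 have disj: "(h k - K) Int (h l - K) = {}" if "k : N" "l : N" "k ~= l" for k l
 proof -
 have "h k ~= h l" using inj that by (auto dest: inj_onD)
 then have "h k Int h l = T" using oIeq[of "h k" "h l" T] h[OF that(1)] h[OF that(2)] T by auto
 then show ?thesis using T by auto
 qed
 have "card (UN k:N. h k - K) = (SUM k:N. card (h k - K))"
 using disj by (intro card_UN_disjoint) auto
 also have "... = 4 * card N" using c4 by simp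
 finally have "4 * card N = card (UN k:N. h k - K)" by simp
 also have "... <= card (- K)" by (intro card_mono) auto
 finally have "4 * card N <= card (- K)" .
 then show False using N(2) cCq[of K] card_index K by (simp add: octadD)
 qed
 then obtain k l where "k : N" "l : N" "k ~= l" "h k = h l" by (auto simp: inj_on_def)
 then show thesis using that[of k l "h k"] h ne by (metis insert_subset)
qed
text \<open>Add to three common points a point \<open>y\<close> of \<open>K\<close> off
  \<open>H\<close>. Five points of \<open>H\<close> lie off \<open>K\<close>, so by
  \<open>tpq\<close> two of them lie in one octad through this tetrad. That octad shares five points
  with \<open>H\<close>, hence equals \<open>H\<close>, although it contains
  \<open>y\<close>.\<close>

lemma oInq: assumes K: "octad K" and H: "octad H" shows "card (K Int H) ~= 3"
proof
 assume 3: "card (K Int H) = 3"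
 have c: "card (H - K) = 5" using 3 H by (simp add: card_Diff_subset_Int octadD Int_commute)
 have "card (K - H) = 5" using 3 K by (simp add: card_Diff_subset_Int octadD)
 then obtain y where y: "y : K" "y ~: H" by (metis DiffE card.empty ex_in_conv zero_neq_numeral)
 have T: "insert y (K Int H) <= K" "card (insert y (K Int H)) = 4" using y 3 by auto
 obtain k l M where M: "k : H - K" "l : H - K" "k ~= l" "octad M" "insert y (K Int H) <= M" "k : M" "l : M"
 by (rule tpq[OF K T, of "H - K"]) (use c in auto)
 have "insert k (insert l (K Int H)) <= M Int H" using M by auto
 moreover have "card (insert k (insert l (K Int H))) = 5" using M 3 by auto
 ultimately have "5 <= card (M Int H)" by (metis card_mono finite)
 then have "M = H" using oeqa M H by blast
 then show False using M y by auto
qed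
text \<open>Take a tetrad of \<open>K\<close> through the single common point \<open>s\<close> and,
  by \<open>tpq\<close>, an octad \<open>M\<close> through it with two further points of
  \<open>H\<close>. Then \<open>M\<close> meets \<open>H\<close> in four points, and the octad
  \<open>M +^ K\<close> meets \<open>H\<close> in these without \<open>s\<close>, which makes three:
  excluded by \<open>oInq\<close>.\<close>

lemma oInqa: assumes K: "octad K" and H: "octad H" shows "card (K Int H) ~= 1"
proof
 assume 1: "card (K Int H) = 1"
 then obtain s where s: "K Int H = {s}" by (metis card_1_singletonE)
 have c: "card (H - K) = 7" using 1 H by (simp add: card_Diff_subset_Int octadD Int_commute)
 obtain R where R: "R <= K - {s}" "card R = 3"
 proof -
 have "s : K" using s by auto
 then have "3 <= card (K - {s})" using K by (simp add: octadD)
 then show ?thesis using that by (metis obtain_subset_with_card_n)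
 qed
 have T: "insert s R <= K" "card (insert s R) = 4" using R s by (auto simp: card_insert_if finite_subset)
 obtain k l M where M: "k : H - K" "l : H - K" "k ~= l" "octad M" "insert s R <= M" "k : M" "l : M" "M ~= K"
 by (rule tpq[OF K T, of "H - K"]) (use c in auto)
 have i4: "M Int K = insert s R" using oIeq[of M K] M K T by auto
 have MH: "M ~= H"
 proof
 assume "M = H"
 then have "insert s R = {s}" using i4 s by (simp add: Int_commute)
 then have "card (insert s R) = card {s}" by (rule arg_cong)
 then show False using T(2) by simp
 qed
 have sub: "{s, k, l} <= M Int H" using M s by auto
 have "s : K" using s by auto
 then have "s ~= k" "s ~= l" using M by auto
 then have "card {s, k, l} = 3" using M(3) by simp
 then have "3 <= card (M Int H)" using sub by (metis card_mono finite)
 then have MH4: "card (M Int H) = 4" using oInq[OF M(4) H] oIlq[OF M(4) H MH] by linarith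
 have oct: "octad (M +^ K)"
 using csqa[of M K] i4 T(2) M(4) K by (auto simp: octad_def scq)
 have "(M +^ K) Int H = (M Int H) - {s}"
 proof (rule Set.set_eqI)
 fix x
 have "x : K & x : H \<longleftrightarrow> x = s" using s by blast
 moreover have "s : M" using M by blast
 ultimately show "x : (M +^ K) Int H \<longleftrightarrow> x : (M Int H) - {s}" by auto
 qed
 then have "card ((M +^ K) Int H) = 3" using MH4 sub by simp
 then show False using oInq[OF oct H] by simp
qed
lemma oIeqa: assumes "octad K" "octad H" shows "even (card (K Int H))"
proof (cases "K = H")
 case True then show ?thesis using assms by (simp add: octadD)
next
 case False
 from oIlq[OF assms False] oInqa[OF assms] oInq[OF assms]
 consider "card (K Int H) = 0" | "card (K Int H) = 2" | "card (K Int H) = 4" by linarith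
 then show ?thesis by cases auto
qed
text \<open>The octads generate the code: an octad through five points of a nonzero word lowers its
  weight when added. Evenness and double evenness thereby reduce to intersections of octads.\<close>

lemma ciqa [consumes 1, case_names empty step]:
 assumes "c : C" and "P {}" and "!!c K. c : C ==> octad K ==> P c ==> P (c +^ K)"
 shows "P c"
 using assms(1)
proof (induction "card c" arbitrary: c rule: less_induct)
 case less
 show ?case
 proof (cases "c = {}")
 case False
 then have "5 <= card c" using min8 less(2) by fastforce
 then obtain S where S: "S <= c" "card S = 5" by (metis obtain_subset_with_card_n)
 obtain K where K: "octad K" "S <= K" using oeq S by blast
 have "5 <= card (c Int K)" using S K by (metis card_mono finite le_inf_iff)
 then have "card (c +^ K) < card c" using csqa[of c K] K by (simp add: octadD)
 then have "P (c +^ K)" using less K scq by (simp add: octadD)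
 then have "P ((c +^ K) +^ K)" using assms(3) less(2) K scq octadD by blast
 then show ?thesis by (simp add: sd_assoc)
 qed (use assms(2) in simp)
qed
lemma eIq: assumes "c : C" "d : C" shows "even (card (c Int d))"
proof -
 have 1: "even (card (K Int c))" if "c : C" "octad K" for c K
 using that(1)
 proof (induction rule: ciqa)
 case (step c H)
 then show ?case using cIsq[of K c H] oIeqa[OF that(2) step(2)] by presburger
 qed simp
 show ?thesis using assms(2)
 proof (induction rule: ciqa)
 case (step d K)
 then show ?case using cIsq[of c d K] 1[OF assms(1) step(2)] by (simp add: Int_commute) presburger
 qed simp
qed
lemma deq: "c : C ==> 4 dvd card c"
proof (induction rule: ciqa)
 case (step c K)
 then have "even (card (c Int K))" using eIq octadD by blast
 then show ?case using csqa[of c K] octadD[OF step(2)] step(3) by presburger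
qed simp
lemma swq: "[|a : C; b : C; c : C|] ==> sQ a (b +^ c) = sQ a b * sQ a c * sT a b c"
 "[|a : C; b : C; c : C|] ==> sQ (b +^ c) a = sQ b a * sQ c a * sT b c a"
 using sQ_sd eIq by (metis, metis sQ_sd eIq scqf spq)
lemma swqa: "[|a : C; b : C|] ==> sW (a +^ b) = sW a * sW b * sQ a b"
 by (simp add: sW_sd deq eIq)
lemma srq [simp]: assumes "a : C" "b : C" shows "sT a a b = 1" "sT a b a = 1" "sT b a a = 1"
 using eIq[OF assms] by (simp_all add: sT_def Int_ac)
lemma ssqd: "a : C ==> sQ a a = 1"
 using deq[of a] by (auto simp: sQ_def elim!: dvdE)
end
lemma sazq:
 fixes f :: "'a => complex"
 assumes "!!a. a : A ==> g a : A" "!!a. a : A ==> g (g a) = a" "!!a. a : A ==> f (g a) = - f a"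
 shows "sum f A = 0"
proof -
 have "sum f A = (SUM a:A. f (g a))"
 by (rule sum.reindex_bij_witness[of _ g g]) (use assms in auto)
 also have "... = - sum f A" using assms(3) by (simp add: sum_negf)
 finally show ?thesis by simp
qed
lemma ssrqa:
 assumes "c : A" "!!a b. a : A ==> b : A ==> a +^ b : A"
 shows "(SUM b:A. f (b +^ c)) = sum f A"
 by (rule sum.reindex_bij_witness[of _ "%b. b +^ c" "%b. b +^ c"]) (use assms in \<open>auto simp: sd_assoc\<close>)
lemma spsq:
 fixes c :: "'i::finite set"
 shows "(SUM J:UNIV. (-1::complex) ^ card (J Int c)) = (if c = {} then 2 ^ CARD('i) else 0)"
proof (cases "c = {}")
 case True
 have "card (UNIV :: 'i set set) = 2 ^ CARD('i)" using card_Pow[of "UNIV :: 'i set"] by simp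
 then show ?thesis using True by simp
next
 case False
 then obtain x where x: "x : c" by auto
 have "(SUM J:UNIV. (-1::complex) ^ card (J Int c)) = 0"
 proof (rule sazq[where g = "%J. J +^ {x}"])
 fix J
 show "(-1::complex) ^ card ((J +^ {x}) Int c) = - ((-1) ^ card (J Int c))"
 using mpeq[OF cIsq[of c J "{x}"]] x by (simp add: Int_commute)
 qed (auto simp: sd_assoc)
 then show ?thesis using False by simp
qed
context golay_code begin
text \<open>Double counting of \<open>(-1) ^ card (J Int c)\<close> over all sets \<open>J\<close>
  and words \<open>c\<close>. Summing over \<open>c\<close> first, only the \<open>J\<close> in the
  dual code contribute, each 2^12; summing over \<open>J\<close> first, only the empty word
  contributes, namely 2^24. So the dual has 2^12 members, and it contains the code by
  \<open>eIq\<close>.\<close>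

lemma dcq: "{J. ALL c:C. even (card (J Int c))} = C"
proof -
 let ?P = "{J. ALL c:C. even (card (J Int c))}"
 have 1: "(SUM c:C. (-1::complex) ^ card (J Int c)) = (if J : ?P then 2 ^ 12 else 0)" for J
 proof (cases "J : ?P")
 case True then show ?thesis using card_code by simp
 next
 case False
 then obtain d where d: "d : C" "odd (card (J Int d))" by auto
 have "(SUM c:C. (-1::complex) ^ card (J Int c)) = 0"
 proof (rule sazq[where g = "%c. c +^ d"])
 fix c
 show "(-1::complex) ^ card (J Int (c +^ d)) = - ((-1) ^ card (J Int c))"
 using mpeq[OF cIsq[of J c d]] d by simp
 qed (use d scq in \<open>auto simp: sd_assoc\<close>)
 then show ?thesis using False by simp
 qed
 have "2 ^ 12 * of_nat (card ?P) = (SUM J:UNIV. SUM c:C. (-1::complex) ^ card (J Int c))"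
 unfolding 1 by (simp add: sum.If_cases)
 also have "... = (SUM c:C. SUM J:UNIV. (-1::complex) ^ card (J Int c))" by (rule sum.swap)
 also have "... = (SUM c:C. if c = {} then 2 ^ 24 else 0)"
 by (simp only: spsq card_index)
 also have "... = 2 ^ 12 * of_nat (2 ^ 12)" using zero_word by (simp add: sum.delta)
 finally have "of_nat (card ?P) = (of_nat (2 ^ 12) :: complex)" by simp
 then have "card ?P = 2 ^ 12" by (simp only: of_nat_eq_iff)
 moreover have "C <= ?P" using eIq by auto
 ultimately have "C = ?P" using card_code by (intro card_subset_eq) simp_all
 then show ?thesis by (rule sym)
qed
lemma Uwq: "UNIV : C"
proof -
 have "even (card c)" if "c : C" for c using deq[OF that] by presburger
 then have "UNIV : {J. ALL c:C. even (card (J Int c))}" by simp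
 then show ?thesis by (simp only: dcq)
qed
lemma Cwq: "c : C ==> - c : C"
 using scq[OF _ Uwq] by simp
lemma weights: assumes "c : C"
 shows "card c = 0 | card c = 8 | card c = 12 | card c = 16 | card c = 24"
proof (cases "c = {} | c = UNIV")
 case False
 then have "8 <= card c" "8 <= card (- c)" using min8[OF assms] min8[OF Cwq[OF assms]] by auto
 moreover obtain k where "card c = 4 * k" using deq[OF assms] by (auto elim: dvdE)
 ultimately show ?thesis using cCq[of c] card_index
 by (cases "k = 2"; cases "k = 3"; cases "k = 4") auto
qed (auto simp: card_index)
abbreviation B where "B \<equiv> disjoint_words"
lemma B_iff: "b : B K \<longleftrightarrow> b : C & b Int K = {}"
 by (simp add: disjoint_words_def)
lemma Bwq: "b : B K ==> b : C" by (simp add: B_iff)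
lemma B_sd: "b : B K ==> c : B K ==> b +^ c : B K"
 by (auto simp: B_iff scq)
lemma Beq [simp]: "{} : B K" by (simp add: B_iff zero_word)
lemma BCq: "octad K ==> - K : B K" by (simp add: B_iff Cwq octadD)
lemma cCoq: "octad K ==> card (- K) = 16"
 by (simp add: cCq card_index octadD)
lemma Bcq: assumes "octad K" "b : B K" obtains "b = {}" | "b = - K" | "octad b" "b ~= - K"
proof -
 have sub: "b <= - K" and bC: "b : C" using assms by (auto simp: B_iff)
 have le: "card b <= 16" using card_mono[OF _ sub] cCoq[OF assms(1)] by simp
 \<comment> \<open>A dodecad inside the 16-set \<open>- K\<close> would have a complement there of
   weight 4.\<close>
 have "card b ~= 12"
 proof
 assume 12: "card b = 12"
 have "b Int - K = b" using sub by auto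
 then have "card (b +^ - K) = 4" using csqa[of b "- K"] 12 cCoq[OF assms(1)] by simp
 then show False using min8[of "b +^ - K"] scq[OF bC] Bwq[OF BCq[OF assms(1)]] by fastforce
 qed
 moreover have "b = - K" if "card b = 16"
 using that sub cCoq[OF assms(1)] by (metis card_subset_eq finite)
 moreover have "octad b & b ~= - K" if "card b = 8"
 using that bC cCoq[OF assms(1)] by (auto simp: octad_def)
 moreover have "b = {}" if "card b = 0" using that by simp
 moreover have "card b ~= 24" using le by simp
 ultimately consider "b = {}" | "b = - K" | "octad b" "b ~= - K" using weights[OF bC] by linarith
 then show thesis using that by cases
qed
lemma Bcqa: assumes "octad K" "b : B K" shows "card b = 0 | card b = 8 | card b = 16"
 using assms by (rule Bcq) (auto simp: cCoq octadD assms(1))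
lemma soqa: "octad K ==> sW K = 1" by (simp add: sW_def octadD)
lemma sW_B: assumes "octad K" "b : B K" shows "sW b = 1"
 using Bcqa[OF assms] by (auto simp: sW_def)
text \<open>The weights in \<open>B K\<close> are 0, 8 and 16, so the squaring sign
  \<open>sW\<close> is trivial on this subgroup, and with it its polarisation
  \<open>sQ\<close>.\<close>

lemma sQ_B: assumes "octad K" "b : B K" "c : B K" shows "sQ b c = 1"
 using swqa[OF Bwq[OF assms(2)] Bwq[OF assms(3)]] sW_B[OF assms(1)] assms(2,3) B_sd by simp
lemma Int_B: "b : B K ==> K Int b = {}" "b : B K ==> b Int K = {}"
 by (auto simp: B_iff)
lemma sKBq [simp]: "b : B K ==> sQ K b = 1" "b : B K ==> sQ b K = 1"
 by (simp_all add: sQ_def Int_B)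
lemma sCq: assumes "b : B K" "c : C" shows "sT c b (- K) = 1" "sT b c (- K) = 1" "sT c (- K) b = 1"
proof -
 have "c Int b Int - K = c Int b" using assms unfolding B_iff by blast
 then have "sT c b (- K) = 1" using eIq[OF assms(2) Bwq[OF assms(1)]] by (simp add: sT_def)
 then show "sT c b (- K) = 1" "sT b c (- K) = 1" "sT c (- K) b = 1"
 by (simp_all add: sT_def Int_ac)
qed
text \<open>Two octads through the same four points of \<open>K\<close> differ by a word of \<open>B K\<close>.\<close>
lemma sq: assumes K: "octad K" and xy: "x ~: K" "y ~: K" "x ~= y"
 shows "EX b:B K. x : b & y ~: b"
proof -
 have "3 <= card K" using K by (simp add: octadD)
 then obtain S where S: "S <= K" "card S = 3" by (metis obtain_subset_with_card_n)
 have "x ~: S" "y ~: S" using S xy by auto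
 then have c5: "card (insert x (insert y S)) = 5" using S xy by simp
 from oeq[OF c5] obtain H where H: "octad H" "insert x (insert y S) <= H" by blast
 have nHK: "H ~= K" using H xy by auto
 have "S <= H Int K" using H S by auto
 then have "3 <= card (H Int K)" using S by (metis card_mono finite)
 then have HK4: "card (H Int K) = 4"
 using oIlq[OF H(1) K nHK] oInq[OF H(1) K] by linarith
 then have "card (K - H) = 4" using K by (simp add: card_Diff_subset_Int octadD Int_commute)
 \<comment> \<open>The tetrad \<open>T\<close> consists of \<open>S\<close> and a point of
   \<open>K\<close> missed by \<open>H\<close>. No octad through \<open>T\<close> can contain both
   \<open>x\<close> and \<open>y\<close>: it would share five points with \<open>H\<close>, hence
   equal \<open>H\<close>, which misses \<open>o5\<close>.\<close>
 then obtain o5 where o5: "o5 : K" "o5 ~: H" by (metis DiffE card.empty ex_in_conv zero_neq_numeral)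
 define T where "T = insert o5 S"
 have "o5 ~: S" using o5 H by auto
 then have T: "T <= K" "card T = 4" using o5(1) S by (auto simp: T_def)
 have c5': "card (insert z T) = 5" if "z ~: K" for z
 proof -
 have "z ~: T" using that T by auto
 then show ?thesis using T by simp
 qed
 obtain M where M: "octad M" "insert x T <= M" using oeq[OF c5'[OF xy(1)]] by blast
 have MK: "M Int K = T" using oIeq[OF M(1) K, of T] M T xy by auto
 have yM: "y ~: M"
 proof
 assume "y : M"
 then have "insert x (insert y S) <= M Int H" using M H by (auto simp: T_def)
 then have "5 <= card (M Int H)" using c5 by (metis card_mono finite)
 then have "M = H" using oeqa M H by blast
 then show False using M o5 by (auto simp: T_def)
 qed
 text \<open>Among the tetrads of \<open>T\<close> outside \<open>K\<close> there is a second one avoiding \<open>y\<close>.\<close>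
 have "card (M Int - K) = 4" using csq[of M K] MK T M(1) by (simp add: octadD)
 then have "card (- K Int - M) = 12"
 using csq[of "- K" M] cCoq[OF K] by (simp add: Int_commute)
 moreover obtain N where N: "octad N" "insert y T <= N"
 using oeq[OF c5'[OF xy(2)]] by blast
 have NK: "N Int K = T" using oIeq[OF N(1) K, of T] N T xy by auto
 have "card (N Int - K) = 4" using csq[of N K] NK T N(1) by (simp add: octadD)
 ultimately have "~ - K Int - M <= N Int - K" using card_mono[of "N Int - K" "- K Int - M"] by auto
 then obtain z where z: "z ~: K" "z ~: M" "z ~: N" by auto
 obtain L where L: "octad L" "insert z T <= L"
 using oeq[OF c5'[OF z(1)]] by blast
 have LK: "L Int K = T" using oIeq[OF L(1) K, of T] L T z by auto
 have yL: "y ~: L" using oIeq[OF L(1) N(1), of T] L N T z xy by auto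
 have xL: "x ~: L" using oIeq[OF L(1) M(1), of T] L M T z xy by auto
 have "M +^ L : B K" using M L MK LK by (simp add: B_iff scq octadD sd_Int)
 then show ?thesis using M yM yL xL by (intro bexI[of _ "M +^ L"]) auto
qed
lemma pCq [simp]: "x ~: K ==> pt x (- K) = - 1" by (simp add: pt_def)
text \<open>Real characters of the elementary abelian group \<open>B K\<close>. In contrast to the
  members of \<open>dual K\<close> they need not be extensional, so that functions given by
  formulas, such as \<open>pt x\<close> and \<open>sT c d\<close>, qualify directly.\<close>

definition B_hom :: "'i set => ('i set => complex) => bool" where
 "B_hom K pz \<longleftrightarrow> (ALL b:B K. pz b = 1 | pz b = - 1) & (ALL b:B K. ALL c:B K. pz (b +^ c) = pz b * pz c)"
lemma Bhq: assumes "B_hom K pz" "b : B K"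
 shows "pz b = 1 | pz b = - 1" "c : B K ==> pz (b +^ c) = pz b * pz c" "pz b * pz b = 1" "cnj (pz b) = pz b"
proof -
 show 1: "pz b = 1 | pz b = - 1" using assms by (auto simp: B_hom_def)
 show "c : B K ==> pz (b +^ c) = pz b * pz c" using assms by (auto simp: B_hom_def)
 show "pz b * pz b = 1" "cnj (pz b) = pz b" using 1 by auto
qed
lemma Bheq: assumes "B_hom K pz" shows "pz {} = 1"
 using Bhq(3)[OF assms Beq] Bhq(2)[OF assms Beq Beq] by simp
lemma Bhmq: "B_hom K pz ==> B_hom K fz ==> B_hom K (%b. pz b * fz b)"
 unfolding B_hom_def by (force simp: mult_ac)
lemma Bhpq: "B_hom K (pt x)"
 unfolding B_hom_def by (simp add: pt_sd) (simp add: pt_def)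
lemma Bhsq: "B_hom K (sT c d)"
 unfolding B_hom_def using scqc[of c d] by (simp add: sT_sd)
lemma Bhoq: "B_hom K (%b. 1)" by (simp add: B_hom_def)
lemma sBhq: assumes "B_hom K pz" "c : B K" "pz c = - 1" shows "sum pz (B K) = 0"
 by (rule sazq[where g = "%b. b +^ c"])
 (use assms Bhq[OF assms(1)] B_sd in \<open>auto simp: sd_assoc\<close>)
lemma sppq: assumes "octad K" "x ~: K" "y ~: K"
 shows "(SUM b:B K. pt x b * pt y b) = (if x = y then of_nat (card (B K)) else 0)"
proof (cases "x = y")
 case False
 then obtain b where "b : B K" "x : b" "y ~: b" using sq assms by blast
 then have "(SUM b:B K. pt x b * pt y b) = 0"
 by (intro sBhq[OF Bhmq[OF Bhpq Bhpq]]) (auto simp: pt_def)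
 then show ?thesis using False by simp
qed simp
lemma spBq: assumes "octad K" "b : B K"
 shows "(SUM x: - K. pt x b) = (if b = {} then 16 else if b = - K then - 16 else 0)"
proof -
 have sub: "b <= - K" using assms by (auto simp: B_iff)
 have "pt x b = 1 - 2*(if x : b then 1 else 0)" for x by (simp add: pt_def)
 then have "(SUM x: - K. pt x b) = (SUM x: - K. 1 - 2*(if x : b then 1 else 0))" by simp
 also have "... = 16 - 2 * of_nat (card b)"
 using sub cCoq[OF assms(1)]
 by (simp add: sum_subtractf sum.If_cases Int_absorb1 inf.absorb2 flip: sum_distrib_left)
 finally have *: "(SUM x: - K. pt x b) = 16 - 2 * of_nat (card b)" .
 show ?thesis
 using assms by (cases rule: Bcq) (use * cCoq[OF assms(1)] octadD in \<open>auto simp: octadD\<close>)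
qed
lemma Cneq: "octad K ==> - K ~= {}"
 using cCoq[of K] by force
text \<open>The size results from evaluating one sum twice. With \<open>N = card (B K)\<close>, the
  squared inner products of the point characters over \<open>x, y\<close> off \<open>K\<close> add
  up to \<open>16 * N * N\<close> by \<open>sppq\<close>. After exchanging sums, \<open>spBq\<close>
  leaves only pairs with \<open>b +^ c\<close> equal to \<open>{}\<close> or \<open>- K\<close>,
  each contributing 256, hence \<open>512 * N\<close>.\<close>

lemma cBq: assumes K: "octad K" shows "card (B K) = 32"
proof -
 let ?X = "- K" and ?N = "of_nat (card (B K)) :: complex"
 have "16*(?N*?N) = (SUM x:?X. SUM y:?X. (if x = y then ?N*?N else 0))"
 by (simp add: cCoq[OF K])
 also have "... = (SUM x:?X. SUM y:?X. (SUM b:B K. pt x b * pt y b)*(SUM c:B K. pt x c * pt y c))"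
 by (intro sum.cong refl) (auto simp: sppq[OF K])
 also have "... = (SUM x:?X. SUM y:?X. SUM b:B K. SUM c:B K. pt x (b +^ c) * pt y (b +^ c))"
 by (simp add: sum_product pt_sd mult_ac)
 also have "... = (SUM x:?X. SUM b:B K. SUM y:?X. SUM c:B K. pt x (b +^ c) * pt y (b +^ c))"
 by (intro sum.cong refl sum.swap)
 also have "... = (SUM b:B K. SUM x:?X. SUM y:?X. SUM c:B K. pt x (b +^ c) * pt y (b +^ c))"
 by (rule sum.swap)
 also have "... = (SUM b:B K. SUM x:?X. SUM c:B K. SUM y:?X. pt x (b +^ c) * pt y (b +^ c))"
 by (intro sum.cong refl sum.swap)
 also have "... = (SUM b:B K. SUM c:B K. SUM x:?X. SUM y:?X. pt x (b +^ c) * pt y (b +^ c))"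
 by (intro sum.cong refl sum.swap)
 also have "... = (SUM b:B K. SUM c:B K. (SUM x:?X. pt x (b +^ c))*(SUM y:?X. pt y (b +^ c)))"
 by (simp add: sum_product)
 also have "... = (SUM b:B K. SUM c:B K. (if c = b then 256 else 0) + (if c = b +^ - K then 256 else 0))"
 proof (intro sum.cong refl)
 fix b c assume bc: "b : B K" "c : B K"
 have e: "b +^ c = - K \<longleftrightarrow> c = b +^ - K" using siq[of b c "b +^ - K"] by simp
 have ne: "b ~= b +^ - K" using siq[of b "{}" "- K"] Cneq[OF K] by simp
 show "(SUM x:?X. pt x (b +^ c))*(SUM y:?X. pt y (b +^ c)) =
 (if c = b then 256 else 0) + (if c = b +^ - K then 256 else 0)"
 unfolding spBq[OF K B_sd[OF bc]] e using ne by (cases "c = b"; cases "c = b +^ - K") simp_all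
 qed
 also have "... = 512*?N"
 using B_sd BCq[OF K] by (simp add: sum.distrib)
 finally have "(16*?N)*?N = 512*?N" by (simp only: mult.assoc)
 moreover have "B K ~= {}" using Beq[of K] by blast
 then have "?N ~= 0" by simp
 ultimately have "16*?N = 512" by (metis mult_cancel_right)
 then have "?N = of_nat 32" by simp
 then show ?thesis by (simp only: of_nat_eq_iff)
qed
text \<open>Characters nontrivial at \<open>- K\<close> are evaluations at points. The inner
  products of \<open>pz\<close> with all point characters add up to 32, with 16 from
  \<open>{}\<close> and 16 from \<open>- K\<close>, so one of them is nonzero; two characters that
  are not orthogonal coincide.\<close>

lemma Bhpqa:
 assumes K: "octad K" and h: "B_hom K pz" "pz (- K) = - 1"
 obtains x where "x ~: K" "!!b. b : B K ==> pz b = pt x b"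
proof -
 have "(SUM x: - K. SUM b:B K. pz b * pt x b) = (SUM b:B K. pz b*(SUM x: - K. pt x b))"
 by (subst sum.swap) (simp add: sum_distrib_left)
 also have "... = (SUM b:B K. (if b = {} then 16 else 0) + (if b = - K then 16 else 0))"
 using h(2) Bheq[OF h(1)] Cneq[OF K]
 by (intro sum.cong refl) (auto simp: spBq[OF K])
 also have "... = 32" using BCq[OF K] by (simp add: sum.distrib)
 finally have "(SUM x: - K. SUM b:B K. pz b * pt x b) ~= 0" by simp
 then obtain x where x: "x : - K" "(SUM b:B K. pz b * pt x b) ~= 0"
 using sum.neutral[of "- K" "%x. SUM b:B K. pz b * pt x b"] by blast
 have "pz b = pt x b" if b: "b : B K" for b
 proof -
 have "pz b * pt x b ~= - 1" using sBhq[OF Bhmq[OF h(1) Bhpq] b] x by blast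
 then show ?thesis using Bhq(1)[OF h(1) b] pt_cases[of x b] by (elim disjE) simp_all
 qed
 then show thesis using that x by auto
qed
lemma peieq: assumes "octad K" "x ~: K" "y ~: K" "!!b. b : B K ==> pt x b = pt y b" shows "x = y"
proof (rule ccontr)
 assume "x ~= y"
 then obtain b where "b : B K" "x : b" "y ~: b" using sq assms by blast
 then show False using assms(4)[of b] by (simp add: pt_def)
qed
end

section \<open>Octads meeting K in two or four points: Gauss sums and sextets\<close>

context golay_code begin
lemma eIoq: assumes "octad d" "octad b" "d ~= b"
 shows "card (d Int b) = 0 | card (d Int b) = 2 | card (d Int b) = 4"
 using oIeqa[OF assms(1,2)] oIlq[OF assms] by presburger
lemma CIBq: "b : B K ==> d Int b Int - K = d Int b" "b : B K ==> b Int - K = b"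
 unfolding B_iff by blast+
lemma Bfqa: assumes "octad K" "b : B K" "octad b" "b ~= - K"
 shows "octad (b +^ - K)" "b +^ - K : B K"
proof -
 show 1: "b +^ - K : B K" using B_sd BCq assms by blast
 show "octad (b +^ - K)" using assms(1) 1
 proof (cases rule: Bcq)
 case 1 then show ?thesis using assms(4) by simp
 next
 case 2 then show ?thesis using assms(3) sd_cancel[of "- K" b] scqa[of b "- K"] by (auto simp: octad_def)
 qed simp
qed
lemma onCq: "octad K ==> octad b ==> b ~= - K"
 using cCoq[of K] by (auto simp: octad_def)
text \<open>Both \<open>b\<close> and \<open>b +^ - K\<close> are octads, and they partition the six
  points of \<open>d\<close> off \<open>K\<close>. Each intersection is 0, 2 or 4, and 0 would force
  6 for the other.\<close>

lemma TIq:
 assumes "octad K" "octad d" "card (d Int K) = 2" "b : B K" "octad b"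
 shows "card (d Int b) = 2 | card (d Int b) = 4"
proof -
 have X: "card (d Int - K) = 6" using csq[of d K] assms(2,3) by (simp add: octadD)
 have ne: "d ~= c" if "c : B K" for c using assms(3) Int_B[OF that] by force
 have e: "card (d Int (b +^ - K)) + card (d Int b) = 6"
 using cIsq[of d b "- K"] CIBq(1)[OF assms(4), of d] X by simp
 note f = Bfqa[OF assms(1,4,5) onCq[OF assms(1,5)]]
 show ?thesis
 using eIoq[OF assms(2,5) ne[OF assms(4)]] eIoq[OF assms(2) f(1) ne[OF f(2)]] e
 by auto
qed
lemma cespq: "of_nat (card (d Int b)) = (SUM y:d. (1 - pt y b)/2)"
 for d :: "'i set"
proof -
 have "(SUM y:d. (1 - pt y b)/2) = (SUM y:d. if y : b then 1 else 0)"
 by (intro sum.cong refl) (simp add: pt_def)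
 then show ?thesis by (simp add: sum.If_cases)
qed
lemma spzq: assumes "octad K" "x ~: K" shows "(SUM b:B K. pt x b) = 0"
 by (rule sBhq[OF Bhpq BCq]) (use assms in simp_all)
text \<open>A Gauss sum. By \<open>TIq\<close> the sign \<open>sQ d b\<close> equals the affine
  function \<open>card (d Int b) - 3\<close> on the octads of \<open>B K\<close>; after
  multiplication by \<open>pt x b\<close> the words \<open>{}\<close> and \<open>- K\<close> need a
  correction of 4 each, together the 8. Orthogonality of point characters extracts whether
  \<open>x\<close> lies in \<open>d\<close>, contributing -16 or 0.\<close>

lemma gTq:
 assumes K: "octad K" and d: "octad d" "card (d Int K) = 2" and x: "x ~: K"
 shows "(SUM b:B K. sQ d b * pt x b) = 8 * pt x d"
proof -
 have X: "card (d Int - K) = 6" using csq[of d K] d by (simp add: octadD)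
 have "sQ d b * pt x b = pt x b * of_nat (card (d Int - K Int b)) - 3 * pt x b
 + ((if b = {} then 4 else 0) + (if b = - K then 4 else 0))" if b: "b : B K" for b
 using K b
 proof (cases rule: Bcq)
 case 1 then show ?thesis using Cneq[OF K] by simp
 next
 case 2
 have "d Int - K Int - K = d Int - K" by blast
 then show ?thesis using X 2 Cneq[OF K] x by (simp add: sQ_def)
 next
 case 3
 have "d Int - K Int b = d Int b" using b unfolding B_iff by blast
 moreover have "b ~= {}" using 3(1) by (auto simp: octad_def)
 ultimately show ?thesis using TIq[OF K d b 3(1)] 3(2) by (elim disjE) (simp_all add: sQ_def)
 qed
 then have "(SUM b:B K. sQ d b * pt x b) = (SUM b:B K. pt x b * of_nat (card (d Int - K Int b)))
 - 3*(SUM b:B K. pt x b) + 8"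
 using BCq[OF K] by (simp add: sum.distrib sum_subtractf flip: sum_distrib_left)
 also have "(SUM b:B K. pt x b * of_nat (card (d Int - K Int b)))
 = (SUM y:d Int - K. SUM b:B K. pt x b*((1 - pt y b)/2))"
 unfolding cespq by (subst sum.swap) (simp add: sum_distrib_left)
 also have "... = (SUM y:d Int - K. if x = y then - 16 else 0)"
 proof (intro sum.cong refl)
 fix y assume y: "y : d Int - K"
 have "(SUM b:B K. pt x b*((1 - pt y b)/2)) = ((SUM b:B K. pt x b) - (SUM b:B K. pt x b * pt y b))/2"
 by (simp add: algebra_simps sum_subtractf sum_divide_distrib diff_divide_distrib)
 then show "(SUM b:B K. pt x b*((1 - pt y b)/2)) = (if x = y then - 16 else 0)"
 using spzq[OF K x] sppq[OF K x, of y] y cBq[OF K] by simp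
 qed
 also have "... = (if x : d then - 16 else 0)" using x by (simp add: sum.delta)
 finally show ?thesis using spzq[OF K x] by (simp add: pt_def)
qed
lemma epiq: "(-1::complex) ^ n = 1 \<longleftrightarrow> even n"
 by (simp add: minus_one_power_iff)
text \<open>
 A 6-set \<open>d - K\<close> contains no affine plane: the other two points of \<open>d\<close> outside \<open>K\<close> would not be
 separated by \<open>B K\<close>.
\<close>
lemma Tnpq:
 assumes K: "octad K" and d: "octad d" "card (d Int K) = 2" and S: "S <= d Int - K" "card S = 4"
 shows "EX b:B K. odd (card (S Int b))"
proof (rule ccontr)
 assume "~ ?thesis"
 then have ev: "even (card (S Int b))" if "b : B K" for b using that by blast
 have "card (d Int - K) = 6" using csq[of d K] d by (simp add: octadD)
 then have "card (d Int - K - S) = 2" using S by (simp add: card_Diff_subset)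
 then obtain p q where pq: "d Int - K - S = {p, q}" "p ~= q" by (meson card_2_iff)
 have p: "p ~: K" "q ~: K" using pq(1) by blast+
 obtain b where b: "b : B K" "p : b" "q ~: b" using sq[OF K p pq(2)] by blast
 have "p : d Int b" "p ~: S" using pq(1) b by blast+
 have "d Int b = insert p (S Int b)"
 proof (rule Set.set_eqI)
 fix y
 have "y : d Int - K - S \<longleftrightarrow> y = p | y = q" using pq(1) by simp
 moreover have "y : b ==> y ~: K" using b unfolding B_iff by blast
 moreover have "y : S ==> y : d" using S by blast
 ultimately show "y : d Int b \<longleftrightarrow> y : insert p (S Int b)" using b by blast
 qed
 then have "card (d Int b) = Suc (card (S Int b))" using \<open>p ~: S\<close> by simp
 then show False using ev[OF b(1)] eIq[OF octadD(1)[OF d(1)] Bwq[OF b(1)]] by simp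
qed
text \<open>The product of the signs is \<open>sQ (d +^ f) b * sT d f b\<close>, and
  \<open>sT d f\<close> is a point character on \<open>B K\<close>. Either \<open>d +^ f\<close> or
  \<open>(d +^ f) +^ - K\<close> is an octad, which reduces the sum to \<open>gTq\<close>.\<close>

lemma gTTq:
 assumes K: "octad K" and d: "octad d" "card (d Int K) = 2" and f: "octad f" "card (f Int K) = 2"
 and df: "card (d Int f Int K) = 1"
 shows "(SUM b:B K. sQ d b * sQ f b) = 8 * sQ d f"
proof -
 have C: "d : C" "f : C" "- K : C" using d f K octadD Cwq by blast+
 have dfK: "card ((d +^ f) Int K) = 2"
 proof -
 have "d Int K Int (f Int K) = d Int f Int K" by blast
 then show ?thesis using csqa[of "d Int K" "f Int K"] d f df by (simp add: sd_Int)
 qed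
 have sp: "card (d Int f) = 1 + card (d Int f Int - K)" using csq[of "d Int f" K] df by simp
 have "d ~= f" using d df by auto
 then have cases: "card (d Int f) = 2 | card (d Int f) = 4"
 using eIoq[OF d(1) f(1)] sp by linarith
 have e: "sQ d b * sQ f b = sQ (d +^ f) b * sT d f b" if "b : B K" for b
 using swq(2)[OF Bwq[OF that] C(1,2)] by (simp add: mult.assoc)
 show ?thesis using cases
 proof
 assume 2: "card (d Int f) = 2"
 then have "card (d Int f Int - K) = 1" using sp by simp
 then obtain z where z: "d Int f Int - K = {z}" by (metis card_1_singletonE)
 then have zz: "z : d" "z : f" "z ~: K" by blast+
 define k where "k = (d +^ f) +^ - K"
 have c12: "card (d +^ f) = 12" using csqa[of d f] 2 d f by (simp add: octadD)
 then have "card ((d +^ f) Int - K) = 10" using csq[of "d +^ f" K] dfK by simp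
 then have k8: "card k = 8" using csqa[of "d +^ f" "- K"] c12 cCoq[OF K] by (simp add: k_def)
 have kC: "k : C" unfolding k_def using C scq by blast
 have "k Int K = (d +^ f) Int K" unfolding k_def by (simp add: sd_Int)
 then have kK: "card (k Int K) = 2" using dfK by simp
 have "sQ d b * sQ f b = sQ k b * pt z b" if b: "b : B K" for b
 proof -
 have "d Int f Int b = {z} Int b" using z b unfolding B_iff by blast
 then have "sT d f b = pt z b" by (simp add: sT_def pt_def)
 moreover have "sQ k b = sQ (d +^ f) b"
 unfolding k_def swq(2)[OF Bwq[OF b] scq[OF C(1,2)] C(3)]
 by (simp add: sQ_B[OF K BCq[OF K] b] sCq[OF b scq[OF C(1,2)]])
 ultimately show ?thesis using e[OF b] by simp
 qed
 then have "(SUM b:B K. sQ d b * sQ f b) = 8 * pt z k"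
 using gTq[OF K _ kK zz(3)] k8 kC by (simp add: octad_def)
 also have "pt z k = - 1" using zz by (simp add: pt_def k_def)
 finally show ?thesis using 2 by (simp add: sQ_def)
 next
 assume 4: "card (d Int f) = 4"
 then have 3: "card (d Int f Int - K) = 3" using sp by simp
 then have "sT d f (- K) = - 1" by (simp add: sT_def)
 then obtain y where y: "y ~: K" "!!b. b : B K ==> sT d f b = pt y b"
 using Bhpqa[OF K Bhsq] by metis
 have oct: "octad (d +^ f)" using csqa[of d f] 4 d f scq by (simp add: octad_def)
 \<comment> \<open>If the point \<open>y\<close> of the character were in \<open>d\<close> or
   \<open>f\<close> but not in both, then \<open>y\<close> and the three common points off
   \<open>K\<close> would form a 4-set meeting every word of \<open>B K\<close> evenly, against
   \<open>Tnpq\<close>.\<close>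
 have no: False if h: "octad h" "card (h Int K) = 2" "y : h" "d Int f <= h" and n: "y ~: d Int f" for h
 proof -
 have n': "y ~: d Int f Int - K" using n by blast
 have c: "card (insert y (d Int f Int - K)) = 4" using card_insert_disjoint[OF finite n'] 3 by linarith
 have "insert y (d Int f Int - K) <= h Int - K" using h y(1) by blast
 then obtain b where b: "b : B K" "odd (card (insert y (d Int f Int - K) Int b))"
 using Tnpq[OF K h(1,2) _ c] by blast
 have "d Int f Int - K Int b = d Int f Int b" using b unfolding B_iff by blast
 then have 1: "(-1::complex) ^ card (b Int (d Int f Int - K)) = pt y b"
 using y(2)[OF b(1)] by (simp add: sT_def Int_commute)
 have "insert y (d Int f Int - K) = (d Int f Int - K) +^ {y}" using n' by auto
 then have "(-1::complex) ^ card (insert y (d Int f Int - K) Int b)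
 = (-1) ^ card (b Int (d Int f Int - K))*(-1) ^ card (b Int {y})"
 using mpeq[OF cIsq[of b "d Int f Int - K" "{y}"]] by (simp only: Int_commute)
 also have "... = 1" unfolding 1 by (simp add: pt_def)
 finally show False using b(2) by (simp add: minus_one_power_iff)
 qed
 have "y ~: d +^ f"
 proof
 assume "y : d +^ f"
 then show False using no[OF d] no[OF f] by auto
 qed
 then have "8 * pt y (d +^ f) = 8 * sQ d f" using 4 by (simp add: pt_def sQ_def)
 moreover have "(SUM b:B K. sQ d b * sQ f b) = 8 * pt y (d +^ f)"
 using gTq[OF K oct dfK y(1)] e y(2) by simp
 ultimately show ?thesis by simp
 qed
qed
text \<open>Nondegeneracy modulo \<open>- K\<close>. Translating the summation variable of
  \<open>gTq\<close> by a radical element \<open>e\<close> multiplies the Gauss sum by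
  \<open>sQ d e * pt x e\<close>. As the sum is nonzero, \<open>pt x e\<close> is the same for all
  points \<open>x\<close> off \<open>K\<close>.\<close>

lemma Trq:
 assumes K: "octad K" and d: "octad d" "card (d Int K) = 2" and e: "e : B K" "!!b. b : B K ==> sT d e b = 1"
 shows "e = {} | e = - K"
proof -
 have C: "d : C" "e : C" using d e octadD Bwq by blast+
 have "pt x e = sQ d e" if x: "x ~: K" for x
 proof -
 have "8 * pt x d = (SUM b:B K. sQ d (b +^ e) * pt x (b +^ e))"
 unfolding gTq[OF K d x, symmetric]
 by (rule ssrqa[symmetric]) (use e B_sd in auto)
 also have "... = (SUM b:B K. (sQ d e * pt x e)*(sQ d b * pt x b))"
 proof (intro sum.cong refl)
 fix b assume b: "b : B K"
 have "sT d b e = 1" using e(2)[OF b] spq by metis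
 then show "sQ d (b +^ e) * pt x (b +^ e) = sQ d e * pt x e*(sQ d b * pt x b)"
 using swq(1)[OF C(1) Bwq[OF b] C(2)] by (simp add: pt_sd)
 qed
 also have "... = (sQ d e * pt x e)*(8 * pt x d)"
 by (simp only: gTq[OF K d x] flip: sum_distrib_left)
 finally show ?thesis using pt_cases[of x d] pt_cases[of x e] sQ_cases[of d e] by (auto simp: pt_def split: if_splits)
 qed
 then have "(if x : e then - 1 else 1) = sQ d e" if "x ~: K" for x
 using that by (simp only: pt_def)
 then have "x : e \<longleftrightarrow> sQ d e = - 1" if "x ~: K" for x
 using that by (cases "x : e") force+
 then have "(ALL x. x ~: K --> x : e) | (ALL x. x ~: K --> x ~: e)" by blast
 moreover have "x : e ==> x ~: K" for x using e(1) unfolding B_iff by blast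
 ultimately show ?thesis by blast
qed
text \<open>The octads of \<open>B K\<close> are the hyperplanes of an affine 4-space on the 16
  points \<open>- K\<close>. For a tetrad \<open>T\<close> of \<open>K\<close> the sets
  \<open>h - K\<close> form one parallel class of planes there; they are four of the six tetrads of
  the sextet of \<open>T\<close>.\<close>

definition planes :: "'i set => 'i set => 'i set set" where
 "planes K T = {h. octad h & h Int K = T}"
lemma planesI: "octad h ==> h Int K = T ==> h : planes K T"
 and planesD: "h : planes K T ==> octad h" "h : planes K T ==> h Int K = T" "h : planes K T ==> h : C"
 "h : planes K T ==> card h = 8"
 by (simp_all add: planes_def octad_def)
lemma otq: assumes "octad K" "T <= K" "card T = 4" "x ~: K"
 shows "EX h. octad h & h Int K = T & x : h"
proof -
 have "x ~: T" using assms by blast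
 then have "card (insert x T) = 5" using assms by simp
 then obtain h where h: "octad h" "insert x T <= h" using oeq by blast
 then have "h ~= K" using assms by blast
 then have "h Int K = T" using oIeq[OF h(1) assms(1), of T] h assms by blast
 then show ?thesis using h by blast
qed
lemma peq: assumes "octad K" "T <= K" "card T = 4" "x ~: K" obtains h where "h : planes K T" "x : h"
 using otq[OF assms] that planesI by blast
lemma pIq: assumes "h : planes K T" "g : planes K T" "h ~= g" "card T = 4" shows "h Int g = T"
proof (rule oIeq[OF planesD(1)[OF assms(1)] planesD(1)[OF assms(2)] assms(3)])
 show "T <= h" "T <= g" using planesD(2)[OF assms(1)] planesD(2)[OF assms(2)] by blast+
qed (rule assms)
lemma psq: assumes "h : planes K T" "g : planes K T" shows "h +^ g : B K"
 using planesD[OF assms(1)] planesD[OF assms(2)] by (simp add: B_iff scq sd_Int)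
lemma psoq: assumes "h : planes K T" "g : planes K T" "h ~= g" "card T = 4" shows "octad (h +^ g)"
 using planesD[OF assms(1)] planesD[OF assms(2)] pIq[OF assms] csqa[of h g] assms(4)
 by (simp add: octad_def scq)
lemma paq: assumes "h : planes K T" "b : B K" "octad (h +^ b)" shows "h +^ b : planes K T"
 using assms planesD(2)[OF assms(1)] Int_B(2)[OF assms(2)] by (intro planesI) (simp_all add: sd_Int)
lemma cpmq: "h : planes K T ==> card T = 4 ==> card (h Int - K) = 4"
 using csq[of h K] planesD(2,4)[of h K T] by simp
lemma cpq: assumes K: "octad K" and T: "T <= K" "card T = 4" shows "card (planes K T) = 4"
proof -
 have "card (UN h:planes K T. h Int - K) = (SUM h:planes K T. card (h Int - K))"
 proof (rule card_UN_disjoint)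
 show "ALL h:planes K T. ALL g:planes K T. h ~= g --> h Int - K Int (g Int - K) = {}"
 using pIq[of _ K T] T by blast
 qed simp_all
 also have "... = 4 * card (planes K T)" using cpmq[OF _ T(2)] by simp
 also have "(UN h:planes K T. h Int - K) = - K" using peq[OF K T] by blast
 finally show ?thesis using cCoq[OF K] by simp
qed
text \<open>The octads through \<open>insert i R\<close> and \<open>x\<close> and through
  \<open>insert j R\<close> and \<open>x\<close> share the tetrad \<open>insert x R\<close>. Their
  sum is therefore an octad, and on \<open>K\<close> only \<open>i\<close> and \<open>j\<close>
  survive.\<close>

lemma opmq:
 assumes K: "octad K" and ij: "i : K" "j : K" "i ~= j" and R: "R <= K - {i, j}" "card R = 3" and x: "x ~: K"
 obtains H1 H2 where "octad H1" "H1 Int K = insert i R" "x : H1" "octad H2" "H2 Int K = insert j R" "x : H2"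
 "octad (H1 +^ H2)" "(H1 +^ H2) Int K = {i, j}"
proof -
 have n: "i ~: R" "j ~: R" using R by blast+
 obtain H1 where H1: "octad H1" "H1 Int K = insert i R" "x : H1"
 using otq[OF K, of "insert i R" x] ij R x n by auto
 obtain H2 where H2: "octad H2" "H2 Int K = insert j R" "x : H2"
 using otq[OF K, of "insert j R" x] ij R x n by auto
 have "i ~: H2 Int K" using n ij H2(2) by auto
 then have "H1 ~= H2" using H1(2) ij by blast
 have "insert x R <= H1 Int H2" using H1 H2 by blast
 moreover have "x ~: R" using x R by blast
 ultimately have "4 <= card (H1 Int H2)" using R(2) card_mono[of "H1 Int H2" "insert x R"] by simp
 then have "card (H1 Int H2) = 4" using oIlq[OF H1(1) H2(1) \<open>H1 ~= H2\<close>] by simp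
 then have "octad (H1 +^ H2)" using csqa[of H1 H2] H1 H2 scq by (simp add: octad_def)
 moreover have "(H1 +^ H2) Int K = {i, j}" using n ij by (auto simp: sd_Int H1 H2)
 ultimately show thesis using that H1 H2 by blast
qed
lemma oaq: assumes "card (A :: 'i set) = n" "finite S" "card S + k <= n"
 obtains R where "R <= A - S" "card R = k"
proof -
 have "card A - card S <= card (A - S)" by (rule diff_card_le_card_Diff) (rule assms)
 then have "k <= card (A - S)" using assms by linarith
 then show thesis using that by (metis obtain_subset_with_card_n)
qed
lemma enioq: assumes "octad K" obtains x where "x ~: K"
 using Cneq[OF assms] by blast
lemma ompq: assumes K: "octad K" and p: "p <= K" "card p = 2"
 obtains H where "octad H" "H Int K = p"
proof -
 obtain i j where ij: "p = {i, j}" "i ~= j" using p by (meson card_2_iff)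
 obtain R where R: "R <= K - {i, j}" "card R = 3"
 using oaq[of K 8 "{i, j}" 3] K ij by (auto simp: octadD)
 obtain x where "x ~: K" using enioq[OF K] .
 then show thesis using opmq[OF K _ _ ij(2) R] that ij p by (metis insert_subset)
qed
text \<open>With \<open>R\<close> in \<open>F - F1\<close> and \<open>x\<close> in
  \<open>F1 - F\<close>, the octads \<open>H1\<close> and \<open>H2\<close> of \<open>opmq\<close>
  both meet the octad \<open>F +^ F1\<close> exactly in \<open>insert x R\<close>. Their sum avoids
  \<open>F +^ F1\<close>, so it has the same trace on \<open>F1\<close> as on
  \<open>F\<close>.\<close>

lemma ombq:
 assumes F: "octad F" "octad F1" "card (F Int F1) = 4" and p: "p <= F Int F1" "card p = 2"
 obtains H where "octad H" "H Int F = p" "H Int F1 = p"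
proof -
 obtain i j where ij: "p = {i, j}" "i ~= j" using p by (meson card_2_iff)
 have L: "octad (F +^ F1)" using csqa[of F F1] F scq by (simp add: octad_def)
 have "card (F Int - F1) = 4" using csq[of F F1] F by (simp add: octadD)
 then have "3 <= card (F Int - F1)" by simp
 then obtain R where R: "R <= F Int - F1" "card R = 3" by (metis obtain_subset_with_card_n)
 have "card (F1 Int - F) = 4" using csq[of F1 F] F by (simp add: octadD Int_commute)
 then have "F1 Int - F ~= {}" by force
 then obtain x where x: "x : F1" "x ~: F" by blast
 have R': "R <= F - {i, j}" using R ij p by blast
 have iF: "i : F" "j : F" "i : F1" "j : F1" using ij p by blast+
 obtain H1 H2 where H: "octad H1" "H1 Int F = insert i R" "x : H1" "octad H2" "H2 Int F = insert j R" "x : H2"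
 "octad (H1 +^ H2)" "(H1 +^ H2) Int F = {i, j}"
 using opmq[OF F(1) iF(1,2) ij(2) R' R(2) x(2)] by blast
 have c4: "card (insert x R) = 4" using R x by (subst card_insert_disjoint) auto
 have H1L: "H1 Int (F +^ F1) = insert x R"
 proof (rule oIeq[OF H(1) L])
 show "H1 ~= F +^ F1" using H(2) iF by auto
 qed (use H R x c4 in auto)
 have H2L: "H2 Int (F +^ F1) = insert x R"
 proof (rule oIeq[OF H(4) L])
 show "H2 ~= F +^ F1" using H(5) iF by auto
 qed (use H R x c4 in auto)
 have "(H1 +^ H2) Int F1 = {i, j}"
 proof (rule Set.set_eqI)
 fix y
 have "y : H1 Int (F +^ F1) \<longleftrightarrow> y : H2 Int (F +^ F1)" by (simp only: H1L H2L)
 moreover have "y : (H1 +^ H2) Int F \<longleftrightarrow> y = i | y = j" by (simp only: H(8)) simp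
 ultimately show "y : (H1 +^ H2) Int F1 \<longleftrightarrow> y : {i, j}" using iF by auto
 qed
 then show thesis using that H ij by blast
qed
text \<open>Two tetrads of \<open>K\<close> sharing only \<open>i\<close> are each completed by
  \<open>j\<close>. More than two common points of \<open>F\<close> and \<open>F'\<close> would put
  more than four points of \<open>F'\<close> into the octad \<open>F +^ K\<close>.\<close>

lemma ofmpq:
 assumes K: "octad K" and ij: "i : K" "j ~: K"
 obtains F F' where "octad F" "octad F'" "F Int F' = {i, j}" "card (F Int K) = 4" "card (F' Int K) = 4"
proof -
 obtain R where R: "R <= K - {i}" "card R = 3"
 using oaq[of K 8 "{i}" 3] K by (auto simp: octadD)
 have iR: "i ~: R" using R by blast
 have cT: "card (insert i R) = 4" using R iR by simp
 obtain R' where R': "R' <= K - insert i R" "card R' = 3"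
 using oaq[of K 8 "insert i R" 3] K cT by (auto simp: octadD)
 have iR': "i ~: R'" "R Int R' = {}" using R' by blast+
 have cT': "card (insert i R') = 4" using R' iR' by simp
 obtain F where F: "octad F" "F Int K = insert i R" "j : F"
 using otq[OF K _ cT ij(2)] ij R by blast
 obtain F' where F': "octad F'" "F' Int K = insert i R'" "j : F'"
 using otq[OF K _ cT' ij(2)] ij R' by blast
 have "F Int F' Int K = insert i R Int insert i R'" using F(2) F'(2) by blast
 then have i1: "F Int F' Int K = {i}" using iR' by auto
 have "R ~= {}" using R(2) by force
 have "F ~= F'"
 proof
 assume "F = F'"
 then have "insert i R = insert i R'" using F(2) F'(2) by simp
 moreover obtain r where r: "r : R" using \<open>R ~= {}\<close> by (meson ex_in_conv)
 ultimately have "r : insert i R'" by (metis insertI2)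
 moreover have "r ~= i" using r iR by (metis)
 moreover have "r ~: R'" using r iR'(2) by (metis IntI empty_iff)
 ultimately show False by simp
 qed
 have L: "octad (F +^ K)" using csqa[of F K] F K cT scq by (simp add: octad_def)
 have "i : F" "i : F'" using F(2) F'(2) by blast+
 then have "i ~: F +^ K" using ij by simp
 then have "F' ~= F +^ K" using \<open>i : F'\<close> by metis
 then have le: "card (F' Int (F +^ K)) <= 4" using oIlq[OF F'(1) L] by simp
 have "card (F' Int F Int K) = 1" using i1 by (simp add: Int_commute)
 then have "card (F' Int (F +^ K)) + 2 = card (F' Int F) + 4"
 using cIsq[of F' F K] F'(2) cT' by simp
 then have "card (F Int F') <= 2" using le by (simp add: Int_commute)
 moreover have "{i, j} <= F Int F'" using F F' by blast
 moreover have "card {i, j} = 2" using ij by (metis card_2_iff)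
 ultimately have "F Int F' = {i, j}" by (metis card_seteq finite)
 then show thesis using that F F' cT cT' by simp
qed
lemma sqa:
 assumes K: "octad K" and i: "i ~: K" "j ~: K" "k ~: K" "i ~= k" "j ~= k"
 shows "EX b:B K. i : b & j : b & k ~: b"
proof -
 obtain b where b: "b : B K" "i : b" "k ~: b" using sq[OF K i(1,3,4)] by blast
 obtain c where c: "c : B K" "j : c" "k ~: c" using sq[OF K i(2,3,5)] by blast
 show ?thesis
 proof (cases "j : b | i : c")
 case True then show ?thesis using b c by blast
 next
 case False
 then show ?thesis using b c B_sd[OF b(1) c(1)] by (intro bexI[of _ "b +^ c"]) auto
 qed
qed
lemma Boqa: assumes "octad K" "b : B K" "x : b" "y ~: b" "y ~: K" shows "octad b"
 using assms(1,2) by (cases rule: Bcq) (use assms in auto)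
text \<open>\<open>F'\<close> is an octad through \<open>i\<close>, \<open>j\<close> and three
  points of \<open>K\<close>; it has two further points off \<open>K\<close>. \<open>F\<close> is an
  octad of \<open>B K\<close> through \<open>i\<close> and \<open>j\<close> that misses one of these
  two, and then it misses the other as well because octads never meet in three points.\<close>

lemma ofopq:
 assumes K: "octad K" and ij: "i ~: K" "j ~: K" "i ~= j"
 obtains F F' where "octad F" "octad F'" "F Int F' = {i, j}" "F Int K = {}" "card (F' Int K) = 4"
proof -
 obtain R where R: "R <= K - {}" "card R = 3"
 using oaq[of K 8 "{}" 3] K by (auto simp: octadD)
 have n: "i ~: R" "j ~: R" using R ij by blast+
 then have "card (insert i (insert j R)) = 5" using R ij by simp
 then obtain F' where F': "octad F'" "insert i (insert j R) <= F'" using oeq by blast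
 have nF': "F' ~= K" using F' ij by blast
 have "R <= F' Int K" using F' R by blast
 then have "3 <= card (F' Int K)" using R(2) card_mono[of "F' Int K" R] by simp
 then have c4: "card (F' Int K) = 4"
 using oIlq[OF F'(1) K nF'] oInq[OF F'(1) K] by linarith
 then have "card (F' Int - K) = 4" using csq[of F' K] F' by (simp add: octadD)
 then have "card (F' Int - K - {i, j}) = 2" using F' ij by (subst card_Diff_subset) auto
 then obtain k l where kl: "F' Int - K - {i, j} = {k, l}" "k ~= l" by (meson card_2_iff)
 have k: "k ~: K" "i ~= k" "j ~= k" "l ~: K" "l ~= i" "l ~= j" "k : F'" "l : F'" using kl(1) by blast+
 obtain b where b: "b : B K" "i : b" "j : b" "k ~: b" using sqa[OF K ij(1,2) k(1-3)] by blast
 have ob: "octad b" using Boqa[OF K b(1,2,4) k(1)] .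
 have mem: "y : F' Int b \<longleftrightarrow> y = i | y = j | (y = l & l : b)" for y
 proof -
 have "y : F' Int - K - {i, j} \<longleftrightarrow> y = k | y = l" using kl(1) by simp
 moreover have "y : b ==> y ~: K" using b unfolding B_iff by blast
 ultimately show ?thesis using F' b k by blast
 qed
 have "l ~: b"
 proof
 assume "l : b"
 then have "F' Int b = {i, j, l}" using mem by blast
 then have "card (F' Int b) = 3" using ij k by simp
 then show False using oInq[OF F'(1) ob] by simp
 qed
 then have "b Int F' = {i, j}" using mem by blast
 then show thesis using that[OF ob F'(1)] c4 Int_B(2)[OF b(1)] by simp
qed
lemma odeq: assumes K: "octad K" obtains b where "octad b" "b : B K"
proof -
 obtain i where i: "i ~: K" using enioq[OF K] .
 have "~ - K <= {i}" using cCoq[OF K] card_mono[of "{i}" "- K"] by auto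
 then obtain j where j: "j ~: K" "i ~= j" by blast
 obtain b where "b : B K" "i : b" "j ~: b" using sq[OF K i j] by blast
 then show thesis using that Boqa[OF K] j by blast
qed
lemma oaqc: obtains K where "octad K" "i ~: K" "j ~: K"
proof -
 have c2: "card {i, j} <= 2" by (simp add: card_insert_if)
 then have "card {i, j} + (5 - card {i, j}) <= 24" by simp
 then obtain R where R: "R <= UNIV - {i, j}" "card R = 5 - card {i, j}"
 using oaq[of "UNIV :: 'i set" 24 "{i, j}"] card_index finite by metis
 define S where "S = {i, j} Un R"
 have "card S = card {i, j} + card R" unfolding S_def using R by (intro card_Un_disjoint) auto
 then have S: "{i, j} <= S" "card S = 5" using R(2) c2 by (auto simp: S_def)
 obtain M where M: "octad M" "S <= M" using oeq[OF S(2)] by blast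
 obtain K where "octad K" "K : B M" using odeq[OF M(1)] .
 moreover from this have "i ~: K" "j ~: K" using M S unfolding B_iff by blast+
 ultimately show thesis using that by blast
qed
lemma osq: assumes "i ~= j" obtains K where "octad K" "i : K" "j ~: K"
proof -
 obtain M where M: "octad M" "i ~: M" "j ~: M" using oaqc .
 obtain b where "b : B M" "i : b" "j ~: b" using sq[OF M assms] by blast
 then show thesis using that Boqa[OF M(1)] M by blast
qed
text \<open>Flags of 5-sets in octads: \<open>24 choose 5 = 42504\<close> sets lie in one octad
  each, and an octad contains \<open>8 choose 5 = 56\<close> of them.\<close>

lemma coqb: "card {K. octad K} = 759"
proof -
 have "(SUM S:{S :: 'i set. card S = 5}. SUM K:{K. octad K}. if S <= K then 1 else 0) = card {S :: 'i set. card S = 5}"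
 proof -
 have "(SUM K:{K. octad K}. if S <= K then 1 else (0::nat)) = 1" if S: "card S = 5" for S :: "'i set"
 proof -
 obtain M where M: "octad M" "S <= M" using oeq[OF S] by blast
 have "S <= K \<longleftrightarrow> K = M" if "octad K" for K
 proof
 assume "S <= K"
 then have "card S <= card (K Int M)" using M by (intro card_mono) auto
 then show "K = M" using oeqa[OF that M(1)] S by simp
 qed (use M in simp)
 then have "(SUM K:{K. octad K}. if S <= K then 1 else (0::nat)) = (SUM K:{K. octad K}. if K = M then 1 else 0)"
 by (intro sum.cong refl) simp
 then show ?thesis using M by simp
 qed
 then show ?thesis by simp
 qed
 moreover have "(SUM S:{S :: 'i set. card S = 5}. SUM K:{K. octad K}. if S <= K then 1 else 0)
 = (SUM K:{K. octad K}. SUM S:{S :: 'i set. card S = 5}. if S <= K then 1 else (0::nat))"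
 by (rule sum.swap)
 moreover have "(SUM S:{S :: 'i set. card S = 5}. if S <= K then 1 else (0::nat)) = 56" if "octad K" for K
 proof -
 have "{S. card S = 5} Int {S. S <= K} = {S. S <= K & card S = 5}" by blast
 then have "(SUM S:{S :: 'i set. card S = 5}. if S <= K then 1 else (0::nat)) = card {S. S <= K & card S = 5}"
 by (simp add: sum.If_cases)
 then show ?thesis using n_subsets[of K 5] that by (simp add: octadD binomial_fact' fact_numeral)
 qed
 moreover have "card {S :: 'i set. card S = 5} = 42504"
 using n_subsets[of "UNIV :: 'i set" 5] card_index by (simp add: binomial_fact' fact_numeral)
 ultimately show ?thesis by simp
qed
text \<open>The same count with one point fixed: \<open>23 choose 4 = 8855\<close> divided by
  \<open>7 choose 4 = 35\<close>.\<close>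

lemma cocq: "card {K. octad K & i : K} = 253"
proof -
 let ?S = "{S. S <= UNIV - {i} & card S = 4}"
 have "(SUM S:?S. SUM K:{K. octad K & i : K}. if S <= K then 1 else 0) = card ?S"
 proof -
 have "(SUM K:{K. octad K & i : K}. if S <= K then 1 else (0::nat)) = 1" if S: "S : ?S" for S
 proof -
 have "i ~: S" using S by blast
 then have c5: "card (insert i S) = 5" using S by simp
 then obtain M where M: "octad M" "insert i S <= M" using oeq by blast
 have "S <= K \<longleftrightarrow> K = M" if "octad K & i : K" for K
 proof
 assume "S <= K"
 then have "card (insert i S) <= card (K Int M)" using M that by (intro card_mono) auto
 then show "K = M" using oeqa[of K M] M that c5 by simp
 qed (use M in simp)
 then have "(SUM K:{K. octad K & i : K}. if S <= K then 1 else (0::nat))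
 = (SUM K:{K. octad K & i : K}. if K = M then 1 else 0)"
 by (intro sum.cong refl) simp
 then show ?thesis using M by simp
 qed
 then show ?thesis by simp
 qed
 moreover have "(SUM S:?S. SUM K:{K. octad K & i : K}. if S <= K then 1 else 0)
 = (SUM K:{K. octad K & i : K}. SUM S:?S. if S <= K then 1 else (0::nat))"
 by (rule sum.swap)
 moreover have "(SUM S:?S. if S <= K then 1 else (0::nat)) = 35" if "octad K & i : K" for K
 proof -
 have "?S Int {S. S <= K} = {S. S <= K - {i} & card S = 4}" by blast
 then have "(SUM S:?S. if S <= K then 1 else (0::nat)) = card {S. S <= K - {i} & card S = 4}"
 by (simp add: sum.If_cases)
 moreover have "card (K - {i}) = 7" using that by (simp add: octadD)
 ultimately show ?thesis using n_subsets[of "K - {i}" 4] by (simp add: binomial_fact' fact_numeral)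
 qed
 moreover have "card (UNIV - {i}) = 23" using card_index by (simp add: card_Diff_subset)
 then have "card ?S = 8855"
 using n_subsets[of "UNIV - {i}" 4] by (simp add: binomial_fact' fact_numeral)
 ultimately show ?thesis by simp
qed
text \<open>Existence by averaging. Summed over all \<open>J\<close>, the product of the inner
  products of \<open>pz\<close> and \<open>fz\<close> with the sign of \<open>J\<close> is 2^24
  times the size of \<open>B K Int B L\<close>, since only \<open>b = c\<close> contributes. So some
  \<open>J\<close> has both inner products nonzero, which forces equality of characters.\<close>

lemma Bheqa:
 assumes K: "octad K" "octad L" and h: "B_hom K pz" "B_hom L fz"
 and agree: "!!b. b : B K ==> b : B L ==> pz b = fz b"
 obtains J where "!!b. b : B K ==> pz b = (-1) ^ card (J Int b)" "!!c. c : B L ==> fz c = (-1) ^ card (J Int c)"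
proof -
 have e: "(-1::complex) ^ card (J Int (b +^ c)) = (-1) ^ card (J Int b)*(-1) ^ card (J Int c)" for J b c :: "'i set"
 using mpeq[OF cIsq] by blast
 have hJ: "B_hom M (%b. (-1) ^ card (J Int b))" for M J
 unfolding B_hom_def using e by (simp add: minus_one_power_iff)
 have "(SUM J:UNIV. (SUM b:B K. pz b*(-1) ^ card (J Int b))*(SUM c:B L. fz c*(-1) ^ card (J Int c)))
 = (SUM J:UNIV. SUM b:B K. SUM c:B L. pz b * fz c*(-1) ^ card (J Int (b +^ c)))"
 unfolding sum_product e by (simp add: mult_ac)
 also have "... = (SUM b:B K. SUM J:UNIV. SUM c:B L. pz b * fz c*(-1) ^ card (J Int (b +^ c)))"
 by (rule sum.swap)
 also have "... = (SUM b:B K. SUM c:B L. SUM J:UNIV. pz b * fz c*(-1) ^ card (J Int (b +^ c)))"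
 by (intro sum.cong refl sum.swap)
 also have "... = (SUM b:B K. SUM c:B L. if c = b then 2 ^ 24 else 0)"
 proof (intro sum.cong refl)
 fix b c assume bc: "b : B K" "c : B L"
 have "(SUM J:UNIV. pz b * fz c*(-1) ^ card (J Int (b +^ c))) = pz b * fz c*(if b = c then 2 ^ 24 else 0)"
 using spsq[of "b +^ c"] card_index by (simp flip: sum_distrib_left)
 moreover have "pz b * fz c = 1" if "b = c"
 using agree[of b] bc that Bhq(3)[OF h(1), of b] by simp
 ultimately show "(SUM J:UNIV. pz b * fz c*(-1) ^ card (J Int (b +^ c))) = (if c = b then 2 ^ 24 else 0)"
 by (cases "b = c") (simp_all only: if_True if_False mult_1_left mult_zero_right refl eq_commute)
 qed
 also have "... = (SUM b:B K. if b : B L then 2 ^ 24 else 0)" by (simp add: sum.delta)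
 also have "... = 2 ^ 24 * of_nat (card (B K Int B L))" by (simp add: sum.If_cases)
 also have "... ~= 0"
 proof -
 have "B K Int B L ~= {}" using Beq[of K] Beq[of L] by blast
 then show ?thesis by simp
 qed
 finally have ne: "(SUM J:UNIV. (SUM b:B K. pz b*(-1) ^ card (J Int b))*(SUM c:B L. fz c*(-1) ^ card (J Int c))) ~= 0" .
 obtain J where "(SUM b:B K. pz b*(-1) ^ card (J Int b))*(SUM c:B L. fz c*(-1) ^ card (J Int c)) ~= 0"
 by (rule sum.not_neutral_contains_not_neutral[OF ne])
 then have J: "(SUM b:B K. pz b*(-1) ^ card (J Int b)) ~= 0" "(SUM c:B L. fz c*(-1) ^ card (J Int c)) ~= 0"
 unfolding mult_eq_0_iff de_Morgan_disj by blast+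
 have *: "pz b = (-1) ^ card (J Int b)" if "B_hom M pz" "(SUM b:B M. pz b*(-1) ^ card (J Int b)) ~= 0" "b : B M" for M pz b
 proof -
 have "pz b*(-1) ^ card (J Int b) ~= - 1"
 using sBhq[OF Bhmq[OF that(1) hJ[of M J]] that(3)] that(2) by blast
 then show ?thesis using Bhq(1)[OF that(1,3)]
 by (elim disjE; cases "even (card (J Int b))") (simp_all add: minus_one_power_iff)
 qed
 show thesis using that *[OF h(1) J(1)] *[OF h(2) J(2)] by blast
qed
lemma diq: "pz : dual K \<longleftrightarrow> B_hom K pz & pz : extensional (B K)"
 unfolding dual_def B_hom_def PiE_def Pi_def sd_def by auto
text \<open>The characters with value -1 at \<open>- K\<close> are the 16 point characters;
  multiplication by one of them is a bijection onto those with value 1.\<close>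

lemma cdq: assumes K: "octad K" shows "card (dual K) = 32"
proof -
 have BX: "- K : B K" using BCq[OF K] .
 let ?r = "%pz. restrict pz (B K)"
 have hr: "B_hom K (?r pz)" if "B_hom K pz" for pz
 using that B_sd unfolding B_hom_def by simp
 define Dm where "Dm = {pz : dual K. pz (- K) = - 1}"
 define Dp where "Dp = {pz : dual K. pz (- K) = 1}"
 have "Dm = (%x. ?r (pt x)) ` (- K)"
 proof
 show "Dm <= (%x. ?r (pt x)) ` (- K)"
 proof
 fix pz assume "pz : Dm"
 then have h: "B_hom K pz" "pz : extensional (B K)" "pz (- K) = - 1" by (auto simp: Dm_def diq)
 obtain x where x: "x ~: K" "!!b. b : B K ==> pz b = pt x b" using Bhpqa[OF K h(1,3)] by blast
 then have "pz = ?r (pt x)" using h(2) by (intro ext) (auto simp: restrict_def extensional_def)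
 then show "pz : (%x. ?r (pt x)) ` (- K)" using x by blast
 qed
 show "(%x. ?r (pt x)) ` (- K) <= Dm" using hr[OF Bhpq] BX by (auto simp: Dm_def diq)
 qed
 moreover have "inj_on (%x. ?r (pt x)) (- K)"
 proof (rule inj_onI)
 fix x y assume xy: "x : - K" "y : - K" and eq: "?r (pt x) = ?r (pt y)"
 have "pt x b = pt y b" if "b : B K" for b using fun_cong[OF eq, of b] that by simp
 then show "x = y" using peieq[OF K, of x y] xy by blast
 qed
 ultimately have cm: "card Dm = 16" using cCoq[OF K] by (simp add: card_image)
 obtain z where z: "z ~: K" using enioq[OF K] .
 let ?m = "%pz. ?r (%b. pz b * pt z b)"
 have mm: "?m (?m pz) = pz" if "pz : dual K" for pz
 using that by (intro ext) (auto simp: restrict_def extensional_def diq mult.assoc)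
 have md: "?m pz : dual K" if "pz : dual K" for pz
 using that hr[OF Bhmq[OF _ Bhpq]] by (simp add: diq)
 have "bij_betw ?m Dm Dp"
 by (rule bij_betw_byWitness[where f' = ?m]) (use mm md BX z in \<open>auto simp: Dm_def Dp_def\<close>)
 then have cp: "card Dp = 16" using cm bij_betw_same_card by metis
 have f: "finite Dm" "finite Dp" using cm cp card_ge_0_finite by force+
 have "pz (- K) = 1 | pz (- K) = - 1" if "pz : dual K" for pz
 using Bhq(1)[OF _ BX] that unfolding diq by blast
 then have "dual K = Dm Un Dp" unfolding Dm_def Dp_def by blast
 moreover have "Dm Int Dp = {}" by (auto simp: Dm_def Dp_def)
 ultimately show ?thesis using cm cp f by (simp add: card_Un_disjoint)
qed
end

section \<open>Parker's loop, the algebra over the complex numbers, its symmetric form\<close>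

context parker_algebra begin
lemma bwq [simp]: "bar d : C" using bar_range by blast
lemma bmq: "bar (d \<diamondop> e) = bar d +^ bar e"
 by (simp add: bar_mult sd_def)
lemma buqa [simp]: "bar \<e> = {}" using bar_kernel by blast
lemma nmq: "m1 \<diamondop> d = neg d" by (simp add: neg_def)
lemma aeq: "even (card (bar d Int bar e Int bar f)) ==> (d \<diamondop> e) \<diamondop> f = d \<diamondop> (e \<diamondop> f)"
 using associating[of d e f] unit_left by simp
lemma aoq: "odd (card (bar d Int bar e Int bar f)) ==> (d \<diamondop> e) \<diamondop> f = neg (d \<diamondop> (e \<diamondop> f))"
 using associating[of d e f] by (simp add: nmq)
lemma ceq: "even (card (bar d Int bar e) div 2) ==> d \<diamondop> e = e \<diamondop> d"
 using commuting[of d e] unit_left by simp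
lemma coqc: "odd (card (bar d Int bar e) div 2) ==> d \<diamondop> e = neg (e \<diamondop> d)"
 using commuting[of d e] by (simp add: nmq)
lemma seqa: "even (card (bar d) div 4) ==> d \<diamondop> d = \<e>"
 using squaring[of d] by simp
lemma soq: "octad (bar d) ==> d \<diamondop> d = \<e>"
 by (rule seqa) (simp add: octadD)
lemma Ocqa: "\<Omega> \<diamondop> d = d \<diamondop> \<Omega>"
proof (rule ceq)
 obtain k where "card (bar d) = 4 * k" using deq[OF bwq] by (rule dvdE)
 then show "even (card (bar \<Omega> Int bar d) div 2)" by (simp add: bar_Omega)
qed
lemma Osq: "\<Omega> \<diamondop> \<Omega> = \<e>"
 by (rule seqa) (simp add: bar_Omega card_index)
lemma Oaq: "(d \<diamondop> e) \<diamondop> \<Omega> = d \<diamondop> (e \<diamondop> \<Omega>)" "(d \<diamondop> \<Omega>) \<diamondop> e = d \<diamondop> (\<Omega> \<diamondop> e)"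
 using eIq[OF bwq[of d] bwq[of e]] by (auto intro!: aeq simp: bar_Omega)
lemma Ocq [simp]: "(d \<diamondop> \<Omega>) \<diamondop> \<Omega> = d"
 by (simp add: Oaq Osq unit_right)
lemma scqe: assumes "octad (bar d)" shows "d \<diamondop> (d \<diamondop> f) = f"
proof -
 have "bar d Int bar d Int bar f = bar d Int bar f" by blast
 then have "(d \<diamondop> d) \<diamondop> f = d \<diamondop> (d \<diamondop> f)"
 using eIq[OF bwq[of d] bwq[of f]] by (intro aeq) simp
 then show ?thesis by (simp add: soq[OF assms] unit_left)
qed
text \<open>Such a map turns the loop element -1 into the scalar -1. Commutators and associators
  then become the scalars \<open>sQ\<close> and \<open>sT\<close>, and loop identities up to sign
  can be applied inside linear combinations.\<close>

definition odd_map :: "('p => complex ^ ('i + 'p)) => bool" where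
 "odd_map G \<longleftrightarrow> (ALL d. G (neg d) = - G d)"
lemma omq: "odd_map G ==> G (neg d) = - G d" by (simp add: odd_map_def)
lemma oaqb: "odd_map G ==> G ((d \<diamondop> e) \<diamondop> f) = sT (bar d) (bar e) (bar f) *s G (d \<diamondop> (e \<diamondop> f))"
 using aeq[of d e f] aoq[of d e f]
 by (cases "even (card (bar d Int bar e Int bar f))") (simp_all add: sT_def omq vec_eq_iff)
lemma ocqb: "odd_map G ==> G (d \<diamondop> e) = sQ (bar d) (bar e) *s G (e \<diamondop> d)"
 using ceq[of d e] coqc[of d e]
 by (cases "even (card (bar d Int bar e) div 2)") (simp_all add: sQ_def omq vec_eq_iff)
lemma omlq: "odd_map G ==> odd_map (%z. G (d \<diamondop> z))"
 and odd_map_right: "odd_map G ==> odd_map (%z. G (z \<diamondop> d))"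
 by (simp_all add: odd_map_def mult_neg)
lemma ssq: "a *s (b *s v) = (a * b) *s v" for v :: "complex ^ 'n"
 by (simp add: vec_eq_iff)
text \<open>Reassociate, exchange \<open>b\<close> and \<open>f\<close>, reassociate back. Of the
  accumulated signs, the two on \<open>b\<close>, \<open>f\<close>, \<open>c\<close> cancel, and so
  do the two on \<open>d\<close>, \<open>b\<close>, \<open>f\<close>.\<close>

lemma oiq:
 assumes G: "odd_map G"
 shows "G ((d \<diamondop> b) \<diamondop> (f \<diamondop> c)) = (sT (bar d) (bar b) (bar c) * sT (bar d) (bar f) (bar c) * sQ (bar f) (bar b))
 *s G ((d \<diamondop> f) \<diamondop> (b \<diamondop> c))"
proof -
 let ?d = "bar d" and ?b = "bar b" and ?f = "bar f" and ?c = "bar c"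
 have 1: "G ((d \<diamondop> b) \<diamondop> (f \<diamondop> c)) = sT ?d ?b (?f +^ ?c) *s G (d \<diamondop> (b \<diamondop> (f \<diamondop> c)))"
 using oaqb[OF G, of d b "f \<diamondop> c"] by (simp add: bmq)
 have 2: "G (d \<diamondop> (b \<diamondop> (f \<diamondop> c))) = sT ?b ?f ?c *s G (d \<diamondop> ((b \<diamondop> f) \<diamondop> c))"
 using oaqb[OF omlq[OF G, of d], of b f c] by (simp add: ssq)
 have 3: "G (d \<diamondop> ((b \<diamondop> f) \<diamondop> c)) = sQ ?b ?f *s G (d \<diamondop> ((f \<diamondop> b) \<diamondop> c))"
 by (rule ocqb[OF odd_map_right[OF omlq[OF G, of d], of c]])
 have 4: "G (d \<diamondop> ((f \<diamondop> b) \<diamondop> c)) = sT ?f ?b ?c *s G (d \<diamondop> (f \<diamondop> (b \<diamondop> c)))"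
 by (rule oaqb[OF omlq[OF G, of d]])
 have 5: "G (d \<diamondop> (f \<diamondop> (b \<diamondop> c))) = sT ?d ?f (?b +^ ?c) *s G ((d \<diamondop> f) \<diamondop> (b \<diamondop> c))"
 using oaqb[OF G, of d f "b \<diamondop> c"] by (simp add: bmq ssq)
 have "sT ?d ?b (?f +^ ?c) * sT ?b ?f ?c * sQ ?b ?f * sT ?f ?b ?c * sT ?d ?f (?b +^ ?c)
 = sT ?d ?b ?c * sT ?d ?f ?c * sQ ?f ?b"
 using scqc[of ?b ?f ?c] scqc[of ?d ?b ?f]
 by (auto simp: sT_sd spq(1)[of ?f ?b ?c] spq(2)[of ?d ?f ?b] scqf[of ?f ?b])
 then show ?thesis unfolding 1 2 3 4 5 ssq by (simp add: mult_ac)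
qed
text \<open>Extends \<open>x_vec\<close> from lifts of octads to the whole loop so that the three
  cases of the product rule become one: for octads meeting in 4, 2 or 0 points the product lies over
  a word of weight 8, 12 or 16, and \<open>sxxXq\<close> holds throughout.\<close>

definition XV :: "'p => complex ^ ('i + 'p)" where
 "XV d = (if card (bar d) = 8 then x_vec d else if card (bar d) = 16 then theta *s x_vec (d \<diamondop> \<Omega>) else 0)"
lemma Xoq: "octad (bar d) ==> XV d = x_vec d" by (simp add: XV_def octad_def)
lemma XV_16: "card (bar d) = 16 ==> XV d = theta *s x_vec (d \<diamondop> \<Omega>)" by (simp add: XV_def)
lemma XV_12: "card (bar d) = 12 ==> XV d = 0" by (simp add: XV_def)
lemma oXq: "odd_map XV"
 by (simp add: odd_map_def XV_def bar_neg x_vec_neg mult_neg vec_eq_iff)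
lemma liq: "d : lifts \<longleftrightarrow> octad (bar d)" by (simp add: lifts_def)
lemma sxxXq: assumes d: "d : lifts" "f : lifts" and ne: "bar d ~= bar f"
 shows "x_vec d \<star> x_vec f = (1/2) *s XV (d \<diamondop> f)"
proof -
 have o: "octad (bar d)" "octad (bar f)" using d by (simp_all add: liq)
 have "f ~= d" "f ~= neg d" using ne bar_neg by auto
 moreover have c: "card (bar (d \<diamondop> f)) + 2 * card (bar d Int bar f) = 16"
 using csqa[of "bar d" "bar f"] o by (simp add: bmq octadD)
 moreover have "card (bar d Int bar f) = 0 \<longleftrightarrow> bar d Int bar f = {}" by simp
 ultimately show ?thesis
 unfolding star_x_x[OF d] prod_xx_def XV_def
 using eIoq[OF o ne] by (elim disjE) simp_all
qed
text \<open>The complexification of the algebra: \<open>alg\<close> without the condition on the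
  field of coordinates. Identities are proved here, and membership in \<open>alg\<close> is
  established later for the roots only.\<close>

definition VV :: "(complex ^ ('i + 'p)) set" where
 "VV = {v. (ALL d. v $ Inr (neg d) = - (v $ Inr d)) & (ALL d. d ~: lifts --> v $ Inr d = 0)}"
lemma Vaq: "v : VV ==> w : VV ==> v + w : VV"
 and VV_scale: "v : VV ==> c *s v : VV"
 and VV_0: "0 : VV"
 and VV_uminus: "v : VV ==> - v : VV"
 and VV_diff: "v : VV ==> w : VV ==> v - w : VV"
 and VV_u: "u_vec i : VV"
 by (simp_all add: VV_def)
lemma Vsq: "(!!a. a : A ==> f a : VV) ==> sum f A : VV"
 by (induction A rule: infinite_finite_induct) (auto intro: Vaq VV_0)
lemma xvsq: "x_vec d $ Inr f = x_vec f $ Inr d"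
proof -
 have "f = d \<longleftrightarrow> d = f" "f = neg d \<longleftrightarrow> d = neg f" using neg_neg by metis+
 then show ?thesis by (simp only: x_vec_Inr)
qed
lemma xvIbq: "bar d ~= bar f ==> x_vec d $ Inr f = 0"
 using bar_neg[of d] by (auto simp: x_vec_Inr)
lemma VV_x: assumes "d : lifts" shows "x_vec d : VV"
proof -
 have "x_vec d $ Inr (neg f) = - x_vec d $ Inr f" for f
 unfolding xvsq[of d] by (simp add: x_vec_neg)
 moreover have "x_vec d $ Inr f = 0" if "f ~: lifts" for f
 using that assms by (intro xvIbq) (auto simp: liq)
 ultimately show ?thesis by (simp add: VV_def)
qed
lemma Veq: assumes "v : VV"
 shows "v = (SUM i:UNIV. v $ Inl i *s u_vec i) + (1/2) *s (SUM d:lifts. v $ Inr d *s x_vec d)"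
proof -
 have odd: "v $ Inr (neg d) = - v $ Inr d" and zero: "d ~: lifts ==> v $ Inr d = 0" for d
 using assms by (auto simp: VV_def)
 have 1: "(SUM i:UNIV. v $ Inl i * u_vec i $ Inl j) = v $ Inl j" for j
 proof -
 have "(SUM i:UNIV. v $ Inl i * u_vec i $ Inl j) = (SUM i:UNIV. if i = j then v $ Inl i else 0)"
 by (intro sum.cong refl) simp
 then show ?thesis by simp
 qed
 have 2: "(SUM d:lifts. v $ Inr d * x_vec d $ Inr f) = 2 * v $ Inr f" for f
 proof (cases "f : lifts")
 case True
 have "(SUM d:lifts. v $ Inr d * x_vec d $ Inr f) = (SUM d:lifts. x_vec f $ Inr d * v $ Inr d)"
 by (simp only: xvsq[of _ f] mult.commute)
 also have "... = 2 * v $ Inr f" using True odd by (rule sum_x_vec)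
 finally show ?thesis .
 next
 case False
 have "f ~= d & f ~= neg d" if "d : lifts" for d using that False lifts_neg by metis
 then show ?thesis using zero[OF False] by (simp add: x_vec_Inr)
 qed
 show ?thesis
 unfolding vec_eq_iff
 proof
 fix k
 show "v $ k = ((SUM i:UNIV. v $ Inl i *s u_vec i) + (1/2) *s (SUM d:lifts. v $ Inr d *s x_vec d)) $ k"
 proof (cases k)
 case (Inl j)
 then show ?thesis
 by (simp only: vector_add_component vector_smult_component sum_component 1 x_vec_Inl) simp
 next
 case (Inr f)
 then show ?thesis
 by (simp only: vector_add_component vector_smult_component sum_component 2 u_vec_nth) simp
 qed
 qed
qed
lemma Viq [consumes 1, case_names u x add scale]:
 assumes v: "v : VV"
 and u: "!!i. P (u_vec i)" and x: "!!d. d : lifts ==> P (x_vec d)"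
 and add: "!!v w. v : VV ==> w : VV ==> P v ==> P w ==> P (v + w)"
 and scale: "!!c v. v : VV ==> P v ==> P (c *s v)"
 shows "P v"
proof -
 have P0: "P 0" using scale[OF VV_u u, of 0 undefined] by simp
 have Ps: "P (sum f A) & sum f A : VV" if "!!a. a : A ==> P (f a) & f a : VV" for f and A :: "'b set"
 using that by (induction A rule: infinite_finite_induct) (auto intro: add Vaq P0 VV_0)
 have 1: "P (SUM i:UNIV. v $ Inl i *s u_vec i) & (SUM i:UNIV. v $ Inl i *s u_vec i) : VV"
 by (rule Ps) (auto intro: scale u VV_scale VV_u)
 have 2: "P (SUM d:lifts. v $ Inr d *s x_vec d) & (SUM d:lifts. v $ Inr d *s x_vec d) : VV"
 by (rule Ps) (auto intro: scale x VV_scale VV_x)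
 show ?thesis
 by (subst Veq[OF v]) (use 1 2 in \<open>auto intro!: add scale VV_scale\<close>)
qed
lemma cdoq: assumes "octad a" "octad b" "a Int b = {}" shows "octad (- (a +^ b))"
proof -
 have "card (a +^ b) = 16" using csqa[of a b] assms by (simp add: octadD)
 then show ?thesis using assms Cwq scq cCq[of "a +^ b"] card_index by (simp add: octad_def)
qed
lemma lmq: assumes "d : lifts" "f : lifts" "card (bar d Int bar f) = 4" shows "d \<diamondop> f : lifts"
 using assms csqa[of "bar d" "bar f"] by (simp add: liq octad_def bmq scq)
lemma lmOq: assumes "d : lifts" "f : lifts" "bar d Int bar f = {}" shows "(d \<diamondop> f) \<diamondop> \<Omega> : lifts"
 using cdoq[of "bar d" "bar f"] assms by (simp add: liq bmq bar_Omega)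
lemma sVq: "v \<star> w : VV"
proof -
 have xx: "prod_xx d f : VV" if "d : lifts" "f : lifts" for d f
 unfolding prod_xx_def using lmq[OF that] lmOq[OF that]
 by (auto intro!: VV_scale VV_diff VV_uminus Vsq VV_u VV_x VV_0)
 have ux: "prod_ux i d : VV" if "d : lifts" for i d
 unfolding prod_ux_def using that by (auto intro!: VV_scale VV_uminus VV_x)
 have uu: "prod_uu i j : VV" for i j
 unfolding prod_uu_def by (auto intro!: VV_scale VV_diff Vaq Vsq VV_u)
 show ?thesis unfolding star_def
 by (intro Vaq Vsq VV_scale xx ux uu)
qed
lemma sarq: "v \<star> (w + z) = v \<star> w + v \<star> z" by (metis star_commute star_add)
lemma ssrq: "v \<star> (c *s w) = cnj c *s (v \<star> w)" by (metis star_commute star_scale)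
lemma szq [simp]: "0 \<star> v = 0" "v \<star> 0 = 0"
 using star_scale[of 0 0 v] ssrq[of v 0 0] by simp_all
lemma smqa: "- v = (-1) *s v" for v :: "complex ^ 'n" by (simp add: vec_eq_iff)
lemma smq: "(- v) \<star> w = - (v \<star> w)" "w \<star> (- v) = - (w \<star> v)"
 using star_scale[of "- 1" v w] ssrq[of w "- 1" v] unfolding smqa[of v, symmetric]
 by (simp_all add: vec_eq_iff)
lemma sdq: "(v - w) \<star> z = v \<star> z - w \<star> z" "z \<star> (v - w) = z \<star> v - z \<star> w"
 using star_add[of v "- w" z] sarq[of z v "- w"] by (simp_all add: smq)
lemma ssqb: "sum f A \<star> z = (SUM a:A. f a \<star> z)" "z \<star> sum f A = (SUM a:A. z \<star> f a)"
 by (induction A rule: infinite_finite_induct; simp add: star_add sarq)+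
lemma haq: "herm (v + w) z = herm v z + herm w z" "herm z (v + w) = herm z v + herm z w"
 by (simp_all add: herm_def algebra_simps sum.distrib)
lemma hsq: "herm (c *s v) z = c * herm v z" "herm z (c *s v) = cnj c * herm z v"
 by (simp_all add: herm_def algebra_simps sum_distrib_left)
lemma hzq [simp]: "herm 0 v = 0" "herm v 0 = 0" by (simp_all add: herm_def)
lemma hmq: "herm (- v) w = - herm v w" "herm w (- v) = - herm w v"
 using hsq(1)[of "- 1" v w] hsq(2)[of w "- 1" v] unfolding smqa[of v, symmetric] by simp_all
lemma hdq: "herm (v - w) z = herm v z - herm w z" "herm z (v - w) = herm z v - herm z w"
 using haq(1)[of v "- w" z] haq(2)[of z v "- w"] by (simp_all add: hmq)
lemma hsqa: "herm (sum f A) z = (SUM a:A. herm (f a) z)" "herm z (sum f A) = (SUM a:A. herm z (f a))"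
 by (induction A rule: infinite_finite_induct; simp add: haq)+
lemma hcq: "cnj (herm v w) = herm w v"
 by (simp add: herm_def mult.commute)
lemma huq: "herm v (u_vec k) = 1/8 * v $ Inl k"
proof -
 have "(SUM i:UNIV. v $ Inl i * cnj (u_vec k $ Inl i)) = (SUM i:UNIV. u_vec k $ Inl i * v $ Inl i)"
 by (simp only: cnj_u_vec mult.commute)
 also have "... = v $ Inl k" by (rule sum_u_vec)
 finally show ?thesis unfolding herm_def by (simp del: u_vec_nth(1))
qed
lemma hxq: assumes "v : VV" "d : lifts" shows "herm v (x_vec d) = v $ Inr d"
proof -
 have "(SUM f:lifts. v $ Inr f * cnj (x_vec d $ Inr f)) = (SUM f:lifts. x_vec d $ Inr f * v $ Inr f)"
 by (simp only: cnj_x_vec mult.commute)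
 also have "... = 2 * v $ Inr d" using assms by (intro sum_x_vec) (auto simp: VV_def)
 finally show ?thesis by (simp add: herm_def)
qed
lemma Veqa: assumes "v : VV" "w : VV" "!!i. herm v (u_vec i) = herm w (u_vec i)"
 "!!d. d : lifts ==> herm v (x_vec d) = herm w (x_vec d)"
 shows "v = w"
proof -
 have 1: "v $ Inl i = w $ Inl i" for i using assms(3)[of i] by (simp add: huq)
 have 2: "v $ Inr d = w $ Inr d" for d
 proof (cases "d : lifts")
 case True then show ?thesis using assms(4)[OF True] hxq[OF assms(1) True] hxq[OF assms(2) True] by simp
 next
 case False then show ?thesis using assms(1,2) by (simp add: VV_def)
 qed
 show ?thesis unfolding vec_eq_iff
 proof
 fix k show "v $ k = w $ k" by (cases k) (simp_all add: 1 2)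
 qed
qed
lemma Vnq: assumes "v : VV" "w : VV" "!!z. z : VV ==> herm v z = herm w z" shows "v = w"
 by (rule Veqa[OF assms(1,2)]) (rule assms(3), rule VV_u, rule assms(3), rule VV_x)
lemma puIq: "prod_uu i j $ Inl k = 1/128*(if i = j then (if k = i then - 81 else 15)
 else if k = i | k = j then 15 else - 1)"
proof -
 have "(SUM k:A. u_vec k $ Inl l) = (if l : A then 1 else 0)" for A :: "'i set" and l
 by (simp add: u_vec_nth)
 then show ?thesis by (auto simp: prod_uu_def)
qed
lemma pxIq: assumes d: "d : lifts" "f : lifts"
 shows "prod_xx d f $ Inr g = (if card (bar d Int bar f) = 4 then 1/2 * x_vec (d \<diamondop> f) $ Inr g
 else if bar d Int bar f = {} then 1/2*(theta * x_vec ((d \<diamondop> f) \<diamondop> \<Omega>) $ Inr g) else 0)"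
proof -
 have "card (bar d Int bar d) = 8" "bar d ~= {}" using d by (auto simp: liq octad_def)
 then show ?thesis by (auto simp: prod_xx_def bar_neg)
qed
text \<open>An octad lift satisfies \<open>d \<diamondop> (d \<diamondop> f) = f\<close>, so the
  relation \<open>g = d \<diamondop> f\<close> is symmetric in \<open>f\<close> and
  \<open>g\<close>; the same holds for the relation with the factor \<open>\<Omega>\<close>, which
  is central of order two. The two summands of \<open>x_vec\<close> are treated separately through
  \<open>neg g\<close>.\<close>

lemma pxsq: assumes d: "d : lifts" "f : lifts" "g : lifts"
 shows "prod_xx d f $ Inr g = prod_xx d g $ Inr f"
proof -
 have o: "octad (bar d)" "octad (bar f)" "octad (bar g)" using d by (simp_all add: liq)
 have A: "card (bar d Int bar g) = 4 & f = d \<diamondop> g" if "octad (bar f)" "card (bar d Int bar f) = 4" "g = d \<diamondop> f" for f g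
 proof -
 have "card (bar d Int bar g) + 2 * card (bar d Int bar d Int bar f) = card (bar d Int bar d) + card (bar d Int bar f)"
 using cIsq[of "bar d" "bar d" "bar f"] that by (simp add: bmq)
 then show ?thesis using that scqe[OF o(1)] o by (simp add: octadD)
 qed
 have A': "card (bar d Int bar f) = 4 & g = d \<diamondop> f \<longleftrightarrow> card (bar d Int bar g) = 4 & f = d \<diamondop> g" if "octad (bar f)" "octad (bar g)" for f g
 using A[of f g] A[of g f] that by blast
 have B: "bar d Int bar g = {} & f = (d \<diamondop> g) \<diamondop> \<Omega>" if "bar d Int bar f = {}" "g = (d \<diamondop> f) \<diamondop> \<Omega>" for f g
 proof -
 have "d \<diamondop> g = (d \<diamondop> (d \<diamondop> f)) \<diamondop> \<Omega>" using that by (simp add: Oaq)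
 moreover have "bar d Int bar g = {}" using that by (auto simp: bmq bar_Omega)
 ultimately show ?thesis using scqe[OF o(1)] by simp
 qed
 have B': "bar d Int bar f = {} & g = (d \<diamondop> f) \<diamondop> \<Omega> \<longleftrightarrow> bar d Int bar g = {} & f = (d \<diamondop> g) \<diamondop> \<Omega>" for f g
 using B[of f g] B[of g f] by blast
 have n: "g = neg h \<longleftrightarrow> neg g = h" for g h using neg_neg by metis
 have e: "(if card (bar d Int bar f) = 4 then x_vec (d \<diamondop> f) $ Inr g else 0)
 = (if card (bar d Int bar f) = 4 & g = d \<diamondop> f then 1 else 0)
 - (if card (bar d Int bar f) = 4 & neg g = d \<diamondop> f then 1 else 0)" for f g
 by (simp add: x_vec_Inr n)
 have e': "(if bar d Int bar f = {} then x_vec ((d \<diamondop> f) \<diamondop> \<Omega>) $ Inr g else 0)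
 = (if bar d Int bar f = {} & g = (d \<diamondop> f) \<diamondop> \<Omega> then 1 else 0)
 - (if bar d Int bar f = {} & neg g = (d \<diamondop> f) \<diamondop> \<Omega> then 1 else 0)" for f g
 by (simp add: x_vec_Inr n)
 have E: "(if card (bar d Int bar f) = 4 then x_vec (d \<diamondop> f) $ Inr g else 0) = (if card (bar d Int bar g) = 4 then x_vec (d \<diamondop> g) $ Inr f else 0)"
 proof -
 have "octad (bar (neg g))" using o(3) by (simp only: bar_neg)
 note a = A'[OF o(2,3)] A'[OF o(2) this, unfolded bar_neg mult_neg n[of f "d \<diamondop> g"]]
 show ?thesis unfolding e a ..
 qed
 have E': "(if bar d Int bar f = {} then x_vec ((d \<diamondop> f) \<diamondop> \<Omega>) $ Inr g else 0)
 = (if bar d Int bar g = {} then x_vec ((d \<diamondop> g) \<diamondop> \<Omega>) $ Inr f else 0)"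
 proof -
 note b = B'[of f g] B'[of f "neg g", unfolded bar_neg mult_neg n[of f "(d \<diamondop> g) \<diamondop> \<Omega>"]]
 show ?thesis unfolding e' b ..
 qed
 have split: "prod_xx d f $ Inr g = 1/2*(if card (bar d Int bar f) = 4 then x_vec (d \<diamondop> f) $ Inr g else 0)
 + 1/2 * theta*(if bar d Int bar f = {} then x_vec ((d \<diamondop> f) \<diamondop> \<Omega>) $ Inr g else 0)" if "f : lifts" for f g
 unfolding pxIq[OF d(1) that] by auto
 show ?thesis by (simp only: split[OF d(2)] split[OF d(3)] E E')
qed
lemma suvIq: "(SUM k:A. u_vec k $ Inl l) = (if l : A then 1 else 0)" for A :: "'i set"
 by simp
lemma huqc: "d : lifts ==> herm (u_vec i \<star> u_vec j) (x_vec d) = 0"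
 by (subst hxq[OF sVq]) (simp_all add: star_u_u prod_uu_def)
lemma huqb: "d : lifts ==> herm (u_vec i \<star> x_vec d) (u_vec j) = 0"
 by (simp add: huq star_u_x prod_ux_def)
lemma huqa: "d : lifts ==> f : lifts ==>
 herm (u_vec i \<star> x_vec d) (x_vec f) = 1/16*(if i : bar d then 3 else - 1) * x_vec d $ Inr f"
 by (subst hxq[OF sVq]) (simp_all add: star_u_x prod_ux_def)
lemma hxqa: "d : lifts ==> f : lifts ==> g : lifts ==> herm (x_vec d \<star> x_vec f) (x_vec g) = prod_xx d f $ Inr g"
 by (subst hxq[OF sVq]) (simp_all add: star_x_x)
lemma hxqb: assumes "d : lifts" "f : lifts"
 shows "herm (x_vec d \<star> x_vec f) (u_vec i) = 1/16*(if i : bar d then 3 else - 1) * x_vec d $ Inr f"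
 using neg_neq[of d] unfolding huq star_x_x[OF assms] prod_xx_def
 by (cases "f = d"; cases "f = neg d") (simp_all add: x_vec_Inr suvIq)
text \<open>With commutativity this makes \<open>herm (v \<star> w) z\<close> totally symmetric and
  conjugate-linear in all three arguments. It is the source of the symmetry of
  \<open>herm (tau r x) y\<close> and, later, of the reduction from pairs of generators to
  triples.\<close>

lemma hssq: assumes "v : VV" "w : VV" "z : VV" shows "herm (v \<star> w) z = herm (v \<star> z) w"
 using assms
proof (induction v rule: Viq)
 case (u i)
 show ?case using u
 proof (induction w rule: Viq)
 case (u j)
 show ?case using u
 proof (induction z rule: Viq)
 case (u k) show ?case by (auto simp: huq star_u_u puIq)
 next
 case (x d) then show ?case by (simp add: huqc huqb)
 qed (simp_all add: haq hsq sarq ssrq)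
 next
 case (x d)
 show ?case using x(2)
 proof (induction z rule: Viq)
 case (u k) then show ?case using x(1) by (simp add: huqc huqb)
 next
 case (x f)
 have "1/16*(if i : bar d then 3 else - 1) * x_vec d $ Inr f = 1/16*(if i : bar f then 3 else - 1) * x_vec f $ Inr d"
 proof (cases "bar d = bar f")
 case True then show ?thesis by (simp only: xvsq[of d f])
 next
 case False then show ?thesis by (simp add: xvIbq)
 qed
 then show ?case unfolding huqa[OF \<open>d : lifts\<close> \<open>f : lifts\<close>] huqa[OF \<open>f : lifts\<close> \<open>d : lifts\<close>] .
 qed (simp_all add: haq hsq sarq ssrq)
 qed (simp_all add: haq hsq sarq ssrq)
next
 case (x d)
 note d = \<open>d : lifts\<close>
 have ux: "herm (x_vec d \<star> u_vec i) (x_vec f) = herm (x_vec d \<star> x_vec f) (u_vec i)" if f: "f : lifts" for i f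
 unfolding star_commute[of "x_vec d" "u_vec i"] huqa[OF d f] hxqb[OF d f] ..
 have uu: "herm (x_vec d \<star> u_vec i) (u_vec j) = 0" for i j
 unfolding star_commute[of "x_vec d" "u_vec i"] by (rule huqb[OF d])
 show ?case using x(2,3)
 proof (induction w rule: Viq)
 case (u j)
 show ?case using u
 proof (induction z rule: Viq)
 case (u k) show ?case by (simp add: uu)
 next
 case (x f) then show ?case by (simp add: ux)
 qed (simp_all add: haq hsq sarq ssrq)
 next
 case (x f)
 note f = \<open>f : lifts\<close>
 show ?case using x(2)
 proof (induction z rule: Viq)
 case (u k) show ?case by (simp add: ux[OF f])
 next
 case (x g) then show ?case
 unfolding hxqa[OF d f \<open>g : lifts\<close>] hxqa[OF d \<open>g : lifts\<close> f] by (rule pxsq[OF d f])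
 qed (simp_all add: haq hsq sarq ssrq)
 qed (simp_all add: haq hsq sarq ssrq)
qed (simp_all add: haq hsq star_add star_scale)
lemma taq: "tau r (v + w) = tau r v + tau r w"
 by (simp add: tau_def star_add haq vec_eq_iff algebra_simps)
lemma tsq: "tau r (c *s v) = cnj c *s tau r v"
 by (simp add: tau_def star_scale hsq vec_eq_iff algebra_simps)
lemma tVq: "r : VV ==> tau r v : VV" by (simp add: tau_def VV_diff sVq VV_scale)
lemma tmq: "tau r (- v) = - tau r v"
 using tsq[of r "- 1" v] unfolding smqa[of v, symmetric] by (simp add: vec_eq_iff)
lemma tdq: "tau r (v - w) = tau r v - tau r w"
 using taq[of r v "- w"] by (simp add: tmq)
lemma tau_0 [simp]: "tau r 0 = 0" using tsq[of r 0 0] by simp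
lemma tsqa: "tau r (sum f A) = (SUM a:A. tau r (f a))"
 by (induction A rule: infinite_finite_induct) (simp_all add: taq)
lemma trsqa: "tau (c *s r) v = cnj c *s (v \<star> r) - (c * c * herm r v) *s r"
 by (simp add: tau_def ssrq hsq vec_eq_iff algebra_simps)
lemma tsqc: assumes "r : VV" "x : VV" "y : VV" shows "herm (tau r x) y = herm (tau r y) x"
proof -
 have "herm (x \<star> r) y = herm (y \<star> r) x"
 unfolding star_commute[of _ r] by (rule hssq[OF assms])
 then show ?thesis by (simp add: tau_def hdq hsq)
qed
text \<open>Conjugate-linear involutory automorphisms of the algebra which preserve the form.\<close>
definition caut :: "(complex ^ ('i + 'p) => complex ^ ('i + 'p)) => bool" where
 "caut T \<longleftrightarrow> (ALL x y. T (x + y) = T x + T y) & (ALL c x. T (c *s x) = cnj c *s T x)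
 & (ALL x:VV. T x : VV & T (T x) = x) & (ALL x:VV. ALL y:VV. T (x \<star> y) = T x \<star> T y)
 & (ALL x:VV. ALL y:VV. herm (T x) (T y) = herm y x)"
lemma cautD: assumes "caut T"
 shows "T (x + y) = T x + T y" "T (c *s x) = cnj c *s T x" "x : VV ==> T x : VV" "x : VV ==> T (T x) = x"
 "x : VV ==> y : VV ==> T (x \<star> y) = T x \<star> T y" "x : VV ==> y : VV ==> herm (T x) (T y) = herm y x"
 using assms unfolding caut_def by blast+
lemma cdqb: assumes "caut T" shows "T (x - y) = T x - T y"
proof -
 have "T (x + (- 1) *s y) = T x + cnj (- 1) *s T y" by (simp only: cautD(1,2)[OF assms])
 moreover have "x + (- 1) *s y = x - y" "T x + cnj (- 1) *s T y = T x - T y" by (simp_all add: vec_eq_iff)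
 ultimately show ?thesis by (simp only:)
qed
lemma thq: assumes "r : VV" "!!x. x : VV ==> tau r (tau r x) = x" "x : VV" "y : VV"
 shows "herm (tau r x) (tau r y) = herm y x"
 using tsqc[OF assms(1,3) tVq[OF assms(1)], of y] assms by simp
lemma ctqa: assumes "r : VV" "!!x. x : VV ==> tau r (tau r x) = x"
 "!!x y. x : VV ==> y : VV ==> tau r (x \<star> y) = tau r x \<star> tau r y"
 shows "caut (tau r)"
 using assms thq[OF assms(1,2)] by (simp add: caut_def taq tsq tVq)
lemma ccq: assumes T: "caut T" and r: "r : VV" "v : VV" shows "T (tau r v) = tau (T r) (T v)"
proof -
 note D = cautD[OF T]
 show ?thesis unfolding tau_def cdqb[OF T] D(2) D(5)[OF r(2,1)] D(6)[OF r] hcq ..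
qed
text \<open>The rank-one terms on the two sides agree because \<open>tau r\<close> preserves the
  form. Multiplicativity against \<open>a\<close> thus amounts to \<open>tau (tau r a)\<close> being
  the conjugate of \<open>tau a\<close> under \<open>tau r\<close>, which can be checked by
  relations between maps, without computing products.\<close>

lemma tmiq: assumes r: "r : VV" and inv: "!!x. x : VV ==> tau r (tau r x) = x" and a: "a : VV" "y : VV"
 shows "tau r (a \<star> y) = tau r a \<star> tau r y \<longleftrightarrow> tau r (tau a y) = tau (tau r a) (tau r y)"
proof -
 have "tau r (tau a y) = tau r (a \<star> y) - herm y a *s tau r a"
 by (simp only: tau_def[of a] tdq tsq star_commute[of y a] hcq)
 moreover have "tau (tau r a) (tau r y) = tau r a \<star> tau r y - herm y a *s tau r a"
 by (simp only: tau_def[of "tau r a"] thq[OF r inv a] star_commute[of "tau r y"])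
 ultimately show ?thesis by simp
qed
subsection \<open>Basic roots\<close>
definition US :: "complex ^ ('i + 'p)" where "US = (SUM k:UNIV. u_vec k)"
lemma Umq: "(SUM k: -A. u_vec k) = US - (SUM k:A. u_vec k)"
 unfolding US_def by (simp add: Compl_eq_Diff_UNIV sum_diff)
definition broot :: "'i => complex ^ ('i + 'p)" where "broot i = US - 8 *s u_vec i"
lemma suq: "u_vec i \<star> u_vec j = (1/128) *s (16 *s u_vec i + 16 *s u_vec j - US)
 + (if i = j then (1/128) *s (16 *s US - 128 *s u_vec i) else 0)"
proof (cases "i = j")
 case False
 then have "(SUM k:{i, j}. u_vec k) = u_vec i + u_vec j" by simp
 then show ?thesis using False by (simp add: star_u_u prod_uu_def Umq vec_eq_iff algebra_simps)
next
 case True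
 then show ?thesis by (simp add: star_u_u prod_uu_def Umq vec_eq_iff algebra_simps)
qed
lemma ssqa: "(SUM a:A. c *s f a) = c *s sum f A" for f :: "'b => complex ^ 'n"
 by (simp add: vec_eq_iff sum_distrib_left)
lemma scsq: "(SUM a:A. v) = of_nat (card A) *s v" for v :: "complex ^ 'n"
 by (induction A rule: infinite_finite_induct) (simp_all add: vec_eq_iff algebra_simps del: sum_constant)
lemma sUuq: "US \<star> u_vec j = (1/16) *s US + 2 *s u_vec j"
proof -
 have "US \<star> u_vec j = (SUM i:UNIV. (1/8) *s u_vec i + ((1/8) *s u_vec j - (1/128) *s US)
 + (if i = j then (1/128) *s (16 *s US - 128 *s u_vec j) else 0))"
 unfolding US_def ssqb by (intro sum.cong refl) (auto simp: suq US_def vec_eq_iff algebra_simps)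
 also have "... = (1/8) *s US + 24 *s ((1/8) *s u_vec j - (1/128) *s US) + (1/128) *s (16 *s US - 128 *s u_vec j)"
 unfolding sum.distrib ssqa US_def[symmetric] scsq by (simp add: card_index)
 finally show ?thesis by (simp add: vec_eq_iff algebra_simps)
qed
lemma suxpq: "d : lifts ==> u_vec i \<star> x_vec d = ((1 - 2 * pt i (bar d))/16) *s x_vec d"
 by (simp add: star_u_x prod_ux_def pt_def vec_eq_iff)
lemma spsqa: "(SUM i:A. pt i c) = of_nat (card A) - 2 * of_nat (card (A Int c))" for A :: "'i set"
proof -
 have "(SUM i:A. pt i c) = (SUM i:A. 1 - 2*(if i : c then 1 else 0))"
 by (intro sum.cong refl) (simp add: pt_def)
 then show ?thesis by (simp add: sum_subtractf sum.If_cases flip: sum_distrib_left)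
qed
lemma ssuxq: "d : lifts ==>
 (SUM i:A. u_vec i) \<star> x_vec d = ((4 * of_nat (card (A Int bar d)) - of_nat (card A))/16) *s x_vec d"
proof -
 assume d: "d : lifts"
 have "(SUM i:A. u_vec i) \<star> x_vec d = (SUM i:A. (1 - 2 * pt i (bar d))/16) *s x_vec d"
 unfolding ssqb suxpq[OF d] by (simp add: vec_eq_iff sum_distrib_right)
 also have "(SUM i:A. (1 - 2 * pt i (bar d))/16) = (4 * of_nat (card (A Int bar d)) - of_nat (card A))/16"
 by (simp add: spsqa sum_subtractf flip: sum_divide_distrib sum_distrib_left)
 finally show ?thesis .
qed
lemma sUxq: "d : lifts ==> US \<star> x_vec d = (1/2) *s x_vec d"
 using ssuxq[of d UNIV] by (simp add: US_def card_index liq octadD)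
lemma US_VV: "US : VV" unfolding US_def by (intro Vsq VV_u)
lemma bVq: "broot i : VV" unfolding broot_def by (intro VV_diff VV_scale US_VV VV_u)
lemma UIq [simp]: "US $ Inl k = 1" "US $ Inr d = 0"
 by (simp_all add: US_def)
lemma hbq: "herm v (broot i) = 1/8*(SUM k:UNIV. v $ Inl k) - v $ Inl i"
 unfolding broot_def US_def by (simp add: hdq hsq hsqa huq sum_divide_distrib)
lemma tbuq: "tau (broot i) (u_vec j) = u_vec j"
proof -
 have h: "herm (broot i) (u_vec j) = 1/8 - (if i = j then 1 else 0)"
 by (simp add: huq broot_def)
 have "u_vec j \<star> broot i = (1/16) *s US + 2 *s u_vec j - 8 *s (u_vec i \<star> u_vec j)"
 by (simp add: broot_def sdq ssrq star_commute[of "u_vec j"] sUuq)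
 then show ?thesis unfolding tau_def h suq by (auto simp: broot_def vec_eq_iff algebra_simps)
qed
lemma tbxq: assumes "d : lifts" shows "tau (broot i) (x_vec d) = pt i (bar d) *s x_vec d"
proof -
 have "herm (x_vec d) (broot i) = 0" by (simp add: hbq)
 then have "herm (broot i) (x_vec d) = 0" using hcq[of "x_vec d" "broot i"] by simp
 moreover have "x_vec d \<star> broot i = (1/2) *s x_vec d - 8 *s (((1 - 2 * pt i (bar d))/16) *s x_vec d)"
 using assms by (simp add: broot_def sdq ssrq star_commute[of "x_vec d"] sUxq suxpq)
 then have "x_vec d \<star> broot i = pt i (bar d) *s x_vec d" by (simp add: vec_eq_iff field_simps)
 ultimately show ?thesis by (simp add: tau_def)
qed
lemma tcq: "cnj theta = - theta" by (simp add: theta_def)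
text \<open>In weight 16 two signs cancel: conjugation negates \<open>theta\<close>, and passing to
  the complement negates \<open>pt i\<close>. Hence \<open>tau (broot i)\<close> acts on
  \<open>XV d\<close> by the character \<open>pt i\<close> in every weight, which is what makes it
  multiplicative.\<close>

lemma tbXq: "tau (broot i) (XV d) = pt i (bar d) *s XV d"
proof -
 consider "octad (bar d)" | "card (bar d) = 16" | "XV d = 0"
 by (cases "card (bar d) = 8"; cases "card (bar d) = 16") (auto simp: XV_def octad_def)
 then show ?thesis
 proof cases
 case 1 then show ?thesis by (simp add: Xoq tbxq liq)
 next
 case 2
 have "octad (bar (d \<diamondop> \<Omega>))"
 using 2 cCq[of "bar d"] card_index Cwq[OF bwq[of d]] by (simp add: octad_def bmq bar_Omega)
 moreover have "pt i (bar (d \<diamondop> \<Omega>)) = - pt i (bar d)" by (simp add: bmq bar_Omega pt_def)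
 ultimately show ?thesis
 by (simp add: XV_16[OF 2] tsq tbxq liq tcq vec_eq_iff)
 qed simp
qed
lemma tbiqa: "x : VV ==> tau (broot i) (tau (broot i) x) = x"
 by (induction x rule: Viq)
 (simp_all add: tbuq tbxq taq tsq ssq)
lemma tbsuq: "tau (broot i) (SUM k:A. u_vec k) = (SUM k:A. u_vec k)"
 by (simp add: tsqa tbuq)
lemma tbmq: assumes "x : VV" "y : VV"
 shows "tau (broot i) (x \<star> y) = tau (broot i) x \<star> tau (broot i) y"
 using assms
proof (induction x rule: Viq)
 case (u j)
 show ?case using u
 proof (induction y rule: Viq)
 case (u k)
 have "tau (broot i) US = US" unfolding US_def by (rule tbsuq)
 then show ?case by (simp add: suq tbuq taq tdq tsq)
 next
 case (x d) then show ?case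
 by (simp add: suxpq tbuq tbxq tsq ssrq ssq mult.commute)
 qed (simp_all add: taq tsq sarq ssrq)
next
 case (x d)
 note d = \<open>d : lifts\<close>
 show ?case using x(2)
 proof (induction y rule: Viq)
 case (u k) show ?case using d
 by (simp add: star_commute[of _ "u_vec k"] suxpq tbuq tbxq tsq ssrq ssq mult.commute)
 next
 case (x f)
 show ?case
 proof (cases "bar d = bar f")
 case False
 show ?thesis
 using d x by (simp add: sxxXq[OF d x False] tsq tbXq tbxq star_scale ssrq
 bmq pt_sd ssq)
 next
 case True
 then have f: "f = d | f = neg d"
 proof -
 have "bar (d \<diamondop> f) = {}" using True by (simp add: bmq)
 then have "d \<diamondop> f = \<e> | d \<diamondop> f = m1" using bar_kernel by blast
 moreover have "d \<diamondop> (d \<diamondop> f) = f" using d scqe liq by blast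
 moreover have "d \<diamondop> m1 = neg d" using m1_central unfolding central_def neg_def by metis
 ultimately show ?thesis using unit_right by metis
 qed
 have *: "tau (broot i) (prod_xx d d) = prod_xx d d"
 by (simp add: prod_xx_def tsq tdq tbsuq)
 have **: "tau (broot i) (prod_xx d f) = prod_xx d f"
 using f * by (auto simp: prod_xx_neg tmq)
 have "pt i (bar d) * pt i (bar f) = 1" using True by simp
 then show ?thesis using ** d x by (simp add: star_x_x tbxq star_scale ssrq ssq mult.commute)
 qed
 qed (simp_all add: taq tsq sarq ssrq)
qed (simp_all add: taq tsq star_add star_scale)
lemma cbq: "caut (tau (broot i))"
 by (rule ctqa) (simp_all add: bVq tbiqa tbmq)
end

section \<open>Octadic roots: the map on generators disjoint from K or meeting it in two
  points\<close>

context parker_algebra begin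
lemma ofq: "\<omega> * cnj \<omega> = 1" "cnj \<omega> = \<omega>\<^sup>2" "\<omega>\<^sup>2 = - 1 - \<omega>"
proof -
 have "(norm \<omega>) ^ 3 = 1" using omega_root(1) by (simp flip: norm_power)
 then have "norm \<omega> = 1" using power_eq_imp_eq_base[of "norm \<omega>" 3 1] by simp
 then show 1: "\<omega> * cnj \<omega> = 1" using complex_norm_square[of \<omega>] by simp
 have "\<omega>*\<omega>\<^sup>2 = \<omega> ^ 3" by (simp add: power2_eq_square power3_eq_cube)
 then have "\<omega>*\<omega>\<^sup>2 = \<omega> * cnj \<omega>" using 1 omega_root(1) by simp
 then show "cnj \<omega> = \<omega>\<^sup>2" using omega_root(1) by auto
 have "(\<omega> - 1)*(\<omega>\<^sup>2 + \<omega> + 1) = \<omega> ^ 3 - 1" by (simp add: algebra_simps power2_eq_square power3_eq_cube)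
 then have "\<omega>\<^sup>2 + \<omega> + 1 = 0" using omega_root by simp
 moreover have "\<omega>\<^sup>2 = (\<omega>\<^sup>2 + \<omega> + 1) - 1 - \<omega>" by simp
 ultimately show "\<omega>\<^sup>2 = - 1 - \<omega>" by simp
qed
lemma toq: "theta = 2*\<omega> + 1"
 by (simp add: theta_def ofq(2,3))
lemma tsqb [simp]: "theta * theta = - 3"
proof -
 have "theta * theta = 4*\<omega>\<^sup>2 + 4*\<omega> + 1" by (simp add: toq algebra_simps power2_eq_square)
 then show ?thesis by (simp add: ofq(3))
qed
lemma tslq [simp]: "theta*(theta * z) = - 3 * z"
 by (simp flip: mult.assoc)
lemma xvsqa [simp]: "x_vec d $ Inr d = 1"
 using neg_neq[of d, symmetric] by (simp add: x_vec_Inr)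
lemma sopq: assumes K: "octad K" and x: "x ~: K" "y ~: K"
 shows "(SUM b:B K - {{}, - K}. if y : b then pt x b else 0) = (if x = y then - 15 else 1)"
proof -
 have "(SUM b:B K. if y : b then pt x b else 0) = (SUM b:B K. (pt x b - pt x b * pt y b)/2)"
 by (intro sum.cong refl) (simp add: pt_def)
 also have "... = ((SUM b:B K. pt x b) - (SUM b:B K. pt x b * pt y b))/2"
 by (simp add: sum_subtractf flip: sum_divide_distrib)
 also have "... = (if x = y then - 16 else 0)"
 by (simp add: spzq[OF K x(1)] sppq[OF K x] cBq[OF K])
 finally have 1: "(SUM b:B K. if y : b then pt x b else 0) = (if x = y then - 16 else 0)" .
 have "(SUM b:B K. if y : b then pt x b else 0)
 = (SUM b:B K - {{}, - K}. if y : b then pt x b else 0) + (SUM b:{{}, - K}. if y : b then pt x b else 0)"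
 by (rule sum.subset_diff) (use BCq[OF K] in auto)
 also have "(SUM b:{{}, - K}. if y : b then pt x b else 0) = - 1"
 using Cneq[OF K] x by simp
 finally show ?thesis using 1 by (simp split: if_splits add: algebra_simps)
qed
text \<open>One datum in place of a lift, a homomorphism and a character: multiplying a homomorphic
  section by a character gives another one, and the lift of \<open>K\<close> is recovered as
  \<open>s (- K) \<diamondop> \<Omega>\<close>.\<close>

definition hsec :: "'i set => ('i set => 'p) => bool" where
 "hsec K s \<longleftrightarrow> octad K & (ALL b:B K. bar (s b) = b) & (ALL b:B K. ALL c:B K. s (b +^ c) = s b \<diamondop> s c)"
text \<open>At \<open>b = - K\<close> the function \<open>XV\<close> supplies both the factor
  \<open>theta\<close> and the lift of \<open>K\<close>, so all nonempty words enter
  uniformly.\<close>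

definition oroot :: "'i set => ('i set => 'p) => complex ^ ('i + 'p)" where
 "oroot K s = (1/2) *s (- (SUM i:K. u_vec i) + (SUM i: -K. u_vec i) + (SUM b:B K - {{}}. XV (s b)))"
end
locale osec = parker_algebra C mult unit m1 bar \<omega> \<Omega>
 for C :: "'i::finite set set"
 and mult :: "'p::finite => 'p => 'p" (infixl \<open>\<diamondop>\<close> 70)
 and unit :: 'p (\<open>\<e>\<close>)
 and m1 :: 'p and bar :: "'p => 'i set"
 and \<omega> :: complex and \<Omega> :: 'p +
 fixes K :: "'i set" and s :: "'i set => 'p"
 assumes hs: "hsec K s"
begin
lemma K: "octad K" using hs by (simp add: hsec_def)
lemma bar_s [simp]: "b : B K ==> bar (s b) = b" using hs by (simp add: hsec_def)
lemma smqb: "b : B K ==> c : B K ==> s b \<diamondop> s c = s (b +^ c)" using hs by (simp add: hsec_def)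
lemma X_in: "- K : B K" by (rule BCq[OF K])
lemma seq: "s {} = \<e>"
proof -
 have "bar (s {}) = {}" by simp
 then have "s {} = \<e> | s {} = m1" using bar_kernel by blast
 then show ?thesis using smqb[of "{}" "{}"] m1_order by auto
qed
definition ow :: 'p where "ow = s (- K) \<diamondop> \<Omega>"
lemma boqa [simp]: "bar ow = K" using X_in by (simp add: ow_def bmq bar_Omega)
lemma oOq: "ow \<diamondop> \<Omega> = s (- K)" by (simp add: ow_def)
lemma olq: "ow : lifts" by (simp add: liq K)
lemma osqa: "ow \<diamondop> ow = \<e>" by (rule soq) (simp add: K)
abbreviation "Bo \<equiv> B K - {{}, - K}"
abbreviation "uK \<equiv> (SUM i:K. u_vec i)"
abbreviation "uX \<equiv> (SUM i: -K. u_vec i)"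
abbreviation "tz \<equiv> tau (oroot K s)"
lemma Boq: "b : Bo ==> octad b" using K Bcq[of K b] by blast
lemma Bo_B: "b : Bo ==> b : B K" by blast
lemma Bfq: "b : Bo ==> b +^ - K : Bo"
proof -
 assume b: "b : Bo"
 have "octad (b +^ - K)" "b +^ - K : B K" using Bfqa[OF K _ Boq[OF b]] b by blast+
 then show ?thesis using onCq[OF K] by (auto simp: octad_def)
qed
lemma Blq: "b : Bo ==> s b : lifts" using Boq Bo_B by (simp add: liq)
lemma XV_X: "XV (s (- K)) = theta *s x_vec ow"
 using X_in cCoq[OF K] by (simp add: XV_16 ow_def)
lemma XV_Bo: "b : Bo ==> XV (s b) = x_vec (s b)" using Boq Bo_B by (simp add: Xoq)
lemma sBsq: "sum f (B K - {{}}) = f (- K) + sum f Bo" for f :: "'i set => 'z::comm_monoid_add"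
proof -
 have "B K - {{}} = insert (- K) Bo" using X_in Cneq[OF K] by blast
 then show ?thesis by simp
qed
lemma sBsqa: "sum f (B K) = f {} + (f (- K) + sum f Bo)" for f :: "'i set => 'z::comm_monoid_add"
proof -
 have "B K = insert {} (B K - {{}})" using Beq by blast
 then have "sum f (B K) = f {} + sum f (B K - {{}})" by (metis Diff_iff finite insertI1 sum.insert)
 then show ?thesis by (simp add: sBsq)
qed
lemma oaqa: "oroot K s = (1/2) *s (- uK + uX + theta *s x_vec ow + (SUM b:Bo. x_vec (s b)))"
 using XV_Bo by (simp add: oroot_def sBsq XV_X add.assoc)
lemma sxVq: "(SUM b:Bo. x_vec (s b)) : VV" using Blq by (intro Vsq VV_x) blast
lemma oVq: "oroot K s : VV"
 unfolding oaqa by (intro VV_scale Vaq VV_uminus Vsq VV_u VV_x olq sxVq)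
lemma suIq: "(SUM i:A. u_vec i) $ Inl j = (if j : A then 1 else 0)" "(SUM i:A. u_vec i) $ Inr d = 0" for A :: "'i set"
 by simp_all
lemma xsIq: "b : B K ==> x_vec (s b) $ Inr f = 0" if "bar f ~= b" for b f
 using that by (intro xvIbq) simp
lemma oIoq: assumes "bar d ~= K" "bar d ~: B K" shows "oroot K s $ Inr d = 0"
proof -
 have "x_vec (s b) $ Inr d = 0" if "b : Bo" for b using that assms xsIq[of d b] by auto
 moreover have "x_vec ow $ Inr d = 0" using assms by (intro xvIbq) auto
 ultimately show ?thesis by (simp add: oaqa suIq)
qed
lemma oIqa: "oroot K s $ Inl j = (if j : K then - 1/2 else 1/2)"
 by (simp add: oaqa suIq)
lemma oIoqa: "oroot K s $ Inr ow = theta/2"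
proof -
 have "x_vec (s b) $ Inr ow = 0" if "b : Bo" for b
 using that Int_B(1)[of b K] K by (intro xsIq) (auto simp: octad_def)
 then show ?thesis by (simp add: oaqa suIq)
qed
lemma oIsq: assumes b: "b : Bo" shows "oroot K s $ Inr (s b) = 1/2"
proof -
 have bB: "b : B K" using b by blast
 have "b ~= K" using Int_B(1)[OF bB] b by auto
 then have "x_vec ow $ Inr (s b) = 0" using bB by (intro xvIbq) simp
 moreover have "x_vec (s c) $ Inr (s b) = (if c = b then 1 else 0)" if "c : Bo" for c
 using that bB xsIq[of "s b" c] by (cases "c = b") simp_all
 then have "(SUM c:Bo. x_vec (s c) $ Inr (s b)) = (SUM c:Bo. if c = b then 1 else 0)" by (intro sum.cong refl)
 then have "(SUM c:Bo. x_vec (s c) $ Inr (s b)) = 1" using b by simp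
 ultimately show ?thesis by (simp add: oaqa suIq)
qed
lemma hoxq: assumes "d : lifts" shows "herm (oroot K s) (x_vec d) = oroot K s $ Inr d"
 using hxq[OF oVq assms] .
lemma sxuq: assumes "d : lifts"
 shows "x_vec d \<star> (- uK + uX) = ((3 - of_nat (card (bar d Int K)))/2) *s x_vec d"
proof -
 have "card (bar d Int K) + card (bar d Int - K) = 8" using csq[of "bar d" K] assms by (simp add: liq octadD)
 then have "of_nat (card (bar d Int - K)) = (8 - of_nat (card (bar d Int K)) :: complex)"
 by (metis add_diff_cancel_left' of_nat_add of_nat_numeral)
 then have e: "of_nat (card (- K Int bar d)) = (8 - of_nat (card (K Int bar d)) :: complex)" by (simp add: Int_commute)
 have "x_vec d \<star> (- uK + uX) = - (uK \<star> x_vec d) + uX \<star> x_vec d"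
 by (simp only: star_commute[of "x_vec d"] star_add smq)
 also have "... = - (((4 * of_nat (card (K Int bar d)) - 8)/16) *s x_vec d)
 + ((4*(8 - of_nat (card (K Int bar d))) - 16)/16) *s x_vec d"
 by (simp only: ssuxq[OF assms] e octadD(2)[OF K] cCoq[OF K] of_nat_numeral)
 also have "... = ((3 - of_nat (card (bar d Int K)))/2) *s x_vec d"
 by (simp add: vec_eq_iff field_simps Int_commute)
 finally show ?thesis .
qed
lemma sxoq: assumes d: "d : lifts" and ne: "bar d ~= K"
 shows "x_vec d \<star> oroot K s = (1/4) *s ((3 - of_nat (card (bar d Int K))) *s x_vec d - theta *s XV (d \<diamondop> ow)
 + 2 *s (SUM b:Bo. x_vec d \<star> x_vec (s b)))"
proof -
 have "x_vec d \<star> (theta *s x_vec ow) = (- theta/2) *s XV (d \<diamondop> ow)"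
 using sxxXq[OF d olq] ne by (simp add: ssrq tcq vec_eq_iff)
 then show ?thesis
 unfolding oaqa ssrq sarq[of _ "- uK + uX"] sarq[of _ "_ + theta *s _"]
 sarq[of _ "- uK + uX + theta *s x_vec ow"] sxuq[OF d] ssqb
 by (simp add: vec_eq_iff field_simps)
qed
text \<open>When \<open>bar d\<close> is neither \<open>K\<close> nor in \<open>B K\<close>, the
  root has no coordinate at \<open>d\<close>, so the rank-one term of \<open>tau\<close> vanishes
  and only the product with the root remains.\<close>

lemma txgq: assumes d: "d : lifts" and ne: "bar d ~= K" "bar d ~: B K"
 shows "tz (x_vec d) = (1/4) *s ((3 - of_nat (card (bar d Int K))) *s x_vec d - theta *s XV (d \<diamondop> ow)
 + (SUM b:Bo. XV (d \<diamondop> s b)))"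
proof -
 have "(SUM b:Bo. x_vec d \<star> x_vec (s b)) = (SUM b:Bo. (1/2) *s XV (d \<diamondop> s b))"
 proof (intro sum.cong refl)
 fix b assume b: "b : Bo"
 then have "bar d ~= bar (s b)" using ne by auto
 then show "x_vec d \<star> x_vec (s b) = (1/2) *s XV (d \<diamondop> s b)" using sxxXq[OF d Blq[OF b]] by blast
 qed
 then have "2 *s (SUM b:Bo. x_vec d \<star> x_vec (s b)) = (SUM b:Bo. XV (d \<diamondop> s b))"
 by (simp add: ssqa ssq)
 moreover have "herm (oroot K s) (x_vec d) = 0" using hoxq[OF d] oIoq[OF ne] by simp
 ultimately show ?thesis unfolding tau_def sxoq[OF d ne(1)] by simp
qed
lemma tTq: assumes d: "d : lifts" and c2: "card (bar d Int K) = 2"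
 shows "tz (x_vec d) = (1/4) *s (SUM b:B K. XV (d \<diamondop> s b))"
proof -
 have o: "octad (bar d)" using d by (simp add: liq)
 have ne: "bar d ~= K" "bar d ~: B K" using c2 K Int_B(2)[of "bar d" K] by (auto simp: octadD)
 have "card (bar (d \<diamondop> ow)) = 12" using csqa[of "bar d" K] c2 o K by (simp add: bmq octadD)
 then have 1: "XV (d \<diamondop> ow) = 0" by (rule XV_12)
 have "card (bar d Int - K) = 6" using csq[of "bar d" K] c2 o by (simp add: octadD)
 then have "card (bar (d \<diamondop> s (- K))) = 12"
 using csqa[of "bar d" "- K"] o cCoq[OF K] X_in by (simp add: bmq octadD)
 then have 2: "XV (d \<diamondop> s (- K)) = 0" by (rule XV_12)
 show ?thesis unfolding txgq[OF d ne] sBsqa 1 2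
 using o by (simp add: c2 seq unit_right Xoq)
qed
lemma TsXq: assumes "octad d" "card (d Int K) = 2" shows "sQ d (- K) = - 1"
 using csq[of d K] assms by (simp add: sQ_def octadD)
lemma Tsfq: assumes d: "octad d" "card (d Int K) = 2" and b: "b : B K" shows "sQ d (b +^ - K) = - sQ d b"
 using swq(1)[OF octadD(1)[OF d(1)] Bwq[OF b] Bwq[OF X_in]] TsXq[OF d] sCq(1)[OF b octadD(1)[OF d(1)]]
 by simp
text \<open>The word \<open>bar d +^ b\<close> has weight 8 or 12, and \<open>sQ (bar d) b\<close>
  tells which. Hence the factor \<open>1 + sQ (bar d) b\<close> selects the octads in the sums
  below, and a scalar at a dodecad may be altered freely because \<open>XV\<close> vanishes
  there.\<close>

lemma T2_XV: assumes d: "octad (bar d)" "card (bar d Int K) = 2" and b: "b : B K"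
 shows "sQ (bar d) b = - 1 ==> XV (d \<diamondop> s b) = 0" "sQ (bar d) b = 1 ==> octad (bar d +^ b)"
 "card ((bar d +^ b) Int K) = 2"
proof -
 have C: "bar d +^ b : C" using scq[OF bwq Bwq[OF b]] .
 show k: "card ((bar d +^ b) Int K) = 2" using d Int_B(2)[OF b] by (simp add: sd_Int)
 have "card (bar d +^ b) = 8 & sQ (bar d) b = 1 | card (bar d +^ b) = 12 & sQ (bar d) b = - 1"
 using K b
 proof (cases rule: Bcq)
 case 1 then show ?thesis using d by (simp add: octadD)
 next
 case 2
 have "card (bar d Int - K) = 6" using csq[of "bar d" K] d by (simp add: octadD)
 then show ?thesis using 2 csqa[of "bar d" "- K"] d(1) cCoq[OF K] TsXq[OF d] by (simp add: octadD)
 next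
 case 3 then show ?thesis using TIq[OF K d b 3(1)] csqa[of "bar d" b] d(1) by (auto simp: octadD sQ_def)
 qed
 then show "sQ (bar d) b = - 1 ==> XV (d \<diamondop> s b) = 0" "sQ (bar d) b = 1 ==> octad (bar d +^ b)"
 using b C by (auto simp: XV_def bmq octad_def)
qed
lemma Xssqa: assumes "b : B K" "c : B K"
 shows "XV ((d \<diamondop> s b) \<diamondop> s c) = sT (bar d) b c *s XV (d \<diamondop> s (b +^ c))"
 using oaqb[OF oXq, of d "s b" "s c"] assms by (simp add: smqb)
lemma tTXq: assumes d: "octad (bar d)" "card (bar d Int K) = 2" and b: "b : B K"
 shows "tz (XV (d \<diamondop> s b)) = (SUM e:B K. ((1 + sQ (bar d) b)/8 * sT (bar d) b e) *s XV (d \<diamondop> s e))"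
proof (cases "sQ (bar d) b = 1")
 case True
 have o: "octad (bar (d \<diamondop> s b))" using T2_XV(2)[OF d b True] b by (simp add: bmq)
 have c2: "card (bar (d \<diamondop> s b) Int K) = 2" using T2_XV(3)[OF d b] b by (simp add: bmq)
 have "tz (XV (d \<diamondop> s b)) = (1/4) *s (SUM c:B K. XV ((d \<diamondop> s b) \<diamondop> s c))"
 using tTq[of "d \<diamondop> s b"] o c2 by (simp add: Xoq liq)
 also have "(SUM c:B K. XV ((d \<diamondop> s b) \<diamondop> s c)) = (SUM c:B K. sT (bar d) b c *s XV (d \<diamondop> s (b +^ c)))"
 using Xssqa b by (intro sum.cong refl) blast
 also have "... = (SUM c:B K. sT (bar d) b (c +^ b) *s XV (d \<diamondop> s (b +^ (c +^ b))))"
 by (rule ssrqa[symmetric]) (use b B_sd in auto)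
 also have "... = (SUM c:B K. sT (bar d) b c *s XV (d \<diamondop> s c))"
 using b by (intro sum.cong refl) (simp add: sT_sd(1) scqa[of _ b] Bwq)
 finally show ?thesis using True by (simp add: ssq flip: ssqa)
next
 case False
 then have "sQ (bar d) b = - 1" using sQ_cases by blast
 then show ?thesis using T2_XV(1)[OF d b] by simp
qed
lemma sslq: "(SUM a:A. f a) *s v = (SUM a:A. f a *s v)" for v :: "complex ^ 'n"
 by (simp add: vec_eq_iff sum_distrib_right)
lemma tTsq: assumes d: "octad (bar d)" "card (bar d Int K) = 2"
 shows "tz (SUM b:B K. f b *s XV (d \<diamondop> s b))
 = (SUM e:B K. (SUM b:B K. cnj (f b)*((1 + sQ (bar d) b)/8 * sT (bar d) b e)) *s XV (d \<diamondop> s e))"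
proof -
 have "tz (SUM b:B K. f b *s XV (d \<diamondop> s b))
 = (SUM b:B K. SUM e:B K. (cnj (f b)*((1 + sQ (bar d) b)/8 * sT (bar d) b e)) *s XV (d \<diamondop> s e))"
 unfolding tsqa tsq using tTXq[OF d]
 by (intro sum.cong refl) (simp add: ssq flip: ssqa)
 also have "... = (SUM e:B K. SUM b:B K. (cnj (f b)*((1 + sQ (bar d) b)/8 * sT (bar d) b e)) *s XV (d \<diamondop> s e))"
 by (rule sum.swap)
 finally show ?thesis by (simp only: sslq)
qed
lemma sBoq: assumes "!!b. b : B K ==> f (b +^ - K) = - f b" shows "sum f (B K) = (0::complex)"
 by (rule sazq[where g = "%b. b +^ - K"]) (use assms B_sd X_in in \<open>auto simp: sd_assoc\<close>)
text \<open>At \<open>e = - K\<close> the character sum is 32, but the vector lies over a dodecad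
  and is zero. For all other nonempty \<open>e\<close> the character is nontrivial by
  \<open>Trq\<close>.\<close>

lemma Tssq: assumes d: "octad (bar d)" "card (bar d Int K) = 2" and e: "e : B K"
 shows "(SUM b:B K. sT (bar d) b e) *s XV (d \<diamondop> s e) = (if e = {} then 32 else 0) *s XV (d \<diamondop> s e)"
proof -
 consider "e = {}" | "e = - K" | "e ~= {}" "e ~= - K" by blast
 then show ?thesis
 proof cases
 case 1 then show ?thesis by (simp add: cBq[OF K])
 next
 case 2
 then have "XV (d \<diamondop> s e) = 0" using T2_XV(1)[OF d e] TsXq[OF d] by simp
 then show ?thesis by simp
 next
 case 3
 then obtain b where "b : B K" "sT (bar d) e b ~= 1" using Trq[OF K d e] by blast
 then have b: "b : B K" "sT (bar d) b e = - 1" using scqc[of "bar d" e b] spq(2)[of "bar d" e b] by auto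
 have "(SUM b:B K. sT (bar d) e b) = 0"
 by (rule sBhq[OF Bhsq b(1)]) (use b spq(2)[of "bar d" e b] in simp)
 then have "(SUM b:B K. sT (bar d) b e) = 0" by (simp only: spq(2)[of "bar d" e])
 then show ?thesis using 3 by simp
 qed
qed
text \<open>Applying the map twice gives at each \<open>e\<close> a sum of \<open>sT\<close> and a
  sum of \<open>sQ * sT\<close>. The second cancels in pairs \<open>b\<close>,
  \<open>b +^ - K\<close>; the first is handled by \<open>Tssq\<close> and leaves only
  \<open>e = {}\<close>.\<close>

lemma tiTq: assumes d: "d : lifts" and c2: "card (bar d Int K) = 2" shows "tz (tz (x_vec d)) = x_vec d"
proof -
 have o: "octad (bar d)" using d by (simp add: liq)
 note dd = o c2
 have z: "(SUM b:B K. sQ (bar d) b * sT (bar d) b e) = 0" if e: "e : B K" for e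
 by (rule sBoq) (use Tsfq[OF dd] sCq[OF e bwq] in \<open>simp add: sT_sd\<close>)
 have "(SUM b:B K. cnj (1/4)*((1 + sQ (bar d) b)/8 * sT (bar d) b e)) *s XV (d \<diamondop> s e)
 = (if e = {} then 1 else 0) *s XV (d \<diamondop> s e)" if e: "e : B K" for e
 proof -
 have "(SUM b:B K. cnj (1/4)*((1 + sQ (bar d) b)/8 * sT (bar d) b e))
 = (1/32)*((SUM b:B K. sT (bar d) b e) + (SUM b:B K. sQ (bar d) b * sT (bar d) b e))"
 unfolding sum.distrib[symmetric] sum_distrib_left by (intro sum.cong refl) (simp add: algebra_simps)
 then have "(SUM b:B K. cnj (1/4)*((1 + sQ (bar d) b)/8 * sT (bar d) b e)) *s XV (d \<diamondop> s e)
 = (1/32) *s ((SUM b:B K. sT (bar d) b e) *s XV (d \<diamondop> s e))"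
 by (simp add: z[OF e] ssq)
 also have "... = (1/32) *s ((if e = {} then 32 else 0) *s XV (d \<diamondop> s e))"
 by (simp only: Tssq[OF dd e])
 also have "... = (if e = {} then 1 else 0) *s XV (d \<diamondop> s e)" by (simp add: ssq)
 finally show ?thesis .
 qed
 then have "tz (SUM b:B K. (1/4) *s XV (d \<diamondop> s b)) = (SUM e:B K. (if e = {} then 1 else 0) *s XV (d \<diamondop> s e))"
 unfolding tTsq[OF dd] by (intro sum.cong refl)
 also have "... = (SUM e:B K. if e = {} then XV (d \<diamondop> s e) else 0)" by (intro sum.cong refl) simp
 also have "... = x_vec d" using o by (simp add: seq unit_right Xoq)
 finally show ?thesis unfolding tTq[OF d c2] ssqa .
qed
lemma bTq: assumes d: "d : lifts" and c2: "card (bar d Int K) = 2" and x: "x ~: K"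
 shows "tz (tau (broot x) (tz (x_vec d))) = tau (broot x) (tz (tau (broot x) (x_vec d)))"
proof -
 have o: "octad (bar d)" using d by (simp add: liq)
 note dd = o c2
 let ?d = "bar d"
 have t: "tz (x_vec d) = (SUM b:B K. (1/4) *s XV (d \<diamondop> s b))" unfolding tTq[OF d c2] ssqa ..
 have r: "tau (broot x) (tz (x_vec d)) = (SUM b:B K. (1/4*(pt x ?d * pt x b)) *s XV (d \<diamondop> s b))"
 unfolding t tsqa by (intro sum.cong refl) (simp add: tsq tbXq bmq pt_sd ssq)
 have z: "(SUM b:B K. pt x b * sT ?d b e) = 0" if e: "e : B K" for e
 by (rule sBoq) (use sCq[OF e bwq] x in \<open>simp add: pt_sd sT_sd\<close>)
 have g: "(SUM b:B K. pt x b*(sQ ?d b * sT ?d b e)) = 8 * sQ ?d e * pt x e * pt x ?d" if e: "e : B K" for e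
 proof -
 have "8 * pt x ?d = (SUM b:B K. sQ ?d (b +^ e) * pt x (b +^ e))"
 unfolding gTq[OF K dd x, symmetric] by (rule ssrqa[symmetric]) (use e B_sd in auto)
 also have "... = (SUM b:B K. (sQ ?d e * pt x e)*(pt x b*(sQ ?d b * sT ?d b e)))"
 using swq(1)[OF bwq Bwq Bwq[OF e]] by (intro sum.cong refl) (simp add: pt_sd mult_ac)
 also have "... = (sQ ?d e * pt x e)*(SUM b:B K. pt x b*(sQ ?d b * sT ?d b e))" by (simp only: sum_distrib_left)
 finally have "8 * pt x ?d = (sQ ?d e * pt x e)*(SUM b:B K. pt x b*(sQ ?d b * sT ?d b e))" .
 then have "(sQ ?d e * pt x e)*(8 * pt x ?d)
 = (sQ ?d e * pt x e)*((sQ ?d e * pt x e)*(SUM b:B K. pt x b*(sQ ?d b * sT ?d b e)))" by simp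
 also have "... = (SUM b:B K. pt x b*(sQ ?d b * sT ?d b e))"
 using sQ_cases[of ?d e] pt_cases[of x e] by auto
 finally show ?thesis by (simp add: mult_ac)
 qed
 have "tz (tau (broot x) (tz (x_vec d))) = (SUM e:B K. (1/4 * pt x e) *s XV (d \<diamondop> s e))"
 unfolding r tTsq[OF dd]
 proof (intro sum.cong refl)
 fix e assume e: "e : B K"
 have "(SUM b:B K. cnj (1/4*(pt x ?d * pt x b))*((1 + sQ ?d b)/8 * sT ?d b e))
 = (pt x ?d/32)*((SUM b:B K. pt x b * sT ?d b e) + (SUM b:B K. pt x b*(sQ ?d b * sT ?d b e)))"
 unfolding sum.distrib[symmetric] sum_distrib_left by (intro sum.cong refl) (simp add: algebra_simps)
 also have "... = 1/4 * sQ ?d e * pt x e" by (simp add: z[OF e] g[OF e] mult_ac)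
 finally have *: "(SUM b:B K. cnj (1/4*(pt x ?d * pt x b))*((1 + sQ ?d b)/8 * sT ?d b e)) = 1/4 * sQ ?d e * pt x e" .
 show "(SUM b:B K. cnj (1/4*(pt x ?d * pt x b))*((1 + sQ ?d b)/8 * sT ?d b e)) *s XV (d \<diamondop> s e)
 = (1/4 * pt x e) *s XV (d \<diamondop> s e)"
 unfolding * using sQ_cases[of ?d e] T2_XV(1)[OF dd e] by auto
 qed
 also have "... = tau (broot x) (tz (tau (broot x) (x_vec d)))"
 unfolding tbxq[OF d] tsq t tsqa
 by (simp add: tsq tbXq bmq pt_sd ssq tsqa mult_ac flip: ssqa)
 finally show ?thesis .
qed
end
context parker_algebra begin
lemma beq: assumes "bar d = bar e" shows "d = e | d = neg e"
proof -
 obtain y where y: "e \<diamondop> y = d" using left_division[of e d] by blast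
 then have "bar e +^ bar y = bar d" using bmq by metis
 then have "bar e +^ (bar e +^ bar y) = {}" using assms by (simp del: sd_cancel)
 then have "bar y = {}" by simp
 then have "y = \<e> | y = m1" using bar_kernel by blast
 moreover have "e \<diamondop> m1 = m1 \<diamondop> e" using m1_central unfolding central_def by metis
 ultimately show ?thesis using y unit_right by (auto simp: neg_def)
qed
lemma scqd: "k *s v = k *s w ==> k ~= 0 ==> v = w" for v :: "complex ^ 'n"
 by (simp add: vec_eq_iff)
text \<open>The basic roots span the part \<open>U\<close>, as their sum is \<open>16 *s US\<close>.
  Statements about \<open>u_vec\<close> can therefore be derived from the images of basic roots,
  which are roots.\<close>

lemma uvbq: "u_vec i = (1/8) *s ((1/16) *s (SUM j:UNIV. broot j) - broot i)"
proof -
 have "(SUM j:UNIV. broot j) = 16 *s US"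
 proof -
 have "(SUM j:UNIV. broot j) = of_nat 24 *s US - 8 *s US"
 by (simp only: broot_def sum_subtractf ssqa US_def[symmetric] scsq card_index)
 then show ?thesis by (simp add: vec_eq_iff)
 qed
 then show ?thesis by (simp add: broot_def ssq vec_eq_iff)
qed
lemma Vibq [consumes 1, case_names r x add scale]:
 assumes v: "v : VV"
 and r: "!!i. P (broot i)" and x: "!!d. d : lifts ==> P (x_vec d)"
 and add: "!!v w. v : VV ==> w : VV ==> P v ==> P w ==> P (v + w)"
 and scale: "!!c v. v : VV ==> P v ==> P (c *s v)"
 shows "P v"
 using v
proof (induction v rule: Viq)
 case (u i)
 have P0: "P 0" using scale[OF bVq r, of 0 undefined] by simp
 have Ps: "P (SUM j:A. broot j) & (SUM j:A. broot j) : VV" for A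
 by (induction A rule: infinite_finite_induct) (auto intro: add Vaq P0 VV_0 r bVq)
 have e: "u_vec i = (1/8) *s ((1/16) *s (SUM j:UNIV. broot j) + (- 1) *s broot i)"
 by (subst uvbq) (simp add: vec_eq_iff)
 show ?case unfolding e by (intro scale add VV_scale Vaq) (use Ps r bVq in auto)
qed (use assms in auto)
text \<open>Multiplication of a section by a character inside the loop; every value other than 1 is
  treated as -1.\<close>

definition twist :: "('i set => complex) => ('i set => 'p) => 'i set => 'p" where
 "twist pz s b = (if pz b = 1 then s b else neg (s b))"
lemma btq [simp]: "bar (twist pz s b) = bar (s b)" by (simp add: twist_def bar_neg)
lemma otqb: assumes "odd_map G" "B_hom K pz" "b : B K" shows "G (twist pz s b) = pz b *s G (s b)"
proof -
 have "pz b = 1 | pz b = - 1" using Bhq(1)[OF assms(2,3)] .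
 moreover have "G (neg (s b)) = - G (s b)" using assms(1) by (rule omq)
 ultimately show ?thesis by (elim disjE) (simp_all add: twist_def vec_eq_iff)
qed
lemma htq: assumes "hsec K s" "B_hom K pz" shows "hsec K (twist pz s)"
proof -
 have "twist pz s (b +^ c) = twist pz s b \<diamondop> twist pz s c" if b: "b : B K" "c : B K" for b c
 using assms(1) b Bhq(1)[OF assms(2) b(1)] Bhq(1)[OF assms(2) b(2)] Bhq(2)[OF assms(2) b]
 by (auto simp: twist_def hsec_def mult_neg neg_neg)
 then show ?thesis using assms(1) by (simp add: hsec_def)
qed
lemma otqa: assumes "B_hom K pz"
 shows "oroot K (twist pz s) = (1/2) *s (- (SUM i:K. u_vec i) + (SUM i: -K. u_vec i) + (SUM b:B K - {{}}. pz b *s XV (s b)))"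
 unfolding oroot_def using otqb[OF oXq assms] by simp
lemma tboq: assumes "hsec K s" shows "tau (broot i) (oroot K s) = oroot K (twist (pt i) s)"
proof -
 have "bar (s b) = b" if "b : B K" for b using assms that by (simp add: hsec_def)
 then have "tau (broot i) (SUM b:B K - {{}}. XV (s b)) = (SUM b:B K - {{}}. pt i b *s XV (s b))"
 unfolding tsqa by (intro sum.cong refl) (simp add: tbXq)
 then show ?thesis unfolding otqa[OF Bhpq]
 by (simp only: oroot_def tsq taq tmq tbsuq) simp
qed
end
context osec begin
lemma tboqb: "x ~: K ==> tau (broot x) (x_vec ow) = x_vec ow"
 using tbxq[OF olq, of x] by (simp add: pt_def)
lemma hobq: "herm (oroot K s) (broot i) = (if i : K then 1 else 0)"
proof -
 have "(SUM k:UNIV. oroot K s $ Inl k) = (SUM k:K. oroot K s $ Inl k) + (SUM k: -K. oroot K s $ Inl k)"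
 by (metis Compl_eq_Diff_UNIV finite subset_UNIV sum.subset_diff add.commute)
 also have "... = 4" using octadD(2)[OF K] cCoq[OF K] by (simp add: oIqa)
 finally show ?thesis by (simp add: hbq oIqa)
qed
lemma tbaq: "tz (broot i) = tau (broot i) (oroot K s)
 + cnj (herm (oroot K s) (broot i)) *s broot i - herm (oroot K s) (broot i) *s oroot K s"
 by (simp add: tau_def hcq star_commute[of _ "broot i"])
lemma ofqa: assumes "i : K" shows "tau (broot i) (oroot K s) = oroot K s"
proof -
 have "pt i b = 1" if "b : B K" for b using that assms by (auto simp: pt_def B_iff)
 then show ?thesis unfolding tboq[OF hs] otqa[OF Bhpq] by (simp add: oroot_def)
qed
lemma tbiq: "i : K ==> tz (broot i) = broot i"
 unfolding tbaq hobq by (simp add: ofqa)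
lemma tboqa: "x ~: K ==> tz (broot x) = oroot K (twist (pt x) s)"
 unfolding tbaq hobq by (simp add: tboq[OF hs])
lemma sbq: "(SUM i:A. broot i) = of_nat (card A) *s (uK + uX) - 8 *s (SUM i:A. u_vec i)"
proof -
 have "US = uK + uX" unfolding US_def by (metis Compl_eq_Diff_UNIV finite subset_UNIV sum.subset_diff add.commute)
 then show ?thesis by (simp only: broot_def sum_subtractf scsq ssqa)
qed
text \<open>Fourier inversion with the 16 point characters. By \<open>spBq\<close> only the words
  \<open>c\<close> and \<open>c +^ - K\<close> survive, with factors 16 and -16. The roots on the
  left are the images of basic roots, so this evaluates the map on sums of
  \<open>u_vec\<close>.\<close>

lemma sotq: assumes c: "c : B K"
 shows "(SUM x: -K. pt x c *s oroot K (twist (pt x) s))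
 = (1/2) *s ((SUM x: -K. pt x c) *s (- uK + uX) + 16 *s (XV (s c) - XV (s (c +^ - K))))"
proof -
 have 0: "XV (s {}) = 0" by (simp add: XV_def seq)
 have 1: "(SUM b:B K - {{}}. f b *s XV (s b)) = (SUM b:B K. f b *s XV (s b))" for f :: "'i set => complex"
 by (rule sum.mono_neutral_left) (auto simp: 0)
 have "(SUM x: -K. pt x c *s oroot K (twist (pt x) s))
 = (SUM x: -K. (1/2) *s (pt x c *s (- uK + uX) + (SUM b:B K. (pt x c * pt x b) *s XV (s b))))"
 proof (intro sum.cong refl)
 fix x
 have "pt x c *s (SUM b:B K. pt x b *s XV (s b)) = (SUM b:B K. (pt x c * pt x b) *s XV (s b))"
 by (simp add: ssq flip: ssqa)
 then show "pt x c *s oroot K (twist (pt x) s)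
 = (1/2) *s (pt x c *s (- uK + uX) + (SUM b:B K. (pt x c * pt x b) *s XV (s b)))"
 unfolding otqa[OF Bhpq] 1 by (simp add: vec_eq_iff algebra_simps)
 qed
 also have "... = (1/2) *s ((SUM x: -K. pt x c) *s (- uK + uX) + (SUM x: -K. SUM b:B K. (pt x c * pt x b) *s XV (s b)))"
 by (simp only: ssqa sum.distrib sslq)
 also have "(SUM x: -K. SUM b:B K. (pt x c * pt x b) *s XV (s b)) = (SUM b:B K. (SUM x: -K. pt x (b +^ c)) *s XV (s b))"
 by (subst sum.swap) (simp add: sslq pt_sd mult.commute)
 also have "... = (SUM b:B K. (if b = c then 16 *s XV (s b) else 0) - (if b = c +^ - K then 16 *s XV (s b) else 0))"
 proof (intro sum.cong refl)
 fix b assume b: "b : B K"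
 have e: "b +^ c = {} \<longleftrightarrow> b = c" "b +^ c = - K \<longleftrightarrow> b = c +^ - K" by (auto simp: sd_def)
 have "c ~= c +^ - K" using Cneq[OF K] by (auto simp: sd_def)
 then show "(SUM x: -K. pt x (b +^ c)) *s XV (s b) = (if b = c then 16 *s XV (s b) else 0) - (if b = c +^ - K then 16 *s XV (s b) else 0)"
 unfolding spBq[OF K B_sd[OF b c]] e by (auto simp: vec_eq_iff)
 qed
 also have "... = 16 *s (XV (s c) - XV (s (c +^ - K)))"
 using c B_sd[OF c X_in] by (simp add: sum_subtractf vec_eq_iff algebra_simps)
 finally show ?thesis .
qed
text \<open>No product is expanded: the map fixes the basic roots at points of \<open>K\<close> and
  sends the others to twisted octadic roots, so the two values follow by adding up basic roots over
  \<open>K\<close> and over \<open>- K\<close>.\<close>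

lemma tuqa: "tz uX = uX" and tau_uK: "tz uK = (- 1/2) *s uK - (theta/2) *s x_vec ow"
proof -
 have c: "of_nat (card K) = (8::complex)" "of_nat (card (- K)) = (16::complex)"
 using octadD(2)[OF K] cCoq[OF K] by simp_all
 have "tz (SUM i:K. broot i) = (SUM i:K. broot i)" unfolding tsqa using tbiq by simp
 then have "8 *s tz uX = 8 *s uX"
 unfolding sbq c tdq tsq taq by (simp add: vec_eq_iff algebra_simps)
 then show 1: "tz uX = uX" by (simp add: vec_eq_iff)
 have "tz (SUM i: -K. broot i) = (SUM x: -K. pt x {} *s oroot K (twist (pt x) s))"
 unfolding tsqa using tboqa by simp
 also have "... = 8 *s (- uK + uX) - 8 *s (theta *s x_vec ow)"
 unfolding sotq[OF Beq] using c by (simp add: XV_X seq XV_def[of \<e>] vec_eq_iff algebra_simps)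
 finally have e: "16 *s (tz uK + uX) - 8 *s uX = 8 *s (- uK + uX) - 8 *s (theta *s x_vec ow)"
 by (simp only: sbq c tdq tsq taq 1 complex_cnj_numeral)
 have "tz uK = (1/16) *s (16 *s (tz uK + uX) - 8 *s uX - 8 *s uX)" by (simp add: vec_eq_iff)
 also have "... = (- 1/2) *s uK - (theta/2) *s x_vec ow" unfolding e by (simp add: vec_eq_iff field_simps)
 finally show "tz uK = (- 1/2) *s uK - (theta/2) *s x_vec ow" .
qed
abbreviation "ub b \<equiv> (SUM i:b. u_vec i) - (SUM i:b +^ - K. u_vec i)"
lemma tuq: assumes b: "b : Bo" shows "tz (ub b) = x_vec (s b) - x_vec (s (b +^ - K))"
proof -
 note bB = Bo_B[OF b] and b' = Bfq[OF b]
 have sp: "(SUM x: -K. pt x b *s f x) = sum f (b +^ - K) - sum f b" for f :: "'i => complex ^ ('i + 'p)"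
 proof -
 have e: "b +^ - K = - K - b" and "b <= - K" using bB by (auto simp: B_iff sd_def)
 then have "(SUM x: -K. pt x b *s f x) = (SUM x: -K - b. pt x b *s f x) + (SUM x:b. pt x b *s f x)"
 by (intro sum.subset_diff) auto
 also have "(SUM x: -K - b. pt x b *s f x) = sum f (- K - b)" by (intro sum.cong refl) (simp add: pt_def)
 also have "(SUM x:b. pt x b *s f x) = - sum f b"
 unfolding sum_negf[symmetric] by (intro sum.cong refl) (simp add: pt_def vec_eq_iff)
 finally show ?thesis unfolding e by simp
 qed
 have c: "card b = card (b +^ - K)" using Boq[OF b] Boq[OF b'] by (simp add: octadD)
 have z: "(SUM x: -K. pt x b) = 0" using spBq[OF K bB] b by auto
 have "tz ((SUM i:b +^ - K. broot i) - (SUM i:b. broot i)) = (SUM x: -K. pt x b *s oroot K (twist (pt x) s))"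
 unfolding sp[symmetric] tsqa by (intro sum.cong refl) (simp add: tsq tboqa)
 also have "... = 8 *s (x_vec (s b) - x_vec (s (b +^ - K)))"
 unfolding sotq[OF bB] z XV_Bo[OF b] XV_Bo[OF b'] by (simp add: ssq)
 also have "(SUM i:b +^ - K. broot i) - (SUM i:b. broot i) = 8 *s ub b"
 unfolding sbq c by (simp add: vec_eq_iff algebra_simps)
 finally have "8 *s tz (ub b) = 8 *s (x_vec (s b) - x_vec (s (b +^ - K)))"
 by (simp only: tsq complex_cnj_numeral)
 then show ?thesis by (rule scqd) simp
qed
lemma sBOq: "b : B K ==> (s b \<diamondop> s (b +^ - K)) \<diamondop> \<Omega> = ow"
 using X_in B_sd by (simp add: smqb ow_def)
lemma ow_s: "b : B K ==> (ow \<diamondop> s b) \<diamondop> \<Omega> = s (b +^ - K)" "b : B K ==> s b \<diamondop> ow = s (b +^ - K) \<diamondop> \<Omega>"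
proof -
 assume b: "b : B K"
 show 1: "s b \<diamondop> ow = s (b +^ - K) \<diamondop> \<Omega>"
 using smqb[OF b X_in] Oaq(1)[of "s b" "s (- K)"] by (simp add: ow_def)
 have "ow \<diamondop> s b = s b \<diamondop> ow" by (rule ceq) (use b Int_B in simp)
 then show "(ow \<diamondop> s b) \<diamondop> \<Omega> = s (b +^ - K)" unfolding 1 by simp
qed
lemma xoxsq: assumes b: "b : Bo" shows "x_vec ow \<star> x_vec (s b) = (theta/2) *s x_vec (s (b +^ - K))"
proof -
 have bB: "b : B K" using b by blast
 have "card (bar (ow \<diamondop> s b)) = 16"
 using csqa[of K b] octadD(2)[OF K] octadD(2)[OF Boq[OF b]] Int_B[OF bB] bB by (simp add: bmq)
 moreover have "bar ow ~= bar (s b)" using Int_B(2)[OF bB] b bB by auto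
 ultimately show ?thesis
 using sxxXq[OF olq Blq[OF b]] ow_s(1)[OF bB] by (simp add: XV_16 ssq)
qed
lemma sBfq: "(SUM b:Bo. f (b +^ - K)) = sum f Bo" for f :: "'i set => 'z::comm_monoid_add"
 by (rule sum.reindex_bij_witness[where i = "%b. b +^ - K" and j = "%b. b +^ - K"]) (use Bfq in \<open>auto simp: sd_assoc\<close>)
lemma toqc: "tz (x_vec ow) = (- 1/2) *s x_vec ow - (theta/2) *s uK"
proof -
 have 1: "x_vec ow \<star> (SUM b:Bo. x_vec (s b)) = (theta/2) *s (SUM b:Bo. x_vec (s b))"
 unfolding ssqb ssqa[symmetric] sBfq[of "%b. (theta/2) *s x_vec (s b)", symmetric]
 using xoxsq by (intro sum.cong refl) blast
 have 2: "x_vec ow \<star> x_vec ow = (1/2) *s (3 *s uK - uX)"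
 using star_x_x[OF olq olq] by (simp add: prod_xx_def)
 have 3: "x_vec ow \<star> (- uK + uX) = (- 5/2) *s x_vec ow"
 unfolding sxuq[OF olq] using octadD(2)[OF K] by simp
 have "x_vec ow \<star> oroot K s = (1/2) *s ((- 5/2) *s x_vec ow + (- theta) *s ((1/2) *s (3 *s uK - uX)) + (theta/2) *s (SUM b:Bo. x_vec (s b)))"
 unfolding oaqa ssrq sarq[of _ "- uK + uX"] sarq[of _ "_ + theta *s _"]
 sarq[of _ "- uK + uX + theta *s x_vec ow"] 1 2 3 tcq by simp
 note 4 = this
 have 5: "herm (oroot K s) (x_vec ow) = theta/2" using hoxq[OF olq] oIoqa by simp
 show ?thesis
 unfolding tau_def 4 5 unfolding oaqa by (simp add: vec_eq_iff field_simps)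
qed
lemma xsxsq: assumes b: "b : Bo" and c: "c : Bo"
 shows "x_vec (s b) \<star> x_vec (s c) = (1/2) *s ((if c = b then 4 *s (SUM i:b. u_vec i) - uK - uX else 0)
 + (if c = b +^ - K then theta *s x_vec ow else 0) + (if c = b | c = b +^ - K then 0 else x_vec (s (b +^ c))))"
proof -
 have bB: "b : B K" "c : B K" using b c by blast+
 have ne: "b ~= b +^ - K" using Cneq[OF K] by (auto simp: sd_def)
 consider "c = b" | "c = b +^ - K" | "c ~= b" "c ~= b +^ - K" by blast
 then show ?thesis
 proof cases
 case 1
 have e: "(SUM i: -b. u_vec i) = uK + uX - (SUM i:b. u_vec i)"
 using Umq[of b] Umq[of K] by simp
 have "x_vec (s b) \<star> x_vec (s b) = (1/2) *s (4 *s (SUM i:b. u_vec i) - uK - uX)"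
 unfolding star_x_x[OF Blq[OF b] Blq[OF b]] prod_xx_def bar_s[OF bB(1)] e
 by (simp add: vec_eq_iff field_simps)
 then show ?thesis using ne unfolding 1 by simp
 next
 case 2
 have "b +^ c = - K" using 2 by simp
 then have cc: "card (b +^ c) = 16" using cCoq[OF K] by (simp only:)
 have "x_vec (s b) \<star> x_vec (s c) = (1/2) *s XV (s b \<diamondop> s c)"
 by (rule sxxXq[OF Blq[OF b] Blq[OF c]]) (unfold bar_s[OF bB(1)] bar_s[OF bB(2)], unfold 2, rule ne)
 moreover have "XV (s b \<diamondop> s c) = theta *s x_vec ow"
 using XV_16[of "s b \<diamondop> s c"] cc unfolding sBOq[OF bB(1), folded 2] bmq bar_s[OF bB(1)] bar_s[OF bB(2)] by blast
 ultimately have "x_vec (s b) \<star> x_vec (s c) = (1/2) *s (theta *s x_vec ow)" by simp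
 then show ?thesis using ne unfolding 2 by simp
 next
 case 3
 have "b +^ c ~= {}" unfolding seeq using 3(1) by blast
 moreover have "b +^ c ~= - K" using 3(2) sd_cancel[of b c] by force
 ultimately have "b +^ c : Bo" using B_sd[OF bB] by blast
 then have "XV (s b \<diamondop> s c) = x_vec (s (b +^ c))" using XV_Bo[of "b +^ c"] smqb[OF bB] by simp
 moreover have "x_vec (s b) \<star> x_vec (s c) = (1/2) *s XV (s b \<diamondop> s c)"
 by (rule sxxXq[OF Blq[OF b] Blq[OF c]]) (unfold bar_s[OF bB(1)] bar_s[OF bB(2)], rule 3(1)[symmetric])
 ultimately have "x_vec (s b) \<star> x_vec (s c) = (1/2) *s x_vec (s (b +^ c))" by simp
 then show ?thesis by (simp only: 3 if_False simp_thms add_0 add_0_right)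
 qed
qed
text \<open>The products with the 30 octads reproduce the whole octad part of the root except at
  \<open>b\<close> and \<open>b +^ - K\<close>. The rank-one term, with inner product 1/2, removes
  it again, and only these two words and a vector of \<open>U\<close> remain.\<close>

lemma tau_s: assumes b: "b : Bo"
 shows "tz (x_vec (s b)) = (1/2) *s (x_vec (s b) + x_vec (s (b +^ - K)) + ub b)"
proof -
 have bB: "b : B K" using b by blast
 note b' = Bfq[OF b]
 have ne: "b ~= b +^ - K" using Cneq[OF K] by (auto simp: sd_def)
 have "(SUM c:Bo. if c = b | c = b +^ - K then 0 else x_vec (s (b +^ c)))
 = (SUM c:Bo - {b, b +^ - K}. x_vec (s (b +^ c)))"
 by (rule sum.mono_neutral_cong_right) auto
 also have "... = (SUM c:Bo - {b, b +^ - K}. x_vec (s c))"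
 proof (rule sum.reindex_bij_witness[where i = "%c. b +^ c" and j = "%c. b +^ c"])
 fix c assume c: "c : Bo - {b, b +^ - K}"
 have nb: "c ~= b" "c ~= b +^ - K" "c ~= {}" "c ~= - K" "c : B K" using c by blast+
 have "b +^ c ~= - K" using nb(2) sd_cancel[of b c] by force
 moreover have "b +^ c ~= {}" unfolding seeq using nb(1) by blast
 moreover have "b +^ c ~= b" using nb(3) siq[of b c "{}"] by (auto simp: sd_def)
 moreover have "b +^ c ~= b +^ - K" using nb(4) siq[of b c "- K"] by blast
 ultimately show "b +^ c : Bo - {b, b +^ - K}" "b +^ c : Bo - {b, b +^ - K}"
 using B_sd[OF bB nb(5)] by blast+
 qed auto
 also have "... = (SUM c:Bo. x_vec (s c)) - x_vec (s b) - x_vec (s (b +^ - K))"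
 proof -
 have "(SUM c:Bo. x_vec (s c)) = (SUM c:Bo - {b, b +^ - K}. x_vec (s c)) + (SUM c:{b, b +^ - K}. x_vec (s c))"
 by (rule sum.subset_diff) (use b b' in blast, simp)
 also have "(SUM c:{b, b +^ - K}. x_vec (s c)) = x_vec (s b) + x_vec (s (b +^ - K))" using ne by simp
 finally show ?thesis by simp
 qed
 finally have 1: "(SUM c:Bo. if c = b | c = b +^ - K then 0 else x_vec (s (b +^ c)))
 = (SUM c:Bo. x_vec (s c)) - x_vec (s b) - x_vec (s (b +^ - K))" .
 have "(SUM c:Bo. x_vec (s b) \<star> x_vec (s c)) = (SUM c:Bo. (1/2) *s ((if c = b then 4 *s (SUM i:b. u_vec i) - uK - uX else 0)
 + (if c = b +^ - K then theta *s x_vec ow else 0) + (if c = b | c = b +^ - K then 0 else x_vec (s (b +^ c)))))"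
 using xsxsq[OF b] by (intro sum.cong refl) blast
 also have "... = (1/2) *s (4 *s (SUM i:b. u_vec i) - uK - uX + theta *s x_vec ow
 + ((SUM c:Bo. x_vec (s c)) - x_vec (s b) - x_vec (s (b +^ - K))))"
 unfolding ssqa sum.distrib 1 using b b' by simp
 finally have 2: "(SUM c:Bo. x_vec (s b) \<star> x_vec (s c)) = (1/2) *s (4 *s (SUM i:b. u_vec i) - uK - uX + theta *s x_vec ow
 + ((SUM c:Bo. x_vec (s c)) - x_vec (s b) - x_vec (s (b +^ - K))))" .
 have "octad (b +^ - K)" using Boq[OF b'] .
 then have "card (- (b +^ - K)) = 16" by (rule cCoq)
 moreover have "bar (s (b +^ - K) \<diamondop> \<Omega>) = - (b +^ - K)" using b' by (auto simp: bmq bar_Omega)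
 ultimately have "XV (s b \<diamondop> ow) = theta *s x_vec (s (b +^ - K))"
 unfolding ow_s(2)[OF bB] by (simp add: XV_16)
 moreover have "bar (s b) ~= K" using Int_B(2)[OF bB] b bB by auto
 ultimately have 3: "x_vec (s b) \<star> oroot K s = (1/4) *s (3 *s x_vec (s b) - theta *s (theta *s x_vec (s (b +^ - K)))
 + 2 *s ((1/2) *s (4 *s (SUM i:b. u_vec i) - uK - uX + theta *s x_vec ow
 + ((SUM c:Bo. x_vec (s c)) - x_vec (s b) - x_vec (s (b +^ - K))))))"
 using sxoq[OF Blq[OF b]] 2 Int_B(2)[OF bB] bB by simp
 have 4: "herm (oroot K s) (x_vec (s b)) = 1/2"
 using hoxq[OF Blq[OF b]] oIsq[OF b] by simp
 have 5: "uX = (SUM i:b. u_vec i) + (SUM i:b +^ - K. u_vec i)"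
 proof -
 have "b +^ - K = - K - b" "b <= - K" using bB by (auto simp: B_iff sd_def)
 then show ?thesis by (metis add.commute finite sum.subset_diff)
 qed
 show ?thesis
 unfolding tau_def 3 4 unfolding oaqa 5 by (simp add: vec_eq_iff field_simps)
qed
lemma sBaq: assumes "!!b. b : Bo ==> f (b +^ - K) = - f b" shows "sum f Bo = (0 :: complex ^ ('i + 'p))"
proof -
 have "sum f Bo = (SUM b:Bo. f (b +^ - K))" by (rule sBfq[symmetric])
 also have "... = - sum f Bo" unfolding sum_negf[symmetric] using assms by (intro sum.cong refl)
 finally show ?thesis by (simp add: vec_eq_iff)
qed
lemma otaq: assumes "B_hom K pz"
 shows "oroot K (twist pz s) = (1/2) *s (- uK + uX + (pz (- K) * theta) *s x_vec ow + (SUM b:Bo. pz b *s x_vec (s b)))"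
 unfolding otqa[OF assms] sBsq XV_X using XV_Bo by (simp add: ssq add.assoc)
lemma ttqa: assumes "B_hom K pz"
 shows "tz (oroot K (twist pz s)) = (1/2) *s ((1/2) *s uK + (theta/2) *s x_vec ow + uX
 + (pz (- K) * - theta) *s ((- 1/2) *s x_vec ow - (theta/2) *s uK)
 + (SUM b:Bo. pz b *s ((1/2) *s (x_vec (s b) + x_vec (s (b +^ - K)) + ub b))))"
proof -
 have "tz (SUM b:Bo. pz b *s x_vec (s b)) = (SUM b:Bo. pz b *s ((1/2) *s (x_vec (s b) + x_vec (s (b +^ - K)) + ub b)))"
 unfolding tsqa using Bhq(4)[OF assms] tau_s by (intro sum.cong refl) (simp add: tsq)
 then show ?thesis
 unfolding otaq[OF assms] tsq taq tmq tuqa tau_uK toqc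
 using Bhq(4)[OF assms X_in] by (simp add: tcq vec_eq_iff)
qed
text \<open>For a character trivial at \<open>- K\<close> the values at \<open>b\<close> and
  \<open>b +^ - K\<close> agree, so the vectors \<open>ub b\<close>, which change sign under this
  exchange, cancel.\<close>

lemma tteq: assumes h: "B_hom K pz" "pz (- K) = 1"
 shows "tz (oroot K (twist pz s)) = oroot K (twist pz s)"
proof -
 have flip: "pz (b +^ - K) = pz b" if "b : Bo" for b
 using Bhq(2)[OF h(1) Bo_B[OF that] X_in] h(2) by simp
 have "(SUM b:Bo. pz b *s ub b) = 0" by (rule sBaq) (simp add: flip sd_assoc vec_eq_iff algebra_simps)
 moreover have "(SUM b:Bo. pz b *s x_vec (s (b +^ - K))) = (SUM b:Bo. pz b *s x_vec (s b))"
 unfolding sBfq[of "%b. pz b *s x_vec (s b)", symmetric] using flip by (intro sum.cong refl) simp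
 ultimately have S: "(SUM b:Bo. pz b *s ((1/2) *s (x_vec (s b) + x_vec (s (b +^ - K)) + ub b))) = (SUM b:Bo. pz b *s x_vec (s b))"
 proof -
 assume *: "(SUM b:Bo. pz b *s ub b) = 0" "(SUM b:Bo. pz b *s x_vec (s (b +^ - K))) = (SUM b:Bo. pz b *s x_vec (s b))"
 have "(SUM b:Bo. pz b *s ((1/2) *s (x_vec (s b) + x_vec (s (b +^ - K)) + ub b)))
 = (1/2) *s ((SUM b:Bo. pz b *s x_vec (s b)) + (SUM b:Bo. pz b *s x_vec (s (b +^ - K))) + (SUM b:Bo. pz b *s ub b))"
 unfolding sum.distrib[symmetric] ssqa[symmetric] by (intro sum.cong refl) (simp add: vec_eq_iff algebra_simps)
 then show ?thesis unfolding * by (simp add: vec_eq_iff)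
 qed
 show ?thesis unfolding ttqa[OF h(1)] S unfolding otaq[OF h(1)] h(2)
 by (simp add: vec_eq_iff field_simps)
qed
text \<open>For a point character the values at \<open>b\<close> and \<open>b +^ - K\<close> are
  opposite, so now the generators cancel; the sums over \<open>b\<close> at each point are evaluated
  by \<open>sopq\<close> and leave a basic root.\<close>

lemma ttpq: assumes x: "x ~: K" shows "tz (oroot K (twist (pt x) s)) = broot x"
proof -
 have flip: "pt x (b +^ - K) = - pt x b" for b using x by (simp add: pt_sd)
 have A: "(SUM b:Bo. pt x b *s (x_vec (s b) + x_vec (s (b +^ - K)))) = 0"
 by (rule sBaq) (simp add: flip sd_assoc vec_eq_iff algebra_simps)
 have D: "(SUM b:Bo. pt x b *s ub b) = 2 *s (SUM b:Bo. pt x b *s (SUM i:b. u_vec i))"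
 proof -
 have "(SUM b:Bo. pt x b *s ub b) = (SUM b:Bo. pt x b *s (SUM i:b. u_vec i)) + (SUM b:Bo. pt x (b +^ - K) *s (SUM i:b +^ - K. u_vec i))"
 unfolding sum.distrib[symmetric] by (intro sum.cong refl) (simp add: flip vec_eq_iff algebra_simps)
 also have "(SUM b:Bo. pt x (b +^ - K) *s (SUM i:b +^ - K. u_vec i)) = (SUM b:Bo. pt x b *s (SUM i:b. u_vec i))"
 by (rule sBfq)
 finally show ?thesis by (simp add: vec_eq_iff)
 qed
 have E: "(SUM b:Bo. pt x b *s (SUM i:b. u_vec i)) = uX - 16 *s u_vec x"
 proof -
 have "(SUM b:Bo. pt x b *s (SUM i:b. u_vec i)) = (SUM b:Bo. SUM y: -K. (if y : b then pt x b else 0) *s u_vec y)"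
 proof (intro sum.cong refl)
 fix b assume "b : Bo"
 then have "b <= - K" by (auto simp: B_iff)
 then have "(SUM y: -K. (if y : b then pt x b else 0) *s u_vec y) = (SUM y:b. (if y : b then pt x b else 0) *s u_vec y)"
 by (intro sum.mono_neutral_right) auto
 then show "pt x b *s (SUM i:b. u_vec i) = (SUM y: -K. (if y : b then pt x b else 0) *s u_vec y)"
 by (simp flip: ssqa)
 qed
 also have "... = (SUM y: -K. (SUM b:Bo. if y : b then pt x b else 0) *s u_vec y)"
 by (subst sum.swap) (simp only: sslq)
 also have "... = (SUM y: -K. u_vec y - (if x = y then 16 *s u_vec y else 0))"
 by (intro sum.cong refl) (simp add: sopq[OF K x] vec_eq_iff)
 also have "... = uX - 16 *s u_vec x" using x by (simp add: sum_subtractf)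
 finally show ?thesis .
 qed
 have "(SUM b:Bo. pt x b *s ((1/2) *s (x_vec (s b) + x_vec (s (b +^ - K)) + ub b)))
 = (1/2) *s ((SUM b:Bo. pt x b *s (x_vec (s b) + x_vec (s (b +^ - K)))) + (SUM b:Bo. pt x b *s ub b))"
 unfolding sum.distrib[symmetric] ssqa[symmetric] by (intro sum.cong refl) (simp add: vec_eq_iff algebra_simps)
 also have "... = uX - 16 *s u_vec x" unfolding A D E by (simp add: vec_eq_iff)
 finally have S: "(SUM b:Bo. pt x b *s ((1/2) *s (x_vec (s b) + x_vec (s (b +^ - K)) + ub b))) = uX - 16 *s u_vec x" .
 have U: "US = uK + uX" using Umq[of K] by simp
 show ?thesis unfolding ttqa[OF Bhpq] S pCq[OF x] broot_def U by (simp add: vec_eq_iff field_simps)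
qed
end
context parker_algebra begin
lemma tbbq: "tau (broot i) (broot j) = broot j"
proof -
 have "tau (broot i) US = US" unfolding US_def by (rule tbsuq)
 then have "tau (broot i) (US - 8 *s u_vec j) = US - 8 *s u_vec j"
 by (simp only: tdq tsq tbuq complex_cnj_numeral)
 then show ?thesis by (simp only: broot_def[of j])
qed
lemma ttq: assumes "B_hom K pz" "B_hom K fz"
 shows "oroot K (twist pz (twist fz s)) = oroot K (twist (%b. pz b * fz b) s)"
proof -
 have "(SUM b:B K - {{}}. pz b *s XV (twist fz s b)) = (SUM b:B K - {{}}. (pz b * fz b) *s XV (s b))"
 using otqb[OF oXq assms(2)] by (intro sum.cong refl) (simp add: ssq)
 then show ?thesis unfolding otqa[OF assms(1)] otqa[OF Bhmq[OF assms]] by simp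
qed
end

section \<open>Generators meeting K in four points; involutivity and the braid relation\<close>

context osec begin
lemma orq: "b : B K ==> (d \<diamondop> ow) \<diamondop> s b = (d \<diamondop> s b) \<diamondop> ow"
proof -
 assume b: "b : B K"
 have e: "bar d Int K Int b = {}" "bar d Int b Int K = {}" using Int_B[OF b] by blast+
 have "(d \<diamondop> ow) \<diamondop> s b = d \<diamondop> (ow \<diamondop> s b)" by (rule aeq) (use b e in simp)
 also have "ow \<diamondop> s b = s b \<diamondop> ow" by (rule ceq) (use b Int_B in simp)
 also have "d \<diamondop> (s b \<diamondop> ow) = (d \<diamondop> s b) \<diamondop> ow" by (rule aeq[symmetric]) (use b e in simp)
 finally show ?thesis .
qed
lemma ow_ow [simp]: "(d \<diamondop> ow) \<diamondop> ow = d"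
proof -
 have "(d \<diamondop> ow) \<diamondop> ow = d \<diamondop> (ow \<diamondop> ow)"
 by (rule aeq) (use eIq[OF bwq octadD(1)[OF K]] in \<open>simp add: Int_assoc\<close>)
 then show ?thesis by (simp add: osqa unit_right)
qed
lemma sOoq: assumes b: "b : B K" shows "(d \<diamondop> s b) \<diamondop> \<Omega> = (d \<diamondop> s (b +^ - K)) \<diamondop> ow"
proof -
 have b': "b +^ - K : B K" using B_sd[OF b X_in] .
 have "bar d Int (b +^ - K) Int - K = bar d Int (b +^ - K)" using b' by (auto simp: B_iff)
 then have "(d \<diamondop> s (b +^ - K)) \<diamondop> s (- K) = d \<diamondop> (s (b +^ - K) \<diamondop> s (- K))"
 using eIq[OF bwq Bwq[OF b']] bar_s[OF b'] bar_s[OF X_in] by (intro aeq) (simp only:)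
 also have "s (b +^ - K) \<diamondop> s (- K) = s b" using smqb[OF b' X_in] by (simp add: sd_assoc)
 finally have "(d \<diamondop> s (b +^ - K)) \<diamondop> s (- K) = d \<diamondop> s b" .
 then show ?thesis using Oaq(1)[of "d \<diamondop> s (b +^ - K)" "s (- K)"] by (simp add: ow_def)
qed
text \<open>Right multiplication by the lift \<open>ow\<close> of \<open>K\<close> is an involution
  on lifts meeting \<open>K\<close> in a tetrad: it exchanges the tetrad with its complement in
  \<open>K\<close> and keeps the points off \<open>K\<close>. For \<open>ez = 1\<close> and
  \<open>ez = - 1\<close> these are its eigenvectors.\<close>

definition zv :: "complex => 'p => complex ^ ('i + 'p)" where
 "zv ez g = x_vec g + ez *s x_vec (g \<diamondop> ow)"
text \<open>As \<open>theta = 2 * \<omega> + 1\<close>, the values at 1 and -1 are the negatives of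
  halves of the two primitive cube roots of unity. This explains the relations collected in
  \<open>kap\<close>.\<close>

definition kap :: "complex => complex" where "kap ez = (1 + ez * theta)/4"
definition Z :: "complex => 'p => 'i set => complex ^ ('i + 'p)" where
 "Z ez d h = zv ez (d \<diamondop> s (bar d +^ h))"
abbreviation Pl where "Pl d \<equiv> planes K (bar d Int K)"
lemma kap: assumes "ez = 1 | ez = - 1"
 shows "cnj (kap ez) = kap (- ez)" "kap ez * kap (- ez) = 1/4" "kap ez * kap ez = - kap (- ez)/2"
 "ez * ez = 1" "cnj ez = ez" "kap ez*4 = 1 + ez * theta"
 using assms by (auto simp: kap_def tcq field_simps)
lemma Tlq: assumes "d : lifts" "card (bar d Int K) = 4"
 shows "bar d : Pl d" "d \<diamondop> ow : lifts" "card (bar (d \<diamondop> ow) Int K) = 4" "bar d ~= K" "bar d ~: B K"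
proof -
 show "bar d : Pl d" using assms by (intro planesI) (auto simp: liq)
 show "d \<diamondop> ow : lifts" by (rule lmq[OF assms(1) olq]) (use assms in simp)
 show "card (bar (d \<diamondop> ow) Int K) = 4" using csqa[of "bar d Int K" K] assms(2) octadD(2)[OF K] by (simp add: bmq sd_Int Int_absorb2)
 show "bar d ~= K" "bar d ~: B K" using assms(2) octadD(2)[OF K] Int_B(2)[of "bar d" K] by auto
qed
text \<open>Words \<open>b\<close> with \<open>bar d +^ b\<close> of weight 16 are matched by
  \<open>b +^ - K\<close> with those giving an octad, and their terms become multiples of
  \<open>x_vec\<close> at the octad times \<open>ow\<close>. The 30 words collapse to the three
  other planes through the same tetrad.\<close>

lemma TXsq: assumes d: "d : lifts" and c4: "card (bar d Int K) = 4"
 shows "(SUM b:Bo. XV (d \<diamondop> s b)) = (SUM h:Pl d - {bar d}. Z theta d h)"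
proof -
 have C: "bar d +^ b : C" if "b : Bo" for b using that Bwq scq bwq by blast
 have fl: "card (bar d +^ (b +^ - K)) = 16 \<longleftrightarrow> octad (bar d +^ b)" if b: "b : Bo" for b
 proof -
 have "bar d +^ (b +^ - K) = - (K +^ (bar d +^ b))" by (auto simp: sd_def)
 then have 1: "card (bar d +^ (b +^ - K)) = 24 - card (K +^ (bar d +^ b))" by (simp add: cCq card_index)
 have "(bar d +^ b) Int K = bar d Int K" using Int_B(2)[of b K] b by (simp add: sd_Int)
 then have "card (K Int (bar d +^ b)) = 4" using c4 by (simp add: Int_commute)
 then have "card (K +^ (bar d +^ b)) = card (bar d +^ b)" using csqa[of K "bar d +^ b"] octadD(2)[OF K] by simp
 moreover have "card (bar d +^ b) <= 24" using card_mono[of UNIV "bar d +^ b"] card_index by simp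
 ultimately show ?thesis using 1 C[OF b] by (auto simp: octad_def)
 qed
 have "XV (d \<diamondop> s b) = (if octad (bar d +^ b) then x_vec (d \<diamondop> s b) else 0)
 + (if card (bar d +^ b) = 16 then theta *s x_vec ((d \<diamondop> s b) \<diamondop> \<Omega>) else 0)" if b: "b : Bo" for b
 using C[OF b] b by (simp add: XV_def octad_def bmq)
 then have "(SUM b:Bo. XV (d \<diamondop> s b)) = (SUM b:Bo. if octad (bar d +^ b) then x_vec (d \<diamondop> s b) else 0)
 + (SUM b:Bo. if card (bar d +^ b) = 16 then theta *s x_vec ((d \<diamondop> s b) \<diamondop> \<Omega>) else 0)"
 unfolding sum.distrib[symmetric] by (intro sum.cong refl)
 also have "(SUM b:Bo. if card (bar d +^ b) = 16 then theta *s x_vec ((d \<diamondop> s b) \<diamondop> \<Omega>) else 0)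
 = (SUM b:Bo. if card (bar d +^ (b +^ - K)) = 16 then theta *s x_vec ((d \<diamondop> s (b +^ - K)) \<diamondop> \<Omega>) else 0)"
 by (rule sBfq[symmetric])
 also have "... = (SUM b:Bo. if octad (bar d +^ b) then theta *s x_vec ((d \<diamondop> s b) \<diamondop> ow) else 0)"
 proof (intro sum.cong refl)
 fix b assume b: "b : Bo"
 have "(d \<diamondop> s (b +^ - K)) \<diamondop> \<Omega> = (d \<diamondop> s b) \<diamondop> ow"
 using sOoq[OF B_sd[OF Bo_B[OF b] X_in], of d] by (simp add: sd_assoc)
 then show "(if card (bar d +^ (b +^ - K)) = 16 then theta *s x_vec ((d \<diamondop> s (b +^ - K)) \<diamondop> \<Omega>) else 0)
 = (if octad (bar d +^ b) then theta *s x_vec ((d \<diamondop> s b) \<diamondop> ow) else 0)" by (simp only: fl[OF b])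
 qed
 also have "(SUM b:Bo. if octad (bar d +^ b) then x_vec (d \<diamondop> s b) else 0)
 + (SUM b:Bo. if octad (bar d +^ b) then theta *s x_vec ((d \<diamondop> s b) \<diamondop> ow) else 0)
 = (SUM b:Bo. if octad (bar d +^ b) then zv theta (d \<diamondop> s b) else 0)"
 unfolding sum.distrib[symmetric] by (intro sum.cong refl) (simp add: zv_def)
 also have "... = (SUM b:{b : Bo. octad (bar d +^ b)}. zv theta (d \<diamondop> s b))"
 by (rule sum.inter_filter[symmetric]) simp
 also have "... = (SUM h:Pl d - {bar d}. Z theta d h)"
 proof (rule sum.reindex_bij_witness[where i = "%h. bar d +^ h" and j = "%b. bar d +^ b"])
 fix b assume b: "b : {b : Bo. octad (bar d +^ b)}"
 then have "bar d +^ b : Pl d" using paq[OF Tlq(1)[OF d c4], of b] by blast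
 moreover have "b ~= {}" using b by blast
 then have "bar d +^ b ~= bar d" using siq[of "bar d" b "{}"] by (auto simp: sd_def)
 ultimately show "bar d +^ b : Pl d - {bar d}" by blast
 show "Z theta d (bar d +^ b) = zv theta (d \<diamondop> s b)" by (simp add: Z_def)
 next
 fix h assume h: "h : Pl d - {bar d}"
 then have o: "octad (bar d +^ h)" using psoq[OF Tlq(1)[OF d c4], of h] c4 by blast
 have "bar d +^ h : B K" using psq[OF Tlq(1)[OF d c4]] h by blast
 moreover have "bar d +^ h ~= {}" unfolding seeq using h by blast
 moreover have "octad h" using h planesD by blast
 ultimately show "bar d +^ h : {b : Bo. octad (bar d +^ b)}"
 using onCq[OF K o] by (simp add: onCq)
 qed simp_all
 finally show ?thesis .
qed
lemma Zsq: "Z ez d (bar d) = zv ez d" by (simp add: Z_def seq unit_right)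
lemma tTqa: assumes d: "d : lifts" and c4: "card (bar d Int K) = 4"
 shows "tz (x_vec d) = (1/4) *s ((SUM h:Pl d. Z theta d h) - 2 *s zv theta d)"
proof -
 note L = Tlq[OF d c4]
 have "(SUM h:Pl d. Z theta d h) = zv theta d + (SUM h:Pl d - {bar d}. Z theta d h)"
 using sum.remove[OF _ L(1), of "Z theta d"] by (simp add: Zsq)
 moreover have "XV (d \<diamondop> ow) = x_vec (d \<diamondop> ow)" using L(2) by (simp add: Xoq liq)
 ultimately show ?thesis
 unfolding txgq[OF d L(4,5)] TXsq[OF d c4, symmetric] c4 by (simp add: zv_def vec_eq_iff field_simps)
qed
lemma Tosq: assumes d: "d : lifts" and c4: "card (bar d Int K) = 4"
 shows "(SUM h:Pl (d \<diamondop> ow). Z theta (d \<diamondop> ow) h) = (SUM h:Pl d. zv theta ((d \<diamondop> s (bar d +^ h)) \<diamondop> ow))"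
proof (rule sum.reindex_bij_witness[where i = "%h. h +^ K" and j = "%h. h +^ K"])
 have T: "bar (d \<diamondop> ow) Int K = (bar d Int K) +^ K" by (simp add: bmq sd_Int)
 have A: "h +^ K : planes K (T +^ K)" if h: "h : planes K T" "card T = 4" for h T
 proof (rule planesI)
 have "card (h +^ K) = 8" using csqa[of h K] planesD(2,4)[OF h(1)] h(2) octadD(2)[OF K] by simp
 then show "octad (h +^ K)" using scq[OF planesD(3)[OF h(1)] octadD(1)[OF K]] by (simp add: octad_def)
 show "(h +^ K) Int K = T +^ K" using planesD(2)[OF h(1)] by (simp add: sd_Int)
 qed
 fix h
 show "h +^ K : Pl d" if "h : Pl (d \<diamondop> ow)" using A[OF that] Tlq(3)[OF d c4] unfolding T by (simp add: sd_assoc)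
 show "h +^ K +^ K = h" "h +^ K +^ K = h" by (simp_all add: sd_assoc)
 show "h +^ K : Pl (d \<diamondop> ow)" if "h : Pl d" using A[OF that c4] unfolding T .
 show "zv theta ((d \<diamondop> s (bar d +^ (h +^ K))) \<diamondop> ow) = Z theta (d \<diamondop> ow) h" if h: "h : Pl (d \<diamondop> ow)"
 proof -
 have e: "bar (d \<diamondop> ow) +^ h = bar d +^ (h +^ K)" by (simp add: bmq sd_ac)
 have "bar (d \<diamondop> ow) +^ h : B K" using psq[OF Tlq(1)[OF Tlq(2,3)[OF d c4]] h] .
 then show ?thesis unfolding Z_def e by (simp add: orq)
 qed
qed
lemma tzqa: assumes d: "d : lifts" and c4: "card (bar d Int K) = 4" and ez: "ez = 1 | ez = - 1"
 shows "tz (zv ez d) = kap ez *s ((SUM h:Pl d. Z ez d h) - 2 *s zv ez d)"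
proof -
 note L = Tlq[OF d c4]
 have k: "(1/4) *s (zv theta g + ez *s zv theta (g \<diamondop> ow)) = kap ez *s zv ez g" for g
 using ez by (auto simp: zv_def kap_def vec_eq_iff field_simps)
 have "tz (zv ez d) = tz (x_vec d) + ez *s tz (x_vec (d \<diamondop> ow))"
 by (simp add: zv_def taq tsq kap(5)[OF ez])
 also have "... = (SUM h:Pl d. (1/4) *s (zv theta (d \<diamondop> s (bar d +^ h)) + ez *s zv theta ((d \<diamondop> s (bar d +^ h)) \<diamondop> ow)))
 - 2 *s ((1/4) *s (zv theta d + ez *s zv theta (d \<diamondop> ow)))"
 unfolding tTqa[OF d c4] tTqa[OF L(2,3)] Tosq[OF d c4] ssqa sum.distrib Z_def
 by (simp add: vec_eq_iff algebra_simps)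
 also have "... = kap ez *s ((SUM h:Pl d. Z ez d h) - 2 *s zv ez d)"
 unfolding k ssqa Z_def by (simp add: vec_eq_iff algebra_simps)
 finally show ?thesis .
qed
text \<open>Any plane of the class can serve as base point in \<open>Z\<close>. The associator met
  on the way is even: the triple intersection is empty or, when \<open>h'\<close> is
  \<open>bar d\<close> again, a tetrad off \<open>K\<close>.\<close>

lemma Tbq: assumes d: "d : lifts" and c4: "card (bar d Int K) = 4" and h: "h : Pl d"
 shows "bar (d \<diamondop> s (bar d +^ h)) = h" "Pl (d \<diamondop> s (bar d +^ h)) = Pl d" "d \<diamondop> s (bar d +^ h) : lifts"
 "card (bar (d \<diamondop> s (bar d +^ h)) Int K) = 4"
 "h' : Pl d ==> Z ez (d \<diamondop> s (bar d +^ h)) h' = Z ez d h'"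
proof -
 note L = Tlq(1)[OF d c4]
 have e: "bar d +^ h : B K" using psq[OF L h] .
 show 1: "bar (d \<diamondop> s (bar d +^ h)) = h" using e by (simp add: bmq)
 show "Pl (d \<diamondop> s (bar d +^ h)) = Pl d" using planesD(2)[OF h] unfolding 1 by simp
 show "d \<diamondop> s (bar d +^ h) : lifts" unfolding liq 1 using planesD(1)[OF h] .
 show "card (bar (d \<diamondop> s (bar d +^ h)) Int K) = 4" unfolding 1 planesD(2)[OF h] using c4 .
 assume h': "h' : Pl d"
 have e': "h +^ h' : B K" using psq[OF h h'] .
 have "even (card (bar d Int (bar d +^ h) Int (h +^ h')))"
 proof (cases "bar d = h | h = h' | bar d ~= h'")
 case True
 have "bar d Int (bar d +^ h) Int (h +^ h') = {}" if ne: "bar d ~= h" "h ~= h'" "bar d ~= h'"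
 proof -
 have "x : h" if "x : bar d" "x : h'" for x
 using pIq[OF L h ne(1) c4] pIq[OF L h' ne(3) c4] that by blast
 then show ?thesis by auto
 qed
 then show ?thesis using True by (cases "bar d = h"; cases "h = h'") auto
 next
 case False
 then have hh: "h' = bar d" and "bar d ~= h" by blast+
 then have "x : h \<longleftrightarrow> x : K" if "x : bar d" for x
 using pIq[OF L h _ c4] that by blast
 then have "bar d Int (bar d +^ h) Int (h +^ h') = bar d - (bar d Int K)"
 unfolding hh by auto
 moreover have "bar d - (bar d Int K) = bar d Int - K" by blast
 then have "card (bar d - (bar d Int K)) = 4" using cpmq[OF L c4] by simp
 ultimately show ?thesis by simp
 qed
 then have "(d \<diamondop> s (bar d +^ h)) \<diamondop> s (h +^ h') = d \<diamondop> (s (bar d +^ h) \<diamondop> s (h +^ h'))"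
 using e e' by (intro aeq) simp
 also have "... = d \<diamondop> s (bar d +^ h')" using smqb[OF e e'] by (simp add: sd_assoc)
 finally show "Z ez (d \<diamondop> s (bar d +^ h)) h' = Z ez d h'" unfolding Z_def 1 by simp
qed
text \<open>On the four planes the map is \<open>kap ez\<close> times the matrix
  \<open>J - 2 I\<close>, with \<open>J\<close> the all-one matrix. Its square is
  \<open>4 I\<close>, which together with \<open>kap ez * kap (- ez) = 1/4\<close> makes the
  conjugate-linear map an involution.\<close>

lemma tau_Z: assumes d: "d : lifts" and c4: "card (bar d Int K) = 4" and ez: "ez = 1 | ez = - 1" and h: "h : Pl d"
 shows "tz (Z ez d h) = kap ez *s ((SUM h:Pl d. Z ez d h) - 2 *s Z ez d h)"
proof -
 note b = Tbq[OF d c4 h]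
 have "(SUM h':Pl (d \<diamondop> s (bar d +^ h)). Z ez (d \<diamondop> s (bar d +^ h)) h') = (SUM h:Pl d. Z ez d h)"
 by (intro sum.cong) (simp_all only: b(2,5))
 then show ?thesis using tzqa[OF b(3,4) ez] by (simp only: Z_def[of _ d h])
qed
lemma tsZq: assumes d: "d : lifts" and c4: "card (bar d Int K) = 4" and ez: "ez = 1 | ez = - 1"
 shows "tz (SUM h:Pl d. Z ez d h) = (2 * kap ez) *s (SUM h:Pl d. Z ez d h)"
proof -
 let ?S = "SUM h:Pl d. Z ez d h"
 have "card (Pl d) = 4" using cpq[OF K _ c4] by simp
 moreover have "tz ?S = (SUM h:Pl d. kap ez *s (?S - 2 *s Z ez d h))"
 unfolding tsqa using tau_Z[OF d c4 ez] by (intro sum.cong refl)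
 ultimately have "tz ?S = kap ez *s (of_nat 4 *s ?S - 2 *s ?S)"
 by (simp only: ssqa sum_subtractf scsq)
 then show ?thesis by (simp add: vec_eq_iff)
qed
lemma tizq: assumes d: "d : lifts" and c4: "card (bar d Int K) = 4" and ez: "ez = 1 | ez = - 1"
 shows "tz (tz (zv ez d)) = zv ez d"
proof -
 have "tz (tz (zv ez d)) = (4*(kap ez * kap (- ez))) *s zv ez d"
 unfolding tzqa[OF assms] tsq tdq tsZq[OF assms] kap(1)[OF ez]
 by (simp add: vec_eq_iff algebra_simps)
 then show ?thesis by (simp add: kap(2)[OF ez])
qed
lemma tbzq: assumes "d : lifts" "card (bar d Int K) = 4" "ez = 1 | ez = - 1" "x ~: K"
 shows "tau (broot x) (zv ez d) = pt x (bar d) *s zv ez d"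
proof -
 have "pt x (bar (d \<diamondop> ow)) = pt x (bar d)" using assms(4) by (simp add: bmq pt_sd pt_def)
 then show ?thesis using Tlq(2)[OF assms(1,2)] assms
 by (simp add: zv_def taq tsq tbxq kap(5)[OF assms(3)] vec_eq_iff algebra_simps)
qed
text \<open>Exactly one plane of a parallel class contains \<open>x\<close>, so
  \<open>tau (broot x)\<close> changes the sign of one basis vector. The relation becomes an
  identity of 4 by 4 matrices with scalars governed by
  \<open>kap ez * kap ez = - kap (- ez)/2\<close>.\<close>

lemma bzq: assumes d: "d : lifts" and c4: "card (bar d Int K) = 4" and ez: "ez = 1 | ez = - 1" and x: "x ~: K"
 shows "tz (tau (broot x) (tz (zv ez d))) = tau (broot x) (tz (tau (broot x) (zv ez d)))"
proof -
 let ?S = "SUM h:Pl d. Z ez d h"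
 obtain h0 where h0: "h0 : Pl d" "x : h0" using peq[OF K _ c4 x] by blast
 have p: "pt x h = (if h = h0 then - 1 else 1)" if h: "h : Pl d" for h
 proof (cases "h = h0")
 case False
 then have "h Int h0 = bar d Int K" using pIq[OF h h0(1) _ c4] by blast
 then have "x ~: h" using h0(2) x by blast
 then show ?thesis using False by (simp add: pt_def)
 qed (use h0 in \<open>simp add: pt_def\<close>)
 have tZ: "tau (broot x) (Z ez d h) = pt x h *s Z ez d h" if h: "h : Pl d" for h
 using tbzq[OF Tbq(3,4)[OF d c4 h] ez x] unfolding Tbq(1)[OF d c4 h] Z_def .
 have "tau (broot x) ?S = (SUM h:Pl d. Z ez d h - (if h = h0 then 2 *s Z ez d h else 0))"
 unfolding tsqa by (intro sum.cong refl) (simp add: tZ p vec_eq_iff)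
 then have tS: "tau (broot x) ?S = ?S - 2 *s Z ez d h0" using h0(1) by (simp add: sum_subtractf)
 note A = tzqa[OF d c4 ez] tau_Z[OF d c4 ez h0(1)] tsZq[OF d c4 ez] tS tbzq[OF d c4 ez x] tZ[OF h0(1)]
 have q: "kap 1*(kap 1 * c) = - kap (- 1)/2 * c" "kap (- 1)*(kap (- 1) * c) = - kap 1/2 * c" for c
 using kap(3)[of 1] kap(3)[of "- 1"] by (simp_all flip: mult.assoc)
 show ?thesis
 proof (cases "bar d = h0")
 case True
 then have z: "Z ez d h0 = zv ez d" using Zsq by blast
 have "pt x (bar d) = - 1" using True h0 by (simp add: pt_def)
 then show ?thesis unfolding A tsq tdq z kap(1)[OF ez]
 using kap(1)[of "- ez"] ez by (auto simp: q vec_eq_iff algebra_simps kap(3))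
 next
 case False
 then have "pt x (bar d) = 1" using p[OF Tlq(1)[OF d c4]] by simp
 then show ?thesis unfolding A tsq tdq kap(1)[OF ez] p[OF h0(1)]
 using kap(1)[of "- ez"] ez by (auto simp: A tdq tsq q vec_eq_iff algebra_simps kap(3))
 qed
qed
lemma xvzq: "x_vec d = (1/2) *s (zv 1 d + zv (- 1) d)" by (simp add: zv_def vec_eq_iff)
lemma lcq [consumes 1, case_names ow b T2 T4]: assumes d: "d : lifts"
 obtains "d = ow | d = neg ow" | b where "b : Bo" "d = s b | d = neg (s b)" | "card (bar d Int K) = 2" | "card (bar d Int K) = 4"
proof (cases "bar d = K")
 case True then show ?thesis using beq[of d ow] that(1) by simp
next
 case False
 have o: "octad (bar d)" using d by (simp add: liq)
 from eIoq[OF o K False] show ?thesis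
 proof (elim disjE)
 assume "card (bar d Int K) = 0"
 then have i: "bar d Int K = {}" by simp
 have B: "bar d : B K" using i by (simp add: B_iff)
 have "bar d ~= {}" using o by (auto simp: octad_def)
 then have "bar d : Bo" using B onCq[OF K o] by blast
 then show ?thesis using that(2)[of "bar d"] beq[of d "s (bar d)"] B by simp
 qed (rule that, assumption)+
qed
lemma txiq: assumes d: "d : lifts" shows "tz (tz (x_vec d)) = x_vec d"
 using d
proof (cases rule: lcq)
 case ow
 have "tz (tz (x_vec ow)) = x_vec ow" unfolding toqc tdq tsq tau_uK
 by (simp add: tcq vec_eq_iff field_simps)
 then show ?thesis using ow by (elim disjE) (simp_all only: x_vec_neg tmq)
next
 case (b b)
 have "tz (tz (x_vec (s b))) = x_vec (s b)"
 unfolding tau_s[OF b(1)] tsq taq tuq[OF b(1)] tau_s[OF Bfq[OF b(1)]]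
 by (simp add: sd_assoc vec_eq_iff field_simps)
 then show ?thesis using b(2) by (elim disjE) (simp_all only: x_vec_neg tmq)
next
 case T2 then show ?thesis using tiTq[OF d] by blast
next
 case T4
 have "tz (tz (x_vec d)) = (1/2) *s (tz (tz (zv 1 d)) + tz (tz (zv (- 1) d)))"
 by (subst xvzq) (simp only: tsq taq complex_cnj_divide complex_cnj_one complex_cnj_numeral)
 then show ?thesis using tizq[OF d T4] xvzq by simp
qed
lemma tiq: assumes "v : VV" shows "tz (tz v) = v"
 using assms
proof (induction v rule: Vibq)
 case (r i) then show ?case
 by (cases "i : K") (simp_all add: tbiq tboqa ttpq)
next
 case (x d) then show ?case by (rule txiq)
qed (simp_all add: taq tsq)
text \<open>The braid relation with a basic root off \<open>K\<close>. It is first needed as a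
  substitute for multiplicativity, which by \<open>tmiq\<close> is a statement of the same
  kind.\<close>

lemma tbq: assumes x: "x ~: K" and v: "v : VV"
 shows "tz (tau (broot x) (tz v)) = tau (broot x) (tz (tau (broot x) v))"
 using v
proof (induction v rule: Vibq)
 case (r y)
 show ?case
 proof (cases "y : K")
 case True then show ?thesis by (simp add: tbiq tbbq)
 next
 case False
 have e: "tau (broot x) (oroot K (twist (pt y) s)) = oroot K (twist (%b. pt x b * pt y b) s)"
 unfolding tboq[OF htq[OF hs Bhpq]] ttq[OF Bhpq Bhpq] ..
 have "tz (oroot K (twist (%b. pt x b * pt y b) s)) = oroot K (twist (%b. pt x b * pt y b) s)"
 by (rule tteq[OF Bhmq[OF Bhpq Bhpq]]) (use x False in simp)
 then show ?thesis using False by (simp add: tboqa tbbq e)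
 qed
next
 case (x d)
 note xK = \<open>x ~: K\<close> and d = x
 from d show ?case
 proof (cases rule: lcq)
 case ow
 have "tz (tau (broot x) (tz (x_vec ow))) = tau (broot x) (tz (tau (broot x) (x_vec ow)))"
 unfolding toqc tdq tsq tboqb[OF xK] tbsuq tau_uK
 by (simp add: tcq vec_eq_iff field_simps)
 then show ?thesis using ow by (elim disjE) (simp_all only: x_vec_neg tmq)
 next
 case (b b)
 note bB = Bo_B[OF b(1)] and b' = Bfq[OF b(1)]
 have t: "tau (broot x) (x_vec (s c)) = pt x c *s x_vec (s c)" if "c : Bo" for c
 using tbxq[OF Blq[OF that]] that by simp
 have p: "pt x (b +^ - K) = - pt x b" using xK by (simp add: pt_sd)
 have u: "tau (broot x) (ub b) = ub b" by (simp only: tdq tbsuq)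
 have m: "tau (broot x) (tz (x_vec (s b))) = (1/2) *s (pt x b *s (x_vec (s b) - x_vec (s (b +^ - K))) + ub b)"
 unfolding tau_s[OF b(1)] tsq taq t[OF b(1)] t[OF b'] p u by (simp add: vec_eq_iff field_simps)
 have w: "tz (x_vec (s b) - x_vec (s (b +^ - K))) = ub b"
 unfolding tdq tau_s[OF b(1)] tau_s[OF b'] by (simp add: sd_assoc vec_eq_iff field_simps)
 have "tz (tau (broot x) (tz (x_vec (s b)))) = tau (broot x) (tz (tau (broot x) (x_vec (s b))))"
 unfolding t[OF b(1)] tsq[of "oroot K s"] tsq[of "broot x"] m unfolding tsq taq w tuq[OF b(1)]
 by (simp add: vec_eq_iff field_simps)
 then show ?thesis using b(2) by (elim disjE) (simp_all only: x_vec_neg tmq)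
 next
 case T2 then show ?thesis using bTq[OF d _ xK] by blast
 next
 case T4
 show ?thesis
 by (subst (1 2) xvzq) (simp add: tsq taq bzq[OF d T4 _ xK])
 qed
qed (simp_all add: taq tsq)
end

section \<open>Multiplicativity: subspace of good vectors, triples, two generators of duad
  type\<close>

context parker_algebra begin
lemma tn0q: "theta ~= 0"
proof
 assume "theta = 0"
 then have "theta * theta = 0" by (simp del: tsqb)
 then show False unfolding tsqb by simp
qed
lemma tbcqa: assumes "v : VV" shows "tau (broot i) (tau (broot j) v) = tau (broot j) (tau (broot i) v)"
 using assms by (induction v rule: Viq) (simp_all add: tbuq tbxq taq tsq ssq mult.commute)
end
context osec begin
text \<open>The vectors with which \<open>tz\<close> is multiplicative. They form a subspace
  invariant under \<open>tz\<close>, so membership spreads from a few roots to the generators over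
  \<open>K\<close> and over \<open>B K\<close>.\<close>

definition S where "S = {a : VV. ALL y:VV. tz (a \<star> y) = tz a \<star> tz y}"
lemma S_VV: "a : S ==> a : VV" by (simp add: S_def)
lemma S_add: "a : S ==> b : S ==> a + b : S" by (simp add: S_def Vaq star_add taq)
lemma Ssq: "a : S ==> c *s a : S" by (simp add: S_def VV_scale star_scale tsq)
lemma S_0: "0 : S" by (simp add: S_def VV_0)
lemma Sdq: "a : S ==> b : S ==> a - b : S" by (simp add: S_def VV_diff sdq tdq)
lemma S_sum: "(!!a. a : A ==> f a : S) ==> sum f A : S"
 by (induction A rule: infinite_finite_induct) (auto intro: S_add S_0)
lemma T_VV: "v : VV ==> tz v : VV" by (rule tVq[OF oVq])
lemma S_tau: assumes "a : S" shows "tz a : S"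
proof -
 have "tz (tz a \<star> y) = tz (tz a) \<star> tz y" if y: "y : VV" for y
 proof -
 have "tz (a \<star> tz y) = tz a \<star> y" using assms y by (simp add: S_def T_VV tiq)
 then have "tz (tz a \<star> y) = a \<star> tz y" using tiq[OF sVq, of a "tz y"] by simp
 then show ?thesis using tiq[OF S_VV[OF assms]] by simp
 qed
 then show ?thesis using S_VV[OF assms] T_VV by (simp add: S_def)
qed
lemma S_I: assumes "a : VV" "!!y. y : VV ==> tz (tau a y) = tau (tz a) (tz y)" shows "a : S"
 using assms tmiq[OF oVq tiq assms(1)] by (simp add: S_def)
lemma tciq: assumes i: "i : K" and y: "y : VV" shows "tau (broot i) (tz y) = tz (tau (broot i) y)"
 using ccq[OF cbq oVq y, of i] ofqa[OF i] by simp
text \<open>By \<open>tmiq\<close> a conjugation relation has to be checked. For \<open>i\<close> in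
  \<open>K\<close> it says that the two maps commute; for \<open>i\<close> off \<open>K\<close> the
  image of \<open>broot i\<close> is \<open>tau (broot i)\<close> of the octadic root, and the
  relation is the braid relation.\<close>

lemma Sbq: "broot i : S"
proof (rule S_I[OF bVq])
 fix y assume y: "y : VV"
 show "tz (tau (broot i) y) = tau (tz (broot i)) (tz y)"
 proof (cases "i : K")
 case True then show ?thesis using tciq[OF True y] by (simp add: tbiq)
 next
 case False
 have "tau (tz (broot i)) (tz y) = tau (tau (broot i) (oroot K s)) (tau (broot i) (tau (broot i) (tz y)))"
 using False by (simp add: tboqa tboq[OF hs] tbiqa T_VV y)
 also have "... = tau (broot i) (tz (tau (broot i) (tz y)))"
 using ccq[OF cbq oVq, of "tau (broot i) (tz y)" i] T_VV[OF y] tVq[OF bVq] by simp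
 also have "... = tz (tau (broot i) (tz (tz y)))" using tbq[OF False T_VV[OF y]] by simp
 finally show ?thesis using tiq[OF y] by simp
 qed
qed
lemma S_u: "u_vec i : S"
 by (subst uvbq) (intro Ssq Sdq S_sum Sbq)
text \<open>The formula \<open>tau_uK\<close> can be solved for \<open>x_vec ow\<close>, expressing
  it by \<open>uK\<close> and \<open>tz uK\<close>.\<close>

lemma S_ow: "x_vec ow : S"
proof -
 have "tz uK : S" by (intro S_tau S_sum S_u)
 then have "(1/theta) *s ((- 2) *s tz uK - uK) : S" by (intro Ssq Sdq S_sum S_u)
 moreover have "(1/theta) *s ((- 2) *s tz uK - uK) = x_vec ow" unfolding tau_uK using tn0q by (simp add: vec_eq_iff field_simps)
 ultimately show ?thesis by simp
qed
text \<open>The product of two point characters is trivial at \<open>- K\<close>, so this root is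
  fixed by \<open>tz\<close>. The conjugation relation then says that \<open>tz\<close> commutes
  with the map of the root, and follows by carrying \<open>tz\<close> through with four braid
  moves.\<close>

lemma Stq: assumes x: "x ~: K" and y: "y ~: K" shows "oroot K (twist (pt y) (twist (pt x) s)) : S"
proof (rule S_I)
 let ?x = "tau (broot x)" and ?y = "tau (broot y)"
 let ?a = "oroot K (twist (pt y) (twist (pt x) s))"
 have a: "?a = ?y (?x (oroot K s))"
 by (simp add: tboq[OF hs] tboq[OF htq[OF hs Bhpq]])
 have V: "?x v : VV" "?y v : VV" if "v : VV" for v using tVq[OF bVq] by blast+
 show "?a : VV" unfolding a by (intro V oVq)
 have ta: "tau ?a v = ?y (?x (tz (?x (?y v))))" if v: "v : VV" for v
 proof -
 have "tau (?y (?x (oroot K s))) (?y (?y v)) = ?y (tau (?x (oroot K s)) (?y v))"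
 by (rule ccq[OF cbq, symmetric]) (intro V oVq v)+
 also have "tau (?x (oroot K s)) (?y v) = tau (?x (oroot K s)) (?x (?x (?y v)))"
 by (simp add: tbiqa[OF V(2)[OF v]])
 also have "... = ?x (tz (?x (?y v)))" by (rule ccq[OF cbq, symmetric]) (intro V oVq v)+
 finally show ?thesis unfolding a tbiqa[OF v] .
 qed
 fix v assume v: "v : VV"
 have "tz ?a = ?a"
 unfolding ttq[OF Bhpq Bhpq]
 by (rule tteq[OF Bhmq[OF Bhpq Bhpq]]) (use x y in simp)
 moreover have "?y (?x (tz (?x (?y (tz v))))) = tz (?y (?x (tz (?x (?y v)))))"
 proof -
 have "?x (tz (?x (?y (tz v)))) = tz (?x (tz (?y (tz v))))"
 by (rule tbq[OF x V(2)[OF T_VV[OF v]], symmetric])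
 also have "tz (?y (tz v)) = ?y (tz (?y v))" by (rule tbq[OF y v])
 also have "?x (?y (tz (?y v))) = ?y (?x (tz (?y v)))" by (rule tbcqa[OF T_VV[OF V(2)[OF v]]])
 finally have "?y (?x (tz (?x (?y (tz v))))) = ?y (tz (?y (?x (tz (?y v)))))" by simp
 also have "... = tz (?y (tz (?x (tz (?y v)))))"
 by (rule tbq[OF y V(1)[OF T_VV[OF V(2)[OF v]]], symmetric])
 also have "tz (?x (tz (?y v))) = ?x (tz (?x (?y v)))" by (rule tbq[OF x V(2)[OF v]])
 finally show ?thesis .
 qed
 ultimately show "tz (tau ?a v) = tau (tz ?a) (tz v)" using ta[OF v] ta[OF T_VV[OF v]] by simp
qed
text \<open>Weighted sums of the roots in \<open>Stq\<close> over \<open>x\<close> give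
  \<open>x_vec (s b) + x_vec (s (b +^ - K))\<close>; the difference of these generators is
  \<open>tz (ub b)\<close> by \<open>tuq\<close>.\<close>

lemma S_s: assumes b: "b : Bo" shows "x_vec (s b) : S"
proof -
 note bB = Bo_B[OF b] and b' = Bfq[OF b]
 obtain y where y: "y ~: K" using enioq[OF K] .
 interpret Y: osec C mult unit m1 bar \<omega> \<Omega> K "twist (pt y) s"
 by unfold_locales (rule htq[OF hs Bhpq])
 have z: "(SUM x: -K. pt x b) = 0" using spBq[OF K bB] b by auto
 have t: "XV (twist (pt y) s c) = pt y c *s x_vec (s c)" if "c : Bo" for c
 using otqb[OF oXq Bhpq, of c K y s] XV_Bo[OF that] that by simp
 have "(SUM x: -K. pt x b *s oroot K (twist (pt x) (twist (pt y) s))) : S"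
 using Stq y by (intro S_sum Ssq) blast
 then have "8 *s (pt y b *s (x_vec (s b) + x_vec (s (b +^ - K)))) : S"
 unfolding Y.sotq[OF bB] z t[OF b] t[OF b'] using y by (simp add: pt_sd ssq)
 then have "(pt y b/8) *s (8 *s (pt y b *s (x_vec (s b) + x_vec (s (b +^ - K))))) : S" by (rule Ssq)
 moreover have "(pt y b/8) *s (8 *s (pt y b *s (x_vec (s b) + x_vec (s (b +^ - K))))) = x_vec (s b) + x_vec (s (b +^ - K))"
 by (simp add: ssq)
 ultimately have 1: "x_vec (s b) + x_vec (s (b +^ - K)) : S" by simp
 have 2: "tz (ub b) : S" by (intro S_tau Sdq S_sum S_u)
 have "(1/2) *s ((x_vec (s b) + x_vec (s (b +^ - K))) + (x_vec (s b) - x_vec (s (b +^ - K)))) : S"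
 by (rule Ssq[OF S_add[OF 1 2[unfolded tuq[OF b]]]])
 moreover have "(1/2) *s ((x_vec (s b) + x_vec (s (b +^ - K))) + (x_vec (s b) - x_vec (s (b +^ - K)))) = x_vec (s b)"
 by (simp add: vec_eq_iff)
 ultimately show ?thesis by (simp only:)
qed
text \<open>Multiplicativity tested against a third vector. By the total symmetry of the trilinear
  form it does not depend on the order of the arguments, so a triple is settled as soon as one of
  its three pairs is known to be multiplicative.\<close>

definition F3 where "F3 a b c \<longleftrightarrow> herm (tz a \<star> tz b) (tz c) = cnj (herm (a \<star> b) c)"
lemma Fsqa: "F3 a b c \<longleftrightarrow> F3 b a c" "a : VV ==> b : VV ==> c : VV ==> F3 a b c \<longleftrightarrow> F3 a c b"
 using hssq[of a b c] hssq[OF T_VV T_VV T_VV, of a b c]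
 by (simp_all add: F3_def star_commute[of b] star_commute[of "tz b"])
lemma Fmq: assumes "tz (a \<star> b) = tz a \<star> tz b" "c : VV" shows "F3 a b c"
 unfolding F3_def assms(1)[symmetric] hcq by (rule thq[OF oVq tiq sVq assms(2)])
lemma mFq: assumes "!!c. c : VV ==> F3 a b c" shows "tz (a \<star> b) = tz a \<star> tz b"
proof (rule Vnq[OF T_VV[OF sVq] sVq])
 fix z assume z: "z : VV"
 have "herm (tz (a \<star> b)) (tz (tz z)) = herm (tz z) (a \<star> b)" by (rule thq[OF oVq tiq sVq T_VV[OF z]])
 moreover have "herm (tz a \<star> tz b) (tz (tz z)) = cnj (herm (a \<star> b) (tz z))" using assms[OF T_VV[OF z]] by (simp add: F3_def)
 ultimately show "herm (tz (a \<star> b)) z = herm (tz a \<star> tz b) z" using tiq[OF z] by (simp add: hcq)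
qed
lemma wzq: assumes V: "a : VV" "b : VV" "c : VV" and p: "p * q * r ~= p' * q' * r'"
 "cnj p = p" "cnj q = q" "cnj r = r" "cnj p' = p'" "cnj q' = q'" "cnj r' = r'"
 and e: "tau (broot i) a = p *s a" "tau (broot i) b = q *s b" "tau (broot i) c = r *s c"
 "tau (broot j) a = p' *s a" "tau (broot j) b = q' *s b" "tau (broot j) c = r' *s c"
 shows "herm (a \<star> b) c = 0"
proof -
 have h: "herm (tau (broot k) a \<star> tau (broot k) b) (tau (broot k) c) = cnj (herm (a \<star> b) c)" for k
 using cautD(5)[OF cbq V(1,2), of k] cautD(6)[OF cbq sVq V(3), of k a b] by (simp add: hcq)
 have "p * q * r * herm (a \<star> b) c = p' * q' * r' * herm (a \<star> b) c"
 using h[of i] h[of j] unfolding e by (simp add: star_scale ssrq hsq p mult_ac)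
 then show ?thesis using p(1) by simp
qed
text \<open>The maps of the basic roots at points of \<open>K\<close> act by the same signs on
  generators and on their images. Unless the three words add up to a word constant on
  \<open>K\<close>, two points of \<open>K\<close> give different total signs, and both sides of
  \<open>F3\<close> are zero.\<close>

lemma Fwq: assumes d: "d : lifts" "f : lifts" "g : lifts" and w: "(bar d +^ bar f +^ bar g) Int K ~= {}" "(bar d +^ bar f +^ bar g) Int K ~= K"
 shows "F3 (x_vec d) (x_vec f) (x_vec g)"
proof -
 obtain i j where ij: "i : K" "j : K" "i : bar d +^ bar f +^ bar g" "j ~: bar d +^ bar f +^ bar g" using w by blast
 then have p: "pt i (bar d) * pt i (bar f) * pt i (bar g) ~= pt j (bar d) * pt j (bar f) * pt j (bar g)"
 by (simp flip: pt_sd) (simp add: pt_def)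
 have e: "tau (broot k) (tz (x_vec d)) = pt k (bar d) *s tz (x_vec d)" if "k : K" "d : lifts" for k d
 using tciq[OF that(1) VV_x[OF that(2)]] by (simp add: tbxq[OF that(2)] tsq)
 have "herm (x_vec d \<star> x_vec f) (x_vec g) = 0"
 by (rule wzq[OF VV_x[OF d(1)] VV_x[OF d(2)] VV_x[OF d(3)] p, where i = i and j = j]) (simp_all add: tbxq d)
 moreover have "herm (tz (x_vec d) \<star> tz (x_vec f)) (tz (x_vec g)) = 0"
 by (rule wzq[OF T_VV[OF VV_x[OF d(1)]] T_VV[OF VV_x[OF d(2)]] T_VV[OF VV_x[OF d(3)]] p, where i = i and j = j]) (simp_all add: e ij d)
 ultimately show ?thesis by (simp add: F3_def)
qed
lemma ssqc: assumes "b : B K" shows "sum F (B K) = (SUM e:B K. F (e +^ b))"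
 by (rule ssrqa[symmetric]) (use assms B_sd in auto)
lemma Twq: assumes "card (bar z Int K) = 2" shows "octad (bar z) | card (bar z) = 12"
proof -
 have "card (bar z) ~= 16"
 proof
 assume 16: "card (bar z) = 16"
 then have o: "octad (- bar z)" using Cwq[OF bwq[of z]] by (simp add: octad_def cCq card_index)
 have "card (K Int - bar z) = 6" using csq[of K "bar z"] assms octadD(2)[OF K] by (simp add: Int_commute)
 moreover have "K ~= - bar z" using assms by auto
 ultimately show False using oIlq[OF K o] by simp
 qed
 moreover have "card (bar z) ~= 0" using assms by auto
 moreover have "card (bar z) ~= 24"
 proof
 assume "card (bar z) = 24"
 then have "bar z = UNIV" using card_index by (metis card_subset_eq finite subset_UNIV)
 then show False using assms octadD(2)[OF K] by simp
 qed
 ultimately show ?thesis using weights[OF bwq[of z]] by (auto simp: octad_def)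
qed
lemma TXcq: assumes "card (bar z Int K) = 2" obtains "octad (bar z)" | "XV z = 0"
 using Twq[OF assms] XV_12 by blast
lemma csKq: "card ((d +^ f) Int K) + 2 * card (d Int f Int K) = card (d Int K) + card (f Int K)"
proof -
 have e: "(d Int K) Int (f Int K) = d Int f Int K" by blast
 show ?thesis using csqa[of "d Int K" "f Int K"] unfolding e sd_Int .
qed
lemma Xssq: assumes b: "b : B K" "c : B K" and o: "octad (bar d +^ b)" "octad (bar f +^ c)" and ne: "bar d Int K ~= bar f Int K"
 shows "XV (d \<diamondop> s b) \<star> XV (f \<diamondop> s c)
 = (1/2*(sT (bar d) b c * sT (bar d) (bar f) c * sQ (bar f) b)) *s XV ((d \<diamondop> f) \<diamondop> s (b +^ c))"
proof -
 have l: "d \<diamondop> s b : lifts" "f \<diamondop> s c : lifts" using o b by (simp_all add: liq bmq)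
 have "(bar d +^ b) Int K ~= (bar f +^ c) Int K" using ne Int_B(2)[OF b(1)] Int_B(2)[OF b(2)] by (simp add: sd_Int)
 then have "bar (d \<diamondop> s b) ~= bar (f \<diamondop> s c)" using b by (auto simp: bmq)
 then have "x_vec (d \<diamondop> s b) \<star> x_vec (f \<diamondop> s c) = (1/2) *s XV ((d \<diamondop> s b) \<diamondop> (f \<diamondop> s c))" by (rule sxxXq[OF l])
 also have "XV ((d \<diamondop> s b) \<diamondop> (f \<diamondop> s c)) = (sT (bar d) b c * sT (bar d) (bar f) c * sQ (bar f) b) *s XV ((d \<diamondop> f) \<diamondop> s (b +^ c))"
 using oiq[OF oXq, of d "s b" f "s c"] b by (simp add: smqb)
 finally show ?thesis using l by (simp add: Xoq liq ssq)
qed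
text \<open>The coefficient at \<open>e\<close> in the product of two 32-term sums. Expanding the
  selectors gives four sums; two cancel under \<open>b +^ - K\<close>, and the others are the Gauss
  sums \<open>gTTq\<close> for the pairs \<open>d\<close>, \<open>g'\<close> and \<open>f\<close>,
  \<open>g'\<close>, where \<open>g'\<close> is \<open>d +^ f +^ e\<close>.\<close>

lemma TTsq:
 assumes d: "octad d" "card (d Int K) = 2" and f: "octad f" "card (f Int K) = 2" and df: "card (d Int f Int K) = 1"
 and e: "e : B K" and g: "octad (d +^ f +^ e)"
 shows "(SUM b:B K. (1 + sQ d b)*(1 + sQ f (e +^ b))/8*(sT d b (e +^ b) * sT d f (e +^ b) * sQ f b)) = 1 + sQ d f"
proof -
 define g' where "g' = d +^ f +^ e"
 note C = octadD(1)[OF d(1)] octadD(1)[OF f(1)] Bwq[OF e]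
 have gC: "g' : C" using g by (simp add: g'_def octad_def)
 have gK: "g' Int K = (d +^ f) Int K" using Int_B(2)[OF e] by (simp add: g'_def sd_Int)
 have g2: "card (g' Int K) = 2" unfolding gK using csKq[of d f] d f df by simp
 have "g' Int d Int K = (d Int K) Int - (d Int f Int K)" "g' Int f Int K = (f Int K) Int - (d Int f Int K)" using gK by auto
 moreover have "card ((d Int K) Int - (d Int f Int K)) = 1"
 using csq[of "d Int K" "d Int f Int K"] d df by (simp add: Int_ac)
 moreover have "card ((f Int K) Int - (d Int f Int K)) = 1"
 using csq[of "f Int K" "d Int f Int K"] f df by (simp add: Int_ac)
 ultimately have g1: "card (d Int g' Int K) = 1" "card (f Int g' Int K) = 1" by (simp_all add: Int_ac)
 have dfX: "sT d f (- K) = - 1"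
 proof -
 have "card (d Int f) = 1 + card (d Int f Int - K)" using csq[of "d Int f" K] df by simp
 then have "odd (card (d Int f Int - K))" using oIeqa[OF d(1) f(1)] by simp
 then show ?thesis by (simp add: sT_def)
 qed
 let ?h1 = "%b. sT d b e * sT d f b * sQ f b * sQ d b" and ?h2 = "%b. sT d b e * sT d f b * sQ f b"
 let ?h3 = "%b. sT d b e * sT d f b * sT f e b" and ?h4 = "%b. sT d b e * sT d f b * sT f e b * sQ d b"
 have exp: "(1 + sQ d b)*(1 + sQ f (e +^ b))/8*(sT d b (e +^ b) * sT d f (e +^ b) * sQ f b)
 = sT d f e/8*(?h2 b + ?h1 b + sQ f e*?h3 b + sQ f e*?h4 b)" if b: "b : B K" for b
 proof -
 have 1: "sT d b (e +^ b) = sT d b e" using C Bwq[OF b] by (simp add: sT_sd)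
 have 2: "sT d f (e +^ b) = sT d f e * sT d f b" by (simp add: sT_sd)
 have 3: "sQ f (e +^ b) = sQ f e * sQ f b * sT f e b" by (rule swq(1)) (use C Bwq[OF b] in auto)
 have 4: "(1 + sQ f e * sQ f b * sT f e b) * sQ f b = sQ f b + sQ f e * sT f e b"
 by (simp add: algebra_simps)
 have "(1 + sQ d b)*(1 + sQ f e * sQ f b * sT f e b)/8*(sT d b e*(sT d f e * sT d f b) * sQ f b)
 = sT d f e/8*(sT d b e * sT d f b*(1 + sQ d b)*((1 + sQ f e * sQ f b * sT f e b) * sQ f b))"
 by (simp add: mult_ac)
 then show ?thesis unfolding 1 2 3 4 by (simp add: algebra_simps)
 qed
 have fl: "sT d (b +^ - K) e = sT d b e" "sT d f (b +^ - K) = - sT d f b" "sT f e (b +^ - K) = sT f e b"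
 "sQ f (b +^ - K) = - sQ f b" "sQ d (b +^ - K) = - sQ d b" if "b : B K" for b
 using Tsfq[OF d that] Tsfq[OF f that] sCq[OF e C(1)] sCq[OF e C(2)] dfX by (simp_all add: sT_sd)
 have s1: "(SUM b:B K. ?h1 b) = 0" by (rule sBoq) (simp add: fl)
 have s3: "(SUM b:B K. ?h3 b) = 0" by (rule sBoq) (simp add: fl)
 have df_g: "d +^ f = g' +^ e" by (simp add: g'_def sd_assoc)
 have h24: "sT d f b * sQ f b * sQ d b = sQ g' b * sT g' e b" if b: "b : B K" for b
 proof -
 have "sQ (d +^ f) b = sQ d b * sQ f b * sT d f b" by (rule swq(2)) (use C Bwq[OF b] in auto)
 moreover have "sQ (g' +^ e) b = sQ g' b * sQ e b * sT g' e b" by (rule swq(2)) (use C gC Bwq[OF b] in auto)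
 ultimately show ?thesis using sQ_B[OF K e b] unfolding df_g by (simp add: mult_ac)
 qed
 have t: "sT d b e * sT f e b = sT g' e b" if b: "b : B K" for b
 proof -
 have "sT (d +^ f) e b = sT (g' +^ e) e b" unfolding df_g ..
 then show ?thesis using C Bwq[OF b] by (simp add: sT_sd spq(2)[of d])
 qed
 have s4: "(SUM b:B K. ?h4 b) = 8 * sQ f g'"
 proof -
 have "(SUM b:B K. ?h4 b) = (SUM b:B K. sQ f b * sQ g' b)"
 proof (intro sum.cong refl)
 fix b assume b: "b : B K"
 have "?h4 b * sQ f b = (sT d b e * sT f e b)*(sT d f b * sQ f b * sQ d b)" by (simp only: mult_ac)
 also have "... = sQ g' b" unfolding t[OF b] h24[OF b] by (simp add: mult_ac)
 finally have eq: "?h4 b * sQ f b = sQ g' b" .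
 have "?h4 b = ?h4 b * sQ f b * sQ f b" by (simp only: mult.assoc sQ_sq mult_1_right)
 also have "... = sQ f b * sQ g' b" unfolding eq by (rule mult.commute)
 finally show "?h4 b = sQ f b * sQ g' b" .
 qed
 then show ?thesis using gTTq[OF K f g[folded g'_def] g2 g1(2)] by simp
 qed
 have s2: "(SUM b:B K. ?h2 b) = sQ d e * sQ g' e*(8 * sQ d g')"
 proof -
 have "(SUM b:B K. ?h2 b) = (SUM b:B K. sQ d e * sQ g' e*(sQ d (b +^ e) * sQ g' (b +^ e)))"
 proof (intro sum.cong refl)
 fix b assume b: "b : B K"
 have q: "sQ d (b +^ e) = sQ d b * sQ d e * sT d b e" "sQ g' (b +^ e) = sQ g' b * sQ g' e * sT g' b e"
 using swq(1)[OF C(1) Bwq[OF b] C(3)] swq(1)[OF gC Bwq[OF b] C(3)] by blast+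
 have "?h2 b * sQ d b = sT d b e*(sT d f b * sQ f b * sQ d b)" by (simp only: mult_ac)
 also have "... = sT d b e * sQ g' b * sT g' e b" unfolding h24[OF b] by (simp only: mult_ac)
 finally have eq: "?h2 b * sQ d b = sT d b e * sQ g' b * sT g' e b" .
 have "?h2 b = ?h2 b * sQ d b * sQ d b" by (simp only: mult.assoc sQ_sq mult_1_right)
 also have "... = sQ d e * sQ g' e*(sQ d (b +^ e) * sQ g' (b +^ e))"
 unfolding eq q by (simp add: mult_ac spq(2)[of g' e b])
 finally show "?h2 b = sQ d e * sQ g' e*(sQ d (b +^ e) * sQ g' (b +^ e))" .
 qed
 also have "... = sQ d e * sQ g' e*(SUM b:B K. sQ d b * sQ g' b)"
 unfolding sum_distrib_left[symmetric] by (simp only: ssqc[OF e, of "%b. sQ d b * sQ g' b"])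
 finally show ?thesis unfolding gTTq[OF K d g[folded g'_def] g2 g1(1)] .
 qed
 have "sQ f g' = sQ d f * sQ f e * sT d f e"
 proof -
 have "g' = d +^ (f +^ e)" by (simp add: g'_def sd_assoc)
 then have "sQ f g' = sQ f d * sQ f (f +^ e) * sT f d (f +^ e)" using swq(1)[OF C(2,1) scq[OF C(2,3)]] by simp
 then show ?thesis using swq(1)[OF C(2,2,3)] ssqd[OF C(2)] C by (simp add: sT_sd spq(1)[of f d] scqf[of f d])
 qed
 moreover have "sQ d g' = sQ d f * sQ d e * sT d f e"
 proof -
 have "g' = d +^ (f +^ e)" by (simp add: g'_def sd_assoc)
 then have "sQ d g' = sQ d d * sQ d (f +^ e) * sT d d (f +^ e)" using swq(1)[OF C(1,1) scq[OF C(2,3)]] by simp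
 then show ?thesis using swq(1)[OF C(1,2,3)] ssqd[OF C(1)] C scq[OF C(2,3)] by simp
 qed
 moreover have "sQ g' e = sQ d f"
 proof -
 have "sW (g' +^ e) = sQ g' e" using swqa[OF gC C(3)] soqa[OF g[folded g'_def]] sW_B[OF K e] by (simp only: mult_1_left)
 moreover have "sW (d +^ f) = sQ d f" using swqa[OF C(1,2)] soqa[OF d(1)] soqa[OF f(1)] by (simp only: mult_1_left)
 ultimately show ?thesis unfolding df_g by (simp only:)
 qed
 ultimately have r: "sT d f e/8*(sQ d e * sQ g' e*(8 * sQ d g') + sQ f e*(8 * sQ f g')) = 1 + sQ d f"
 by (simp add: algebra_simps)
 have "(SUM b:B K. (1 + sQ d b)*(1 + sQ f (e +^ b))/8*(sT d b (e +^ b) * sT d f (e +^ b) * sQ f b))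
 = (SUM b:B K. sT d f e/8*(?h2 b + ?h1 b + sQ f e*?h3 b + sQ f e*?h4 b))" using exp by (intro sum.cong refl)
 also have "... = sT d f e/8*((SUM b:B K. ?h2 b) + (SUM b:B K. ?h1 b) + sQ f e*(SUM b:B K. ?h3 b) + sQ f e*(SUM b:B K. ?h4 b))"
 by (simp only: sum_distrib_left sum.distrib[symmetric])
 also have "... = 1 + sQ d f" unfolding s1 s2 s3 s4 using r by simp
 finally show ?thesis .
qed
text \<open>By \<open>TTsq\<close> the product of the images is a multiple of the sum of all
  \<open>XV\<close> over the coset of \<open>d \<diamondop> f\<close>. The factor
  \<open>1 + sQ (bar d) (bar f)\<close> is 2 if the octads meet in four points and 0 if in two, just
  when the product of the generators vanishes.\<close>

lemma mTTqb: assumes d: "d : lifts" "card (bar d Int K) = 2" and f: "f : lifts" "card (bar f Int K) = 2"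
 and df: "card (bar d Int bar f Int K) = 1"
 shows "tz (x_vec d \<star> x_vec f) = tz (x_vec d) \<star> tz (x_vec f)"
proof -
 let ?d = "bar d" and ?f = "bar f"
 have o: "octad ?d" "octad ?f" using d f by (simp_all add: liq)
 have ne: "?d Int K ~= ?f Int K"
 proof
 assume "?d Int K = ?f Int K"
 then have "?d Int ?f Int K = ?d Int K" by blast
 then show False using d df by simp
 qed
 have c2: "card ((?d +^ ?f) Int K) = 2" using csKq[of ?d ?f] d f df by simp
 define co where "co b c = (1 + sQ ?d b)*(1 + sQ ?f c)/8*(sT ?d b c * sT ?d ?f c * sQ ?f b)" for b c
 have p: "XV (d \<diamondop> s b) \<star> XV (f \<diamondop> s c) = co b c *s XV ((d \<diamondop> f) \<diamondop> s (b +^ c))" if b: "b : B K" "c : B K" for b c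
 proof -
 consider "sQ ?d b = - 1" | "sQ ?f c = - 1" | "sQ ?d b = 1" "sQ ?f c = 1" using sQ_cases by blast
 then show ?thesis
 proof cases
 case 3
 then show ?thesis using Xssq[OF b T2_XV(2)[OF o(1) d(2) b(1)] T2_XV(2)[OF o(2) f(2) b(2)] ne] by (simp add: co_def)
 qed (use T2_XV(1)[OF o(1) d(2) b(1)] T2_XV(1)[OF o(2) f(2) b(2)] in \<open>simp_all add: co_def\<close>)
 qed
 have q: "(SUM b:B K. XV (d \<diamondop> s b)) \<star> (SUM c:B K. XV (f \<diamondop> s c))
 = (SUM b:B K. SUM c:B K. co b c *s XV ((d \<diamondop> f) \<diamondop> s (b +^ c)))"
 unfolding ssqb(1) using p by (simp add: ssqb(2))
 have "tz (x_vec d) \<star> tz (x_vec f) = (1/16) *s (SUM b:B K. SUM c:B K. co b c *s XV ((d \<diamondop> f) \<diamondop> s (b +^ c)))"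
 unfolding tTq[OF d] tTq[OF f] star_scale ssrq q by (simp add: ssq)
 also have "(SUM b:B K. SUM c:B K. co b c *s XV ((d \<diamondop> f) \<diamondop> s (b +^ c)))
 = (SUM b:B K. SUM e:B K. co b (e +^ b) *s XV ((d \<diamondop> f) \<diamondop> s e))"
 proof (rule sum.cong[OF refl])
 fix b assume b: "b : B K"
 have "b +^ (e +^ b) = e" for e by (simp add: scqa[of e b])
 then show "(SUM c:B K. co b c *s XV ((d \<diamondop> f) \<diamondop> s (b +^ c))) = (SUM e:B K. co b (e +^ b) *s XV ((d \<diamondop> f) \<diamondop> s e))"
 by (subst ssqc[OF b]) (simp only:)
 qed
 also have "... = (SUM e:B K. (SUM b:B K. co b (e +^ b)) *s XV ((d \<diamondop> f) \<diamondop> s e))"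
 by (subst sum.swap) (simp only: sslq)
 also have "... = (SUM e:B K. (1 + sQ ?d ?f) *s XV ((d \<diamondop> f) \<diamondop> s e))"
 proof (intro sum.cong refl)
 fix e assume e: "e : B K"
 have be: "bar ((d \<diamondop> f) \<diamondop> s e) = ?d +^ ?f +^ e" using e by (simp add: bmq)
 have "card (bar ((d \<diamondop> f) \<diamondop> s e) Int K) = 2" unfolding be sd_Int Int_B(2)[OF e] using c2 by (simp add: sd_Int)
 then show "(SUM b:B K. co b (e +^ b)) *s XV ((d \<diamondop> f) \<diamondop> s e) = (1 + sQ ?d ?f) *s XV ((d \<diamondop> f) \<diamondop> s e)"
 proof (cases rule: TXcq)
 case 1
 then show ?thesis using TTsq[OF o(1) d(2) o(2) f(2) df e] unfolding be co_def by (simp only:)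
 qed simp
 qed
 also have "(1/16) *s (SUM e:B K. (1 + sQ ?d ?f) *s XV ((d \<diamondop> f) \<diamondop> s e))
 = ((1 + sQ ?d ?f)/16) *s (SUM e:B K. XV ((d \<diamondop> f) \<diamondop> s e))"
 by (simp only: ssqa ssq) simp
 finally have R: "tz (x_vec d) \<star> tz (x_vec f) = ((1 + sQ ?d ?f)/16) *s (SUM e:B K. XV ((d \<diamondop> f) \<diamondop> s e))" .
 have L: "x_vec d \<star> x_vec f = (1/2) *s XV (d \<diamondop> f)" using sxxXq[OF d(1) f(1)] ne by auto
 have "card (?d Int ?f) >= 1" using df csq[of "?d Int ?f" K] by simp
 moreover have "?d ~= ?f" using ne by auto
 ultimately consider "card (?d Int ?f) = 4" | "card (?d Int ?f) = 2" using eIoq[OF o] by linarith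
 then show ?thesis
 proof cases
 case 1
 have l: "d \<diamondop> f : lifts" using lmq[OF d(1) f(1) 1] .
 have "card (bar (d \<diamondop> f) Int K) = 2" using c2 by (simp add: bmq)
 moreover have "XV (d \<diamondop> f) = x_vec (d \<diamondop> f)" using l by (simp add: Xoq liq)
 ultimately show ?thesis unfolding R L using tTq[OF l] 1 by (simp add: tsq ssq sQ_def)
 next
 case 2
 have "card (bar (d \<diamondop> f)) = 12" using csqa[of ?d ?f] 2 o by (simp add: bmq octadD)
 then show ?thesis unfolding R L using 2 by (simp add: XV_12 sQ_def)
 qed
qed
end

section \<open>Products of two generators meeting K in tetrads\<close>

context golay_code begin
lemma plq: assumes "octad K" "T <= K" "card T = 4" "h1 : planes K T"
 obtains h2 h3 h4 where "planes K T = {h1, h2, h3, h4}" "distinct [h1, h2, h3, h4]"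
proof -
 have "card (planes K T - {h1}) = 3" using cpq[OF assms(1-3)] assms(4) by simp
 from iffD1[OF card_3_iff this] obtain h2 h3 h4
 where h: "planes K T - {h1} = {h2, h3, h4}" "h2 ~= h3" "h3 ~= h4" "h2 ~= h4" by (elim exE conjE)
 then have ne: "h1 ~= h2" "h1 ~= h3" "h1 ~= h4" by blast+
 have "planes K T = insert h1 (planes K T - {h1})" using assms(4) by (simp add: insert_absorb)
 then have "planes K T = {h1, h2, h3, h4}" unfolding h(1) .
 then show ?thesis by (rule that) (simp add: h ne)
qed
lemma pcq: assumes "octad K" "T <= K" "card T = 4"
 shows "card (V Int - K) = (SUM h:planes K T. card (V Int h Int - K))"
proof -
 have "V Int - K = (UN h:planes K T. V Int h Int - K)" using peq[OF assms] by blast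
 moreover have "card (UN h:planes K T. V Int h Int - K) = (SUM h:planes K T. card (V Int h Int - K))"
 proof (rule card_UN_disjoint)
 show "ALL h:planes K T. ALL k:planes K T. h ~= k --> (V Int h Int - K) Int (V Int k Int - K) = {}"
 using pIq[of _ K T] assms by blast
 qed simp_all
 ultimately show ?thesis by simp
qed
end
context osec begin
lemma zsq: assumes f: "f : lifts" "card (bar f Int K) = 4" and g: "g : lifts" "card (bar g Int K) = 4"
 and ez: "ez = 1 | ez = - 1" and dz: "dz = 1 | dz = - 1"
 and ne: "(bar f +^ bar g) Int K ~= {}" "(bar f +^ bar g) Int K ~= K"
 and t: "sT (bar f) (bar g) K = t"
 shows "zv ez f \<star> zv dz g = (1/2) *s ((1 + ez * dz * t) *s XV (f \<diamondop> g) + (ez + dz * t) *s XV ((f \<diamondop> g) \<diamondop> ow))"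
proof -
 have tt: "t * t = 1" using sT_sq unfolding t[symmetric] .
 have l: "f \<diamondop> ow : lifts" "g \<diamondop> ow : lifts" using Tlq(2)[OF f] Tlq(2)[OF g] by blast+
 have b: "bar f ~= bar g" "bar f ~= bar (g \<diamondop> ow)" "bar (f \<diamondop> ow) ~= bar g" "bar (f \<diamondop> ow) ~= bar (g \<diamondop> ow)"
 proof -
 show 1: "bar f ~= bar g" using ne(1) by auto
 show "bar f ~= bar (g \<diamondop> ow)" "bar (f \<diamondop> ow) ~= bar g" using ne(2) by (auto simp: bmq)
 show "bar (f \<diamondop> ow) ~= bar (g \<diamondop> ow)" using 1 siq[of K "bar f" "bar g"] by (simp add: bmq scqa)
 qed
 have qK: "sQ (bar g) K = 1" "sQ K (bar g) = 1" using g(2) by (simp_all add: sQ_def Int_commute)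
 have 1: "XV (f \<diamondop> (g \<diamondop> ow)) = t *s XV ((f \<diamondop> g) \<diamondop> ow)"
 using oaqb[OF oXq, of f g ow] tt by (simp add: t ssq)
 have "XV ((f \<diamondop> ow) \<diamondop> g) = sT (bar f) K (bar g) *s XV (f \<diamondop> (ow \<diamondop> g))"
 using oaqb[OF oXq, of f ow g] by simp
 also have "sT (bar f) K (bar g) = t" using t spq(2)[of "bar f" K "bar g"] by simp
 also have "XV (f \<diamondop> (ow \<diamondop> g)) = XV (f \<diamondop> (g \<diamondop> ow))"
 using ocqb[OF omlq[OF oXq, of f], of ow g] qK by simp
 finally have 2: "XV ((f \<diamondop> ow) \<diamondop> g) = XV ((f \<diamondop> g) \<diamondop> ow)" unfolding 1 by (simp add: ssq tt)
 have 3: "XV ((f \<diamondop> ow) \<diamondop> (g \<diamondop> ow)) = t *s XV (f \<diamondop> g)"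
 using oiq[OF oXq, of f ow g ow] octadD(1)[OF K] by (simp add: t qK osqa unit_right)
 show ?thesis
 unfolding zv_def star_add sarq star_scale ssrq sxxXq[OF f(1) g(1) b(1)]
 sxxXq[OF f(1) l(2) b(2)] sxxXq[OF l(1) g(1) b(3)] sxxXq[OF l(1,2) b(4)] 1 2 3 kap(5)[OF ez] kap(5)[OF dz]
 by (simp add: vec_eq_iff field_simps)
qed
definition wt :: "'i set => 'i set => complex" where "wt a h = (if h = a then - 1 else 1)"
lemma wt_sq [simp]: "wt a h * wt a h = 1" "cnj (wt a h) = wt a h" by (simp_all add: wt_def)
lemma tZwq: assumes d: "d : lifts" and c4: "card (bar d Int K) = 4" and ez: "ez = 1 | ez = - 1" and h: "h : Pl d"
 shows "tz (Z ez d h) = kap ez *s (SUM h':Pl d. wt h h' *s Z ez d h')"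
proof -
 have "(SUM h':Pl d. wt h h' *s Z ez d h') = (SUM h':Pl d. Z ez d h' - (if h' = h then 2 *s Z ez d h' else 0))"
 by (intro sum.cong refl) (simp add: wt_def vec_eq_iff)
 then show ?thesis unfolding tau_Z[OF assms] using h by (simp add: sum_subtractf)
qed
lemma PIKq: "h : planes K T ==> k : planes K T' ==> h Int k Int K = T Int T'"
 using planesD(2) by blast
lemma ZsXq: assumes f: "f : lifts" "card (bar f Int K) = 4" and g: "g : lifts" "card (bar g Int K) = 4" and G: "odd_map G"
 and h: "h : Pl f" and k: "k : Pl g" and e: "e = bar f +^ h +^ (bar g +^ k)"
 shows "G ((f \<diamondop> s (bar f +^ h)) \<diamondop> (g \<diamondop> s (bar g +^ k)))
 = (sT (bar f) (bar f +^ h) (bar g +^ k) * sT (bar f) (bar g) (bar g +^ k) * sQ (bar g) (bar f +^ h)) *s G ((f \<diamondop> g) \<diamondop> s e)"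
proof -
 have b: "bar f +^ h : B K" "bar g +^ k : B K"
 using psq[OF Tlq(1)[OF f] h] psq[OF Tlq(1)[OF g] k] by blast+
 show ?thesis using oiq[OF G, of f "s (bar f +^ h)" g "s (bar g +^ k)"] b by (simp add: smqb e)
qed
text \<open>Tetrads with three common points. All 16 sums \<open>h +^ k\<close> of planes are octads
  meeting \<open>K\<close> in a pair; the 16 words \<open>E h k\<close> are distinct and have
  \<open>sQ ?D\<close> equal to 1. As only 16 words of \<open>B K\<close> have this sign, the double
  sum over planes is the full sum describing the image of
  \<open>x_vec (f \<diamondop> g)\<close>.\<close>

lemma mzoq: assumes f: "f : lifts" "card (bar f Int K) = 4" and g: "g : lifts" "card (bar g Int K) = 4"
 and fg: "card (bar f Int bar g Int K) = 3" and ez: "ez = 1 | ez = - 1" and dz: "dz = 1 | dz = - 1"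
 shows "tz (zv ez f \<star> zv dz g) = tz (zv ez f) \<star> tz (zv dz g)"
proof -
 let ?f = "bar f" and ?g = "bar g"
 let ?D = "?f +^ ?g"
 have C: "?f : C" "?g : C" by simp_all
 note Pf = Tlq(1)[OF f] and Pg = Tlq(1)[OF g]
 have TT: "(?f Int K) Int (?g Int K) = ?f Int ?g Int K" by blast
 have hkK: "h Int k Int K = ?f Int ?g Int K" if "h : Pl f" "k : Pl g" for h k using PIKq[OF that] TT by simp
 have hk4: "card (h Int k) = 4" if hk: "h : Pl f" "k : Pl g" for h k
 proof -
 have "h ~= k" using planesD(2)[OF hk(1)] planesD(2)[OF hk(2)] fg f(2) hkK[OF hk] by force
 moreover have "card (h Int k) >= 3" using fg hkK[OF hk] csq[of "h Int k" K] by simp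
 ultimately show ?thesis using eIoq[OF planesD(1)[OF hk(1)] planesD(1)[OF hk(2)]] by linarith
 qed
 have hk1: "card (h Int k Int - K) = 1" if hk: "h : Pl f" "k : Pl g" for h k
 using hk4[OF hk] fg hkK[OF hk] csq[of "h Int k" K] by simp
 have D2: "card ((h +^ k) Int K) = 2" if hk: "h : Pl f" "k : Pl g" for h k
 using csKq[of h k] hkK[OF hk] fg planesD(2)[OF hk(1)] planesD(2)[OF hk(2)] f(2) g(2) by simp
 have Do: "octad (h +^ k)" if hk: "h : Pl f" "k : Pl g" for h k
 using csqa[of h k] hk4[OF hk] planesD[OF hk(1)] planesD[OF hk(2)] scq by (simp add: octad_def)
 define E where "E h k = ?f +^ h +^ (?g +^ k)" for h k
 have EB: "E h k : B K" if "h : Pl f" "k : Pl g" for h k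
 unfolding E_def using psq[OF Pf that(1)] psq[OF Pg that(2)] by (rule B_sd)
 \<comment> \<open>The loop signs coincide with the entries of the two matrices
   \<open>J - 2 I\<close>, so after multiplication by these entries all 16 terms carry the same
   coefficient.\<close>
 have sgn: "sT ?f (?f +^ h) (?g +^ k) * sT ?f ?g (?g +^ k) * sQ ?g (?f +^ h) = wt ?f h * wt ?g k" if hk: "h : Pl f" "k : Pl g" for h k
 proof -
 have i: "?f Int h = ?f Int K" if "h ~= ?f" using pIq[OF Pf hk(1) that[symmetric] f(2)] .
 have j: "?g Int k = ?g Int K" if "k ~= ?g" using pIq[OF Pg hk(2) that[symmetric] g(2)] .
 have c: "h : C" "k : C" using hk planesD(3) by blast+
 have 1: "sT ?f ?g (?g +^ k) = - wt ?g k"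
 proof (cases "k = ?g")
 case False
 have "?f Int ?g Int k = ?f Int ?g Int K" using j[OF False] by blast
 then have "sT ?f ?g k = - 1" using fg by (simp add: sT_def)
 then show ?thesis using False by (simp add: sT_sd wt_def)
 qed (simp add: wt_def sT_sd)
 have 2: "sQ ?g (?f +^ h) = - wt ?f h"
 proof (cases "h = ?f")
 case False
 have "?g Int ?f Int h = ?g Int (?f Int K)" unfolding i[OF False, symmetric] by (rule Int_assoc)
 then have "?g Int ?f Int h = ?f Int ?g Int K" by (simp only: Int_ac)
 then have "sT ?g ?f h = - 1" using fg by (simp add: sT_def)
 moreover have "sQ ?g ?f = 1" "sQ ?g h = 1" using hk4[OF Pf Pg] hk4[OF hk(1) Pg] by (simp_all add: sQ_def Int_commute)
 ultimately show ?thesis using False swq(1)[OF C(2,1) c(1)] by (simp add: wt_def)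
 qed (simp add: wt_def)
 have 3: "sT ?f (?f +^ h) (?g +^ k) = 1"
 proof (cases "h = ?f")
 case False
 have "?f Int h Int ?g = ?f Int ?g Int K" unfolding i[OF False] by (simp only: Int_ac)
 moreover have "?f Int h Int k = ?f Int k Int K" unfolding i[OF False] by (simp only: Int_ac)
 then have "?f Int h Int k = ?f Int ?g Int K" unfolding hkK[OF Pf hk(2)] .
 ultimately
 have "sT ?f h ?g = - 1" "sT ?f h k = - 1" using fg by (simp_all add: sT_def)
 then show ?thesis using C c by (simp add: sT_sd)
 qed simp
 show ?thesis unfolding 1 2 3 by simp
 qed
 have tm: "sT h k K = - 1" if hk: "h : Pl f" "k : Pl g" for h k using fg hkK[OF hk] by (simp add: sT_def)
 have P: "Z ez f h \<star> Z dz g k = ((1 - ez * dz)/2*(wt ?f h * wt ?g k)) *s XV ((f \<diamondop> g) \<diamondop> s (E h k))"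
 if hk: "h : Pl f" "k : Pl g" for h k
 proof -
 note bf = Tbq[OF f hk(1)] and bg = Tbq[OF g hk(2)]
 let ?z = "(f \<diamondop> s (?f +^ h)) \<diamondop> (g \<diamondop> s (?g +^ k))"
 have n: "(h +^ k) Int K ~= {}" "(h +^ k) Int K ~= K" using D2[OF hk] octadD(2)[OF K] by auto
 have "card ((h +^ k) +^ K) = 12" using csqa[of "h +^ k" K] D2[OF hk] Do[OF hk] K by (simp add: octadD)
 then have 0: "XV (?z \<diamondop> ow) = 0" using bf(1) bg(1) by (intro XV_12) (simp add: bmq[of ?z] bmq[of "f \<diamondop> s (?f +^ h)"])
 have "Z ez f h \<star> Z dz g k = (1/2) *s ((1 + ez * dz * - 1) *s XV ?z + (ez + dz * - 1) *s XV (?z \<diamondop> ow))"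
 unfolding Z_def by (rule zsq[OF bf(3,4) bg(3,4) ez dz]) (simp_all only: bf(1) bg(1) n tm[OF hk] not_False_eq_True)
 also have "XV ?z = (wt ?f h * wt ?g k) *s XV ((f \<diamondop> g) \<diamondop> s (E h k))"
 unfolding ZsXq[OF f g oXq hk E_def] sgn[OF hk] ..
 finally show ?thesis unfolding 0 by (simp add: ssq)
 qed
 have inj: "inj_on (%(h, k). E h k) (Pl f \<times> Pl g)"
 proof (rule inj_onI, clarify)
 fix h k h' k' assume a: "h : Pl f" "k : Pl g" "h' : Pl f" "k' : Pl g" "E h k = E h' k'"
 have e: "h +^ h' = k +^ k'"
 proof -
 have "h +^ (?f +^ (?g +^ k)) = h' +^ (?f +^ (?g +^ k'))" using a(5) unfolding E_def by (simp only: sd_ac)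
 then have "h' +^ (h +^ (?f +^ (?g +^ k))) = ?f +^ (?g +^ k')" by simp
 then have "?f +^ (?g +^ (h +^ (h' +^ k))) = ?f +^ (?g +^ k')" by (simp only: sd_ac)
 then have "h +^ (h' +^ k) = k'" by simp
 then have "k +^ (h +^ (h' +^ k)) = k +^ k'" by simp
 then show ?thesis by (simp add: sd_left_commute[of k] scqa[of _ k])
 qed
 have hh: "h = h'"
 proof (rule ccontr)
 assume n: "h ~= h'"
 then have "h +^ h' ~= {}" by simp
 then have nk: "k ~= k'" using e by auto
 have X: "x ~: k'" if "x : k" "x ~: K" for x using pIq[OF a(2,4) nk g(2)] that by blast
 have "card ((k Int - K) Int (h +^ h')) + 2 * card ((k Int - K) Int h Int h') = card ((k Int - K) Int h) + card ((k Int - K) Int h')" by (rule cIsq)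
 moreover have "(k Int - K) Int h Int h' = {}" using pIq[OF a(1,3) n f(2)] by blast
 moreover have "card ((k Int - K) Int h) = 1" "card ((k Int - K) Int h') = 1" using hk1[OF a(1,2)] hk1[OF a(3,2)] by (simp_all add: Int_ac)
 moreover have "(k Int - K) Int (h +^ h') = k Int (k +^ k') Int - K" unfolding e by blast
 moreover have "k Int (k +^ k') Int - K = k Int - K" using X by auto
 moreover have "card (k Int - K) = 4" using cpmq[OF a(2) g(2)] .
 ultimately show False by simp
 qed
 then have "k +^ k' = {}" using e by auto
 then show "h = h' & k = k'" using hh by simp
 qed
 have oD: "octad ?D" and D2': "card (?D Int K) = 2" using Do[OF Pf Pg] D2[OF Pf Pg] by blast+
 have sums: "(SUM h:Pl f. SUM k:Pl g. XV ((f \<diamondop> g) \<diamondop> s (E h k))) = (SUM e:B K. XV ((f \<diamondop> g) \<diamondop> s e))"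
 proof -
 let ?I = "(%(h, k). E h k) ` (Pl f \<times> Pl g)" and ?O = "{e : B K. sQ ?D e = 1}"
 have "(SUM h:Pl f. SUM k:Pl g. XV ((f \<diamondop> g) \<diamondop> s (E h k))) = (SUM e:?I. XV ((f \<diamondop> g) \<diamondop> s e))"
 by (subst sum.reindex[OF inj]) (simp add: sum.cartesian_product case_prod_beta)
 also have "?I = ?O"
 proof (rule card_subset_eq)
 show "?I <= ?O"
 proof clarify
 fix h k assume hk: "h : Pl f" "k : Pl g"
 have "?D +^ E h k = h +^ k"
 proof -
 have "?D +^ E h k = ?f +^ (?f +^ (?g +^ (?g +^ (h +^ k))))" unfolding E_def by (simp only: sd_ac)
 then show ?thesis by simp
 qed
 then have "sW (?D +^ E h k) = 1" using soqa[OF Do[OF hk]] by simp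
 then have "sQ ?D (E h k) = 1"
 using swqa[OF octadD(1)[OF oD] Bwq[OF EB[OF hk]]] soqa[OF oD] sW_B[OF K EB[OF hk]] by simp
 then show "E h k : B K & sQ ?D (E h k) = 1" using EB[OF hk] by simp
 qed
 have "card ?I = 16" using card_image[OF inj] cpq[OF K _ f(2)] cpq[OF K _ g(2)] by (simp add: card_cartesian_product)
 moreover have "(of_nat (card ?O) :: complex) = (SUM e:B K. if sQ ?D e = 1 then 1 else 0)"
 by (simp add: sum.inter_filter[symmetric])
 moreover have "... = (SUM e:B K. 1/2 + sQ ?D e/2)" using sQ_cases[of ?D] by (intro sum.cong refl) force
 moreover have "... = 16 + (SUM e:B K. sQ ?D e/2)" by (simp add: sum.distrib cBq[OF K])
 moreover have "(SUM e:B K. sQ ?D e/2) = 0" by (rule sBoq) (simp add: Tsfq[OF oD D2'])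
 ultimately have "(of_nat (card ?O) :: complex) = of_nat (card ?I)" by simp
 then show "card ?I = card ?O" by (simp only: of_nat_eq_iff)
 qed simp
 also have "(SUM e:?O. XV ((f \<diamondop> g) \<diamondop> s e)) = (SUM e:B K. XV ((f \<diamondop> g) \<diamondop> s e))"
 proof (rule sum.mono_neutral_left)
 show "ALL e:B K - ?O. XV ((f \<diamondop> g) \<diamondop> s e) = 0"
 using T2_XV(1)[of "f \<diamondop> g"] oD D2' sQ_cases[of ?D] by (auto simp: bmq)
 qed auto
 finally show ?thesis .
 qed
 have R: "tz (zv ez f) \<star> tz (zv dz g) = (kap (- ez) * kap (- dz)*((1 - ez * dz)/2)) *s (SUM e:B K. XV ((f \<diamondop> g) \<diamondop> s e))"
 proof -
 have "(SUM h:Pl f. wt ?f h *s Z ez f h) \<star> (SUM k:Pl g. wt ?g k *s Z dz g k)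
 = (SUM h:Pl f. SUM k:Pl g. ((1 - ez * dz)/2) *s XV ((f \<diamondop> g) \<diamondop> s (E h k)))"
 unfolding ssqb(1)
 proof (rule sum.cong[OF refl])
 fix h assume h: "h : Pl f"
 show "wt ?f h *s Z ez f h \<star> (SUM k:Pl g. wt ?g k *s Z dz g k) = (SUM k:Pl g. ((1 - ez * dz)/2) *s XV ((f \<diamondop> g) \<diamondop> s (E h k)))"
 unfolding ssqb(2)
 proof (rule sum.cong[OF refl])
 fix k assume k: "k : Pl g"
 have "wt ?g k*(wt ?f h*((1 - ez * dz)/2*(wt ?f h * wt ?g k))) = (1 - ez * dz)/2" by (simp add: wt_def)
 then show "wt ?f h *s Z ez f h \<star> (wt ?g k *s Z dz g k) = ((1 - ez * dz)/2) *s XV ((f \<diamondop> g) \<diamondop> s (E h k))"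
 unfolding star_scale ssrq P[OF h k] wt_sq(2) ssq by (simp only:)
 qed
 qed
 also have "... = ((1 - ez * dz)/2) *s (SUM e:B K. XV ((f \<diamondop> g) \<diamondop> s e))" by (simp only: ssqa sums)
 finally have q: "(SUM h:Pl f. wt ?f h *s Z ez f h) \<star> (SUM k:Pl g. wt ?g k *s Z dz g k) = ((1 - ez * dz)/2) *s (SUM e:B K. XV ((f \<diamondop> g) \<diamondop> s e))" .
 show ?thesis using tZwq[OF f ez Pf] tZwq[OF g dz Pg] unfolding Zsq
 by (simp only: star_scale ssrq q kap(1)[OF ez] kap(1)[OF dz] ssq mult.assoc mult.left_commute)
 qed
 have "E ?f ?g = {}" by (simp add: E_def)
 then have "zv ez f \<star> zv dz g = ((1 - ez * dz)/2) *s x_vec (f \<diamondop> g)"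
 using P[OF Pf Pg] oD by (simp add: Zsq wt_def seq unit_right Xoq bmq)
 moreover have "tz (x_vec (f \<diamondop> g)) = (1/4) *s (SUM b:B K. XV ((f \<diamondop> g) \<diamondop> s b))"
 by (rule tTq) (use oD D2' in \<open>simp_all add: liq bmq\<close>)
 moreover have "kap (- ez) * kap (- dz)*((1 - ez * dz)/2) = (1 - ez * dz)/2*(1/4)" "cnj ((1 - ez * dz)/2) = (1 - ez * dz)/2"
 using ez dz kap(2)[of 1] kap(2)[of "- 1"] by (auto simp: mult_ac)
 ultimately show ?thesis unfolding R by (simp only: tsq ssq)
qed
end
context osec begin
definition PP :: "complex => 'p => complex ^ ('i + 'p)" where "PP ez z = XV z + ez *s XV (z \<diamondop> ow)"
lemma oPq: "odd_map (PP ez)"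
 unfolding odd_map_def PP_def mult_neg using omq[OF oXq] by (simp add: vec_eq_iff)
text \<open>Tetrads with two common points. Two planes share 0 or 2 points off \<open>K\<close>,
  with row and column sums 4, and the resulting 4 by 4 matrix splits into two blocks of entries 2.
  Products at zero entries vanish; the other eight give each of the four planes of
  \<open>f \<diamondop> g\<close> twice, with sign -1 in the second block. The claim is then a
  comparison of coefficients for each \<open>k\<close>.\<close>

lemma mZeq: assumes f: "f : lifts" "card (bar f Int K) = 4" and g: "g : lifts" "card (bar g Int K) = 4"
 and fg: "card (bar f Int bar g Int K) = 2" "card (bar f Int bar g) = 4"
 and ez: "ez = 1 | ez = - 1" and dz: "dz = 1 | dz = - 1" and k: "k : Pl g"
 shows "tz (zv ez f \<star> Z dz g k) = tz (zv ez f) \<star> tz (Z dz g k)"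
proof -
 let ?f = "bar f" and ?g = "bar g"
 have C: "?f : C" "?g : C" by simp_all
 note Pf = Tlq(1)[OF f] and Pg = Tlq(1)[OF g]
 have hkK: "h Int k Int K = ?f Int ?g Int K" if "h : Pl f" "k : Pl g" for h k
 proof -
 have "h Int k Int K = (?f Int K) Int (?g Int K)" by (rule PIKq[OF that])
 then show ?thesis by (simp only: Int_ac Int_left_absorb Int_absorb)
 qed
 have D4: "card ((h +^ k) Int K) = 4" if hk: "h : Pl f" "k : Pl g" for h k
 using csKq[of h k] hkK[OF hk] fg planesD(2)[OF hk(1)] planesD(2)[OF hk(2)] f(2) g(2) by simp
 define n where "n h k = card (h Int k Int - K)" for h k
 have nn: "card (h Int k) = 2 + n h k" "n h k = 0 | n h k = 2" if hk: "h : Pl f" "k : Pl g" for h k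
 proof -
 show 1: "card (h Int k) = 2 + n h k" using csq[of "h Int k" K] hkK[OF hk] fg by (simp add: n_def)
 have "h ~= k" using D4[OF hk] by auto
 then show "n h k = 0 | n h k = 2"
 using eIoq[OF planesD(1)[OF hk(1)] planesD(1)[OF hk(2)]] 1 by linarith
 qed
 have rows: "(SUM k:Pl g. n h k) = 4" if h: "h : Pl f" for h
 using pcq[OF K _ g(2), of h] cpmq[OF h f(2)] by (simp add: n_def)
 have cols: "(SUM h:Pl f. n h k) = 4" if k: "k : Pl g" for k
 using pcq[OF K _ f(2), of k] cpmq[OF k g(2)] by (simp add: n_def Int_commute)
 have n11: "n ?f ?g = 2" using nn(1)[OF Pf Pg] fg by simp
 have F: "?f Int K <= K" "?g Int K <= K" by blast+
 obtain k2 k3 k4 where P: "Pl g = {?g, k2, k3, k4}" "distinct [?g, k2, k3, k4]" "n ?f k2 = 2" "n ?f k3 = 0" "n ?f k4 = 0"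
 proof -
 obtain a b c where P: "Pl g = {?g, a, b, c}" "distinct [?g, a, b, c]" by (rule plq[OF K F(2) g(2) Pg])
 have m: "a : Pl g" "b : Pl g" "c : Pl g" unfolding P(1) by simp_all
 have "n ?f ?g + (n ?f a + (n ?f b + n ?f c)) = 4" using rows[OF Pf] P by simp
 then consider "n ?f a = 2" "n ?f b = 0" "n ?f c = 0" | "n ?f b = 2" "n ?f a = 0" "n ?f c = 0" | "n ?f c = 2" "n ?f b = 0" "n ?f a = 0"
 using n11 nn(2)[OF Pf m(1)] nn(2)[OF Pf m(2)] nn(2)[OF Pf m(3)] by linarith
 then show ?thesis
 proof cases
 case 1 then show ?thesis by (rule that[OF P])
 next
 case 2
 have "Pl g = {?g, b, a, c}" unfolding P(1) by (simp add: insert_commute)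
 moreover have "distinct [?g, b, a, c]" using P(2) by auto
 ultimately show ?thesis by (rule that[OF _ _ 2])
 next
 case 3
 have "Pl g = {?g, c, b, a}" unfolding P(1) by (simp add: insert_commute)
 moreover have "distinct [?g, c, b, a]" using P(2) by auto
 ultimately show ?thesis by (rule that[OF _ _ 3])
 qed
 qed
 obtain h2 h3 h4 where Q: "Pl f = {?f, h2, h3, h4}" "distinct [?f, h2, h3, h4]" "n h2 ?g = 2" "n h3 ?g = 0" "n h4 ?g = 0"
 proof -
 obtain a b c where P: "Pl f = {?f, a, b, c}" "distinct [?f, a, b, c]" by (rule plq[OF K F(1) f(2) Pf])
 have m: "a : Pl f" "b : Pl f" "c : Pl f" unfolding P(1) by simp_all
 have "n ?f ?g + (n a ?g + (n b ?g + n c ?g)) = 4" using cols[OF Pg] P by simp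
 then consider "n a ?g = 2" "n b ?g = 0" "n c ?g = 0" | "n b ?g = 2" "n a ?g = 0" "n c ?g = 0" | "n c ?g = 2" "n b ?g = 0" "n a ?g = 0"
 using n11 nn(2)[OF m(1) Pg] nn(2)[OF m(2) Pg] nn(2)[OF m(3) Pg] by linarith
 then show ?thesis
 proof cases
 case 1 then show ?thesis by (rule that[OF P])
 next
 case 2
 have "Pl f = {?f, b, a, c}" unfolding P(1) by (simp add: insert_commute)
 moreover have "distinct [?f, b, a, c]" using P(2) by auto
 ultimately show ?thesis by (rule that[OF _ _ 2])
 next
 case 3
 have "Pl f = {?f, c, b, a}" unfolding P(1) by (simp add: insert_commute)
 moreover have "distinct [?f, c, b, a]" using P(2) by auto
 ultimately show ?thesis by (rule that[OF _ _ 3])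
 qed
 qed
 have mk: "k2 : Pl g" "k3 : Pl g" "k4 : Pl g" and mh: "h2 : Pl f" "h3 : Pl f" "h4 : Pl f"
 unfolding P(1) Q(1) by simp_all
 let ?H = "?g +^ k2"
 have BH: "?H : B K" "?f +^ h2 : B K" using psq[OF Pg mk(1)] psq[OF Pf mh(1)] by blast+
 have XH: "card (h Int ?H) = n h ?g + n h k2" if h: "h : Pl f" for h
 proof -
 have nK: "x ~: k2" if "x : ?g" "x ~: K" for x using pIq[OF Pg mk(1) _ g(2)] P(2) that by auto
 have "h Int ?H = (h Int - K) Int ?H" using BH(1) unfolding B_iff by blast
 moreover have "(h Int - K) Int ?g Int k2 = {}" using nK by blast
 moreover have "(h Int - K) Int ?g = h Int ?g Int - K" "(h Int - K) Int k2 = h Int k2 Int - K" by blast+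
 ultimately show ?thesis using cIsq[of "h Int - K" ?g k2] by (simp add: n_def)
 qed
 \<comment> \<open>The two octads of \<open>B K\<close> share \<open>6 + n h2 k2\<close> points. As
   \<open>sQ\<close> is trivial on \<open>B K\<close>, this number is a multiple of four, hence 8,
   and the octads coincide.\<close>
 have n22: "n h2 k2 = 2" and HH: "?f +^ h2 = ?H"
 proof -
 have o: "octad ?H" "octad (?f +^ h2)" using psoq[OF Pg mk(1) _ g(2)] psoq[OF Pf mh(1) _ f(2)] P(2) Q(2) by auto
 have nK: "x ~: h2" if "x : ?f" "x ~: K" for x using pIq[OF Pf mh(1) _ f(2)] Q(2) that by auto
 have "?H Int ?f Int h2 = {}" using nK BH(1) unfolding B_iff by blast
 then have c: "card (?H Int (?f +^ h2)) = 4 + (2 + n h2 k2)"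
 using cIsq[of ?H ?f h2] XH[OF Pf] XH[OF mh(1)] n11 P(3) Q(3) by (simp add: Int_commute)
 have "sQ ?H (?f +^ h2) = 1" by (rule sQ_B[OF K BH])
 then show 1: "n h2 k2 = 2" using nn(2)[OF mh(1) mk(1)] unfolding sQ_def c by auto
 then show "?f +^ h2 = ?H" using oeqa[OF o] c by simp
 qed
 have N: "n h2 k3 = 0" "n h2 k4 = 0" "n h3 k2 = 0" "n h4 k2 = 0"
 using rows[OF mh(1)] cols[OF mk(1)] P Q n22 by simp_all
 have N': "n h3 k3 = 2" "n h3 k4 = 2" "n h4 k3 = 2" "n h4 k4 = 2"
 proof -
 have le: "n h k <= 2" if "h : Pl f" "k : Pl g" for h k using nn(2)[OF that] by linarith
 have "n h3 ?g + (n h3 k2 + (n h3 k3 + n h3 k4)) = 4" "n h4 ?g + (n h4 k2 + (n h4 k3 + n h4 k4)) = 4"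
 using rows[OF mh(2)] rows[OF mh(3)] P(2) unfolding P(1) by simp_all
 then have "n h3 k3 + n h3 k4 = 4" "n h4 k3 + n h4 k4 = 4" unfolding Q(4,5) N by simp_all
 then show "n h3 k3 = 2" "n h3 k4 = 2" "n h4 k3 = 2" "n h4 k4 = 2"
 using le[OF mh(2) mk(2)] le[OF mh(2) mk(3)] le[OF mh(3) mk(2)] le[OF mh(3) mk(3)] by linarith+
 qed
 define E where "E h k = ?f +^ h +^ (?g +^ k)" for h k
 have four: "a +^ b +^ (c +^ d) = - K" if "planes K T = {a, b, c, d}" "distinct [a, b, c, d]" "T <= K" "card T = 4" for a b c d T
 proof (rule Set.set_eqI)
 fix x
 have m: "a : planes K T" "b : planes K T" "c : planes K T" "d : planes K T" unfolding that(1) by simp_all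
 have k: "h Int K = T" if "h : planes K T" for h using planesD(2)[OF that] .
 have i: "h Int h' = T" if "h : planes K T" "h' : planes K T" "h ~= h'" for h h' using pIq[OF that \<open>card T = 4\<close>] .
 have p: "a Int b = T" "a Int c = T" "a Int d = T" "b Int c = T" "b Int d = T" "c Int d = T" using i m that(2) by auto
 show "x : a +^ b +^ (c +^ d) \<longleftrightarrow> x : - K"
 proof (cases "x : K")
 case True
 have "x : h \<longleftrightarrow> x : T" if "h : planes K T" for h using k[OF that] True by blast
 then show ?thesis using True m by simp
 next
 case False
 have nT: "x ~: T" using False that(3) by blast
 have q: "~ (x : h & x : h')" if "h Int h' = T" for h h' using that nT by blast
 obtain h where "h : planes K T" "x : h" using peq[OF K \<open>T <= K\<close> \<open>card T = 4\<close> False] .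
 then have "x : a | x : b | x : c | x : d" unfolding that(1) by blast
 then show ?thesis using q[OF p(1)] q[OF p(2)] q[OF p(3)] q[OF p(4)] q[OF p(5)] q[OF p(6)] False by simp blast
 qed
 qed
 have x1: "?f +^ h4 = - K +^ (?H +^ (?f +^ h3))"
 proof -
 have "- K +^ (?H +^ (?f +^ h3)) = (?f +^ h2 +^ (h3 +^ h4)) +^ ((?f +^ h2) +^ (?f +^ h3))"
 unfolding four[OF Q(1,2) F(1) f(2)] unfolding HH ..
 also have "... = ?f +^ (?f +^ (h2 +^ (h2 +^ (h3 +^ (h3 +^ (?f +^ h4))))))" by (simp only: sd_ac)
 finally show ?thesis by simp
 qed
 have x2: "?g +^ k4 = - K +^ (?H +^ (?g +^ k3))"
 proof -
 have "- K +^ (?H +^ (?g +^ k3)) = (?g +^ k2 +^ (k3 +^ k4)) +^ ((?g +^ k2) +^ (?g +^ k3))"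
 unfolding four[OF P(1,2) F(2) g(2)] ..
 also have "... = ?g +^ (?g +^ (k2 +^ (k2 +^ (k3 +^ (k3 +^ (?g +^ k4))))))" by (simp only: sd_ac)
 finally show ?thesis by simp
 qed
 have ab: "A +^ (H +^ U) +^ (A +^ (H +^ V)) = U +^ V" "A +^ (H +^ U) +^ V = U +^ (A +^ (H +^ V))"
 "A +^ (H +^ (A +^ (H +^ V))) = V" for A H U V :: "'i set"
 by (auto simp: set_eq_iff)
 have EE: "E ?f ?g = {}" "E ?f k2 = ?H" "E h2 ?g = ?H" "E h2 k2 = {}" "E h4 k4 = E h3 k3" "E h4 k3 = E h3 k4"
 unfolding E_def HH by (simp_all add: x1 x2 ab)
 have ne: "(h +^ k) Int K ~= {}" "(h +^ k) Int K ~= K" if "h : Pl f" "k : Pl g" for h k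
 using D4[OF that] octadD(2)[OF K] by auto
 have sgn: "sT ?f (?f +^ h) (?g +^ k) * sT ?f ?g (?g +^ k) * sQ ?g (?f +^ h) = (if n h ?g = 2 then 1 else - 1)"
 if hk: "h : Pl f" "k : Pl g" for h k
 proof -
 have i: "?f Int h = ?f Int K" if "h ~= ?f" using pIq[OF Pf hk(1) that[symmetric] f(2)] .
 have j: "?g Int k = ?g Int K" if "k ~= ?g" using pIq[OF Pg hk(2) that[symmetric] g(2)] .
 have c: "h : C" "k : C" using hk planesD(3) by blast+
 have 1: "sT ?f ?g (?g +^ k) = 1"
 proof (cases "k = ?g")
 case False
 have "?f Int ?g Int k = ?f Int (?g Int K)" unfolding j[OF False, symmetric] by (rule Int_assoc)
 then have "?f Int ?g Int k = ?f Int ?g Int K" by (simp only: Int_assoc)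
 then have "sT ?f ?g k = 1" using fg by (simp add: sT_def)
 then show ?thesis by (simp add: sT_sd)
 qed simp
 have 2: "sQ ?g (?f +^ h) = (if n h ?g = 2 then 1 else - 1)"
 proof (cases "h = ?f")
 case False
 have "?g Int ?f Int h = ?g Int (?f Int K)" unfolding i[OF False, symmetric] by (rule Int_assoc)
 then have "?g Int ?f Int h = ?f Int ?g Int K" by (simp only: Int_ac)
 then have "sT ?g ?f h = 1" using fg by (simp add: sT_def)
 moreover have "sQ ?g ?f = 1" using fg(2) by (simp add: sQ_def Int_commute)
 moreover have "sQ ?g h = (if n h ?g = 2 then 1 else - 1)"
 using nn[OF hk(1) Pg] by (auto simp: sQ_def Int_commute)
 ultimately show ?thesis using swq(1)[OF C(2,1) c(1)] by simp
 qed (simp add: n11)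
 have 3: "sT ?f (?f +^ h) (?g +^ k) = 1"
 proof (cases "h = ?f")
 case False
 have "?f Int h Int ?g = ?f Int ?g Int K" unfolding i[OF False] by (simp only: Int_ac)
 moreover have "?f Int h Int k = ?f Int k Int K" unfolding i[OF False] by (simp only: Int_ac)
 then have "?f Int h Int k = ?f Int ?g Int K" unfolding hkK[OF Pf hk(2)] .
 ultimately have "sT ?f h ?g = 1" "sT ?f h k = 1" using fg by (simp_all add: sT_def)
 then show ?thesis using C c by (simp add: sT_sd)
 qed simp
 show ?thesis unfolding 1 2 3 by simp
 qed
 have tm: "sT h k K = 1" if hk: "h : Pl f" "k : Pl g" for h k using fg hkK[OF hk] by (simp add: sT_def)
 have bz: "bar ((f \<diamondop> s (?f +^ h)) \<diamondop> (g \<diamondop> s (?g +^ k))) = h +^ k" if "h : Pl f" "k : Pl g" for h k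
 using Tbq(1)[OF f that(1)] Tbq(1)[OF g that(2)] by (simp add: bmq[of "f \<diamondop> s (?f +^ h)"])
 have Pr: "Z ez f h \<star> Z dz g k = (1/2) *s ((1 + ez * dz) *s XV ((f \<diamondop> s (?f +^ h)) \<diamondop> (g \<diamondop> s (?g +^ k)))
 + (ez + dz) *s XV (((f \<diamondop> s (?f +^ h)) \<diamondop> (g \<diamondop> s (?g +^ k))) \<diamondop> ow))" if hk: "h : Pl f" "k : Pl g" for h k
 unfolding Z_def
 using zsq[OF Tbq(3,4)[OF f hk(1)] Tbq(3,4)[OF g hk(2)] ez dz, unfolded Tbq(1)[OF f hk(1)] Tbq(1)[OF g hk(2)], OF ne[OF hk] tm[OF hk]]
 by (simp only: mult_1_right)
 show ?thesis
 proof (cases "ez = dz")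
 case False
 \<comment> \<open>Eigenvectors for opposite eigenvalues have product zero, on every pair of planes,
   so both sides vanish.\<close>
 then have "ez * dz = - 1" "ez + dz = 0" using ez dz by auto
 then have z: "Z ez f h \<star> Z dz g k = 0" if "h : Pl f" "k : Pl g" for h k using Pr[OF that] by simp
 have "tz (Z ez f ?f) \<star> tz (Z dz g k) = 0"
 unfolding tZwq[OF f ez Pf] tZwq[OF g dz k] star_scale ssrq ssqb(1)
 by (simp add: ssqb(2) star_scale ssrq z)
 then show ?thesis using z[OF Pf k] by (simp add: Zsq)
 next
 case True
 have ee: "ez * ez = 1" using kap(4)[OF ez] .
 have PPr: "Z ez f h \<star> Z ez g k = (if n h ?g = 2 then 1 else - 1) *s PP ez ((f \<diamondop> g) \<diamondop> s (E h k))" if hk: "h : Pl f" "k : Pl g" for h k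
 proof -
 have "Z ez f h \<star> Z ez g k = PP ez ((f \<diamondop> s (?f +^ h)) \<diamondop> (g \<diamondop> s (?g +^ k)))"
 using Pr[OF hk] unfolding True[symmetric] ee PP_def by (simp add: vec_eq_iff algebra_simps)
 then show ?thesis unfolding ZsXq[OF f g oPq hk E_def] sgn[OF hk] .
 qed
 have PP0: "Z ez f h \<star> Z ez g k = 0" if hk: "h : Pl f" "k : Pl g" "n h k = 0" for h k
 proof -
 have c: "card (h +^ k) = 12" using csqa[of h k] nn(1)[OF hk(1,2)] hk(3) planesD(4)[OF hk(1)] planesD(4)[OF hk(2)] by simp
 have "card ((h +^ k) +^ K) = 12" using csqa[of "h +^ k" K] D4[OF hk(1,2)] octadD(2)[OF K] c by simp
 then have "card (bar (((f \<diamondop> s (?f +^ h)) \<diamondop> (g \<diamondop> s (?g +^ k))) \<diamondop> ow)) = 12"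
 unfolding bmq[of "(f \<diamondop> s (?f +^ h)) \<diamondop> (g \<diamondop> s (?g +^ k))"] bz[OF hk(1,2)] boqa .
 then show ?thesis using Pr[OF hk(1,2)] c unfolding True[symmetric] by (simp add: XV_12 bz[OF hk(1,2)])
 qed
 let ?d = "f \<diamondop> g"
 have bd: "bar ?d = ?f +^ ?g" by (rule bmq)
 have dl: "?d : lifts" "card (bar ?d Int K) = 4" using lmq[OF f(1) g(1) fg(2)] D4[OF Pf Pg] by (simp_all add: bd)
 have jo: "h +^ k : Pl ?d" if hk: "h : Pl f" "k : Pl g" "n h k = 2" for h k
 proof (rule planesI)
 show "octad (h +^ k)" using csqa[of h k] nn(1)[OF hk(1,2)] hk(3) planesD[OF hk(1)] planesD[OF hk(2)] scq by (simp add: octad_def)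
 show "(h +^ k) Int K = bar ?d Int K" unfolding bd sd_Int planesD(2)[OF hk(1)] planesD(2)[OF hk(2)] ..
 qed
 have PPZ: "PP ez (?d \<diamondop> s (E h k)) = Z ez ?d (h +^ k)" if hk: "h : Pl f" "k : Pl g" "n h k = 2" for h k
 proof -
 have e: "bar ?d +^ (h +^ k) = E h k" unfolding bd E_def by (simp only: sd_ac)
 note b = Tbq[OF dl jo[OF hk], unfolded e]
 have "octad (bar (?d \<diamondop> s (E h k)))" "octad (bar ((?d \<diamondop> s (E h k)) \<diamondop> ow))" using b(3) Tlq(2)[OF b(3,4)] by (simp_all add: liq)
 then show ?thesis unfolding Z_def e PP_def zv_def by (simp add: Xoq)
 qed
 define j0 jH j1 j2 where j: "j0 = ?f +^ ?g" "jH = ?f +^ k2" "j1 = h3 +^ k3" "j2 = h3 +^ k4"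
 have jm: "j0 : Pl ?d" "jH : Pl ?d" "j1 : Pl ?d" "j2 : Pl ?d"
 unfolding j by (intro jo Pf Pg mk mh n11 P(3) N')+
 have dj: "h3 +^ k' ~= ?f +^ k" if "k : Pl g" "k' : Pl g" "k ~= k'" "n ?f k = 2" "n h3 k = 0" for k k'
 proof
 assume "h3 +^ k' = ?f +^ k"
 then have "?f +^ (h3 +^ k') +^ k' = ?f +^ (?f +^ k) +^ k'" by simp
 moreover have "?f +^ (h3 +^ k') +^ k' = k' +^ (k' +^ (?f +^ h3))" by (simp only: sd_ac)
 ultimately have e: "?f +^ h3 = k +^ k'" by simp
 have X: "x ~: h3" if "x : ?f" "x ~: K" for x using pIq[OF Pf mh(2) _ f(2)] Q(2) that by auto
 have Y: "x ~: k'" if "x : k" "x ~: K" for x using pIq[OF \<open>k : Pl g\<close> \<open>k' : Pl g\<close> \<open>k ~= k'\<close> g(2)] that by blast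
 have "(k Int - K) Int ?f Int h3 = {}" using X by blast
 moreover have "(k Int - K) Int ?f = ?f Int k Int - K" "(k Int - K) Int h3 = h3 Int k Int - K" by blast+
 moreover have "(k Int - K) Int (k +^ k') = k Int - K" using Y by auto
 moreover have "card (k Int - K) = 4" using cpmq[OF that(1) g(2)] .
 ultimately show False using cIsq[of "k Int - K" ?f h3] that(4,5) unfolding e by (simp add: n_def)
 qed
 have jd: "distinct [j0, jH, j1, j2]"
 using P(2) dj[OF Pg mk(2) _ n11 Q(4)] dj[OF Pg mk(3) _ n11 Q(4)] dj[OF mk(1) mk(2) _ P(3) N(3)] dj[OF mk(1) mk(3) _ P(3) N(3)]
 unfolding j by (simp add: eq_commute)
 have Pd: "Pl ?d = {j0, jH, j1, j2}"
 proof (rule card_subset_eq[symmetric])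
 show "card {j0, jH, j1, j2} = card (Pl ?d)" using jd cpq[OF K _ dl(2)] by simp
 qed (use jm in auto)
 let ?J = "Z ez ?d"
 have SJ: "(SUM j:Pl ?d. ?J j) = ?J j0 + (?J jH + (?J j1 + ?J j2))" unfolding Pd using jd by simp
 let ?A = "Z ez f" and ?B = "Z ez g"
 have SA: "(SUM h:Pl f. ?A h) = ?A ?f + (?A h2 + (?A h3 + ?A h4))" unfolding Q(1) using Q(2) by simp
 have SB: "(SUM k:Pl g. ?B k) = ?B ?g + (?B k2 + (?B k3 + ?B k4))" unfolding P(1) using P(2) by simp
 have e0: "?J (h2 +^ k2) = ?J j0" "?J (h2 +^ ?g) = ?J jH" "?J (h4 +^ k4) = ?J j1" "?J (h4 +^ k3) = ?J j2"
 unfolding j PPZ[OF mh(1) mk(1) n22, symmetric] PPZ[OF Pf Pg n11, symmetric] PPZ[OF mh(1) Pg Q(3), symmetric] PPZ[OF Pf mk(1) P(3), symmetric]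
 PPZ[OF mh(3) mk(3) N'(4), symmetric] PPZ[OF mh(2) mk(2) N'(1), symmetric] PPZ[OF mh(3) mk(2) N'(3), symmetric] PPZ[OF mh(2) mk(3) N'(2), symmetric] EE by (rule refl)+
 have T: "?A ?f \<star> ?B ?g = ?J j0" "?A ?f \<star> ?B k2 = ?J jH" "?A h2 \<star> ?B ?g = ?J jH" "?A h2 \<star> ?B k2 = ?J j0"
 "?A h3 \<star> ?B k3 = - ?J j1" "?A h4 \<star> ?B k4 = - ?J j1" "?A h3 \<star> ?B k4 = - ?J j2" "?A h4 \<star> ?B k3 = - ?J j2"
 using PPr[OF Pf Pg] PPr[OF Pf mk(1)] PPr[OF mh(1) Pg] PPr[OF mh(1) mk(1)] PPr[OF mh(2) mk(2)] PPr[OF mh(3) mk(3)] PPr[OF mh(2) mk(3)] PPr[OF mh(3) mk(2)]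
 unfolding PPZ[OF Pf Pg n11] PPZ[OF Pf mk(1) P(3)] PPZ[OF mh(1) Pg Q(3)] PPZ[OF mh(1) mk(1) n22] PPZ[OF mh(2) mk(2) N'(1)] PPZ[OF mh(3) mk(3) N'(4)]
 PPZ[OF mh(2) mk(3) N'(2)] PPZ[OF mh(3) mk(2) N'(3)] e0 j[symmetric] n11 Q(3-5) by (simp_all add: smqa[symmetric])
 have T0: "?A ?f \<star> ?B k3 = 0" "?A ?f \<star> ?B k4 = 0" "?A h2 \<star> ?B k3 = 0" "?A h2 \<star> ?B k4 = 0" "?A h3 \<star> ?B ?g = 0" "?A h3 \<star> ?B k2 = 0"
 "?A h4 \<star> ?B ?g = 0" "?A h4 \<star> ?B k2 = 0"
 by (intro PP0 Pf Pg mk mh P Q N)+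
 have kk: "kap (- ez)*(kap (- ez) * c) = - kap ez/2 * c" for c
 using kap(3)[of "- ez"] ez by (simp flip: mult.assoc) (elim disjE; simp)
 have R: "tz (?A ?f) \<star> tz (?B k) = (- kap ez/2) *s ((- ?A ?f + ?A h2 + ?A h3 + ?A h4) \<star> (?B ?g + (?B k2 + (?B k3 + ?B k4)) - 2 *s ?B k))"
 proof -
 have "(SUM h:Pl f. ?A h) - 2 *s ?A ?f = - ?A ?f + ?A h2 + ?A h3 + ?A h4" unfolding SA by (simp add: vec_eq_iff)
 then show ?thesis unfolding tau_Z[OF f ez Pf] tau_Z[OF g ez k] SB star_scale ssrq kap(1)[OF ez] ssq
 using kk[of 1] by simp
 qed
 have k2: "cnj 2 = (2::complex)" by simp
 have "k = ?g | k = k2 | k = k3 | k = k4" using k unfolding P(1) by blast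
 then have "tz (?A ?f \<star> ?B k) = tz (?A ?f) \<star> tz (?B k)"
 proof (elim disjE)
 assume kk: "k = ?g"
 show ?thesis unfolding R unfolding kk T tau_Z[OF dl ez jm(1)] SJ star_add sarq sdq smq ssrq k2 T T0
 by (simp add: vec_eq_iff field_simps)
 next
 assume kk: "k = k2"
 show ?thesis unfolding R unfolding kk T tau_Z[OF dl ez jm(2)] SJ star_add sarq sdq smq ssrq k2 T T0
 by (simp add: vec_eq_iff field_simps)
 next
 assume kk: "k = k3"
 show ?thesis unfolding R unfolding kk T0(1) tau_0 star_add sarq sdq smq ssrq k2 T T0
 by (simp add: vec_eq_iff field_simps)
 next
 assume kk: "k = k4"
 show ?thesis unfolding R unfolding kk T0(2) tau_0 star_add sarq sdq smq ssrq k2 T T0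
 by (simp add: vec_eq_iff field_simps)
 qed
 then show ?thesis unfolding Zsq True .
 qed
qed
end

section \<open>Mixed products and the automorphism property\<close>

context osec begin
lemma TXoq: assumes "card (bar w Int K) = 2" shows "XV (w \<diamondop> ow) = theta *s XV (w \<diamondop> s (- K))"
proof -
 let ?v = "w \<diamondop> s (- K)"
 have e: "w \<diamondop> ow = ?v \<diamondop> \<Omega>" using Oaq(1)[of w "s (- K)"] by (simp add: ow_def)
 have bO: "bar (?v \<diamondop> \<Omega>) = - bar ?v" by (auto simp: bmq bar_Omega)
 have "bar ?v Int K = bar w Int K" using X_in by (auto simp: bmq)
 then have "card (bar ?v Int K) = 2" using assms by simp
 from Twq[OF this] show ?thesis
 proof
 assume o: "octad (bar ?v)"
 have "card (bar (?v \<diamondop> \<Omega>)) = 16" unfolding bO by (rule cCoq[OF o])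
 then show ?thesis unfolding e by (simp only: XV_16 Ocq Xoq[OF o])
 next
 assume c: "card (bar ?v) = 12"
 have "card (bar (?v \<diamondop> \<Omega>)) = 12" unfolding bO cCq c card_index by simp
 then show ?thesis unfolding e by (simp add: XV_12 c)
 qed
qed
text \<open>A 32-term sum over \<open>B K\<close> meets a 4-term sum over planes. Compared at each
  word \<open>e\<close> of the coset of \<open>d \<diamondop> g\<close>, the claim is the identity
  \<open>main\<close> between the coefficients of the four planes. Once \<open>mW\<close> and
  \<open>tX\<close> express everything by the two signs \<open>t ha\<close> and \<open>t hb\<close>,
  a case check remains.\<close>

lemma mxZq: assumes d: "d : lifts" "card (bar d Int K) = 2" and g: "g : lifts" "card (bar g Int K) = 4"
 and dg: "card (bar d Int bar g Int K) = 2" "card (bar d Int bar g) = 4"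
 and ez: "ez = 1 | ez = - 1" and h: "h : Pl g"
 shows "tz (x_vec d \<star> Z ez g h) = tz (x_vec d) \<star> tz (Z ez g h)"
proof -
 let ?d = "bar d" and ?g = "bar g"
 let ?f = "d \<diamondop> g"
 have bf: "bar ?f = ?d +^ ?g" by (rule bmq)
 have C: "?d : C" "?g : C" "bar ?f : C" by simp_all
 note Pg = Tlq(1)[OF g]
 have od: "octad ?d" using d by (simp add: liq)
 have fl: "?f : lifts" by (rule lmq[OF d(1) g(1) dg(2)])
 have f2: "card (bar ?f Int K) = 2" using csKq[of ?d ?g] d g dg unfolding bf by simp
 have of': "octad (bar ?f)" using fl by (simp add: liq)
 have gK: "?g Int K <= K" by blast
 have hK: "h Int K = ?g Int K" if "h : Pl g" for h using planesD(2)[OF that] .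
 have hg: "?g Int h = ?g Int K" if "h : Pl g" "h ~= ?g" for h using pIq[OF Pg that(1) that(2)[symmetric] g(2)] .
 define bb where "bb h = ?g +^ h" for h
 have bB: "bb h : B K" if "h : Pl g" for h unfolding bb_def using psq[OF Pg that] .
 have sQg: "sQ ?g (bb h) = 1" if h: "h : Pl g" for h
 proof (cases "h = ?g")
 case False
 have "sQ ?g h = 1" using hg[OF h False] g(2) by (simp add: sQ_def)
 moreover have "sT ?g ?g h = 1" using C planesD(3)[OF h] by simp
 ultimately show ?thesis unfolding bb_def using swq(1)[OF C(2,2) planesD(3)[OF h]] ssqd[OF C(2)] by simp
 qed (simp add: bb_def)
 have sTdg: "sT ?d ?g (bb h) = 1" if h: "h : Pl g" for h
 proof (cases "h = ?g")
 case False
 have "?d Int ?g Int h = ?d Int (?g Int K)" unfolding hg[OF h False, symmetric] by (rule Int_assoc)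
 then have "sT ?d ?g h = 1" using dg(1) by (simp add: sT_def Int_assoc)
 then show ?thesis unfolding bb_def using C by (simp add: sT_sd)
 qed (simp add: bb_def)
 have sTge: "sT ?g e (bb h) = 1" if e: "e : B K" and h: "h : Pl g" for e h
 proof (cases "h = ?g")
 case False
 have "?g Int e Int h = (?g Int h) Int e" by blast
 then have "?g Int e Int h = {}" unfolding hg[OF h False] using Int_B[OF e] by blast
 then have "sT ?g e h = 1" by (simp add: sT_def)
 then show ?thesis unfolding bb_def using C Bwq[OF e] by (simp add: sT_sd)
 qed (simp add: bb_def)
 have gX: "sQ ?g (- K) = 1" using cpmq[OF Pg g(2)] by (simp add: sQ_def)
 define sg where "sg h c = sT ?d c (bb h) * sT ?d ?g (bb h) * sQ ?g c" for h c
 have step: "XV (d \<diamondop> s c) \<star> Z ez g h = ((1 + sQ ?d c)/4 * sg h c) *s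
 (XV (?f \<diamondop> s (c +^ bb h)) + (ez * theta) *s XV (?f \<diamondop> s (c +^ bb h +^ - K)))" if c: "c : B K" and h: "h : Pl g" for c h
 proof (cases "sQ ?d c = 1")
 case False
 then have "sQ ?d c = - 1" using sQ_cases by blast
 then show ?thesis using T2_XV(1)[OF od d(2) c] by simp
 next
 case True
 note b = Tbq[OF g h, folded bb_def]
 let ?x = "d \<diamondop> s c" and ?y = "g \<diamondop> s (bb h)"
 have xo: "octad (bar ?x)" and x2: "card (bar ?x Int K) = 2" using T2_XV(2)[OF od d(2) c True] T2_XV(3)[OF od d(2) c] c by (simp_all add: bmq)
 have xl: "?x : lifts" using xo by (simp add: liq)
 have xK: "bar ?x Int K = ?d Int K" using c Int_B(2)[OF c] by (simp add: bmq sd_Int)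
 have n: "bar ?x ~= bar ?y" "bar ?x ~= bar (?y \<diamondop> ow)" using x2 b(4) Tlq(3)[OF b(3,4)] by auto
 have "bar ?x Int bar ?y Int K = (bar ?x Int K) Int (bar ?y Int K)" by blast
 also have "... = ?d Int ?g Int K" unfolding xK b(1) hK[OF h] by blast
 finally have "even (card (bar ?x Int bar ?y Int bar ow))" using dg(1) by simp
 then have a: "?x \<diamondop> (?y \<diamondop> ow) = (?x \<diamondop> ?y) \<diamondop> ow" by (rule aeq[symmetric])
 have G: "G (?x \<diamondop> ?y) = sg h c *s G (?f \<diamondop> s (c +^ bb h))" if "odd_map G" for G
 using oiq[OF that, of d "s c" g "s (bb h)"] c bB[OF h] by (simp add: smqb sg_def)
 have e: "c +^ bb h : B K" using B_sd[OF c bB[OF h]] .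
 have "card (bar (?f \<diamondop> s (c +^ bb h)) Int K) = 2" unfolding bmq[of ?f] bar_s[OF e] using f2 by (simp add: sd_Int Int_B(2)[OF c] Int_B(2)[OF bB[OF h]])
 then have o: "XV ((?f \<diamondop> s (c +^ bb h)) \<diamondop> ow) = theta *s XV (?f \<diamondop> s (c +^ bb h +^ - K))"
 using TXoq Xssqa[OF e X_in, of ?f] sCq(1)[OF e C(3)] by simp
 have "x_vec ?x \<star> Z ez g h = (1/2) *s (XV (?x \<diamondop> ?y) + ez *s XV ((?x \<diamondop> ?y) \<diamondop> ow))"
 unfolding Z_def zv_def bb_def[symmetric] sarq ssrq kap(5)[OF ez] sxxXq[OF xl b(3) n(1)] sxxXq[OF xl Tlq(2)[OF b(3,4)] n(2)] a
 by (simp add: vec_eq_iff field_simps)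
 then show ?thesis unfolding G[OF oXq] G[OF odd_map_right[OF oXq]] o Xoq[OF xo] using True
 by (simp add: ssq vec_eq_iff field_simps)
 qed
 define co where "co h e = (1/4 * sg h (e +^ bb h))*((1 + sQ ?d (e +^ bb h)) + ez * theta*(1 - sQ ?d (e +^ bb h)))" for h e
 have sumc: "(SUM c:B K. XV (d \<diamondop> s c)) \<star> Z ez g h = (SUM e:B K. co h e *s XV (?f \<diamondop> s e))" if h: "h : Pl g" for h
 proof -
 have b: "bb h : B K" "bb h +^ - K : B K" using bB[OF h] B_sd[OF _ X_in] by blast+
 have "(SUM c:B K. XV (d \<diamondop> s c)) \<star> Z ez g h = (SUM c:B K. ((1 + sQ ?d c)/4 * sg h c) *s XV (?f \<diamondop> s (c +^ bb h)))
 + (SUM c:B K. ((1 + sQ ?d c)/4 * sg h c*(ez * theta)) *s XV (?f \<diamondop> s (c +^ (bb h +^ - K))))"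
 unfolding ssqb(1) sum.distrib[symmetric] using step[OF _ h]
 by (intro sum.cong refl) (simp add: vec_eq_iff algebra_simps sd_assoc)
 also have "(SUM c:B K. ((1 + sQ ?d c)/4 * sg h c) *s XV (?f \<diamondop> s (c +^ bb h)))
 = (SUM e:B K. ((1 + sQ ?d (e +^ bb h))/4 * sg h (e +^ bb h)) *s XV (?f \<diamondop> s e))"
 by (subst ssqc[OF b(1)]) (simp add: sd_assoc)
 also have "(SUM c:B K. ((1 + sQ ?d c)/4 * sg h c*(ez * theta)) *s XV (?f \<diamondop> s (c +^ (bb h +^ - K))))
 = (SUM e:B K. ((1 - sQ ?d (e +^ bb h))/4 * sg h (e +^ bb h)*(ez * theta)) *s XV (?f \<diamondop> s e))"
 proof (subst ssqc[OF b(2)], rule sum.cong[OF refl])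
 fix e assume e: "e : B K"
 have eb: "e +^ bb h : B K" using B_sd[OF e b(1)] .
 have q: "sQ ?d (e +^ bb h +^ - K) = - sQ ?d (e +^ bb h)" by (rule Tsfq[OF od d(2) eb])
 have "sT ?g (e +^ bb h) (- K) = 1" by (rule sCq(1)[OF eb C(2)])
 then have "sQ ?g (e +^ bb h +^ - K) = sQ ?g (e +^ bb h)"
 using swq(1)[OF C(2) Bwq[OF eb] Bwq[OF X_in]] gX by simp
 moreover have "sT ?d (e +^ bb h +^ - K) (bb h) = sT ?d (e +^ bb h) (bb h)"
 using sCq(3)[OF b(1) C(1)] by (simp add: sT_sd(2))
 ultimately have r: "sg h (e +^ bb h +^ - K) = sg h (e +^ bb h)" by (simp add: sg_def)
 show "((1 + sQ ?d (e +^ (bb h +^ - K)))/4 * sg h (e +^ (bb h +^ - K))*(ez * theta)) *s XV (?f \<diamondop> s (e +^ (bb h +^ - K) +^ (bb h +^ - K)))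
 = ((1 - sQ ?d (e +^ bb h))/4 * sg h (e +^ bb h)*(ez * theta)) *s XV (?f \<diamondop> s e)"
 unfolding sd_assoc[symmetric, of e "bb h" "- K"] q r by (simp add: sd_assoc)
 qed
 finally show ?thesis unfolding sum.distrib[symmetric]
 by (simp only: co_def) (simp add: vec_eq_iff algebra_simps add_divide_distrib diff_divide_distrib)
 qed
 have dh: "card (?d Int h) = 2 + card (?d Int h Int - K)" "card (?d Int h Int - K) = 0 | card (?d Int h Int - K) = 2" if h: "h : Pl g" for h
 proof -
 have "?d Int h Int K = ?d Int (h Int K)" by blast
 also have "... = ?d Int ?g Int K" unfolding hK[OF h] by blast
 finally show 1: "card (?d Int h) = 2 + card (?d Int h Int - K)" using csq[of "?d Int h" K] dg(1) by simp
 have "?d ~= h" using d(2) hK[OF h] g(2) by auto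
 then show "card (?d Int h Int - K) = 0 | card (?d Int h Int - K) = 2"
 using eIoq[OF od planesD(1)[OF h]] 1 by linarith
 qed
 define n where "n h = card (?d Int h Int - K)" for h
 have dX: "card (?d Int - K) = 6" using csq[of ?d K] d(2) octadD(2)[OF od] by simp
 have n1: "n ?g = 2" using dh(1)[OF Pg] dg(2) by (simp add: n_def)
 \<comment> \<open>Of the six points of \<open>d\<close> off \<open>K\<close> two lie on the plane
   \<open>?g\<close>; the other planes contain 0 or 2 of them, hence 2, 2 and 0.\<close>
 obtain ha hb h0 where P: "Pl g = {?g, ha, hb, h0}" "distinct [?g, ha, hb, h0]" and nn: "n ha = 2" "n hb = 2" "n h0 = 0"
 proof -
 obtain a b c where P: "Pl g = {?g, a, b, c}" "distinct [?g, a, b, c]" by (rule plq[OF K gK g(2) Pg])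
 have m: "a : Pl g" "b : Pl g" "c : Pl g" unfolding P(1) by simp_all
 have "(SUM h:Pl g. n h) = 6" using pcq[OF K gK g(2), of ?d] dX by (simp add: n_def)
 then have "n ?g + (n a + (n b + n c)) = 6" using P by simp
 then consider "n a = 2" "n b = 2" "n c = 0" | "n a = 2" "n c = 2" "n b = 0" | "n b = 2" "n c = 2" "n a = 0"
 using n1 dh(2)[OF m(1), folded n_def] dh(2)[OF m(2), folded n_def] dh(2)[OF m(3), folded n_def] by linarith
 then show ?thesis
 proof cases
 case 1 then show ?thesis by (rule that[OF P])
 next
 case 2
 have "Pl g = {?g, a, c, b}" unfolding P(1) by (simp add: insert_commute)
 moreover have "distinct [?g, a, c, b]" using P(2) by auto
 ultimately show ?thesis by (rule that[OF _ _ 2])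
 next
 case 3
 have "Pl g = {?g, b, c, a}" unfolding P(1) by (simp add: insert_commute)
 moreover have "distinct [?g, b, c, a]" using P(2) by auto
 ultimately show ?thesis by (rule that[OF _ _ 3])
 qed
 qed
 have m: "ha : Pl g" "hb : Pl g" "h0 : Pl g" unfolding P(1) by simp_all
 have dis: "ha ~= ?g" "hb ~= ?g" "h0 ~= ?g" "ha ~= hb" "ha ~= h0" "hb ~= h0" using P(2) by auto
 have sQdg: "sQ ?d ?g = 1" using dg(2) by (simp add: sQ_def)
 have q: "sQ ?d (bb h) = (if n h = 2 then 1 else - 1)" if h: "h : Pl g" for h
 proof (cases "h = ?g")
 case False
 have "sT ?d ?g h = 1" using sTdg[OF h] C by (simp add: bb_def sT_sd)
 moreover have "sQ ?d h = (if n h = 2 then 1 else - 1)"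
 using dh[OF h] by (auto simp: sQ_def n_def)
 ultimately show ?thesis unfolding bb_def using swq(1)[OF C(1,2) planesD(3)[OF h]] sQdg by simp
 qed (simp add: bb_def n1)
 have tX: "sT ?d e (bb h0) = sT ?d e (bb ha) * sT ?d e (bb hb)" if e: "e : B K" for e
 proof -
 have "sT ?d e (bb ha +^ (bb hb +^ bb h0)) = 1"
 proof -
 have "?d Int e Int (bb ha +^ (bb hb +^ bb h0)) = ?d Int e"
 proof (rule Set.set_eqI)
 fix x
 have "x : bb ha +^ (bb hb +^ bb h0)" if xK: "x ~: K"
 proof -
 obtain h where h: "h : Pl g" "x : h" using peq[OF K gK g(2) xK] .
 have i: "~ (x : u & x : v)" if "u : Pl g" "v : Pl g" "u ~= v" for u v
 using pIq[OF that g(2)] \<open>x ~: K\<close> by blast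
 have "x : ?g | x : ha | x : hb | x : h0" using h unfolding P(1) by blast
 then show ?thesis unfolding bb_def msqb
 using i[OF m(1) Pg dis(1)] i[OF m(2) Pg dis(2)] i[OF m(3) Pg dis(3)] i[OF m(1,2) dis(4)] i[OF m(1,3) dis(5)] i[OF m(2,3) dis(6)] by blast
 qed
 moreover have "x ~: K" if "x : e" using that Int_B[OF e] by blast
 ultimately show "x : ?d Int e Int (bb ha +^ (bb hb +^ bb h0)) \<longleftrightarrow> x : ?d Int e" by blast
 qed
 then show ?thesis using eIq[OF C(1) Bwq[OF e]] by (simp add: sT_def)
 qed
 then have "sT ?d e (bb ha)*(sT ?d e (bb hb) * sT ?d e (bb h0)) = 1" by (simp add: sT_sd)
 then show ?thesis using scqc[of ?d e "bb ha"] scqc[of ?d e "bb hb"] scqc[of ?d e "bb h0"] by auto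
 qed
 have tg: "sT ?d ?g e = sT ?d e (bb h0)" if e: "e : B K" for e
 proof -
 have "?d Int h0 Int - K = {}" using nn(3) by (simp add: n_def)
 then have "?d Int e Int h0 = {}" using Int_B[OF e] by blast
 then have "sT ?d e h0 = 1" by (simp add: sT_def)
 then show ?thesis unfolding bb_def by (simp add: sT_sd spq(2)[of ?d e ?g])
 qed
 \<comment> \<open>The subgroup \<open>A\<close> generated by \<open>?a\<close>, \<open>?b\<close>
   and \<open>- K\<close> has order 8, as has the common kernel \<open>W\<close> of the two
   characters, so they are equal; on \<open>A\<close> the sign is 1. Conversely, sign 1 forces every
   plane off \<open>K\<close> to lie inside \<open>e\<close> or to miss it, which makes both
   characters trivial at \<open>e\<close>.\<close>
 have mW: "(sQ ?g e = 1) = (sT ?d e (bb ha) = 1 & sT ?d e (bb hb) = 1)" if e: "e : B K" for e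
 proof -
 let ?a = "bb ha" and ?b = "bb hb"
 have aB: "?a : B K" "?b : B K" using bB m by blast+
 define W where "W = {e : B K. sT ?d e ?a = 1 & sT ?d e ?b = 1}"
 define A0 where "A0 = {{}, ?a, ?b, ?a +^ ?b}"
 define A where "A = A0 Un (%u. u +^ - K) ` A0"
 have oo: "octad ?a" "octad ?b" "octad (?a +^ ?b)"
 proof -
 show "octad ?a" "octad ?b" unfolding bb_def using psoq[OF Pg m(1) _ g(2)] psoq[OF Pg m(2) _ g(2)] dis by auto
 have "?a +^ ?b = ha +^ hb" unfolding bb_def by (auto simp: sd_def)
 then show "octad (?a +^ ?b)" using psoq[OF m(1,2) dis(4) g(2)] by simp
 qed
 have abT: "sT ?d ?a ?b = 1"
 proof -
 have "sT ?d ha ?g = 1" using sTdg[OF m(1)] C by (simp add: bb_def sT_sd spq(2)[of ?d ha])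
 moreover have "?d Int ha Int hb = ?d Int (ha Int hb)" by blast
 then have "sT ?d ha hb = 1" unfolding pIq[OF m(1,2) dis(4) g(2)] using dg(1) by (simp add: sT_def Int_assoc)
 ultimately have "sT ?d ha ?b = 1" unfolding bb_def by (simp add: sT_sd)
 moreover have "sT ?d ?a ?b = sT ?d ?g ?b * sT ?d ha ?b" unfolding bb_def[of ha] by (simp add: sT_sd)
 ultimately show ?thesis using sTdg[OF m(2)] by simp
 qed
 have hom: "B_hom K (%e. sT ?d e c)" for c    proof -
 have "(%e. sT ?d e c) = sT ?d c" by (rule ext) (rule spq(2))
 then show ?thesis using Bhsq[of K ?d c] by simp
 qed
 have zero: "(SUM e:B K. sT ?d e c) = 0" if c: "c : B K" "octad c" for c
 proof -
 have "c ~= {}" "c ~= - K" using c(2) onCq[OF K c(2)] by (auto simp: octad_def)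
 then obtain b where b: "b : B K" "sT ?d c b ~= 1" using Trq[OF K od d(2) c(1)] by blast
 then have "sT ?d b c = - 1" using scqc[of ?d c b] by (simp add: spq(2)[of ?d b c])
 then show ?thesis by (rule sBhq[OF hom b(1)])
 qed
 have "(of_nat (card W) :: complex) = (SUM e:B K. if sT ?d e ?a = 1 & sT ?d e ?b = 1 then 1 else 0)"
 by (simp add: W_def sum.inter_filter[symmetric])
 also have "... = (SUM e:B K. 1/4 + sT ?d e ?a/4 + sT ?d e ?b/4 + sT ?d e (?a +^ ?b)/4)"
 proof (intro sum.cong refl)
 fix e
 show "(if sT ?d e ?a = 1 & sT ?d e ?b = 1 then 1 else 0) = 1/4 + sT ?d e ?a/4 + sT ?d e ?b/4 + sT ?d e (?a +^ ?b)/4"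
 using scqc[of ?d e ?a] scqc[of ?d e ?b] by (auto simp: sT_sd)
 qed
 also have "... = 8" unfolding sum.distrib sum_divide_distrib[symmetric] zero[OF aB(1) oo(1)] zero[OF aB(2) oo(2)] zero[OF B_sd[OF aB] oo(3)]
 by (simp add: cBq[OF K])
 finally have cW: "card W = 8" by (metis of_nat_eq_iff of_nat_numeral)
 have E: "{} ~= ?a" "{} ~= ?b" "?a ~= ?b" using oo by (auto simp: octad_def)
 have nX: "u ~= - K" if "octad u" for u using onCq[OF K that] .
 have cA: "card A = 8"
 proof -
 have e: "{} +^ u = u" "u +^ {} = u" "(u +^ v) +^ v = u" "(u +^ v) +^ u = v" "v +^ (u +^ v) = u" "v +^ u = u +^ v" for u v :: "'i set"
 by (auto simp: sd_def)
 have nab: "?a +^ ?b ~= {}" "?a +^ ?b ~= ?a" "?a +^ ?b ~= ?b"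
 using E seeq[of ?a ?b] siq[of ?a ?b "{}"] siq[of ?b ?a "{}"] by (simp_all add: e(2) e(6)[of ?b ?a])
 have c0: "card A0 = 4" unfolding A0_def using E nab by (simp add: card_insert_if eq_commute)
 have cl: "u +^ v : A0" if "u : A0" "v : A0" for u v
 using that unfolding A0_def by (elim insertE emptyE) (simp_all add: e(1-5) e(6)[of ?b ?a])
 have n0: "u ~= - K" if "u : A0" for u
 using that nX[OF oo(1)] nX[OF oo(2)] nX[OF oo(3)] Cneq[OF K] unfolding A0_def by (elim insertE emptyE) simp_all
 have "A0 Int (%u. u +^ - K) ` A0 = {}"
 proof (rule ccontr)
 assume "A0 Int (%u. u +^ - K) ` A0 ~= {}"
 then obtain u where u: "u : A0" "u +^ - K : A0" by blast
 have "u +^ (u +^ - K) : A0" by (rule cl[OF u])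
 then show False using n0[of "- K"] by simp
 qed
 moreover have "inj_on (%u. u +^ - K) A0" by (intro inj_onI) (metis e(3))
 then have "card ((%u. u +^ - K) ` A0) = 4" using card_image c0 by fastforce
 ultimately show ?thesis unfolding A_def using card_Un_disjoint[of A0 "(%u. u +^ - K) ` A0"] c0 by simp
 qed
 have Xt: "sT ?d (- K) ?a = 1" "sT ?d (- K) ?b = 1" using sCq(3)[OF aB(1) C(1)] sCq(3)[OF aB(2) C(1)] .
 have rep: "sT ?d ?a ?a = 1" "sT ?d ?b ?b = 1" "sT ?d ?b ?a = 1" using C Bwq[OF aB(1)] Bwq[OF aB(2)] abT spq(2)[of ?d ?b ?a] by simp_all
 have AW: "A <= W"
 unfolding A_def A0_def W_def using aB X_in B_sd abT Xt rep by (simp add: sT_sd)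
 then have WA: "A = W" using card_subset_eq[of W A] cW cA by simp
 have mA: "sQ ?g e = 1" if "e : A"
 proof -
 note q1 = sQg[OF m(1)] sQg[OF m(2)] gX
 have "sT ?g ?a ?b = 1" using sTge[OF aB(1) m(2)] .
 then have ab1: "sQ ?g (?a +^ ?b) = 1" using swq(1)[OF C(2) Bwq[OF aB(1)] Bwq[OF aB(2)]] q1 by simp
 have q0: "sQ ?g u = 1 & u : B K" if "u : A0" for u
 using that ab1 q1 aB B_sd[OF aB] unfolding A0_def by (elim insertE emptyE) simp_all
 have "sQ ?g (u +^ - K) = 1" if "u : A0" for u
 using q0[OF that] gX sCq(1)[of u K ?g, OF _ C(2)] swq(1)[OF C(2) Bwq[of u K] Bwq[OF X_in]] by simp
 then show ?thesis using that q0 unfolding A_def by blast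
 qed
 have "e : W" if m1: "sQ ?g e = 1"
 proof -
 have t: "even (card (?d Int e Int h))" if h: "h : Pl g" for h
 proof -
 have "sQ h e = 1"
 proof -
 have "h = ?g +^ bb h" by (simp add: bb_def)
 then have "sQ h e = sQ ?g e * sQ (bb h) e * sT ?g (bb h) e" using swq(2)[OF Bwq[OF e] C(2) Bwq[OF bB[OF h]]] by simp
 then show ?thesis using m1 sQ_B[OF K bB[OF h] e] sTge[OF e h] spq(2)[of ?g "bb h" e] by simp
 qed
 moreover have he: "h Int e = (h Int - K) Int e" using Int_B[OF e] by blast
 moreover have "card ((h Int - K) Int e) + card ((h Int - K) Int - e) = 4" using csq[of "h Int - K" e] cpmq[OF h g(2)] by simp
 moreover have "even (card (h Int e))" using eIq[OF planesD(3)[OF h] Bwq[OF e]] .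
 ultimately have "card ((h Int - K) Int e) = 0 | card ((h Int - K) Int - e) = 0"
 proof -
 assume a: "sQ h e = 1" "h Int e = (h Int - K) Int e" "card ((h Int - K) Int e) + card ((h Int - K) Int - e) = 4" "even (card (h Int e))"
 have "card (h Int e) = 0 | card (h Int e) = 2 | card (h Int e) = 4" using a(2,3,4) by presburger
 moreover have "card (h Int e) ~= 2" using a(1) by (auto simp: sQ_def)
 ultimately show ?thesis using a(2,3) by force
 qed
 then have "(h Int - K) Int e = {} | (h Int - K) Int - e = {}" by simp
 then have "?d Int e Int h = {} | ?d Int e Int h = ?d Int h Int - K" using Int_B[OF e] by blast
 then show ?thesis using dh(2)[OF h] by auto
 qed
 have "sT ?d e h = 1" if "h : Pl g" for h using t[OF that] by (simp add: sT_def)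
 then show ?thesis unfolding W_def bb_def using e Pg m by (simp add: sT_sd)
 qed
 then show ?thesis using mA WA e unfolding W_def by blast
 qed
 have main: "cnj (kap ez)*(SUM h':Pl g. wt h h' * co h' e) = 1/4*(sT ?d e (bb h)*((1 + sQ ?d (bb h)) - ez * theta*(1 - sQ ?d (bb h))))"
 if e: "e : B K" "sQ (bar ?f) e = 1" and h: "h : Pl g" for h e
 proof -
 define t where "t h = sT ?d e (bb h)" for h
 define mm where "mm = sQ ?g e"
 have "sQ (bar ?f) e = sQ ?d e * mm * sT ?d ?g e" unfolding bf mm_def by (rule swq(2)) (use C Bwq[OF e(1)] in auto)
 then have "sQ ?d e*(mm * t h0) = 1" using e tg[OF e(1)] by (simp add: t_def mult.assoc)
 then have de: "sQ ?d e = mm * t h0"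
 using sQ_cases[of ?d e] sQ_cases[of ?g e] scqc[of ?d e "bb h0"] unfolding mm_def t_def by auto
 have cs: "co h e = (1/4*(mm * t h))*((1 + mm * t h0 * sQ ?d (bb h) * t h) + ez * theta*(1 - mm * t h0 * sQ ?d (bb h) * t h))" if h: "h : Pl g" for h
 proof -
 have bw: "bb h : C" using Bwq[OF bB[OF h]] .
 have "sT ?d (e +^ bb h) (bb h) = t h" using C bw by (simp add: sT_sd t_def)
 moreover have "sQ ?g (e +^ bb h) = mm" using swq(1)[OF C(2) Bwq[OF e(1)] bw] sQg[OF h] sTge[OF e(1) h] by (simp add: mm_def)
 ultimately have "sg h (e +^ bb h) = mm * t h" using sTdg[OF h] by (simp add: sg_def)
 moreover have "sQ ?d (e +^ bb h) = mm * t h0 * sQ ?d (bb h) * t h"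
 using swq(1)[OF C(1) Bwq[OF e(1)] bw] de by (simp add: t_def)
 ultimately show ?thesis by (simp add: co_def)
 qed
 have t1: "t ?g = 1" by (simp add: t_def bb_def)
 have t0: "t h0 = t ha * t hb" using tX[OF e(1)] by (simp add: t_def)
 have qq: "sQ ?d (bb ?g) = 1" "sQ ?d (bb ha) = 1" "sQ ?d (bb hb) = 1" "sQ ?d (bb h0) = - 1" using q[OF Pg] q[OF m(1)] q[OF m(2)] q[OF m(3)] n1 nn by simp_all
 have S: "(SUM h':Pl g. wt h h' * co h' e) = wt h ?g * co ?g e + (wt h ha * co ha e + (wt h hb * co hb e + wt h h0 * co h0 e))"
 unfolding P(1) using dis by simp
 have tc: "t ha = 1 | t ha = - 1" "t hb = 1 | t hb = - 1" unfolding t_def by (rule scqc)+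
 have mm: "mm = (if t ha = 1 & t hb = 1 then 1 else - 1)" using mW[OF e(1)] sQ_cases[of ?g e] unfolding mm_def t_def by auto
 have kc: "cnj (kap ez) = (1 - ez * theta)/4" using kap(1)[OF ez] by (simp add: kap_def)
 have "h = ?g | h = ha | h = hb | h = h0" using h unfolding P(1) by blast
 then show ?thesis
 proof (elim disjE)
 assume hh: "h = ?g"
 have w: "wt h ?g = - 1" "wt h ha = 1" "wt h hb = 1" "wt h h0 = 1" "sT ?d e (bb h) = 1" "sQ ?d (bb h) = 1"
 using dis qq t1 unfolding hh wt_def t_def by simp_all
 show ?thesis unfolding S w cs[OF Pg] cs[OF m(1)] cs[OF m(2)] cs[OF m(3)] qq t1 t0 kc
 using tc ez mm by (elim disjE) (simp_all add: field_simps)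
 next
 assume hh: "h = ha"
 have w: "wt h ?g = 1" "wt h ha = - 1" "wt h hb = 1" "wt h h0 = 1" "sT ?d e (bb h) = t ha" "sQ ?d (bb h) = 1"
 using dis qq unfolding hh wt_def t_def by auto
 show ?thesis unfolding S w cs[OF Pg] cs[OF m(1)] cs[OF m(2)] cs[OF m(3)] qq t1 t0 kc
 using tc ez mm by (elim disjE) (simp_all add: field_simps)
 next
 assume hh: "h = hb"
 have w: "wt h ?g = 1" "wt h ha = 1" "wt h hb = - 1" "wt h h0 = 1" "sT ?d e (bb h) = t hb" "sQ ?d (bb h) = 1"
 using dis qq unfolding hh wt_def t_def by auto
 show ?thesis unfolding S w cs[OF Pg] cs[OF m(1)] cs[OF m(2)] cs[OF m(3)] qq t1 t0 kc
 using tc ez mm by (elim disjE) (simp_all add: field_simps)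
 next
 assume hh: "h = h0"
 have w: "wt h ?g = 1" "wt h ha = 1" "wt h hb = 1" "wt h h0 = - 1" "sT ?d e (bb h) = t ha * t hb" "sQ ?d (bb h) = - 1"
 using dis qq t0 unfolding hh wt_def by (auto simp: t_def)
 show ?thesis unfolding S w cs[OF Pg] cs[OF m(1)] cs[OF m(2)] cs[OF m(3)] qq t1 t0 kc
 using tc ez mm by (elim disjE) (simp_all add: field_simps)
 qed
 qed
 have L: "tz (x_vec d) \<star> tz (Z ez g h) = (1/4) *s (SUM e:B K. (cnj (kap ez)*(SUM h':Pl g. wt h h' * co h' e)) *s XV (?f \<diamondop> s e))"
 proof -
 have "(SUM c:B K. XV (d \<diamondop> s c)) \<star> (SUM h':Pl g. wt h h' *s Z ez g h') = (SUM h':Pl g. SUM e:B K. (wt h h' * co h' e) *s XV (?f \<diamondop> s e))"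
 unfolding ssqb(2)
 by (rule sum.cong[OF refl]) (simp only: ssrq sumc wt_sq ssqa[symmetric] ssq)
 also have "... = (SUM e:B K. (SUM h':Pl g. wt h h' * co h' e) *s XV (?f \<diamondop> s e))"
 by (subst sum.swap) (simp only: sslq)
 finally show ?thesis unfolding tTq[OF d] tZwq[OF g ez h] star_scale ssrq
 by (simp add: ssq flip: ssqa)
 qed
 have b: "bb h : B K" "bb h +^ - K : B K" using bB[OF h] B_sd[OF _ X_in] by blast+
 have sf: "sQ (bar ?f) (bb h) = sQ ?d (bb h)"
 unfolding bf using swq(2)[OF Bwq[OF b(1)] C(1,2)] sQg[OF h] sTdg[OF h] by simp
 have tf: "sT (bar ?f) (bb h) e = sT ?d e (bb h)" if e: "e : B K" for e
 unfolding bf using sTge[OF e h] by (simp add: sT_sd spq(2)[of _ "bb h" e])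
 have R0: "x_vec d \<star> Z ez g h = (1/2) *s (XV (?f \<diamondop> s (bb h)) + (ez * theta) *s XV (?f \<diamondop> s (bb h +^ - K)))"
 using step[OF Beq h] sTdg[OF h] od by (simp add: seq unit_right Xoq sg_def sd_def)
 have R: "tz (x_vec d \<star> Z ez g h) = (1/16) *s (SUM e:B K. (sT ?d e (bb h)*((1 + sQ ?d (bb h)) - ez * theta*(1 - sQ ?d (bb h)))) *s XV (?f \<diamondop> s e))"
 proof -
 have 1: "tz (XV (?f \<diamondop> s (bb h))) = (SUM e:B K. ((1 + sQ ?d (bb h))/8 * sT ?d e (bb h)) *s XV (?f \<diamondop> s e))"
 unfolding tTXq[OF of' f2 b(1)] sf using tf by (intro sum.cong refl) simp
 have "sQ (bar ?f) (bb h +^ - K) = - sQ ?d (bb h)" using Tsfq[OF of' f2 b(1)] sf by simp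
 moreover have "sT (bar ?f) (bb h +^ - K) e = sT ?d e (bb h)" if e: "e : B K" for e
 using tf[OF e] sCq(3)[OF e C(3)] by (simp add: sT_sd)
 ultimately have 2: "tz (XV (?f \<diamondop> s (bb h +^ - K))) = (SUM e:B K. ((1 - sQ ?d (bb h))/8 * sT ?d e (bb h)) *s XV (?f \<diamondop> s e))"
 unfolding tTXq[OF of' f2 b(2)] by (intro sum.cong refl) simp
 have "tz (x_vec d \<star> Z ez g h) = (1/2) *s ((SUM e:B K. ((1 + sQ ?d (bb h))/8 * sT ?d e (bb h)) *s XV (?f \<diamondop> s e))
 + (- ez * theta) *s (SUM e:B K. ((1 - sQ ?d (bb h))/8 * sT ?d e (bb h)) *s XV (?f \<diamondop> s e)))"
 unfolding R0 tsq taq 1 2 using kap(5)[OF ez] by (simp add: tcq)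
 also have "... = (1/16) *s (SUM e:B K. (sT ?d e (bb h)*((1 + sQ ?d (bb h)) - ez * theta*(1 - sQ ?d (bb h)))) *s XV (?f \<diamondop> s e))"
 unfolding ssqa[symmetric] sum.distrib[symmetric] by (intro sum.cong refl) (simp add: vec_eq_iff field_simps)
 finally show ?thesis .
 qed
 have pe: "(cnj (kap ez)*(SUM h':Pl g. wt h h' * co h' e)) *s XV (?f \<diamondop> s e)
 = (1/4*(sT ?d e (bb h)*((1 + sQ ?d (bb h)) - ez * theta*(1 - sQ ?d (bb h))))) *s XV (?f \<diamondop> s e)" if e: "e : B K" for e
 using main[OF e _ h] T2_XV(1)[OF of' f2 e] sQ_cases[of "bar ?f" e] by auto
 have "tz (x_vec d) \<star> tz (Z ez g h) = (1/4) *s (SUM e:B K. (1/4*(sT ?d e (bb h)*((1 + sQ ?d (bb h)) - ez * theta*(1 - sQ ?d (bb h))))) *s XV (?f \<diamondop> s e))"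
 unfolding L by (intro arg_cong[where f="%v. (1/4) *s v"] sum.cong refl pe)
 also have "... = (1/16) *s (SUM e:B K. (sT ?d e (bb h)*((1 + sQ ?d (bb h)) - ez * theta*(1 - sQ ?d (bb h)))) *s XV (?f \<diamondop> s e))"
 unfolding ssqa[symmetric] ssq by (intro sum.cong refl) simp
 finally show ?thesis unfolding R by (rule sym)
qed
lemma Slq: assumes d: "d : lifts" and n: "card (bar d Int K) ~= 2" "card (bar d Int K) ~= 4" shows "x_vec d : S"
proof -
 have neg: "x_vec (neg e) : S" if "x_vec e : S" for e
 using Ssq[OF that, of "- 1"] by (simp add: x_vec_neg flip: smqa)
 show ?thesis using d
 proof (cases rule: lcq)
 case ow then show ?thesis using S_ow neg by blast
 next
 case (b b) then show ?thesis using S_s neg by blast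
 qed (use n in simp_all)
qed
definition mu where "mu a b \<longleftrightarrow> tz (a \<star> b) = tz a \<star> tz b"
lemma msq: "mu a b \<longleftrightarrow> mu b a" by (simp add: mu_def star_commute)
lemma maq: "mu a b ==> mu a c ==> mu a (b + c)" by (simp add: mu_def sarq taq)
lemma msqa: "mu a b ==> mu a (c *s b)" by (simp add: mu_def ssrq tsq)
lemma x_zv: "x_vec g = (1/2) *s (zv 1 g + zv (- 1) g)" "x_vec (g \<diamondop> ow) = (1/2) *s (zv 1 g + (- 1) *s zv (- 1) g)"
 by (simp_all add: zv_def vec_eq_iff)
lemma mu_zv: assumes "mu a (zv 1 g)" "mu a (zv (- 1) g)" shows "mu a (x_vec g)" "mu a (x_vec (g \<diamondop> ow))"
 apply (subst x_zv(1), intro msqa maq assms)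
 apply (subst x_zv(2), intro msqa maq assms)
 done
lemma mzq: assumes "!!ez dz. ez = 1 | ez = - 1 ==> dz = 1 | dz = - 1 ==> mu (zv ez f) (zv dz g)"
 shows "mu (x_vec f) (x_vec g)" "mu (x_vec f) (x_vec (g \<diamondop> ow))"
proof -
 have "mu (zv ez f) (x_vec g) & mu (zv ez f) (x_vec (g \<diamondop> ow))" if "ez = 1 | ez = - 1" for ez
 using mu_zv[OF assms[OF that] assms[OF that]] by simp
 then have "mu (x_vec g) (zv ez f) & mu (x_vec (g \<diamondop> ow)) (zv ez f)" if "ez = 1 | ez = - 1" for ez
 using that msq by blast
 then show "mu (x_vec f) (x_vec g)" "mu (x_vec f) (x_vec (g \<diamondop> ow))"
 using mu_zv(1)[of "x_vec g" f] mu_zv(1)[of "x_vec (g \<diamondop> ow)" f] msq by simp_all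
qed
text \<open>The preceding cases require four common points. Some plane of the class of
  \<open>g\<close> meets \<open>d\<close> off \<open>K\<close>; with the two common points on
  \<open>K\<close> this gives at least three, hence four. By \<open>Tbq\<close> this plane can
  replace \<open>bar g\<close> as base point.\<close>

lemma mpq: assumes g: "g : lifts" "card (bar g Int K) = 4" and d: "octad d" "card (d Int bar g Int K) = 2" "0 < card (d Int - K)"
 and ne: "d Int K ~= bar g Int K"
 obtains k where "k : Pl g" "card (d Int k) = 4" "d Int k Int K = d Int bar g Int K"
proof -
 have "card (d Int - K) = (SUM h:Pl g. card (d Int h Int - K))" by (rule pcq[OF K _ g(2)]) blast
 then have "(SUM h:Pl g. card (d Int h Int - K)) ~= 0" using d(3) by linarith
 then obtain k where k: "k : Pl g" "card (d Int k Int - K) ~= 0" by (meson sum.neutral)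
 have "d Int k Int K = d Int (k Int K)" by blast
 then have e: "d Int k Int K = d Int bar g Int K" unfolding planesD(2)[OF k(1)] by blast
 have "card (d Int k) = card (d Int k Int K) + card (d Int k Int - K)" by (rule csq)
 then have "card (d Int k) >= 3" unfolding e using d(2) k(2) by linarith
 moreover have "d ~= k" using ne planesD(2)[OF k(1)] by auto
 ultimately have "card (d Int k) = 4" using eIoq[OF d(1) planesD(1)[OF k(1)]] by linarith
 then show ?thesis using that k e by blast
qed
lemma mTT2q: assumes d: "d : lifts" "card (bar d Int K) = 2" and g: "g : lifts" "card (bar g Int K) = 4"
 and dg: "card (bar d Int bar g Int K) = 2"
 shows "mu (x_vec d) (x_vec g)" "mu (x_vec d) (x_vec (g \<diamondop> ow))"
proof -
 have o: "octad (bar d)" using d by (simp add: liq)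
 have X: "0 < card (bar d Int - K)" using csq[of "bar d" K] d(2) octadD(2)[OF o] by simp
 obtain k where k: "k : Pl g" "card (bar d Int k) = 4" "bar d Int k Int K = bar d Int bar g Int K"
 by (rule mpq[OF g o dg X]) (use d g in auto)
 note b = Tbq[OF g k(1)]
 have gP: "bar g : Pl g" by (rule Tlq(1)[OF g])
 have z: "mu (x_vec d) (zv ez g)" if ez: "ez = 1 | ez = - 1" for ez
 proof -
 have "mu (x_vec d) (Z ez (g \<diamondop> s (bar g +^ k)) (bar g))"
 unfolding mu_def by (rule mxZq[OF d b(3,4) _ _ ez]) (simp_all only: b(1,2) k dg gP planesD(2)[OF k(1)])
 then show ?thesis unfolding b(5)[OF gP] Zsq .
 qed
 show "mu (x_vec d) (x_vec g)" "mu (x_vec d) (x_vec (g \<diamondop> ow))" using mu_zv[OF z z] by simp_all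
qed
lemma cIoq: "card (d Int bar (g \<diamondop> ow) Int K) + card (d Int bar g Int K) = card (d Int K)"
proof -
 have "d Int bar (g \<diamondop> ow) Int K = (d Int K) Int - bar g" by (auto simp: bmq)
 moreover have "d Int bar g Int K = (d Int K) Int bar g" by blast
 ultimately show ?thesis using csq[of "d Int K" "bar g"] by simp
qed
lemma mTTqa: assumes d: "d : lifts" "card (bar d Int K) = 2" and g: "g : lifts" "card (bar g Int K) = 4"
 and dg: "card (bar d Int bar g Int K) = 2 | card (bar d Int bar g Int K) = 0"
 shows "mu (x_vec d) (x_vec g)"
 using dg
proof
 assume "card (bar d Int bar g Int K) = 2" then show ?thesis using mTT2q[OF d g] by blast
next
 assume "card (bar d Int bar g Int K) = 0"
 then have "card (bar d Int bar (g \<diamondop> ow) Int K) = 2" using cIoq[of "bar d" g] d(2) by simp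
 from mTT2q(2)[OF d Tlq(2,3)[OF g] this] show ?thesis by simp
qed
lemma mTTq: assumes f: "f : lifts" "card (bar f Int K) = 4" and g: "g : lifts" "card (bar g Int K) = 4"
 and fg: "card (bar f Int bar g Int K) = 1 | card (bar f Int bar g Int K) = 2 | card (bar f Int bar g Int K) = 3"
 shows "mu (x_vec f) (x_vec g)"
 using fg
proof (elim disjE)
 assume "card (bar f Int bar g Int K) = 1"
 then have "card (bar f Int bar (g \<diamondop> ow) Int K) = 3" using cIoq[of "bar f" g] f(2) by simp
 note z = mzoq[OF f Tlq(2,3)[OF g] this]
 show ?thesis using mzq(2)[of f "g \<diamondop> ow"] z unfolding mu_def by simp
next
 assume "card (bar f Int bar g Int K) = 3"
 note z = mzoq[OF f g this]
 show ?thesis using mzq(1)[of f g] z unfolding mu_def by simp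
next
 assume fg: "card (bar f Int bar g Int K) = 2"
 have o: "octad (bar f)" using f by (simp add: liq)
 have X: "0 < card (bar f Int - K)" using csq[of "bar f" K] f(2) octadD(2)[OF o] by simp
 have ne: "bar f Int K ~= bar g Int K"
 proof
 assume "bar f Int K = bar g Int K"
 then have "bar f Int bar g Int K = bar f Int K" by blast
 then show False using fg f by simp
 qed
 obtain k where k: "k : Pl g" "card (bar f Int k) = 4" "bar f Int k Int K = bar f Int bar g Int K"
 by (rule mpq[OF g o fg X ne])
 note b = Tbq[OF g k(1)]
 have gP: "bar g : Pl g" by (rule Tlq(1)[OF g])
 have "mu (zv ez f) (zv dz g)" if ez: "ez = 1 | ez = - 1" and dz: "dz = 1 | dz = - 1" for ez dz
 proof -
 have "mu (zv ez f) (Z dz (g \<diamondop> s (bar g +^ k)) (bar g))"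
 unfolding mu_def by (rule mZeq[OF f b(3,4) _ _ ez dz]) (simp_all only: b(1,2) k fg gP planesD(2)[OF k(1)])
 then show ?thesis unfolding b(5)[OF gP] Zsq .
 qed
 then show ?thesis by (rule mzq(1))
qed
text \<open>By \<open>Slq\<close> only octads meeting \<open>K\<close> in 2 or 4 points are left,
  and by \<open>Fwq\<close> their traces may be assumed to add up to \<open>{}\<close> or
  \<open>K\<close>. This ties the pairwise intersections on \<open>K\<close> to the sizes of the
  traces, and in each of the eight size patterns some pair is covered by \<open>mTTqb\<close>,
  \<open>mTTqa\<close> or \<open>mTTq\<close>.\<close>

lemma F3_x: assumes d: "d : lifts" "f : lifts" "g : lifts" shows "F3 (x_vec d) (x_vec f) (x_vec g)"
proof -
 note V = VV_x[OF d(1)] VV_x[OF d(2)] VV_x[OF d(3)]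
 have m: "F3 (x_vec d) (x_vec f) (x_vec g)" if "mu (x_vec d) (x_vec f) | mu (x_vec d) (x_vec g) | mu (x_vec f) (x_vec g)"
 using that
 proof (elim disjE)
 assume "mu (x_vec d) (x_vec f)" then show ?thesis using Fmq[OF _ V(3)] by (simp add: mu_def)
 next
 assume "mu (x_vec d) (x_vec g)"
 then have "F3 (x_vec d) (x_vec g) (x_vec f)" using Fmq[OF _ V(2)] by (simp add: mu_def)
 then show ?thesis using Fsqa(2)[OF V] by blast
 next
 assume "mu (x_vec f) (x_vec g)"
 then have "F3 (x_vec f) (x_vec g) (x_vec d)" using Fmq[OF _ V(1)] by (simp add: mu_def)
 then have "F3 (x_vec f) (x_vec d) (x_vec g)" using Fsqa(2)[OF V(2,3,1)] by blast
 then show ?thesis using Fsqa(1) by blast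
 qed
 have Sm: "mu a b" if "a : S" "b : VV" for a b using that by (simp add: S_def mu_def)
 have c: "card (bar h Int K) = 2 | card (bar h Int K) = 4 | x_vec h : S" if "h : lifts" for h using Slq[OF that] by blast
 show ?thesis
 proof (cases "x_vec d : S | x_vec f : S")
 case True then show ?thesis using m Sm V msq by blast
 next
 case n1: False
 show ?thesis
 proof (cases "x_vec g : S")
 case True then show ?thesis using m Sm V msq by blast
 next
 case False
 then have cc: "card (bar d Int K) = 2 | card (bar d Int K) = 4" "card (bar f Int K) = 2 | card (bar f Int K) = 4"
 "card (bar g Int K) = 2 | card (bar g Int K) = 4" using c d n1 by blast+
 show ?thesis
 proof (cases "(bar d +^ bar f +^ bar g) Int K = {} | (bar d +^ bar f +^ bar g) Int K = K")
 case False then show ?thesis using Fwq[OF d] by blast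
 next
 case w: True
 have third: "card (A Int K) = card (D Int K) | card (A Int K) + card (D Int K) = 8" if "(A +^ D) Int K = {} | (A +^ D) Int K = K" for A D :: "'i set"
 using that
 proof
 assume "(A +^ D) Int K = {}"
 then have "x : A \<longleftrightarrow> x : D" if "x : K" for x using that by (auto simp: set_eq_iff)
 then have "A Int K = D Int K" by blast
 then show ?thesis by simp
 next
 assume "(A +^ D) Int K = K"
 then have "x : A \<longleftrightarrow> x ~: D" if "x : K" for x using that by (auto simp: set_eq_iff)
 then have "A Int K = K Int - D" by blast
 then show ?thesis using csq[of K D] octadD(2)[OF K] by (simp add: Int_commute)
 qed
 have e: "bar d +^ bar f +^ bar g = bar d +^ bar g +^ bar f" "bar d +^ bar f +^ bar g = bar f +^ bar g +^ bar d" by (simp_all only: sd_ac)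
 have t: "card ((bar d +^ bar f) Int K) = card (bar g Int K) | card ((bar d +^ bar f) Int K) + card (bar g Int K) = 8"
 "card ((bar d +^ bar g) Int K) = card (bar f Int K) | card ((bar d +^ bar g) Int K) + card (bar f Int K) = 8"
 "card ((bar f +^ bar g) Int K) = card (bar d Int K) | card ((bar f +^ bar g) Int K) + card (bar d Int K) = 8"
 using third[OF w] third[OF w[unfolded e(1)]] third[OF w[unfolded e(2)]] by blast+
 have x: "card ((bar d +^ bar f) Int K) + 2 * card (bar d Int bar f Int K) = card (bar d Int K) + card (bar f Int K)"
 "card ((bar d +^ bar g) Int K) + 2 * card (bar d Int bar g Int K) = card (bar d Int K) + card (bar g Int K)"
 "card ((bar f +^ bar g) Int K) + 2 * card (bar f Int bar g Int K) = card (bar f Int K) + card (bar g Int K)"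
 by (rule csKq)+
 have p22: "mu (x_vec a) (x_vec b)" if "a : lifts" "b : lifts" "card (bar a Int K) = 2" "card (bar b Int K) = 2" "card (bar a Int bar b Int K) = 1" for a b
 using mTTqb[OF that(1,3,2,4,5)] by (simp add: mu_def)
 have p42: "mu (x_vec a) (x_vec b)" if "a : lifts" "b : lifts" "card (bar a Int K) = 4" "card (bar b Int K) = 2"
 "card (bar a Int bar b Int K) = 2 | card (bar a Int bar b Int K) = 0" for a b
 using mTTqa[OF that(2,4,1,3)] that(5) msq by (simp add: Int_commute)
 consider "card (bar d Int K) = 2" "card (bar f Int K) = 2" "card (bar g Int K) = 2"
 | "card (bar d Int K) = 2" "card (bar f Int K) = 2" "card (bar g Int K) = 4"
 | "card (bar d Int K) = 2" "card (bar f Int K) = 4" "card (bar g Int K) = 2"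
 | "card (bar d Int K) = 4" "card (bar f Int K) = 2" "card (bar g Int K) = 2"
 | "card (bar d Int K) = 2" "card (bar f Int K) = 4" "card (bar g Int K) = 4"
 | "card (bar d Int K) = 4" "card (bar f Int K) = 2" "card (bar g Int K) = 4"
 | "card (bar d Int K) = 4" "card (bar f Int K) = 4" "card (bar g Int K) = 2"
 | "card (bar d Int K) = 4" "card (bar f Int K) = 4" "card (bar g Int K) = 4"
 using cc by blast
 then have "mu (x_vec d) (x_vec f) | mu (x_vec d) (x_vec g) | mu (x_vec f) (x_vec g)"
 proof cases
 case 1
 then have "card (bar d Int bar f Int K) = 1" using t(1) x(1) by linarith
 then show ?thesis using p22[OF d(1,2)] 1 by blast
 next
 case 2
 then have "card (bar d Int bar g Int K) = 2 | card (bar d Int bar g Int K) = 0" using t(2) x(2) by linarith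
 then show ?thesis using mTTqa[OF d(1) _ d(3)] 2 by blast
 next
 case 3
 then have "card (bar d Int bar f Int K) = 2 | card (bar d Int bar f Int K) = 0" using t(1) x(1) by linarith
 then show ?thesis using mTTqa[OF d(1) _ d(2)] 3 by blast
 next
 case 4
 then have "card (bar d Int bar f Int K) = 2 | card (bar d Int bar f Int K) = 0" using t(1) x(1) by linarith
 then show ?thesis using p42[OF d(1,2)] 4 by blast
 next
 case 5
 then have "card (bar f Int bar g Int K) = 1 | card (bar f Int bar g Int K) = 3" using t(3) x(3) by linarith
 then show ?thesis using mTTq[OF d(2) _ d(3)] 5 by blast
 next
 case 6
 then have "card (bar d Int bar g Int K) = 1 | card (bar d Int bar g Int K) = 3" using t(2) x(2) by linarith
 then show ?thesis using mTTq[OF d(1) _ d(3)] 6 by blast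
 next
 case 7
 then have "card (bar d Int bar f Int K) = 1 | card (bar d Int bar f Int K) = 3" using t(1) x(1) by linarith
 then show ?thesis using mTTq[OF d(1) _ d(2)] 7 by blast
 next
 case 8
 then have "card (bar d Int bar f Int K) = 2" using t(1) x(1) by linarith
 then show ?thesis using mTTq[OF d(1) _ d(2)] 8 by blast
 qed
 then show ?thesis by (rule m)
 qed
 qed
 qed
qed
lemma Faq: "F3 a b c ==> F3 a' b c ==> F3 (a + a') b c" "F3 a b c ==> F3 a b' c ==> F3 a (b + b') c" "F3 a b c ==> F3 a b c' ==> F3 a b (c + c')"
 by (simp_all add: F3_def taq star_add sarq haq)
lemma Fsq: "F3 a b c ==> F3 (k *s a) b c" "F3 a b c ==> F3 a (k *s b) c" "F3 a b c ==> F3 a b (k *s c)"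
 by (simp_all add: F3_def tsq star_scale ssrq hsq)
lemma Faqa: assumes "a : VV" "b : VV" "c : VV" shows "F3 a b c"
 using assms
proof (induction a rule: Viq)
 case (u i) then show ?case using S_u[of i] Fmq by (simp add: S_def)
next
 case (x d)
 show ?case using x(2,3)
 proof (induction b rule: Viq)
 case (u i)
 have "F3 (u_vec i) (x_vec d) c" using S_u[of i] Fmq u VV_x[OF x(1)] by (simp add: S_def)
 then show ?case using Fsqa(1) by blast
 next
 case (x f)
 note df = \<open>d : lifts\<close> x(1)
 show ?case using x(2)
 proof (induction c rule: Viq)
 case (u i)
 have "F3 (u_vec i) (x_vec d) (x_vec f)" using S_u[of i] Fmq VV_x df by (simp add: S_def)
 then show ?case using Fsqa VV_u VV_x df by metis
 next
 case (x g) then show ?case using F3_x df by blast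
 qed (simp_all add: Faq Fsq)
 qed (simp_all add: Faq Fsq)
qed (simp_all add: Faq Fsq)
lemma cTq: "caut tz"
 by (rule ctqa[OF oVq tiq mFq[OF Faqa]])
end

section \<open>Norms of roots, monomial automorphisms, inner products of octadic roots\<close>

context parker_algebra begin
lemma osIq: "hsec K s ==> osec C mult unit m1 bar \<omega> \<Omega> K s"
 by unfold_locales
lemma coq: "hsec K s ==> caut (tau (oroot K s))"
 by (rule osec.cTq[OF osIq])
lemma oiVq: "hsec K s ==> oroot K s : VV"
 by (rule osec.oVq[OF osIq])
lemma hsecD: assumes "hsec K s" shows "octad K" "b : B K ==> bar (s b) = b"
 "b : B K ==> c : B K ==> s (b +^ c) = s b \<diamondop> s c"
 using assms by (auto simp: hsec_def)
lemma hszq: assumes v: "v : VV" and 0: "herm v v = 0" shows "v = 0"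
proof -
 let ?a = "SUM i:UNIV. (cmod (v $ Inl i))\<^sup>2" and ?b = "SUM d:lifts. (cmod (v $ Inr d))\<^sup>2"
 have e: "herm v v = of_real (1/8*?a + 1/2*?b)"
 by (simp add: herm_def complex_norm_square[symmetric])
 have "1/8*?a + 1/2*?b = 0" using e[unfolded 0, symmetric] by (simp only: of_real_eq_0_iff)
 moreover have "?a >= 0" "?b >= 0" by (simp_all add: sum_nonneg)
 ultimately have "?a = 0" "?b = 0" by linarith+
 then have 1: "v $ Inl i = 0" "d : lifts ==> v $ Inr d = 0" for i d
 by (simp_all add: sum_nonneg_eq_0_iff)
 have "v $ k = 0" for k
 proof (cases k)
 case (Inr d) then show ?thesis using 1(2)[of d] v by (cases "d : lifts") (auto simp: VV_def)
 qed (simp add: 1)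
 then show ?thesis by (simp add: vec_eq_iff)
qed
text \<open>The properties transported by automorphisms. Given norm 9, the equation
  \<open>r \<star> r = 10 *s r\<close> is another form of \<open>tau r r = r\<close>.\<close>

definition isroot :: "complex ^ ('i + 'p) => bool" where
 "isroot r \<longleftrightarrow> r : VV & caut (tau r) & herm r r = 9 & r \<star> r = 10 *s r"
lemma isrootD: assumes "isroot r" shows "r : VV" "caut (tau r)" "herm r r = 9" "r \<star> r = 10 *s r"
 using assms by (simp_all add: isroot_def)
lemma iIq: assumes "r : VV" "caut (tau r)" "herm r r = 9" "tau r r = r" shows "isroot r"
proof -
 have "r \<star> r = tau r r + 9 *s r" by (simp add: tau_def assms(3))
 then have "r \<star> r = 10 *s r" unfolding assms(4) by (simp add: vec_eq_iff)
 then show ?thesis using assms by (simp add: isroot_def)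
qed
lemma hbbq: "herm (broot i) (broot j) = (if i = j then 9 else 1)"
proof -
 have "(SUM k:UNIV. broot i $ Inl k) = (SUM k:UNIV. 1 - (if i = k then 8 else 0))"
 by (intro sum.cong refl) (simp add: broot_def)
 also have "... = 16" by (simp add: sum_subtractf card_index)
 finally show ?thesis by (simp add: hbq) (simp add: broot_def)
qed
lemma ibq: "isroot (broot i)"
 using iIq[OF bVq cbq] tbbq hbbq by simp
lemma toqa: "twist (%_. 1) s = s" by (rule ext) (simp add: twist_def)
lemma hoq: assumes "hsec K s" "v : VV"
 shows "herm v (oroot K s) = 1/2*((SUM i: -K. v $ Inl i)/8 - (SUM i:K. v $ Inl i)/8 + (SUM b:B K - {{}}. herm v (XV (s b))))"
 unfolding oroot_def hsq haq hmq hsqa huq by (simp add: sum_divide_distrib)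
lemma ioq: assumes h: "hsec K s" shows "isroot (oroot K s)"
proof (rule iIq)
 interpret osec C mult unit m1 bar \<omega> \<Omega> K s by (rule osIq[OF h])
 show "oroot K s : VV" by (rule oVq)
 show "caut tz" by (rule cTq)
 show "tz (oroot K s) = oroot K s" using tteq[OF Bhoq] by (simp add: toqa)
 have cB: "card Bo = 30"
 proof -
 have "Bo = B K - {{}, - K}" by simp
 then show ?thesis using cBq[OF K] X_in Cneq[OF K] by (simp add: card_Diff_subset)
 qed
 \<comment> \<open>The word \<open>- K\<close> contributes 3/2 and the 30 octads 1/2 each; the part
   in \<open>U\<close> adds another 3/2, and half of the total 18 is the norm 9.\<close>
 have S: "(SUM b:B K - {{}}. herm (oroot K s) (XV (s b))) = 3/2 + 15"
 proof -
 have "herm (oroot K s) (XV (s b)) = 1/2" if "b : Bo" for b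
 unfolding XV_Bo[OF that] hoxq[OF Blq[OF that]] by (rule oIsq[OF that])
 then have "(SUM b:Bo. herm (oroot K s) (XV (s b))) = (SUM b:Bo. 1/2)" by (intro sum.cong refl)
 then have "(SUM b:Bo. herm (oroot K s) (XV (s b))) = 15" using cB by simp
 moreover have "herm (oroot K s) (XV (s (- K))) = 3/2"
 unfolding XV_X hsq hoxq[OF olq] oIoqa by (simp add: tcq)
 ultimately show ?thesis unfolding sBsq by simp
 qed
 show "herm (oroot K s) (oroot K s) = 9"
 unfolding hoq[OF h oVq] S using octadD(2)[OF K] cCoq[OF K] by (simp add: oIqa)
qed
lemma tiqa: assumes T: "caut T" and r: "r : VV" and v: "v : VV" shows "tau (T r) v = T (tau r (T v))"
 using ccq[OF T r cautD(3)[OF T v]] cautD(4)[OF T v] by simp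
lemma iiq: assumes T: "caut T" and r: "isroot r" shows "isroot (T r)"
proof -
 note R = isrootD[OF r] and D = cautD[OF T] and E = cautD[OF isrootD(2)[OF r]]
 note tau = tiqa[OF T R(1)]
 have "caut (tau (T r))"
 proof (rule ctqa[OF D(3)[OF R(1)]])
 fix x assume x: "x : VV"
 show "tau (T r) (tau (T r) x) = x" using x by (simp add: tau tVq D(3,4) E(3,4) R(1))
 fix y assume y: "y : VV"
 show "tau (T r) (x \<star> y) = tau (T r) x \<star> tau (T r) y"
 using x y by (simp add: tau sVq D(3,5) E(3,5))
 qed
 moreover have "T r \<star> T r = 10 *s T r" using D(5)[OF R(1,1)] R(4) D(2)[of 10 r] by simp
 ultimately show ?thesis using R D(3)[OF R(1)] D(6)[OF R(1,1)] by (simp add: isroot_def)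
qed
lemma crq: assumes "h ^ 3 = (1::complex)" shows "h * cnj h = 1" "cnj h = h\<^sup>2" "h * h = cnj h"
proof -
 have "(norm h) ^ 3 = 1" using assms by (simp flip: norm_power)
 then have "norm h = 1" using power_eq_imp_eq_base[of "norm h" 3 1] by simp
 then show 1: "h * cnj h = 1" using complex_norm_square[of h] by simp
 have "h * cnj h = h * h\<^sup>2" using 1 assms by (simp add: power2_eq_square power3_eq_cube mult.assoc)
 moreover have "h ~= 0" using 1 by auto
 ultimately show "cnj h = h\<^sup>2" by (simp only: mult_cancel_left simp_thms)
 then show "h * h = cnj h" by (simp add: power2_eq_square)
qed
text \<open>Equality in the Cauchy--Schwarz inequality: \<open>(\<tau>\<^sub>r s, s) = 10 (s, r) - (r, s)\<^sup>2\<close> has absolute value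
 \<open>9 = (s, s)\<close> when \<open>(r, s)\<close> is a cube root of unity.\<close>
lemma tcqa: assumes r: "isroot r" and s: "isroot s" and h: "herm r s ^ 3 = 1"
 shows "tau r s = cnj (herm r s) *s s"
proof -
 note R = isrootD[OF r] and S = isrootD[OF s]
 let ?h = "herm r s" and ?w = "tau r s"
 have hc: "?h * cnj ?h = 1" "?h*?h = cnj ?h" using crq(1)[OF h] crq(3)[OF h] .
 have "herm (s \<star> r) s = herm (s \<star> s) r" by (rule hssq[OF S(1) R(1) S(1)])
 then have 1: "herm ?w s = 9 * cnj ?h" using hc by (simp add: tau_def hdq hsq S(4) hcq)
 then have 2: "herm s ?w = 9*?h" using hcq[of ?w s] by simp
 have 3: "herm ?w ?w = 9" using cautD(6)[OF R(2) S(1,1)] S(3) by simp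
 have "herm (?w - cnj ?h *s s) (?w - cnj ?h *s s) = 9 - 9*(?h * cnj ?h)"
 by (simp add: hdq hsq 1 2 3 S(3) algebra_simps)
 then have "?w - cnj ?h *s s = 0" using hc tVq[OF R(1)] S(1) by (intro hszq VV_diff VV_scale) simp_all
 then show ?thesis by simp
qed
lemma tzq: "herm r s = 0 ==> tau r s = s \<star> r" by (simp add: tau_def)
lemma xviq: assumes "x_vec e = x_vec e'" shows "e = e'"
proof -
 have "x_vec e' $ Inr e = 1" using assms by (metis xvsqa)
 then show ?thesis by (auto simp: x_vec_Inr split: if_splits)
qed
end
text \<open>A product of two automorphisms which permutes the basic roots is monomial in the \<open>x\<^sub>d\<close>.\<close>
locale monomial = parker_algebra C mult unit m1 bar \<omega> \<Omega>
 for C :: "'i::finite set set"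
 and mult :: "'p::finite => 'p => 'p" (infixl \<open>\<diamondop>\<close> 70)
 and unit :: 'p (\<open>\<e>\<close>)
 and m1 :: 'p and bar :: "'p => 'i set"
 and \<omega> :: complex and \<Omega> :: 'p +
 fixes T1 T2 :: "complex ^ ('i + 'p) => complex ^ ('i + 'p)" and qz :: "'i => 'i"
 assumes T: "caut T1" "caut T2" and qz: "!!i. T1 (T2 (broot i)) = broot (qz i)"
begin
definition g where "g v = T1 (T2 v)"
lemma g_add: "g (v + w) = g v + g w" and g_scale: "g (c *s v) = c *s g v" and g_VV: "v : VV ==> g v : VV"
 and g_star: "v : VV ==> w : VV ==> g (v \<star> w) = g v \<star> g w" and g_herm: "v : VV ==> w : VV ==> herm (g v) (g w) = herm v w"
 using cautD[OF T(1)] cautD[OF T(2)] by (simp_all add: g_def)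
lemma gmqa: "g (- v) = - g v" using g_scale[of "- 1" v] by (simp flip: smqa)
lemma gdq: "g (v - w) = g v - g w" using g_add[of v "- w"] by (simp add: gmqa)
lemma g_0: "g 0 = 0" using g_scale[of 0 0] by simp
lemma g_sum: "g (sum f A) = (SUM a:A. g (f a))"
 by (induction A rule: infinite_finite_induct) (simp_all add: g_add g_0)
lemma gbq: "g (broot i) = broot (qz i)" by (simp add: g_def qz)
lemma g_tau: assumes "v : VV" shows "g (tau (broot i) v) = tau (broot (qz i)) (g v)"
 using g_herm[OF bVq assms, of i] by (simp add: tau_def gdq g_scale g_star[OF assms bVq] gbq)
lemma qiq: "qz i = qz j ==> i = j"
 using g_herm[OF bVq bVq, of i j] by (auto simp: gbq hbbq split: if_splits)
lemma qbq: "bij qz" using qiq finite_UNIV_inj_surj[of qz] by (simp add: bij_def inj_def)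
lemma sqq: "(SUM i:A. f (qz i)) = sum f (qz ` A)" for f :: "'i => 'z::comm_monoid_add"
 by (simp add: sum.reindex inj_def[THEN iffD2] inj_on_def qiq)
lemma g_u: "g (u_vec i) = u_vec (qz i)"
proof -
 have "(SUM j:UNIV. broot (qz j)) = (SUM j:UNIV. broot j)" using sqq[of broot UNIV] qbq by (simp add: bij_def)
 then show ?thesis by (subst uvbq, subst uvbq) (simp add: g_scale gdq g_sum gbq)
qed
lemma tbcq: assumes v: "v : VV"
 shows "tau (broot j) v $ Inl k = cnj (v $ Inl k)" "e : lifts ==> tau (broot j) v $ Inr e = pt j (bar e) * cnj (v $ Inr e)"
proof -
 have t: "tau (broot j) v : VV" by (rule tVq[OF bVq])
 show "tau (broot j) v $ Inl k = cnj (v $ Inl k)"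
 using tsqc[OF bVq v VV_u, of j k] hcq[of v "u_vec k", symmetric] by (simp add: huq tbuq)
 assume e: "e : lifts"
 show "tau (broot j) v $ Inr e = pt j (bar e) * cnj (v $ Inr e)"
 using tsqc[OF bVq v VV_x[OF e], of j] hcq[of v "x_vec e", symmetric] hxq[OF v e] hxq[OF t e]
 by (simp add: tbxq[OF e] hsq)
qed
lemma cqq: "card (qz ` A) = card A" by (rule card_image) (simp add: inj_on_def qiq)
text \<open>The image of \<open>x_vec d\<close> is an eigenvector of all
  \<open>tau (broot j)\<close>, with signs carried along by \<open>qz\<close>. Both signs occur, so
  its part in \<open>U\<close> is zero; its other coordinates lie over the image of
  \<open>bar d\<close>, since the image of the complement has weight 16. Norm one leaves
  \<open>x_vec e\<close> or its negative, which is again a generator.\<close>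

lemma g_x: assumes d: "d : lifts" obtains e where "e : lifts" "bar e = qz ` bar d" "g (x_vec d) = x_vec e"
proof -
 let ?v = "g (x_vec d)"
 have V: "?v : VV" by (rule g_VV[OF VV_x[OF d]])
 have od: "octad (bar d)" using d by (simp add: liq)
 have tv: "tau (broot (qz i)) ?v = pt i (bar d) *s ?v" for i
 using g_tau[OF VV_x[OF d], of i] by (simp add: tbxq[OF d] g_scale)
 have nv: "herm ?v ?v = 1" using g_herm[OF VV_x[OF d] VV_x[OF d]] herm_x_x[OF d, of d] by simp
 have Inl: "?v $ Inl k = 0" for k
 proof -
 have "cnj (?v $ Inl k) = pt i (bar d)*?v $ Inl k" for i
 using arg_cong[OF tv[of i], of "%w. w $ Inl k"] tbcq(1)[OF V] by simp
 moreover obtain i j where "i : bar d" "j ~: bar d" using enioq[OF od] octadD(2)[OF od] by fastforce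
 ultimately have "- (?v $ Inl k) = ?v $ Inl k" by (metis pt_def mult_1 mult_minus1)
 then show ?thesis by simp
 qed
 have supp: "bar e = qz ` bar d & cnj (?v $ Inr e) = ?v $ Inr e" if e: "e : lifts" "?v $ Inr e ~= 0" for e
 proof -
 have eq: "pt (qz i) (bar e) * cnj (?v $ Inr e) = pt i (bar d)*?v $ Inr e" for i
 using arg_cong[OF tv[of i], of "%w. w $ Inr e"] tbcq(2)[OF V e(1)] by simp
 have c: "cnj (?v $ Inr e) = ?v $ Inr e | cnj (?v $ Inr e) = - ?v $ Inr e"
 using eq[of undefined] pt_cases[of "qz undefined" "bar e"] pt_cases[of undefined "bar d"] by (auto simp: minus_equation_iff)
 have ins: "bar e = qz ` A" if "!!i. qz i : bar e \<longleftrightarrow> i : A" for A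
 proof (rule Set.set_eqI)
 fix j
 obtain i where "j = qz i" using qbq by (metis bij_pointE)
 then show "j : bar e \<longleftrightarrow> j : qz ` A" using that[of i] qiq by (auto simp: image_iff)
 qed
 from c show ?thesis
 proof
 assume c: "cnj (?v $ Inr e) = ?v $ Inr e"
 then have q: "pt (qz i) (bar e) = pt i (bar d)" for i using eq[of i] e(2) by simp
 have "bar e = qz ` bar d"
 proof (rule ins)
 fix i show "qz i : bar e \<longleftrightarrow> i : bar d" using q[of i] by (simp add: pt_def split: if_splits)
 qed
 then show ?thesis using c by simp
 next
 assume c: "cnj (?v $ Inr e) = - ?v $ Inr e"
 have q: "- pt (qz i) (bar e) = pt i (bar d)" for i
 proof -
 have "(- pt (qz i) (bar e))*?v $ Inr e = pt i (bar d)*?v $ Inr e" using eq[of i] unfolding c by simp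
 then show ?thesis using e(2) by (simp only: mult_cancel_right simp_thms)
 qed
 have "bar e = qz ` (- bar d)"
 proof (rule ins)
 fix i show "qz i : bar e \<longleftrightarrow> i : - bar d" using q[of i] by (simp add: pt_def split: if_splits)
 qed
 then have "card (bar e) = 16" using cqq cCoq[OF od] by simp
 then show ?thesis using e(1) by (simp add: liq octadD)
 qed
 qed
 have "?v ~= 0" using nv by auto
 then obtain k where k: "?v $ k ~= 0" by (auto simp: vec_eq_iff)
 then obtain e where ke: "k = Inr e" using Inl by (cases k) auto
 have el: "e : lifts" using k V unfolding ke VV_def by blast
 note I = supp[OF el k[unfolded ke]]
 have ne: "?v $ Inr (neg e) = - ?v $ Inr e" using V by (simp add: VV_def)
 have ve: "?v = (?v $ Inr e) *s x_vec e"
 unfolding vec_eq_iff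
 proof
 fix k show "?v $ k = ((?v $ Inr e) *s x_vec e) $ k"
 proof (cases k)
 case (Inr f)
 consider "f = e" | "f = neg e" "f ~= e" | "f ~= e" "f ~= neg e" by blast
 then show ?thesis
 proof cases
 case 3
 have "?v $ Inr f = 0"
 proof (rule ccontr)
 assume nz: "?v $ Inr f ~= 0"
 then have "f : lifts" using V unfolding VV_def by blast
 then have "bar f = bar e" using supp[OF _ nz] I by simp
 then show False using beq[of f e] 3 by blast
 qed
 then show ?thesis using 3 Inr by (simp add: x_vec_Inr)
 qed (use Inr ne in \<open>simp_all add: x_vec_Inr\<close>)
 qed (simp add: Inl)
 qed
 have "herm ?v ?v = (?v $ Inr e) * cnj (?v $ Inr e)"
 by (subst (1 2) ve) (simp add: hsq herm_x_x[OF el])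
 then have "(?v $ Inr e)*(?v $ Inr e) = 1" using nv I by simp
 then consider "?v $ Inr e = 1" | "?v $ Inr e = - 1" using square_eq_1_iff by (metis power2_eq_square)
 then show ?thesis
 proof cases
 case 1 then show ?thesis using that[OF el] I ve by simp
 next
 case 2
 have "?v = x_vec (neg e)" by (subst ve) (simp add: 2 x_vec_neg flip: smqa)
 then show ?thesis using that[of "neg e"] I el by (simp add: lifts_neg bar_neg)
 qed
qed
definition gz where "gz d = (SOME e. e : lifts & bar e = qz ` bar d & g (x_vec d) = x_vec e)"
lemma gz: assumes "d : lifts" shows "gz d : lifts" "bar (gz d) = qz ` bar d" "g (x_vec d) = x_vec (gz d)"
proof -
 obtain e where "e : lifts" "bar e = qz ` bar d" "g (x_vec d) = x_vec e" by (rule g_x[OF assms])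
 then have "EX e. e : lifts & bar e = qz ` bar d & g (x_vec d) = x_vec e" by (intro exI conjI)
 from someI_ex[OF this] show "gz d : lifts" "bar (gz d) = qz ` bar d" "g (x_vec d) = x_vec (gz d)" unfolding gz_def by blast+
qed
lemma qIq: "qz ` A Int qz ` A' = qz ` (A Int A')" by (rule image_Int[symmetric]) (simp add: inj_def qiq)
lemma gmq: assumes d: "d : lifts" "f : lifts"
 shows "card (bar d Int bar f) = 4 ==> gz (d \<diamondop> f) = gz d \<diamondop> gz f"
 "bar d Int bar f = {} ==> gz ((d \<diamondop> f) \<diamondop> \<Omega>) = (gz d \<diamondop> gz f) \<diamondop> \<Omega>"
proof -
 have c8: "card (bar d) = 8" "card (bar (gz d)) = 8" using d(1) gz(1)[OF d(1)] by (simp_all add: liq octadD)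
 have nn: "f ~= d" "f ~= neg d" "gz f ~= gz d" "gz f ~= neg (gz d)" if "card (bar d Int bar f) < 8"
 using that c8 gz(2)[OF d(1)] gz(2)[OF d(2)] cqq[of "bar d Int bar f"] by (auto simp: bar_neg qIq[symmetric])
 have s: "g (prod_xx d f) = prod_xx (gz d) (gz f)"
 using g_star[OF VV_x[OF d(1)] VV_x[OF d(2)]] by (simp add: star_x_x d gz)
 have I: "bar (gz d) Int bar (gz f) = qz ` (bar d Int bar f)" by (simp add: gz(2) d qIq)
 show "gz (d \<diamondop> f) = gz d \<diamondop> gz f" if c: "card (bar d Int bar f) = 4"
 proof -
 have "(1/2) *s x_vec (gz (d \<diamondop> f)) = (1/2) *s x_vec (gz d \<diamondop> gz f)"
 using s nn c unfolding prod_xx_def I cqq by (simp add: g_scale gz(3)[OF lmq[OF d c]])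
 then have "x_vec (gz (d \<diamondop> f)) = x_vec (gz d \<diamondop> gz f)" by (rule scqd) simp
 then show ?thesis by (rule xviq)
 qed
 show "gz ((d \<diamondop> f) \<diamondop> \<Omega>) = (gz d \<diamondop> gz f) \<diamondop> \<Omega>" if c: "bar d Int bar f = {}"
 proof -
 have "(1/2) *s (theta *s x_vec (gz ((d \<diamondop> f) \<diamondop> \<Omega>))) = (1/2) *s (theta *s x_vec ((gz d \<diamondop> gz f) \<diamondop> \<Omega>))"
 proof -
 have c0: "card (bar d Int bar f) < 8" unfolding c by simp
 note n = nn[OF c0]
 have I0: "bar (gz d) Int bar (gz f) = {}" unfolding I c by simp
 have "prod_xx d f = (1/2) *s (theta *s x_vec ((d \<diamondop> f) \<diamondop> \<Omega>))"
 unfolding prod_xx_def c by (simp add: n)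
 moreover have "prod_xx (gz d) (gz f) = (1/2) *s (theta *s x_vec ((gz d \<diamondop> gz f) \<diamondop> \<Omega>))"
 unfolding prod_xx_def I0 by (simp add: n)
 ultimately show ?thesis using s by (simp only: g_scale gz(3)[OF lmOq[OF d c]])
 qed
 then have "theta *s x_vec (gz ((d \<diamondop> f) \<diamondop> \<Omega>)) = theta *s x_vec ((gz d \<diamondop> gz f) \<diamondop> \<Omega>)" by (rule scqd) simp
 then have "x_vec (gz ((d \<diamondop> f) \<diamondop> \<Omega>)) = x_vec ((gz d \<diamondop> gz f) \<diamondop> \<Omega>)" by (rule scqd) (rule tn0q)
 then show ?thesis by (rule xviq)
 qed
qed
lemma qoq: assumes "octad F" shows "octad (qz ` F)"
proof -
 obtain d where d: "bar d = F" using assms bar_range unfolding octad_def by blast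
 then have "d : lifts" using assms by (simp add: liq)
 then show ?thesis using gz(1,2)[of d] d by (simp add: liq)
qed
lemma qz_sd: "qz ` (A +^ A') = qz ` A +^ qz ` A'"
 using qiq by (auto simp: sd_def)
lemma qwq: "c : C ==> qz ` c : C"
 by (induction rule: ciqa) (auto simp: zero_word qz_sd intro: scq octadD(1)[OF qoq])
lemma qCq: "qz ` (- A) = - qz ` A" using qbq by (rule bij_image_Compl_eq)
lemma B_qz: assumes F: "octad F" shows "B (qz ` F) = (%b. qz ` b) ` B F"
proof (rule card_subset_eq[symmetric])
 show "(%b. qz ` b) ` B F <= B (qz ` F)" by (auto simp: B_iff qwq qIq)
 have "inj_on (%b. qz ` b) (B F)" using qiq by (auto intro!: inj_onI simp: inj_image_eq_iff inj_def)
 then show "card ((%b. qz ` b) ` B F) = card (B (qz ` F))" by (simp add: card_image cBq[OF F] cBq[OF qoq[OF F]])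
qed simp
lemma goq: assumes h: "hsec F t" obtains t' where "hsec (qz ` F) t'" "g (oroot F t) = oroot (qz ` F) t'"
proof -
 interpret F: osec C mult unit m1 bar \<omega> \<Omega> F t by (rule osIq[OF h])
 let ?o = "F.ow" and ?P = "qz ` F"
 \<comment> \<open>On octads the section is carried over by \<open>gz\<close>. Its value at the
   complement of the octad cannot be obtained in this way and is set to the image of the lift
   \<open>F.ow\<close> times \<open>\<Omega>\<close>, in accordance with the definition of
   \<open>ow\<close>.\<close>
 define t0 where "t0 b = (if b = {} then \<e> else if b = - F then gz ?o \<diamondop> \<Omega> else gz (t b))" for b
 define t' where "t' b = t0 (qz -` b)" for b
 have t't0: "t' (qz ` b) = t0 b" for b unfolding t'_def using qiq by (simp add: inj_vimage_image_eq inj_def)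
 have X0: "- F ~= {}" by (rule Cneq[OF F.K])
 have t0s: "t0 {} = \<e>" "t0 (- F) = gz ?o \<diamondop> \<Omega>" "b : F.Bo ==> t0 b = gz (t b)" for b using X0 by (auto simp: t0_def)
 note go = gz[OF F.olq] and gt = gz[OF F.Blq]
 have bt: "bar (t b) = b" if "b : F.Bo" for b using that by simp
 have bo: "bar (gz ?o) = ?P" using go by simp
 have dis: "bar ?o Int bar (t b) = {}" if "b : F.Bo" for b using that Int_B(1)[of b F] by simp
 have Xb: "gz ?o \<diamondop> \<Omega> \<diamondop> gz (t b) = gz (t (b +^ - F))" "gz (t b) \<diamondop> (gz ?o \<diamondop> \<Omega>) = gz (t (b +^ - F))" if b: "b : F.Bo" for b
 proof -
 have e: "(gz ?o \<diamondop> gz (t b)) \<diamondop> \<Omega> = gz (t (b +^ - F))"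
 using gmq(2)[OF F.olq F.Blq[OF b] dis[OF b]] F.ow_s(1)[of b] b by simp
 show "gz ?o \<diamondop> \<Omega> \<diamondop> gz (t b) = gz (t (b +^ - F))" using e by (simp add: Oaq Ocqa)
 have "gz ?o \<diamondop> gz (t b) = gz (t b) \<diamondop> gz ?o"
 proof (rule ceq)
 have "bar (gz ?o) Int bar (gz (t b)) = {}" using dis[OF b] by (simp add: go(2) gt(2)[OF b] qIq del: F.boqa)
 then show "even (card (bar (gz ?o) Int bar (gz (t b))) div 2)" by simp
 qed
 then show "gz (t b) \<diamondop> (gz ?o \<diamondop> \<Omega>) = gz (t (b +^ - F))" using e by (simp add: Oaq)
 qed
 have hom: "t0 (b +^ c) = t0 b \<diamondop> t0 c" if b: "b : B F" and c: "c : B F" for b c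
 proof -
 have cs: "b = {} | b = - F | b : F.Bo" "c = {} | c = - F | c : F.Bo" using b c by blast+
 have e: "{} +^ a = a" "a +^ {} = a" for a :: "'i set" by (auto simp: sd_def)
 show ?thesis
 proof (cases "b = {} | c = {}")
 case True then show ?thesis by (elim disjE) (simp_all add: e t0s unit_left unit_right)
 next
 case ne: False
 show ?thesis
 proof (cases "b = c")
 case True
 have "t0 c \<diamondop> t0 c = \<e>"
 proof (cases "c = - F")
 case True
 have "bar (gz ?o \<diamondop> \<Omega>) = - ?P" using bo by (auto simp: bmq bar_Omega)
 then have "card (bar (gz ?o \<diamondop> \<Omega>)) = 16" using cCoq[OF qoq[OF F.K]] by simp
 then show ?thesis using True by (simp add: t0s seqa)
 next
 case False
 then have "c : F.Bo" using cs ne by blast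
 then show ?thesis using gt(1)[of c] by (simp add: t0s soq liq)
 qed
 then show ?thesis using True by (simp add: t0s)
 next
 case nbc: False
 consider "b = - F" "c : F.Bo" | "c = - F" "b : F.Bo" | "b : F.Bo" "c : F.Bo" using cs ne nbc by blast
 then show ?thesis
 proof cases
 case 1
 then show ?thesis using Xb(1)[OF 1(2)] t0s(3)[OF F.Bfq[OF 1(2)]] by (simp add: t0s scqa[of "- F"])
 next
 case 2 then show ?thesis using Xb(2)[OF 2(2)] t0s(3)[OF F.Bfq[OF 2(2)]] by (simp add: t0s)
 next
 case 3
 show ?thesis
 proof (cases "b +^ c = - F")
 case True
 have cb: "c = b +^ - F" using True sd_cancel[of b c] by simp
 have "bar (t b) Int bar (t c) = {}" unfolding bt[OF 3(1)] bt[OF 3(2)] unfolding cb using Int_B(2)[OF b]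
 by (simp add: set_eq_iff)
 from gmq(2)[OF F.Blq[OF 3(1)] F.Blq[OF 3(2)] this]
 have "(gz (t b) \<diamondop> gz (t c)) \<diamondop> \<Omega> = gz ?o" using F.sBOq[OF b] unfolding cb by simp
 then have "gz (t b) \<diamondop> gz (t c) = gz ?o \<diamondop> \<Omega>" using Ocq[of "gz (t b) \<diamondop> gz (t c)"] by simp
 then show ?thesis using 3 True by (simp add: t0s)
 next
 case False
 have "b +^ c ~= {}" unfolding seeq using nbc .
 then have bc: "b +^ c : F.Bo" using False B_sd[OF b c] by blast
 have "card (b Int c) = 4" using csqa[of b c] F.Boq[OF bc] F.Boq[OF 3(1)] F.Boq[OF 3(2)] by (simp add: octadD)
 then have "gz (t b \<diamondop> t c) = gz (t b) \<diamondop> gz (t c)" using gmq(1)[OF F.Blq[OF 3(1)] F.Blq[OF 3(2)]] bt[OF 3(1)] bt[OF 3(2)] by simp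
 then show ?thesis using 3 bc F.smqb[OF b c] by (simp add: t0s)
 qed
 qed
 qed
 qed
 qed
 have bar0: "bar (t0 b) = qz ` b" if bB: "b : B F" for b
 proof -
 consider "b = {}" | "b = - F" | "b : F.Bo" using bB by blast
 then show ?thesis
 proof cases
 case 2 then show ?thesis using bo by (auto simp: t0s bmq bar_Omega qCq)
 next
 case 3 then show ?thesis using gt(2)[OF 3] bt[OF 3] by (simp add: t0s)
 qed (simp add: t0s)
 qed
 have h': "hsec ?P t'"
 unfolding hsec_def
 proof (intro conjI ballI)
 show "octad ?P" by (rule qoq[OF F.K])
 fix b assume "b : B ?P"
 then obtain b0 where b0: "b0 : B F" "b = qz ` b0" unfolding B_qz[OF F.K] by blast
 show "bar (t' b) = b" unfolding b0(2) t't0 by (rule bar0[OF b0(1)])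
 fix c assume "c : B ?P"
 then obtain c0 where c0: "c0 : B F" "c = qz ` c0" unfolding B_qz[OF F.K] by blast
 show "t' (b +^ c) = t' b \<diamondop> t' c" unfolding b0(2) c0(2) qz_sd[symmetric] t't0 by (rule hom[OF b0(1) c0(1)])
 qed
 interpret P: osec C mult unit m1 bar \<omega> \<Omega> ?P t' by (rule osIq[OF h'])
 have ow': "P.ow = gz ?o" unfolding P.ow_def qCq[symmetric] t't0 t0s by simp
 have inj: "inj (%b. qz ` b)" using qiq by (auto intro!: injI simp: inj_image_eq_iff inj_def)
 have "P.Bo = (%b. qz ` b) ` F.Bo"
 unfolding B_qz[OF F.K] using inj by (subst image_set_diff[OF inj]) (simp add: qCq)
 then have "(SUM b:P.Bo. x_vec (t' b)) = (SUM b:F.Bo. x_vec (t' (qz ` b)))"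
 using inj by (simp add: sum.reindex inj_on_subset)
 also have "... = (SUM b:F.Bo. g (x_vec (t b)))" by (intro sum.cong refl) (simp only: t't0 t0s(3) gt(3))
 finally have "(SUM b:P.Bo. x_vec (t' b)) = g (SUM b:F.Bo. x_vec (t b))" by (simp only: g_sum)
 moreover have "g (SUM i:A. u_vec i) = (SUM i:qz ` A. u_vec i)" for A by (simp add: g_sum g_u sqq)
 ultimately have "g (oroot F t) = oroot ?P t'"
 unfolding F.oaqa P.oaqa ow' qCq[symmetric] g_scale g_add gmqa go(3)[symmetric] by simp
 then show ?thesis using that h' by blast
qed
end
context parker_algebra begin
lemma chq: "caut T ==> x : VV ==> y : VV ==> herm (T x) (T y) = cnj (herm x y)"
 by (simp add: cautD(6) hcq)
lemma ciq: "caut T ==> x : VV ==> T (T x) = x"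
 by (rule cautD(4))
lemma csqb: "caut T ==> x : VV ==> y : VV ==> T (x \<star> y) = T x \<star> T y"
 by (rule cautD(5))
lemma csqc: "caut T ==> T (c *s x) = cnj c *s T x"
 by (rule cautD(2))
lemma hzsq: "herm v w = 0 ==> herm w v = 0"
 using hcq[of v w] by simp
lemma ocqa: assumes "!!b. b : B K ==> s b = t b" shows "oroot K s = oroot K t"
proof -
 have "(SUM b:B K - {{}}. XV (s b)) = (SUM b:B K - {{}}. XV (t b))" by (rule sum.cong) (use assms in auto)
 then show ?thesis by (simp only: oroot_def)
qed
lemma otcq: "(!!b. b : B K ==> pz b = fz b) ==> oroot K (twist pz s) = oroot K (twist fz s)"
 by (rule ocqa) (simp add: twist_def)
lemma scqb: assumes "hsec K s" "b : B K" "bar e = b"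
 shows "e = s b | e = neg (s b)"
 using beq[of e "s b"] hsecD(2)[OF assms(1,2)] assms(3) by simp
lemma stqa: assumes s: "hsec K s" and t: "hsec K t"
 obtains pz where "B_hom K pz" "oroot K t = oroot K (twist pz s)"
proof -
 define pz :: "'i set => complex" where "pz b = (if t b = s b then 1 else - 1)" for b
 have c: "t b = s b | t b = neg (s b)" if "b : B K" for b
 by (rule scqb[OF s that hsecD(2)[OF t that]])
 have n: "s b ~= neg (s b)" for b using neg_neq[of "s b"] by metis
 have h: "B_hom K pz"
 unfolding B_hom_def
 proof (intro conjI ballI)
 fix b c' assume b: "b : B K" and c': "c' : B K"
 note st = hsecD(3)[OF s b c'] hsecD(3)[OF t b c']
 show "pz (b +^ c') = pz b * pz c'"
 using c[OF b] c[OF c'] unfolding pz_def st by (elim disjE) (simp_all add: mult_neg neg_neg neg_neq)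
 qed (simp add: pz_def)
 have "oroot K t = oroot K (twist pz s)"
 by (rule ocqa) (use c in \<open>auto simp: twist_def pz_def\<close>)
 then show ?thesis using that h by blast
qed
lemma BhCq: assumes "octad K" "B_hom K pz" shows "pz (- K) = 1 | pz (- K) = - 1"
 using Bhq(1)[OF assms(2) BCq[OF assms(1)]] .
lemma toqb: assumes s: "hsec K s" and pz: "B_hom K pz" "pz (- K) = - 1"
 obtains x where "x ~: K" "oroot K (twist pz s) = tau (broot x) (oroot K s)" "tau (oroot K s) (oroot K (twist pz s)) = broot x"
proof -
 interpret S: osec C mult unit m1 bar \<omega> \<Omega> K s by (rule osIq[OF s])
 obtain x where x: "x ~: K" "!!b. b : B K ==> pz b = pt x b" by (rule Bhpqa[OF S.K pz]) blast
 have e: "oroot K (twist pz s) = oroot K (twist (pt x) s)" by (rule otcq[OF x(2)])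
 show ?thesis using that[OF x(1)] S.ttpq[OF x(1)] tboq[OF s] unfolding e by simp
qed
lemma tsqd: assumes s: "hsec K s" and t: "hsec K t"
 shows "tau (oroot K s) (oroot K t) = oroot K t | (EX x. tau (oroot K s) (oroot K t) = broot x)"
proof -
 interpret S: osec C mult unit m1 bar \<omega> \<Omega> K s by (rule osIq[OF s])
 obtain pz where pz: "B_hom K pz" "oroot K t = oroot K (twist pz s)" by (rule stqa[OF s t])
 from BhCq[OF S.K pz(1)] show ?thesis
 proof
 assume "pz (- K) = 1" then show ?thesis using S.tteq[OF pz(1)] pz(2) by simp
 next
 assume o: "pz (- K) = - 1"
 obtain x where "tau (oroot K s) (oroot K (twist pz s)) = broot x" by (rule toqb[OF s pz(1) o])
 then show ?thesis using pz(2) by auto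
 qed
qed
text \<open>Because \<open>kz\<close> is trivial at \<open>- K\<close>, the product of
  \<open>kz\<close> with a point character is again nontrivial there, hence a point character. The
  product of the two maps therefore permutes the basic roots off \<open>K\<close>, acting on
  \<open>- K\<close> like a translation with respect to \<open>B K\<close>, and the locale
  \<open>monomial\<close> applies.\<close>

lemma tq: assumes h: "hsec K s" and kz: "B_hom K kz" "kz (- K) = 1"
 obtains qz where "bij qz" "!!i. i : K ==> qz i = i" "!!z. z ~: K ==> qz z ~: K"
 "!!z b. z ~: K ==> b : B K ==> pt (qz z) b = kz b * pt z b"
 "!!F. octad F ==> octad (qz ` F)"
 "!!F t. hsec F t ==> EX t'. hsec (qz ` F) t' & tau (oroot K (twist kz s)) (tau (oroot K s) (oroot F t)) = oroot (qz ` F) t'"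
proof -
 interpret S: osec C mult unit m1 bar \<omega> \<Omega> K s by (rule osIq[OF h])
 have h1: "hsec K (twist kz s)" by (rule htq[OF h kz(1)])
 interpret S1: osec C mult unit m1 bar \<omega> \<Omega> K "twist kz s" by (rule osIq[OF h1])
 define Q where "Q z w \<longleftrightarrow> (z : K --> w = z) & (z ~: K --> w ~: K & (ALL b:B K. pt w b = kz b * pt z b))
 & tau (oroot K (twist kz s)) (tau (oroot K s) (broot z)) = broot w" for z w
 have "EX w. Q z w" for z
 proof (cases "z : K")
 case True then show ?thesis unfolding Q_def using S.tbiq S1.tbiq by auto
 next
 case False
 have hz: "B_hom K (%b. kz b * pt z b)" by (rule Bhmq[OF kz(1) Bhpq])
 have m: "kz (- K) * pt z (- K) = - 1" using kz(2) False by simp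
 obtain w where w: "w ~: K" "!!b. b : B K ==> kz b * pt z b = pt w b" by (rule Bhpqa[OF S.K hz m]) blast
 have "oroot K (twist (pt w) (twist kz s)) = oroot K (twist (%b. pt w b * kz b) s)"
 by (rule ttq[OF Bhpq kz(1)])
 also have "... = oroot K (twist (pt z) s)"
 proof (rule otcq)
 fix b assume b: "b : B K"
 show "pt w b * kz b = pt z b" using Bhq(3)[OF kz(1) b] unfolding w(2)[OF b, symmetric] by (simp add: mult.commute mult.left_commute)
 qed
 finally have "tau (oroot K (twist kz s)) (tau (oroot K s) (broot z)) = broot w"
 using S.tboqa[OF False] S1.ttpq[OF w(1)] by simp
 then show ?thesis unfolding Q_def using False w by auto
 qed
 then obtain qz where qz: "!!z. Q z (qz z)" by metis
 interpret M: monomial C mult unit m1 bar \<omega> \<Omega> "tau (oroot K (twist kz s))" "tau (oroot K s)" qz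
 by unfold_locales (use coq[OF h] coq[OF h1] qz in \<open>auto simp: Q_def\<close>)
 show ?thesis
 proof (rule that)
 show "bij qz" by (rule M.qbq)
 show "octad (qz ` F)" if "octad F" for F by (rule M.qoq[OF that])
 show "EX t'. hsec (qz ` F) t' & tau (oroot K (twist kz s)) (tau (oroot K s) (oroot F t)) = oroot (qz ` F) t'" if "hsec F t" for F t
 using M.goq[OF that] unfolding M.g_def by metis
 qed (use qz in \<open>auto simp: Q_def\<close>)
qed
definition agree :: "('i set => 'p) => ('i set => 'p) => 'i set => complex" where
 "agree s t b = (if t b = s b then 1 else - 1)"
lemma oIq: assumes s: "hsec K s" shows
 "b : B K ==> octad b ==> bar e = b ==> oroot K s $ Inr e = (if e = s b then 1/2 else - 1/2)"
 "bar e = K ==> oroot K s $ Inr e = (if e = s (- K) \<diamondop> \<Omega> then theta/2 else - theta/2)"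
proof -
 interpret S: osec C mult unit m1 bar \<omega> \<Omega> K s by (rule osIq[OF s])
 have odd: "oroot K s $ Inr (neg f) = - (oroot K s $ Inr f)" for f using S.oVq by (simp add: VV_def)
 { assume b: "b : B K" "octad b" and e: "bar e = b"
 have "b : S.Bo" using b onCq[OF S.K b(2)] octadD(2)[OF b(2)] by auto
 then show "oroot K s $ Inr e = (if e = s b then 1/2 else - 1/2)"
 using scqb[OF s b(1) e] S.oIsq[of b] odd[of "s b"] by auto }
 { assume e: "bar e = K"
 then have "e = S.ow | e = neg S.ow" using beq[of e S.ow] by simp
 then show "oroot K s $ Inr e = (if e = s (- K) \<diamondop> \<Omega> then theta/2 else - theta/2)"
 using S.oIoqa odd[of S.ow] unfolding S.ow_def[symmetric] by auto }
qed
lemma ssqe: "(SUM i:A. if i : K then - 1/2 else 1/2 :: complex) = of_nat (card A)/2 - of_nat (card (A Int K))" for A K :: "'i set"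
proof -
 have "(SUM i:A. if i : K then - 1/2 else 1/2 :: complex) = (SUM i:A. 1/2 - (if i : K then 1 else 0))"
 by (rule sum.cong) auto
 then show ?thesis by (simp add: sum_subtractf sum.If_cases)
qed
lemma hooq: assumes s: "hsec K s" and t: "hsec F t"
 shows "herm (oroot K s) (oroot F t) = 1/2*((of_nat (card (K Int F)) - 2)/4 + (SUM b:B F - {{}}. herm (oroot K s) (XV (t b))))"
proof -
 interpret S: osec C mult unit m1 bar \<omega> \<Omega> K s by (rule osIq[OF s])
 note o = hsecD(1)[OF s] hsecD(1)[OF t]
 have c: "card (- F) = 16" "card F = 8" "card (- F Int K) = 8 - card (K Int F)" "card (K Int F) <= 8"
 using cCoq[OF o(2)] octadD(2)[OF o(2)] octadD(2)[OF o(1)] csq[of K F] by (auto simp: Int_commute)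
 have "herm (oroot K s) (oroot F t) = 1/2*((SUM i: -F. oroot K s $ Inl i)/8 - (SUM i:F. oroot K s $ Inl i)/8 + (SUM b:B F - {{}}. herm (oroot K s) (XV (t b))))"
 by (rule hoq[OF t S.oVq])
 also have "... = 1/2*((of_nat (card (K Int F)) - 2)/4 + (SUM b:B F - {{}}. herm (oroot K s) (XV (t b))))"
 unfolding S.oIqa ssqe c using c(4) by (simp add: of_nat_diff Int_commute[of F K] field_simps)
 finally show ?thesis .
qed
lemma hoXq: assumes s: "hsec K s" and t: "hsec F t" and b: "b : B F" shows
 "octad b ==> b : B K ==> herm (oroot K s) (XV (t b)) = agree s t b/2"
 "octad b ==> b ~= K ==> b ~: B K ==> herm (oroot K s) (XV (t b)) = 0"
 "K : B F ==> herm (oroot K s) (XV (t K)) = (if t K = s (- K) \<diamondop> \<Omega> then theta/2 else - theta/2)"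
 "F ~= K ==> F ~: B K ==> herm (oroot K s) (XV (t (- F))) = 0"
 "F : B K ==> herm (oroot K s) (XV (t (- F))) = - theta*(if s F = t (- F) \<diamondop> \<Omega> then 1/2 else - 1/2)"
proof -
 interpret S: osec C mult unit m1 bar \<omega> \<Omega> K s by (rule osIq[OF s])
 interpret T: osec C mult unit m1 bar \<omega> \<Omega> F t by (rule osIq[OF t])
 have o: "herm (oroot K s) (XV (t c)) = oroot K s $ Inr (t c)" if "octad c" "c : B F" for c
 using that hxq[OF S.oVq, of "t c"] by (simp add: Xoq liq)
 show "herm (oroot K s) (XV (t b)) = agree s t b/2" if "octad b" "b : B K"
 unfolding o[OF that(1) b] oIq(1)[OF s that(2,1) T.bar_s[OF b]] agree_def by simp
 show "herm (oroot K s) (XV (t b)) = 0" if "octad b" "b ~= K" "b ~: B K"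
 unfolding o[OF that(1) b] using that b by (intro S.oIoq) simp_all
 show "herm (oroot K s) (XV (t K)) = (if t K = s (- K) \<diamondop> \<Omega> then theta/2 else - theta/2)" if "K : B F"
 unfolding o[OF S.K that] oIq(2)[OF s T.bar_s[OF that]] ..
 have f: "herm (oroot K s) (XV (t (- F))) = - theta * oroot K s $ Inr T.ow"
 unfolding T.XV_X hsq hxq[OF S.oVq T.olq] by (simp add: tcq)
 show "herm (oroot K s) (XV (t (- F))) = 0" if "F ~= K" "F ~: B K"
 unfolding f using S.oIoq[of T.ow] that by simp
 show "herm (oroot K s) (XV (t (- F))) = - theta*(if s F = t (- F) \<diamondop> \<Omega> then 1/2 else - 1/2)" if "F : B K"
 unfolding f oIq(1)[OF s that T.K T.boqa] by (simp add: T.ow_def eq_commute[of "t (- F) \<diamondop> \<Omega>" "s F"])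
qed
text \<open>The two roots share no octad: \<open>K +^ F\<close> is a dodecad, and a common octad
  disjoint from it would produce a word of weight 20. The parts in \<open>U\<close> are orthogonal
  exactly because the intersection has two points.\<close>

lemma ho2q: assumes s: "hsec K s" and t: "hsec F t" and c: "card (K Int F) = 2"
 shows "herm (oroot K s) (oroot F t) = 0"
proof -
 note o = hsecD(1)[OF s] hsecD(1)[OF t]
 have KF: "F ~= K" "F ~: B K" using c octadD(2)[OF o(1)] by (auto simp: B_iff Int_commute)
 have "herm (oroot K s) (XV (t b)) = 0" if b: "b : B F" "b ~= {}" for b
 using o(2) b(1)
 proof (cases rule: Bcq)
 case 1 then show ?thesis using b by simp
 next
 case 2 then show ?thesis using hoXq(4)[OF s t b(1) KF] by simp
 next
 case 3
 have "b ~= K" using Int_B(2)[OF b(1)] c by (auto simp: Int_commute)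
 moreover have "b ~: B K"
 proof
 assume bK: "b : B K"
 have "card (K +^ F) = 12" using csqa[of K F] c octadD(2)[OF o(1)] octadD(2)[OF o(2)] by simp
 moreover have "(K +^ F) Int b = {}" using Int_B(1)[OF b(1)] Int_B(1)[OF bK] by (auto simp: set_eq_iff)
 ultimately have "card (K +^ F +^ b) = 20" using csqa[of "K +^ F" b] octadD(2)[OF 3(1)] by simp
 then show False using weights[of "K +^ F +^ b"] scq octadD(1) o 3(1) by fastforce
 qed
 ultimately show ?thesis using hoXq(2)[OF s t b(1) 3(1)] by simp
 qed
 then have "(SUM b:B F - {{}}. herm (oroot K s) (XV (t b))) = 0" by (intro sum.neutral) simp
 then show ?thesis unfolding hooq[OF s t] using c by simp
qed
text \<open>An octad disjoint from \<open>K\<close> and \<open>F\<close> distributes its eight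
  points over the planes \<open>h2\<close>, \<open>h3\<close>, \<open>h4\<close>, at most four on
  each. The weights in \<open>B K\<close> force the sum of two such numbers to be 0, 4 or 8, so two
  of the planes are filled.\<close>

lemma pwq: assumes K: "octad K" and P: "planes K (K Int F) = {F, h2, h3, h4}" "distinct [F, h2, h3, h4]" and c: "card (K Int F) = 4"
 shows "h2 +^ h3 : B K" "h2 +^ h3 : B F" "octad (h2 +^ h3)"
 and "!!b. octad b ==> b : B K ==> b : B F ==> b = h2 +^ h3 | b = h2 +^ h4 | b = h3 +^ h4"
proof -
 have m: "F : planes K (K Int F)" "h2 : planes K (K Int F)" "h3 : planes K (K Int F)" "h4 : planes K (K Int F)" unfolding P(1) by simp_all
 have F: "octad F" by (rule planesD(1)[OF m(1)])
 show "h2 +^ h3 : B K" by (rule psq[OF m(2,3)])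
 show o23: "octad (h2 +^ h3)" using psoq[OF m(2,3) _ c] P(2) by simp
 have i: "h2 Int F = K Int F" by (rule pIq[OF m(2,1) _ c]) (use P(2) in \<open>simp add: eq_commute[of h2 F]\<close>)
 have i': "h3 Int F = K Int F" by (rule pIq[OF m(3,1) _ c]) (use P(2) in \<open>simp add: eq_commute[of h3 F]\<close>)
 have "x : F ==> x : h2 \<longleftrightarrow> x : K" "x : F ==> x : h3 \<longleftrightarrow> x : K" for x using i i' by blast+
 then have "(h2 +^ h3) Int F = {}" by auto
 then show "h2 +^ h3 : B F" using octadD(1)[OF o23] by (simp add: B_iff)
 fix b assume b: "octad b" "b : B K" "b : B F"
 define n where "n h = card (b Int h Int - K)" for h
 have "card (b Int - K) = (SUM h:planes K (K Int F). n h)" unfolding n_def by (rule pcq[OF K _ c]) blast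
 then have "8 = n F + (n h2 + (n h3 + n h4))" unfolding P(1) CIBq(2)[OF b(2)] octadD(2)[OF b(1)] using P(2) by simp
 moreover have "n F = 0" unfolding n_def Int_B(2)[OF b(3)] by simp
 ultimately have n8: "n h2 + n h3 + n h4 = 8" by simp
 have le: "n h <= 4" if "h : planes K (K Int F)" for h
 unfolding n_def cpmq[OF that c, symmetric] by (rule card_mono) auto
 have pr: "card (b Int (h +^ k)) = n h + n k & (n h + n k = 0 | n h + n k = 4 | n h + n k = 8)"
 if h: "h : planes K (K Int F)" and k: "k : planes K (K Int F)" and hk: "h ~= k" for h k
 proof -
 have bK: "b Int h = b Int h Int - K" "b Int k = b Int k Int - K" using Int_B(2)[OF b(2)] by auto
 have "b Int h Int k = b Int (K Int F)" using pIq[OF h k hk c] by blast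
 also have "... = {}" using Int_B(2)[OF b(2)] by auto
 finally have e: "card (b Int (h +^ k)) = n h + n k" using cIsq[of b h k] bK unfolding n_def by simp
 have ho: "octad (h +^ k)" by (rule psoq[OF h k hk c])
 have "card (b +^ (h +^ k)) = 0 | card (b +^ (h +^ k)) = 8 | card (b +^ (h +^ k)) = 16"
 by (rule Bcqa[OF K B_sd[OF b(2) psq[OF h k]]])
 then show ?thesis using csqa[of b "h +^ k"] octadD(2)[OF b(1)] octadD(2)[OF ho] e by auto
 qed
 have q: "b = h +^ k" if "h : planes K (K Int F)" "k : planes K (K Int F)" "h ~= k" "n h + n k = 8" for h k
 by (rule oeqa[OF b(1) psoq[OF that(1-3) c]]) (use pr[OF that(1-3)] that(4) in simp)
 have ar: "x + y = 8 | x + z = 8 | y + z = 8" if "x + y + z = 8" "x <= 4" "y <= 4" "z <= 4"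
 "x + y = 0 | x + y = 4 | x + y = 8" "x + z = 0 | x + z = 4 | x + z = 8" for x y z :: nat
 using that by presburger
 have ne: "h2 ~= h3" "h2 ~= h4" "h3 ~= h4" using P(2) by simp_all
 have "n h2 + n h3 = 8 | n h2 + n h4 = 8 | n h3 + n h4 = 8"
 by (rule ar[OF n8 le[OF m(2)] le[OF m(3)] le[OF m(4)] conjunct2[OF pr[OF m(2,3) ne(1)]] conjunct2[OF pr[OF m(2,4) ne(2)]]])
 then show "b = h2 +^ h3 | b = h2 +^ h4 | b = h3 +^ h4" using q[OF m(2,3) ne(1)] q[OF m(2,4) ne(2)] q[OF m(3,4) ne(3)] by blast
qed
text \<open>By \<open>pwq\<close> the shared octads are the three pairwise sums of the other planes.
  The summand 1 comes from the parts in \<open>U\<close>, as \<open>(4 - 2)/4 = 1/2\<close> before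
  the final halving.\<close>

lemma ho4q: assumes s: "hsec K s" and t: "hsec F t" and c: "card (K Int F) = 4"
 and P: "planes K (K Int F) = {F, h2, h3, h4}" "distinct [F, h2, h3, h4]"
 shows "herm (oroot K s) (oroot F t) = (1 + agree s t (h2 +^ h3) + agree s t (h2 +^ h4) + agree s t (h3 +^ h4))/4"
proof -
 note o = hsecD(1)[OF s] hsecD(1)[OF t]
 have P': "planes K (K Int F) = {F, h2, h4, h3}" "planes K (K Int F) = {F, h3, h4, h2}" unfolding P(1) by auto
 have D': "distinct [F, h2, h4, h3]" "distinct [F, h3, h4, h2]" using P(2) by auto
 note w1 = pwq[OF o(1) P c] and w2 = pwq[OF o(1) P'(1) D'(1) c] and w3 = pwq[OF o(1) P'(2) D'(2) c]
 have KF: "F ~= K" "F ~: B K" using c octadD(2)[OF o(1)] by (auto simp: B_iff Int_commute)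
 let ?L = "{h2 +^ h3, h2 +^ h4, h3 +^ h4}"
 have z: "herm (oroot K s) (XV (t b)) = 0" if b: "b : B F - {{}} - ?L" for b
 proof -
 have bF: "b : B F" using b by simp
 show ?thesis using o(2) bF
 proof (cases rule: Bcq)
 case 1 then show ?thesis using b by simp
 next
 case 2 then show ?thesis using hoXq(4)[OF s t bF KF] by simp
 next
 case 3
 have "b ~= K" using Int_B(2)[OF bF] c by (auto simp: Int_commute)
 moreover have "b ~: B K" using w1(4)[OF 3(1) _ bF] b by blast
 ultimately show ?thesis using hoXq(2)[OF s t bF 3(1)] by simp
 qed
 qed
 have "h2 +^ h3 ~= {}" "h2 +^ h4 ~= {}" "h3 +^ h4 ~= {}" using P(2) by simp_all
 then have L: "?L <= B F - {{}}" using w1(2) w2(2) w3(2) by blast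
 have d1: "h2 +^ h3 ~= h2 +^ h4" using P(2) by simp
 have d2: "h2 +^ h4 ~= h3 +^ h4" unfolding scqa[of h2 h4] scqa[of h3 h4] using P(2) by simp
 have d3: "h2 +^ h3 ~= h3 +^ h4" unfolding scqa[of h2 h3] using P(2) by simp
 have "(SUM b:?L. f b) = f (h2 +^ h3) + (f (h2 +^ h4) + f (h3 +^ h4))" for f :: "'i set => complex"
 using d1 d2 d3 by simp
 then have "(SUM b:?L. herm (oroot K s) (XV (t b))) = agree s t (h2 +^ h3)/2 + (agree s t (h2 +^ h4)/2 + agree s t (h3 +^ h4)/2)"
 unfolding hoXq(1)[OF s t w1(2,3,1), symmetric] hoXq(1)[OF s t w2(2,3,1), symmetric] hoXq(1)[OF s t w3(2,3,1), symmetric] .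
 moreover have "(SUM b:B F - {{}}. herm (oroot K s) (XV (t b))) = (SUM b:?L. herm (oroot K s) (XV (t b)))"
 by (rule sum.mono_neutral_right) (use L z in auto)
 ultimately show ?thesis unfolding hooq[OF s t] c by (simp add: field_simps)
qed
text \<open>The shared coordinates lie over \<open>K\<close>, \<open>F\<close> and the third octad
  \<open>?L\<close> of the trio, and the sign at \<open>?L\<close> is determined by the other two.
  The nonzero values are the two primitive cube roots of unity, see \<open>ocq\<close>.\<close>

lemma ho0q: assumes s: "hsec K s" and t: "hsec F t" and c: "K Int F = {}"
 shows "herm (oroot K s) (oroot F t) = (if (t K = s (- K) \<diamondop> \<Omega>) = (s F = t (- F) \<diamondop> \<Omega>) then 0
 else if t K = s (- K) \<diamondop> \<Omega> then (theta - 1)/2 else (- theta - 1)/2)"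
proof -
 interpret S: osec C mult unit m1 bar \<omega> \<Omega> K s by (rule osIq[OF s])
 interpret T: osec C mult unit m1 bar \<omega> \<Omega> F t by (rule osIq[OF t])
 have FK: "F : B K" "K : B F" using c octadD(1)[OF S.K] octadD(1)[OF T.K] by (auto simp: B_iff)
 let ?L = "F +^ - K"
 have LKF: "K +^ - F = ?L" by auto
 have Lc: "?L = - (K Un F)" using c by auto
 have L: "?L : B K" "?L : B F" using B_sd[OF FK(1) S.X_in] B_sd[OF FK(2) T.X_in] LKF by simp_all
 have c8: "card K = 8" "card F = 8" "card (- F) = 16" using octadD(2)[OF S.K] octadD(2)[OF T.K] cCoq[OF T.K] by simp_all
 have "card (F Int - K) = 8" using csq[of F K] c c8 by (simp add: Int_commute)
 then have L8: "card ?L = 8" using csqa[of F "- K"] c8 cCoq[OF S.K] by simp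
 have Lo: "octad ?L" using L8 Bwq[OF L(1)] by (simp add: octad_def)
 have neq: "A ~= A'" if "card A ~= card A'" for A A' :: "'i set" using that by blast
 have KL: "K Int ?L = {}" unfolding Lc by blast
 have ne1: "- F ~= K" "- F ~= ?L" "- F ~= {}" "K ~= {}" "?L ~= {}"
 by (rule neq, use c8 L8 in simp)+
 have ne2: "K ~= ?L"
 proof
 assume "K = ?L"
 then have "K = {}" using KL by (metis Int_absorb)
 then show False using ne1(4) by simp
 qed
 note ne = ne1(1,2) ne2 ne1(3-5)
 let ?A = "{- F, K, ?L}"
 have z: "herm (oroot K s) (XV (t b)) = 0" if b: "b : B F - {{}} - ?A" for b
 proof -
 have bF: "b : B F" using b by simp
 show ?thesis using T.K bF
 proof (cases rule: Bcq)
 case 3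
 have "b ~: B K"
 proof
 assume bK: "b : B K"
 have "b <= ?L" unfolding Lc using Int_B(2)[OF bK] Int_B(2)[OF bF] by auto
 then have "b = ?L" using L8 octadD(2)[OF 3(1)] by (intro card_subset_eq) auto
 then show False using b by simp
 qed
 then show ?thesis using hoXq(2)[OF s t bF 3(1)] b by simp
 qed (use b in simp_all)
 qed
 have tK: "t K = S.ow | t K = neg S.ow" using beq[of "t K" S.ow] FK(2) by simp
 have sF: "T.ow = s F | T.ow = neg (s F)" using beq[of T.ow "s F"] FK(1) by simp
 have tL: "t ?L = t K \<diamondop> (T.ow \<diamondop> \<Omega>)" unfolding T.oOq T.smqb[OF FK(2) T.X_in] LKF ..
 have sL: "s ?L = S.ow \<diamondop> (s F \<diamondop> \<Omega>)" using S.ow_s(1)[OF FK(1)] by (simp add: Oaq(1))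
 have nn: "neg d ~= d" "d ~= neg d" for d using neg_neq[of d] by metis+
 have ag: "agree s t ?L = (if (t K = S.ow) = (s F = T.ow) then 1 else - 1)"
 unfolding agree_def tL sL using tK sF by (elim disjE) (simp_all add: mult_neg neg_neg nn)
 have e: "(SUM b:?A. f b) = f (- F) + (f K + f ?L)" for f :: "'i set => complex" using ne by simp
 have "(SUM b:B F - {{}}. herm (oroot K s) (XV (t b))) = (SUM b:?A. herm (oroot K s) (XV (t b)))"
 by (rule sum.mono_neutral_right) (use L FK T.X_in ne z in auto)
 also have "... = - theta*(if s F = T.ow then 1/2 else - 1/2) + ((if t K = S.ow then theta/2 else - theta/2) + agree s t ?L/2)"
 unfolding e hoXq(1)[OF s t L(2) Lo L(1)] hoXq(3)[OF s t FK(2) FK(2)] hoXq(5)[OF s t FK(2) FK(1)] S.ow_def T.ow_def ..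
 finally have tot: "(SUM b:B F - {{}}. herm (oroot K s) (XV (t b))) = - theta*(if s F = T.ow then 1/2 else - 1/2) + ((if t K = S.ow then theta/2 else - theta/2) + agree s t ?L/2)" .
 show ?thesis unfolding hooq[OF s t] tot ag unfolding c S.ow_def[symmetric] T.ow_def[symmetric]
 by (cases "t K = S.ow"; cases "s F = T.ow") (simp_all add: field_simps)
qed
lemma ocq: "((theta - 1)/2) ^ 3 = 1" "((- theta - 1)/2) ^ 3 = 1"
proof -
 have "(theta - 1)/2 = \<omega>" unfolding toq by simp
 then show "((theta - 1)/2) ^ 3 = 1" using omega_root(1) by simp
 have "(- theta - 1)/2 = \<omega>\<^sup>2" unfolding toq ofq(3) by (simp add: field_simps)
 moreover have "(\<omega>\<^sup>2) ^ 3 = (\<omega> ^ 3)\<^sup>2" by (simp flip: power_mult)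
 ultimately show "((- theta - 1)/2) ^ 3 = 1" using omega_root(1) by simp
qed
lemma acq: "agree s t b = 1 | agree s t b = - 1" by (simp add: agree_def)
lemma atq: assumes s: "hsec K s" and t: "hsec F t" and kz: "B_hom K kz" and b: "b : B K" "b : B F"
 shows "agree (twist kz s) t b = kz b * agree s t b"
 using scqb[OF s b(1) hsecD(2)[OF t b(2)]] Bhq(1)[OF kz b(1)] neg_neq[of "s b"]
 by (auto simp: agree_def twist_def)
text \<open>The character is \<open>pt x * pt y\<close>, trivial at \<open>- K\<close>, with
  \<open>x\<close> in \<open>F\<close> off \<open>K\<close>. For disjoint octads \<open>y\<close>
  lies outside both, so the sign at \<open>F\<close> is flipped and the two conditions of
  \<open>ho0q\<close> disagree. For a common tetrad \<open>y\<close> lies on the plane that occurs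
  in both negative signs; these become positive, and the inner product becomes 1.\<close>

lemma ctq: assumes s: "hsec K s" and t: "hsec F t" and c: "card (K Int F) = 0 | card (K Int F) = 4"
 and 0: "herm (oroot K s) (oroot F t) = 0"
 obtains kz where "B_hom K kz" "kz (- K) = 1" "herm (oroot K (twist kz s)) (oroot F t) ^ 3 = 1"
 using c
proof
 note o = hsecD(1)[OF s] hsecD(1)[OF t]
 assume c: "card (K Int F) = 0"
 then have d: "K Int F = {}" by simp
 have FK: "F : B K" using d octadD(1)[OF o(2)] by (auto simp: B_iff)
 have "F ~= {}" using octadD(2)[OF o(2)] by auto
 then obtain x where x: "x : F" by blast
 have "card (K Un F) <= 16" using card_Un_le[of K F] octadD(2) o by simp
 then have "K Un F ~= UNIV" using card_index by auto
 then obtain y where y: "y ~: F" "y ~: K" by blast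
 have xK: "x ~: K" using x d by auto
 define kz where "kz = (%b. pt x b * pt y b)"
 have h: "B_hom K kz" unfolding kz_def by (rule Bhmq[OF Bhpq Bhpq])
 have m: "kz (- K) = 1" "kz F = - 1" using x y xK by (simp_all add: kz_def pt_def)
 interpret T: osec C mult unit m1 bar \<omega> \<Omega> F t by (rule osIq[OF t])
 have sF: "s F = T.ow | s F = neg T.ow" using beq[of "s F" T.ow] hsecD(2)[OF s FK] by simp
 have tw: "twist kz s (- K) = s (- K)" "twist kz s F = neg (s F)" using m by (simp_all add: twist_def)
 have n: "T.ow ~= neg T.ow" using neg_neq[of T.ow] by metis
 have nz: "(theta - 1)/2 ~= 0" "(- theta - 1)/2 ~= 0" using ocq by force+
 have "(t K = s (- K) \<diamondop> \<Omega>) = (s F = T.ow)"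
 using 0 nz unfolding ho0q[OF s t d] T.ow_def by (auto split: if_splits)
 then have "(t K = s (- K) \<diamondop> \<Omega>) ~= (neg (s F) = T.ow)" using sF n by (auto simp: neg_neg)
 then have "herm (oroot K (twist kz s)) (oroot F t) ^ 3 = 1"
 using ocq unfolding ho0q[OF htq[OF s h] t d] tw T.ow_def by auto
 then show ?thesis using that h m by blast
next
 note o = hsecD(1)[OF s] hsecD(1)[OF t]
 assume c: "card (K Int F) = 4"
 note concl = that
 have "card (F Int - K) = 4" using csq[of F K] c octadD(2)[OF o(2)] by (simp add: Int_commute)
 then have "F Int - K ~= {}" by auto
 then obtain x where x: "x : F" "x ~: K" by blast
 have go: "thesis" if P: "planes K (K Int F) = {F, h2, h3, h4}" "distinct [F, h2, h3, h4]"
 and a: "agree s t (h2 +^ h3) = 1" "agree s t (h2 +^ h4) = - 1" "agree s t (h3 +^ h4) = - 1" for h2 h3 h4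
 proof -
 have P': "planes K (K Int F) = {F, h2, h4, h3}" "planes K (K Int F) = {F, h3, h4, h2}" unfolding P(1) by auto
 have D': "distinct [F, h2, h4, h3]" "distinct [F, h3, h4, h2]" using P(2) by auto
 note w1 = pwq[OF o(1) P c] and w2 = pwq[OF o(1) P'(1) D'(1) c] and w3 = pwq[OF o(1) P'(2) D'(2) c]
 have m: "h2 : planes K (K Int F)" "h3 : planes K (K Int F)" "h4 : planes K (K Int F)" unfolding P(1) by simp_all
 have "h4 Int - K ~= {}" using cpmq[OF m(3) c] by auto
 then obtain y where y: "y : h4" "y ~: K" by blast
 have "h4 Int h2 = K Int F" by (rule pIq[OF m(3,1) _ c]) (use P(2) in \<open>simp add: eq_commute[of h4 h2]\<close>)
 moreover have "h4 Int h3 = K Int F" by (rule pIq[OF m(3,2) _ c]) (use P(2) in \<open>simp add: eq_commute[of h4 h3]\<close>)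
 ultimately have y': "y ~: h2" "y ~: h3" using y by blast+
 have x': "x ~: h2 +^ h3" "x ~: h2 +^ h4" "x ~: h3 +^ h4"
 using x(1) Int_B(2)[OF w1(2)] Int_B(2)[OF w2(2)] Int_B(2)[OF w3(2)] by blast+
 define kz where "kz = (%b. pt x b * pt y b)"
 have h: "B_hom K kz" unfolding kz_def by (rule Bhmq[OF Bhpq Bhpq])
 have v: "kz (- K) = 1" using x y by (simp add: kz_def)
 have e: "kz (h2 +^ h3) = 1" "kz (h2 +^ h4) = - 1" "kz (h3 +^ h4) = - 1"
 using x' y y' unfolding kz_def pt_def by simp_all
 have "herm (oroot K (twist kz s)) (oroot F t) = 1"
 unfolding ho4q[OF htq[OF s h] t c P] atq[OF s t h w1(1,2)] atq[OF s t h w2(1,2)] atq[OF s t h w3(1,2)] a e by simp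
 then show thesis using concl[OF h v] by simp
 qed
 have "F : planes K (K Int F)" by (rule planesI[OF o(2)]) blast
 from plq[OF o(1) _ c this] obtain h2 h3 h4 where P: "planes K (K Int F) = {F, h2, h3, h4}" "distinct [F, h2, h3, h4]" by blast
 have sum0: "1 + agree s t (h2 +^ h3) + agree s t (h2 +^ h4) + agree s t (h3 +^ h4) = 0"
 using 0 unfolding ho4q[OF s t c P] by simp
 consider "agree s t (h2 +^ h3) = 1" "agree s t (h2 +^ h4) = - 1" "agree s t (h3 +^ h4) = - 1"
 | "agree s t (h2 +^ h3) = - 1" "agree s t (h2 +^ h4) = 1" "agree s t (h3 +^ h4) = - 1"
 | "agree s t (h2 +^ h3) = - 1" "agree s t (h2 +^ h4) = - 1" "agree s t (h3 +^ h4) = 1"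
 using sum0 acq[of s t "h2 +^ h3"] acq[of s t "h2 +^ h4"] acq[of s t "h3 +^ h4"] by (elim disjE) simp_all
 then show thesis
 proof cases
 case 1 then show ?thesis by (rule go[OF P])
 next
 case 2
 have "planes K (K Int F) = {F, h2, h4, h3}" "distinct [F, h2, h4, h3]" using P by auto
 then show ?thesis by (rule go) (use 2 in \<open>simp_all add: scqa[of h4 h3]\<close>)
 next
 case 3
 have "planes K (K Int F) = {F, h3, h4, h2}" "distinct [F, h3, h4, h2]" using P by auto
 then show ?thesis by (rule go) (use 3 in \<open>simp_all add: scqa[of h4 h2] scqa[of h3 h2]\<close>)
 qed
qed
text \<open>For a common tetrad the three words add up to zero, so the three signs multiply to 1 and
  the sum with 1 is 4 or 0.\<close>

lemma hocq: assumes s: "hsec K s" and t: "hsec F t" and c: "card (K Int F) = 0 | card (K Int F) = 4"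
 shows "herm (oroot K s) (oroot F t) = 0 | herm (oroot K s) (oroot F t) ^ 3 = 1"
 using c
proof
 assume "card (K Int F) = 0"
 then have "K Int F = {}" by simp
 then show ?thesis unfolding ho0q[OF s t \<open>K Int F = {}\<close>] using ocq by auto
next
 note o = hsecD(1)[OF s] hsecD(1)[OF t]
 assume c: "card (K Int F) = 4"
 have "F : planes K (K Int F)" by (rule planesI[OF o(2)]) blast
 from plq[OF o(1) _ c this] obtain h2 h3 h4 where P: "planes K (K Int F) = {F, h2, h3, h4}" "distinct [F, h2, h3, h4]" by blast
 have P': "planes K (K Int F) = {F, h2, h4, h3}" "planes K (K Int F) = {F, h3, h4, h2}" unfolding P(1) by auto
 have D': "distinct [F, h2, h4, h3]" "distinct [F, h3, h4, h2]" using P(2) by auto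
 note w1 = pwq[OF o(1) P c] and w2 = pwq[OF o(1) P'(1) D'(1) c] and w3 = pwq[OF o(1) P'(2) D'(2) c]
 have e: "(h2 +^ h3) +^ (h2 +^ h4) = h3 +^ h4" by auto
 have st: "s (h3 +^ h4) = s (h2 +^ h3) \<diamondop> s (h2 +^ h4)" "t (h3 +^ h4) = t (h2 +^ h3) \<diamondop> t (h2 +^ h4)"
 using hsecD(3)[OF s w1(1) w2(1)] hsecD(3)[OF t w1(2) w2(2)] unfolding e by simp_all
 have n: "neg d ~= d" "d ~= neg d" for d using neg_neq[of d] by metis+
 have "agree s t (h3 +^ h4) = agree s t (h2 +^ h3) * agree s t (h2 +^ h4)"
 using scqb[OF s w1(1) hsecD(2)[OF t w1(2)]] scqb[OF s w2(1) hsecD(2)[OF t w2(2)]]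
 unfolding agree_def st by (elim disjE) (simp_all add: mult_neg neg_neg n)
 then show ?thesis unfolding ho4q[OF s t c P]
 using acq[of s t "h2 +^ h3"] acq[of s t "h2 +^ h4"] by (elim disjE) simp_all
qed
text \<open>In the orthogonal case the section twisted by \<open>ctq\<close> has a map fixing the
  second root up to a cube root of unity. Composed with the original map it is monomial by
  \<open>tq\<close>, so the image under the original map is an octadic root up to that
  scalar.\<close>

lemma tooq: assumes s: "hsec K s" and t: "hsec F t" and c: "card (K Int F) = 0 | card (K Int F) = 4"
 obtains k H u where "k ^ 3 = 1" "hsec H u" "tau (oroot K s) (oroot F t) = k *s oroot H u"
 using hocq[OF s t c]
proof
 assume h: "herm (oroot K s) (oroot F t) ^ 3 = 1"
 have "cnj (herm (oroot K s) (oroot F t)) ^ 3 = 1" using h by (metis complex_cnj_one complex_cnj_power)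
 then show thesis using that[OF _ t] tcqa[OF ioq[OF s] ioq[OF t] h] by blast
next
 assume 0: "herm (oroot K s) (oroot F t) = 0"
 obtain kz where kz: "B_hom K kz" "kz (- K) = 1" and h: "herm (oroot K (twist kz s)) (oroot F t) ^ 3 = 1"
 by (rule ctq[OF s t c 0])
 let ?h = "herm (oroot K (twist kz s)) (oroot F t)"
 have s1: "hsec K (twist kz s)" by (rule htq[OF s kz(1)])
 obtain qz where "!!F t. hsec F t ==> EX t'. hsec (qz ` F) t' & tau (oroot K (twist kz (twist kz s))) (tau (oroot K (twist kz s)) (oroot F t)) = oroot (qz ` F) t'"
 by (rule tq[OF s1 kz]) blast
 then obtain t' where t': "hsec (qz ` F) t'" "tau (oroot K (twist kz (twist kz s))) (tau (oroot K (twist kz s)) (oroot F t)) = oroot (qz ` F) t'"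
 using t by blast
 have "oroot K (twist kz (twist kz s)) = oroot K (twist (%_. 1) s)"
 unfolding ttq[OF kz(1) kz(1)] by (rule otcq) (rule Bhq(3)[OF kz(1)])
 then have e: "oroot K (twist kz (twist kz s)) = oroot K s" by (simp add: toqa)
 have "?h *s tau (oroot K s) (oroot F t) = oroot (qz ` F) t'"
 using t'(2) unfolding e tcqa[OF ioq[OF s1] ioq[OF t] h] tsq by simp
 then have "cnj ?h *s oroot (qz ` F) t' = (cnj ?h*?h) *s tau (oroot K s) (oroot F t)" by (simp add: ssq flip: ssq)
 then have "tau (oroot K s) (oroot F t) = cnj ?h *s oroot (qz ` F) t'" using crq(1)[OF h] by (simp add: mult.commute)
 moreover have "cnj ?h ^ 3 = 1" using h by (metis complex_cnj_one complex_cnj_power)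
 ultimately show thesis using that t'(1) by blast
qed
end

section \<open>Closure of the root set, and inner products of arbitrary roots\<close>

context parker_algebra begin
text \<open>Records the two octads but hides the sections: a duadic root has to be rewritten over
  other pairs of octads with the same intersection.\<close>

definition rep :: "'i set => 'i set => complex ^ ('i + 'p) => bool" where
 "rep K F r \<longleftrightarrow> (EX s t. hsec K s & hsec F t & r = oroot K s \<star> oroot F t)"
definition rt0 :: "complex ^ ('i + 'p) => bool" where
 "rt0 r \<longleftrightarrow> (EX i. r = broot i) | (EX K s. hsec K s & r = oroot K s) | (EX K F. card (K Int F) = 2 & rep K F r)"
definition rt :: "complex ^ ('i + 'p) => bool" where
 "rt r \<longleftrightarrow> (EX c r0. c ^ 3 = 1 & rt0 r0 & r = c *s r0)"
lemma rsqc: "rep K F r ==> rep F K r" unfolding rep_def using star_commute by metis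
lemma rt0_I: "rt0 (broot i)" "hsec K s ==> rt0 (oroot K s)" "hsec K s ==> hsec F t ==> card (K Int F) = 2 ==> rt0 (oroot K s \<star> oroot F t)"
 unfolding rt0_def rep_def by blast+
lemma rrq: "rt0 r ==> rt r" unfolding rt_def by (intro exI[of _ 1] exI[of _ r]) simp
lemma rsqb: assumes "c ^ 3 = 1" "rt r" shows "rt (c *s r)"
proof -
 obtain b r0 where b: "b ^ 3 = 1" "rt0 r0" "r = b *s r0" using assms(2) unfolding rt_def by blast
 have "(c * b) ^ 3 = 1" using assms(1) b(1) by (simp add: power_mult_distrib)
 then show ?thesis unfolding rt_def b(3) ssq using b(2) by blast
qed
lemma stq: assumes s: "hsec K s" and t: "hsec F t" and c: "card (K Int F) = 2"
 shows "oroot K s \<star> oroot F t = tau (oroot K s) (oroot F t)" "oroot K s \<star> oroot F t = tau (oroot F t) (oroot K s)"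
 using tzq[OF ho2q[OF s t c]] tzq[OF hzsq[OF ho2q[OF s t c]]] star_commute by simp_all
lemma rtoqa: assumes s: "hsec K s" and t: "hsec F t" shows "rt (tau (oroot K s) (oroot F t))"
proof (cases "K = F")
 case True
 from tsqd[OF s t[folded True]] show ?thesis using rrq[OF rt0_I(1)] rrq[OF rt0_I(2)[OF t]] True by auto
next
 case False
 have "card (K Int F) = 2 | (card (K Int F) = 0 | card (K Int F) = 4)" using eIoq[OF hsecD(1)[OF s] hsecD(1)[OF t] False] by blast
 then show ?thesis
 proof
 assume c: "card (K Int F) = 2"
 show ?thesis unfolding stq(1)[OF s t c, symmetric] by (rule rrq[OF rt0_I(3)[OF s t c]])
 next
 assume c: "card (K Int F) = 0 | card (K Int F) = 4"
 obtain k H u where k: "k ^ 3 = 1" "hsec H u" "tau (oroot K s) (oroot F t) = k *s oroot H u" by (rule tooq[OF s t c])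
 show ?thesis unfolding k(3) by (rule rsqb[OF k(1) rrq[OF rt0_I(2)[OF k(2)]]])
 qed
qed
lemma rszq: assumes s: "hsec K s" and t: "hsec F t" and 0: "herm (oroot K s) (oroot F t) = 0"
 shows "rt (oroot K s \<star> oroot F t)"
 using rtoqa[OF s t] unfolding tzq[OF 0] star_commute[of "oroot F t"] .
text \<open>Off \<open>H\<close> the permutation acts like a translation. If \<open>F\<close> were
  invariant, the points \<open>m\<close>, \<open>z\<close> and their images would form a 4-set in
  \<open>F - H\<close> that meets every word of \<open>B H\<close> evenly, which \<open>Tnpq\<close>
  forbids.\<close>

lemma tmqa: assumes H: "octad H" and F: "octad F" and c: "card (F Int H) = 2"
 and b: "bij qz" and out: "!!z. z ~: H ==> qz z ~: H"
 and p: "!!z b. z ~: H ==> b : B H ==> pt (qz z) b = kz b * pt z b"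
 and m: "m : F" "m ~: H" "qz m ~= m"
 shows "qz ` F ~= F"
proof
 assume e: "qz ` F = F"
 let ?n = "qz m"
 have n: "?n : F" "?n ~: H" using e m out by blast+
 have c6: "card (F Int - H) = 6" using csq[of F H] c octadD(2)[OF F] by simp
 have "~ F Int - H <= {m, ?n}"
 proof
 assume "F Int - H <= {m, ?n}"
 then have "card (F Int - H) <= card {m, ?n}" by (intro card_mono) auto
 then show False using c6 m(3) by simp
 qed
 then obtain z where z: "z : F" "z ~: H" "z ~= m" "z ~= ?n" by blast
 let ?w = "qz z"
 have w: "?w : F" "?w ~: H" using e z out by blast+
 have k2: "kz b * kz b = 1" if "b : B H" for b
 proof -
 have "pt ?n b * pt ?n b = (kz b * kz b)*(pt m b * pt m b)" unfolding p[OF m(2) that] by simp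
 then show ?thesis by simp
 qed
 have wz: "?w ~= z"
 proof
 assume wz: "?w = z"
 have "pt ?n b = pt m b" if "b : B H" for b
 using p[OF z(2) that] p[OF m(2) that] pt_cases[of z b] unfolding wz by auto
 then have "?n = m" using peieq[OF H n(2) m(2)] by blast
 then show False using m(3) by simp
 qed
 have wm: "?w ~= m"
 proof
 assume wm: "?w = m"
 have "pt ?n b = pt z b" if "b : B H" for b
 using p[OF z(2) that] p[OF m(2) that] k2[OF that] unfolding wm by (simp flip: mult.assoc)
 then have "?n = z" using peieq[OF H n(2) z(2)] by blast
 then show False using z(4) by simp
 qed
 have wn: "?w ~= ?n" using b z(3) by (auto dest: bij_is_inj injD)
 note ne = m(3)[symmetric] z(3)[symmetric] z(4)[symmetric] wz[symmetric] wm[symmetric] wn[symmetric]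
 have S: "{m, ?n, z, ?w} <= F Int - H" "card {m, ?n, z, ?w} = 4" using m n z w ne by simp_all
 obtain b where b: "b : B H" "odd (card ({m, ?n, z, ?w} Int b))" using Tnpq[OF H F c S] by blast
 have "(-1::complex) ^ card ({m, ?n, z, ?w} Int b) = pt m b * pt ?n b*(pt z b * pt ?w b)"
 using ne by (cases "m : b"; cases "?n : b"; cases "z : b"; cases "?w : b") (simp_all add: pt_def Int_insert_left)
 also have "... = (kz b * kz b)*((pt m b * pt m b)*(pt z b * pt z b))"
 unfolding p[OF m(2) b(1)] p[OF z(2) b(1)] by (simp only: mult_ac)
 also have "... = 1" using k2[OF b(1)] by simp
 finally show False using b(2) by (simp add: epiq)
qed
text \<open>The monomial map of \<open>H\<close> that exchanges the two points \<open>m\<close>,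
  \<open>n\<close> of \<open>F Int F1\<close> off \<open>H\<close> moves \<open>F\<close> to another
  octad with the same trace on \<open>H\<close>, still containing the tetrad
  \<open>F Int F1\<close>. A third octad is excluded: the complement of the sum of all three would
  share six points with \<open>H\<close> and thus equal it.\<close>

lemma psqa: assumes r: "rep F H r" and D: "octad F1" and c: "card (F Int H) = 2" and e: "F1 Int H = F Int H"
 shows "rep F1 H r"
proof (cases "F1 = F")
 case True then show ?thesis using r by simp
next
 case False
 obtain t u where t: "hsec F t" and u: "hsec H u" and r: "r = oroot F t \<star> oroot H u" using r unfolding rep_def by blast
 note o = hsecD(1)[OF t] hsecD(1)[OF u]
 have iff: "x : H ==> x : F1 \<longleftrightarrow> x : F" for x using e by blast
 have FB: "F +^ F1 : B H" using iff scq[OF octadD(1)[OF o(1)] octadD(1)[OF D]] by (auto simp: B_iff)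
 have "card (F Int H) <= card (F Int F1)" by (rule card_mono) (use iff in auto)
 then have c4: "card (F Int F1) = 4" "card (F +^ F1) = 8"
 using c eIoq[OF o(1) D] False Bcqa[OF o(2) FB] csqa[of F F1] octadD(2)[OF o(1)] octadD(2)[OF D] by auto
 have "F Int F1 Int H = F Int H" using iff by blast
 then have "card (F Int F1 Int - H) = 2" using csq[of "F Int F1" H] c4 c by simp
 then obtain m n where mn: "F Int F1 Int - H = {m, n}" "m ~= n" unfolding card_2_iff by blast
 have mn': "m : F" "m : F1" "m ~: H" "n : F" "n : F1" "n ~: H" using mn(1) by blast+
 define kz where "kz = (%b. pt m b * pt n b)"
 have k: "B_hom H kz" "kz (- H) = 1" unfolding kz_def using mn' by (simp_all add: Bhmq[OF Bhpq Bhpq])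
 obtain qz where qz: "bij qz" "!!i. i : H ==> qz i = i" "!!z. z ~: H ==> qz z ~: H"
 "!!z b. z ~: H ==> b : B H ==> pt (qz z) b = kz b * pt z b" "!!F. octad F ==> octad (qz ` F)"
 "!!F t. hsec F t ==> EX t'. hsec (qz ` F) t' & tau (oroot H (twist kz u)) (tau (oroot H u) (oroot F t)) = oroot (qz ` F) t'"
 by (rule tq[OF u k]) blast
 have qzm: "qz m = n" by (rule peieq[OF o(2) qz(3)[OF mn'(3)] mn'(6)]) (simp add: qz(4)[OF mn'(3)] kz_def)
 have qzn: "qz n = m" by (rule peieq[OF o(2) qz(3)[OF mn'(6)] mn'(3)]) (simp add: qz(4)[OF mn'(6)] kz_def)
 let ?F = "qz ` F"
 have Fo: "octad ?F" by (rule qz(5)[OF o(1)])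
 have iff': "x : ?F \<longleftrightarrow> x : F" if x: "x : H" for x
 proof
 assume "x : ?F" then obtain y where y: "y : F" "x = qz y" by blast
 then have "y : H" using qz(3) x by blast
 then show "x : F" using y qz(2) by simp
 next
 assume "x : F" then show "x : ?F" using qz(2)[OF x] by (metis imageI)
 qed
 have "m : ?F" "n : ?F" using qzm qzn mn' by (metis imageI)+
 have T: "F Int F1 <= ?F"
 proof
 fix x assume x: "x : F Int F1"
 show "x : ?F"
 proof (cases "x : H")
 case True then show ?thesis using iff' x by blast
 next
 case False then have "x = m | x = n" using mn(1) x by blast
 then show ?thesis using \<open>m : ?F\<close> \<open>n : ?F\<close> by blast
 qed
 qed
 have nF: "?F ~= F" by (rule tmqa[OF o(2,1) c qz(1,3,4) mn'(1,3)]) (use qzm mn(2) in auto)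
 have "?F = F1"
 proof (rule ccontr)
 assume nF1: "?F ~= F1"
 have i1: "F Int ?F = F Int F1" by (rule oIeq[OF o(1) Fo nF[symmetric] _ T c4(1)]) blast
 have i2: "F1 Int ?F = F Int F1" by (rule oIeq[OF D Fo nF1[symmetric] _ T c4(1)]) blast
 let ?W = "F +^ F1 +^ ?F"
 have W: "?W : C" by (intro scq octadD(1) o(1) D Fo)
 have "(F +^ F1) Int ?F = {}" using i1 i2 by (auto simp: set_eq_iff)
 then have "card ?W = 16" using csqa[of "F +^ F1" ?F] c4(2) octadD(2)[OF Fo] by simp
 then have Wo: "octad (- ?W)" using Cwq[OF W] cCq[of ?W] card_index by (simp add: octad_def)
 have Hx: "x : H ==> x : ?W \<longleftrightarrow> x : F" for x using iff iff' by auto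
 then have WH: "- ?W Int H = H Int - F" by blast
 have "card (H Int - F) = 6" using csq[of H F] c octadD(2)[OF o(2)] by (simp add: Int_commute)
 then have "- ?W = H" by (intro oeqa[OF Wo o(2)]) (simp add: WH)
 then have "F Int H = {}" using Hx by blast
 then show False using c by simp
 qed
 then obtain t' where t': "hsec F1 t'" "tau (oroot H (twist kz u)) (tau (oroot H u) (oroot F t)) = oroot F1 t'" using qz(6)[OF t] by auto
 have u': "hsec H (twist kz u)" by (rule htq[OF u k(1)])
 have rv: "r = tau (oroot H u) (oroot F t)" unfolding r by (rule stq(2)[OF t u c])
 have "r : VV" unfolding r by (rule sVq)
 then have "r = tau (oroot H (twist kz u)) (tau (oroot H (twist kz u)) r)" using ciq[OF coq[OF u']] by simp
 also have "... = oroot F1 t' \<star> oroot H (twist kz u)"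
 using stq(2)[OF t'(1) u'] c e t'(2) unfolding rv[symmetric] by simp
 finally show ?thesis unfolding rep_def using t'(1) u' by blast
qed
text \<open>One octad is exchanged at a time by \<open>psqa\<close>. This needs \<open>A\<close> and
  \<open>D\<close> to meet just in the pair; if they meet in a tetrad, the octad from
  \<open>ombq\<close> serves as an intermediate partner for both.\<close>

lemma pcqa: assumes r: "rep A A' r" and c: "card (A Int A') = 2" and D: "octad D" "octad D'" "D Int D' = A Int A'"
 shows "rep D D' r"
proof -
 have o: "octad A" "octad A'" using r hsecD(1) unfolding rep_def by blast+
 have right: "rep P R r" if "rep P Q r" "octad R" "card (P Int Q) = 2" "P Int R = P Int Q" for P Q R
 by (rule rsqc[OF psqa[OF rsqc[OF that(1)] that(2)]]) (use that(3,4) in \<open>simp_all add: Int_commute\<close>)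
 have via: "rep D D' r" if H: "octad H" "H Int A = A Int A'" "H Int D = A Int A'" for H
 proof -
 have 1: "rep A H r" by (rule right[OF r H(1) c]) (use H(2) in \<open>simp add: Int_commute\<close>)
 have AH: "A Int H = A Int A'" "D Int H = A Int A'" using H by (simp_all add: Int_commute)
 have 2: "rep D H r" by (rule psqa[OF 1 D(1)]) (use AH c in simp_all)
 show ?thesis by (rule right[OF 2 D(2)]) (use AH D(3) c in simp_all)
 qed
 have p: "A Int A' <= A Int D" using D(3) by blast
 have "card (A Int A') <= card (A Int D)" by (rule card_mono[OF _ p]) simp
 then have "A = D | card (A Int D) = 2 | card (A Int D) = 4"
 proof (cases "A = D")
 case False
 from eIoq[OF o(1) D(1) False] show ?thesis
 proof (elim disjE)
 assume "card (A Int D) = 0" then show ?thesis using \<open>card (A Int A') <= card (A Int D)\<close> c by linarith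
 qed simp_all
 qed simp
 then show ?thesis
 proof (elim disjE)
 assume "A = D" then show ?thesis using right[OF r D(2) c] D(3) by simp
 next
 assume c2: "card (A Int D) = 2"
 have AD: "A Int D = A Int A'" using card_subset_eq[OF _ p] c c2 by simp
 have "rep D A r" by (rule rsqc[OF right[OF r D(1) c AD]])
 then show ?thesis by (rule right[OF _ D(2)]) (use AD c D(3) in \<open>simp_all add: Int_commute\<close>)
 next
 assume c4: "card (A Int D) = 4"
 obtain H where "octad H" "H Int A = A Int A'" "H Int D = A Int A'" by (rule ombq[OF o(1) D(1) c4 p c])
 then show ?thesis by (rule via)
 qed
qed
text \<open>Both factors go to octadic roots up to cube roots of unity by \<open>tooq\<close>. They
  remain orthogonal because the map preserves the form, so their product is a root by
  \<open>rszq\<close>.\<close>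

lemma rtsq: assumes s: "hsec K s" and a: "hsec A a" and a': "hsec A' a'" and c: "card (A Int A') = 2"
 and k: "card (K Int A) = 0 | card (K Int A) = 4" "card (K Int A') = 0 | card (K Int A') = 4"
 shows "rt (tau (oroot K s) (oroot A a \<star> oroot A' a'))"
proof -
 obtain k H u where H: "k ^ 3 = 1" "hsec H u" "tau (oroot K s) (oroot A a) = k *s oroot H u" by (rule tooq[OF s a k(1)])
 obtain k' H' u' where H': "k' ^ 3 = 1" "hsec H' u'" "tau (oroot K s) (oroot A' a') = k' *s oroot H' u'" by (rule tooq[OF s a' k(2)])
 note v = oiVq[OF a] oiVq[OF a']
 have nz: "k ~= 0" "k' ~= 0" using H(1) H'(1) by auto
 have "herm (k *s oroot H u) (k' *s oroot H' u') = 0"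
 using chq[OF coq[OF s] v] ho2q[OF a a' c] unfolding H(3) H'(3) by simp
 then have 0: "herm (oroot H u) (oroot H' u') = 0" using nz by (simp add: hsq)
 have "tau (oroot K s) (oroot A a \<star> oroot A' a') = (cnj k * cnj k') *s (oroot H u \<star> oroot H' u')"
 unfolding csqb[OF coq[OF s] v] H(3) H'(3) star_scale ssrq by (simp add: ssq)
 moreover have "(cnj k * cnj k') ^ 3 = 1" using H(1) H'(1) by (metis complex_cnj_mult complex_cnj_one complex_cnj_power mult_1 power_mult_distrib)
 ultimately show ?thesis using rsqb rszq[OF H(2) H'(2) 0] by simp
qed
text \<open>The duadic root is first rewritten over octads in good position. For a pair not inside
  \<open>K\<close>, both can be chosen to meet \<open>K\<close> in 0 or 4 points. For a pair inside
  \<open>K\<close> one factor is taken over \<open>K\<close> itself, and its character at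
  \<open>- K\<close> decides whether it is fixed or becomes a basic root.\<close>

lemma rtodq: assumes s: "hsec K s" and r: "rep A A' r" and c: "card (A Int A') = 2"
 shows "rt (tau (oroot K s) r)"
proof -
 note K = hsecD(1)[OF s]
 obtain i j where ij: "A Int A' = {i, j}" "i ~= j" using c unfolding card_2_iff by blast
 have mixed: "rt (tau (oroot K s) r)" if e: "A Int A' = {i, j}" "i : K" "j ~: K" for i j
 proof -
 obtain F F' where F: "octad F" "octad F'" "F Int F' = {i, j}" "card (F Int K) = 4" "card (F' Int K) = 4" by (rule ofmpq[OF K e(2,3)])
 obtain t t' where t: "hsec F t" "hsec F' t'" "r = oroot F t \<star> oroot F' t'" using pcqa[OF r c F(1,2)] F(3) e unfolding rep_def by auto
 show ?thesis unfolding t(3) by (rule rtsq[OF s t(1,2)]) (use F e c in \<open>simp_all add: Int_commute\<close>)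
 qed
 consider "i : K" "j : K" | "i : K" "j ~: K" | "i ~: K" "j : K" | "i ~: K" "j ~: K" by blast
 then show ?thesis
 proof cases
 case 2 then show ?thesis using mixed[OF ij(1)] by blast
 next
 case 3 then show ?thesis using mixed[of j i] ij(1) by (simp add: insert_commute)
 next
 case 4
 obtain F F' where F: "octad F" "octad F'" "F Int F' = {i, j}" "F Int K = {}" "card (F' Int K) = 4" by (rule ofopq[OF K 4 ij(2)])
 obtain t t' where t: "hsec F t" "hsec F' t'" "r = oroot F t \<star> oroot F' t'" using pcqa[OF r c F(1,2)] F(3) ij unfolding rep_def by auto
 show ?thesis unfolding t(3) by (rule rtsq[OF s t(1,2)]) (use F ij c in \<open>simp_all add: Int_commute\<close>)
 next
 case 1
 then have p: "A Int A' <= K" using ij(1) by simp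
 obtain H where H: "octad H" "H Int K = A Int A'" by (rule ompq[OF K p c])
 have KH: "K Int H = A Int A'" using H(2) by (simp add: Int_commute)
 obtain k h where kh: "hsec K k" "hsec H h" "r = oroot K k \<star> oroot H h" using pcqa[OF r c K H(1) KH] unfolding rep_def by blast
 obtain pz where pz: "B_hom K pz" "oroot K k = oroot K (twist pz s)" by (rule stqa[OF s kh(1)])
 have ct: "caut (tau (oroot K s))" by (rule coq[OF s])
 note v = oiVq[OF kh(1)] oiVq[OF kh(2)]
 have KH2: "card (K Int H) = 2" using KH c by simp
 interpret S: osec C mult unit m1 bar \<omega> \<Omega> K s by (rule osIq[OF s])
 from BhCq[OF K pz(1)] show ?thesis
 proof
 assume e1: "pz (- K) = 1"
 have fx: "tau (oroot K s) (oroot K k) = oroot K k" unfolding pz(2) by (rule S.tteq[OF pz(1) e1])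
 have "herm (oroot K k) (tau (oroot K s) (oroot H h)) = 0"
 using chq[OF ct v] ho2q[OF kh(1,2) KH2] unfolding fx by simp
 from tzq[OF this] have "tau (oroot K s) r = tau (oroot K k) (tau (oroot K s) (oroot H h))"
 unfolding kh(3) csqb[OF ct v] fx by (simp add: star_commute)
 moreover obtain qz where "!!F t. hsec F t ==> EX t'. hsec (qz ` F) t' & tau (oroot K (twist pz s)) (tau (oroot K s) (oroot F t)) = oroot (qz ` F) t'"
 by (rule tq[OF s pz(1) e1]) blast
 ultimately show ?thesis using kh(2) rrq[OF rt0_I(2)] unfolding pz(2) by metis
 next
 assume e1: "pz (- K) = - 1"
 obtain x where x: "tau (oroot K s) (oroot K k) = broot x" by (rule toqb[OF s pz(1) e1]) (use pz(2) in auto)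
 have "herm (broot x) (tau (oroot K s) (oroot H h)) = 0"
 using chq[OF ct v] ho2q[OF kh(1,2) KH2] unfolding x by simp
 from tzq[OF this] have "tau (oroot K s) r = tau (broot x) (tau (oroot K s) (oroot H h))"
 unfolding kh(3) csqb[OF ct v] x by (simp add: star_commute)
 also have "... = tau (broot x) (oroot K s \<star> oroot H h)" unfolding stq(1)[OF s kh(2) KH2] ..
 also have "... = oroot K (twist (pt x) s) \<star> oroot H (twist (pt x) h)"
 unfolding csqb[OF cbq S.oVq v(2)] tboq[OF s] tboq[OF kh(2)] ..
 finally show ?thesis using rrq[OF rt0_I(3)[OF htq[OF s Bhpq] htq[OF kh(2) Bhpq] KH2]] by simp
 qed
 qed
qed
lemma rcq [consumes 1, case_names basic octadic duadic]:
 assumes "rt0 r" obtains i where "r = broot i" | K s where "hsec K s" "r = oroot K s"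
 | K s F t where "hsec K s" "hsec F t" "card (K Int F) = 2" "r = oroot K s \<star> oroot F t"
 using assms unfolding rt0_def rep_def by metis
lemma rlq: assumes T: "caut T" and t: "!!r. rt0 r ==> rt (T r)" and r: "rt r" shows "rt (T r)"
proof -
 obtain c r0 where c: "c ^ 3 = 1" "rt0 r0" "r = c *s r0" using r unfolding rt_def by blast
 have "cnj c ^ 3 = 1" using c(1) by (metis complex_cnj_one complex_cnj_power)
 then show ?thesis unfolding c(3) csqc[OF T] by (rule rsqb[OF _ t[OF c(2)]])
qed
lemma rtbq: assumes "rt0 r" shows "rt (tau (broot i) r)"
 using assms
proof (cases rule: rcq)
 case (basic j) then show ?thesis using rrq[OF rt0_I(1)] by (simp add: tbbq)
next
 case (octadic K s) then show ?thesis using rrq[OF rt0_I(2)[OF htq[OF octadic(1) Bhpq]]] by (simp add: tboq)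
next
 case (duadic K s F t)
 have "tau (broot i) r = oroot K (twist (pt i) s) \<star> oroot F (twist (pt i) t)"
 unfolding duadic(4) csqb[OF cbq oiVq[OF duadic(1)] oiVq[OF duadic(2)]] tboq[OF duadic(1)] tboq[OF duadic(2)] ..
 then show ?thesis using rrq[OF rt0_I(3)[OF htq[OF duadic(1) Bhpq] htq[OF duadic(2) Bhpq] duadic(3)]] by simp
qed
lemma rtoq: assumes s: "hsec K s" and r: "rt0 r" shows "rt (tau (oroot K s) r)"
 using r
proof (cases rule: rcq)
 case (basic j)
 interpret S: osec C mult unit m1 bar \<omega> \<Omega> K s by (rule osIq[OF s])
 show ?thesis using S.tbiq[of j] S.tboqa[of j] rrq[OF rt0_I(1)] rrq[OF rt0_I(2)[OF htq[OF s Bhpq]]] basic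
 by (cases "j : K") auto
next
 case (octadic F t) then show ?thesis using rtoqa[OF s] by simp
next
 case (duadic A a A' a')
 then have "rep A A' r" unfolding rep_def by blast
 then show ?thesis by (rule rtodq[OF s _ duadic(3)])
qed
lemma irq: assumes "rt0 r" shows "isroot r"
 using assms
proof (cases rule: rcq)
 case (duadic K s F t) then show ?thesis
 using iiq[OF coq[OF duadic(1)] ioq[OF duadic(2)]] stq(1)[OF duadic(1-3)] by simp
qed (simp_all add: ibq ioq)
lemma rtq: assumes r: "rt0 r" and s: "rt s" shows "rt (tau r s)"
 using r
proof (cases rule: rcq)
 case (basic i) show ?thesis unfolding basic by (rule rlq[OF cbq rtbq s])
next
 case (octadic K k) show ?thesis unfolding octadic(2) by (rule rlq[OF coq[OF octadic(1)] rtoq[OF octadic(1)] s])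
next
 case (duadic K k F t)
 have o: "rt (tau (oroot K k) v)" if "rt v" for v by (rule rlq[OF coq[OF duadic(1)] rtoq[OF duadic(1)] that])
 have o': "rt (tau (oroot F t) v)" if "rt v" for v by (rule rlq[OF coq[OF duadic(2)] rtoq[OF duadic(2)] that])
 have "s : VV" using s isrootD(1)[OF irq] VV_scale unfolding rt_def by blast
 then have "tau r s = tau (oroot K k) (tau (oroot F t) (tau (oroot K k) s))"
 unfolding duadic(4) stq(1)[OF duadic(1-3)] by (rule tiqa[OF coq[OF duadic(1)] oiVq[OF duadic(2)]])
 then show ?thesis using o o' s by simp
qed
text \<open>The map of one factor is moved to the basic root. That map fixes the basic root if
  \<open>i\<close> is on the factor's octad and otherwise makes it an octadic root over the same
  octad, which is orthogonal to the other factor by \<open>ho2q\<close>.\<close>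

lemma hsbq: assumes s: "hsec K s" and t: "hsec F t" and c: "card (K Int F) = 2"
 shows "herm (oroot K s \<star> oroot F t) (broot i) = (if i : K Int F then 1 else 0)"
proof -
 interpret S: osec C mult unit m1 bar \<omega> \<Omega> K s by (rule osIq[OF s])
 interpret T: osec C mult unit m1 bar \<omega> \<Omega> F t by (rule osIq[OF t])
 have 1: "herm (oroot K s \<star> oroot F t) (broot i) = cnj (herm (oroot F t) (tau (oroot K s) (broot i)))"
 using chq[OF S.cTq T.oVq tVq[OF S.oVq, of "broot i"]] ciq[OF S.cTq bVq] stq(1)[OF s t c] by simp
 have 2: "herm (oroot K s \<star> oroot F t) (broot i) = cnj (herm (oroot K s) (tau (oroot F t) (broot i)))"
 using chq[OF T.cTq S.oVq tVq[OF T.oVq, of "broot i"]] ciq[OF T.cTq bVq] stq(2)[OF s t c] by simp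
 consider "i : K" | "i ~: K" "i : F" | "i ~: K" "i ~: F" by blast
 then show ?thesis
 proof cases
 case 1 then show ?thesis unfolding \<open>herm (oroot K s \<star> oroot F t) (broot i) = cnj (herm (oroot F t) (tau (oroot K s) (broot i)))\<close>
 by (simp add: S.tbiq T.hobq)
 next
 case 2 then show ?thesis unfolding \<open>herm (oroot K s \<star> oroot F t) (broot i) = cnj (herm (oroot K s) (tau (oroot F t) (broot i)))\<close>
 by (simp add: T.tbiq S.hobq)
 next
 case 3 then show ?thesis unfolding 2 T.tboqa[OF 3(2)] using ho2q[OF s htq[OF t Bhpq] c] by simp
 qed
qed
definition mu3 :: "complex => bool" where "mu3 c \<longleftrightarrow> c ^ 3 = 1"
lemma mu3: "mu3 1" "mu3 c ==> mu3 (cnj c)" "mu3 c ==> mu3 e ==> mu3 (c * e)" "mu3 c ==> c ~= 0"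
 by (auto simp: mu3_def power_mult_distrib simp flip: complex_cnj_power)
text \<open>The trichotomy behind the 3-transposition property: orthogonal, inner product a cube
  root of unity, or the same ray. In this form it can be transported by automorphisms permuting the
  roots up to scalars.\<close>

definition orth :: "complex ^ ('i + 'p) => bool" where
 "orth s \<longleftrightarrow> (ALL r. rt0 r --> herm r s = 0 | mu3 (herm r s) | (EX c. mu3 c & r = c *s s))"
lemma oiqb: assumes T: "caut T" "!!r. rt0 r ==> rt (T r)" and s: "s : VV" and o: "orth (T s)" shows "orth s"
 unfolding orth_def
proof (intro allI impI)
 fix r assume r: "rt0 r"
 obtain c r0 where c: "c ^ 3 = 1" "rt0 r0" "T r = c *s r0" using T(2)[OF r] unfolding rt_def by blast
 have V: "r : VV" by (rule isrootD(1)[OF irq[OF r]])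
 have cc: "mu3 c" using c(1) by (simp add: mu3_def)
 have h: "herm r s = cnj (c * herm r0 (T s))"
 using chq[OF T(1) V s] unfolding c(3) hsq by (metis complex_cnj_cnj)
 from o c(2) consider "herm r0 (T s) = 0" | "mu3 (herm r0 (T s))" | e where "mu3 e" "r0 = e *s T s" unfolding orth_def by blast
 then show "herm r s = 0 | mu3 (herm r s) | (EX c. mu3 c & r = c *s s)"
 proof cases
 case 1 then show ?thesis unfolding h by simp
 next
 case 2 then show ?thesis unfolding h using mu3(2,3) cc by blast
 next
 case 3
 have "r = T (T r)" using ciq[OF T(1) V] by simp
 also have "... = cnj (c * e) *s s" unfolding c(3) 3(2) ssq csqc[OF T(1)] ciq[OF T(1) s] ..
 finally show ?thesis using mu3(2,3) cc 3(1) by blast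
 qed
qed
lemma hrbq: assumes "rt0 r" shows "herm r (broot i) = 0 | herm r (broot i) = 1 | r = broot i"
 using assms
proof (cases rule: rcq)
 case (octadic K s)
 interpret S: osec C mult unit m1 bar \<omega> \<Omega> K s by (rule osIq[OF octadic(1)])
 show ?thesis unfolding octadic(2) S.hobq by simp
next
 case (duadic K s F t) show ?thesis unfolding duadic(4) hsbq[OF duadic(1-3)] by simp
qed (simp add: hbbq)
lemma ofbq: assumes s: "hsec K s" and x: "x ~: K" shows "tau (oroot K (twist (pt x) s)) (broot x) = oroot K s"
 "tau (oroot K (twist (pt x) s)) (oroot K s) = broot x"
proof -
 have s': "hsec K (twist (pt x) s)" by (rule htq[OF s Bhpq])
 interpret S: osec C mult unit m1 bar \<omega> \<Omega> K "twist (pt x) s" by (rule osIq[OF s'])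
 have "oroot K (twist (pt x) (twist (pt x) s)) = oroot K (twist (%_. 1) s)" unfolding ttq[OF Bhpq Bhpq] by simp
 then have "oroot K (twist (pt x) (twist (pt x) s)) = oroot K s" by (simp add: toqa)
 then show "tau (oroot K (twist (pt x) s)) (broot x) = oroot K s" "tau (oroot K (twist (pt x) s)) (oroot K s) = broot x"
 using S.tboqa[OF x] S.ttpq[OF x] by simp_all
qed
text \<open>For a basic root the inner products are known from \<open>hrbq\<close>. An octadic root
  is carried to a basic root by one octadic map and a duadic root to an octadic one, so
  \<open>oiqb\<close> applies.\<close>

lemma orqa: assumes "rt0 s" shows "orth s"
proof -
 have b: "orth (broot i)" for i unfolding orth_def
 proof (intro allI impI)
 fix r assume "rt0 r"
 from hrbq[OF this, of i] show "herm r (broot i) = 0 | mu3 (herm r (broot i)) | (EX c. mu3 c & r = c *s broot i)"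
 using mu3(1) by (metis vector_smult_lid)
 qed
 have o: "orth (oroot K s)" if s: "hsec K s" for K s
 proof -
 obtain x where x: "x ~: K" by (rule enioq[OF hsecD(1)[OF s]])
 have s': "hsec K (twist (pt x) s)" by (rule htq[OF s Bhpq])
 show ?thesis by (rule oiqb[OF coq[OF s'] rtoq[OF s'] oiVq[OF s]], assumption) (subst ofbq(2)[OF s x], rule b)
 qed
 show ?thesis using assms
 proof (cases rule: rcq)
 case (duadic K s' F t)
 have e: "tau (oroot K s') s = oroot F t" unfolding duadic(4) stq(1)[OF duadic(1-3)] by (rule ciq[OF coq[OF duadic(1)] oiVq[OF duadic(2)]])
 show ?thesis by (rule oiqb[OF coq[OF duadic(1)] rtoq[OF duadic(1)]]) (use e o[OF duadic(2)] isrootD(1)[OF irq[OF assms]] in auto)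
 qed (simp_all add: b o)
qed
lemma oiqc: assumes s: "hsec K s" and t: "hsec K t" and e: "oroot K s = c *s oroot K t" and b: "b : B K"
 shows "s b = t b" "c = 1"
proof -
 interpret S: osec C mult unit m1 bar \<omega> \<Omega> K s by (rule osIq[OF s])
 interpret T: osec C mult unit m1 bar \<omega> \<Omega> K t by (rule osIq[OF t])
 obtain i where i: "i ~: K" by (rule enioq[OF S.K])
 have "oroot K s $ Inl i = c * oroot K t $ Inl i" unfolding e by simp
 then show c: "c = 1" using i unfolding S.oIqa T.oIqa by simp
 have e: "oroot K s = oroot K t" using e c by simp
 show "s b = t b" using S.K b
 proof (cases rule: Bcq)
 case 1 then show ?thesis using S.seq T.seq by simp
 next
 case 2
 have "oroot K s $ Inr T.ow = theta/2" unfolding e by (rule T.oIoqa)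
 then have "T.ow = S.ow" using oIq(2)[OF s T.boqa] tn0q unfolding S.ow_def by (auto split: if_splits)
 then show ?thesis using 2 S.oOq T.oOq by simp
 next
 case 3
 have "oroot K t $ Inr (t b) = 1/2" using oIq(1)[OF t b 3(1), of "t b"] b by simp
 then show ?thesis using oIq(1)[OF s b 3(1), of "t b"] b unfolding e by (auto split: if_splits)
 qed
qed
text \<open>The two sections over \<open>H\<close> differ by a character. If it is trivial at
  \<open>- H\<close>, the associated monomial map preserves \<open>F\<close>, hence by
  \<open>tmqa\<close> fixes a point of \<open>F\<close> off \<open>H\<close>, and the character is
  trivial. Otherwise the octadic root over \<open>F\<close> would be a duadic root, although its
  inner products with basic roots show eight points instead of two.\<close>

lemma diqa: assumes F: "hsec F t" "hsec F t'" and H: "hsec H u" "hsec H u'" and c: "card (F Int H) = 2"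
 and e: "oroot F t \<star> oroot H u = oroot F t' \<star> oroot H u'"
 shows "oroot F t = oroot F t' & oroot H u = oroot H u'"
proof -
 note o = hsecD(1)[OF H(1)] hsecD(1)[OF F(1)]
 obtain pz where pz: "B_hom H pz" "oroot H u' = oroot H (twist pz u)" by (rule stqa[OF H])
 have e': "tau (oroot H u) (oroot F t) = tau (oroot H u') (oroot F t')"
 using e unfolding stq(2)[OF F(1) H(1) c] stq(2)[OF F(2) H(2) c] .
 have i': "tau (oroot H u') (tau (oroot H u') v) = v" "tau (oroot H u) (tau (oroot H u) v) = v" if "v : VV" for v
 using ciq[OF coq[OF H(2)] that] ciq[OF coq[OF H(1)] that] by simp_all
 have g: "tau (oroot H u') (tau (oroot H u) (oroot F t)) = oroot F t'" unfolding e' by (rule i'(1)[OF oiVq[OF F(2)]])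
 from BhCq[OF o(1) pz(1)] show ?thesis
 proof
 assume e1: "pz (- H) = 1"
 obtain qz where qz: "bij qz" "!!i. i : H ==> qz i = i" "!!z. z ~: H ==> qz z ~: H"
 "!!z b. z ~: H ==> b : B H ==> pt (qz z) b = pz b * pt z b"
 "!!F t. hsec F t ==> EX t'. hsec (qz ` F) t' & tau (oroot H (twist pz u)) (tau (oroot H u) (oroot F t)) = oroot (qz ` F) t'"
 by (rule tq[OF H(1) pz(1) e1]) blast
 obtain t2 where t2: "hsec (qz ` F) t2" "oroot F t' = oroot (qz ` F) t2" using qz(5)[OF F(1)] g unfolding pz(2) by auto
 interpret S: osec C mult unit m1 bar \<omega> \<Omega> F t' by (rule osIq[OF F(2)])
 interpret T: osec C mult unit m1 bar \<omega> \<Omega> "qz ` F" t2 by (rule osIq[OF t2(1)])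
 have "i : qz ` F \<longleftrightarrow> i : F" for i
 using S.hobq[of i] T.hobq[of i] unfolding t2(2) by (auto split: if_splits)
 then have qzF: "qz ` F = F" by blast
 have "~ F <= H" using card_mono[of "F Int H" F] c octadD(2)[OF o(2)] by auto
 then obtain m where m: "m : F" "m ~: H" by blast
 have "qz m = m" using tmqa[OF o c qz(1,3,4) m] qzF by blast
 then have "pz b = 1" if "b : B H" for b using qz(4)[OF m(2) that] pt_cases[of m b] by auto
 then have "oroot H (twist pz u) = oroot H (twist (%_. 1) u)" by (rule otcq)
 then have uu: "oroot H u' = oroot H u" unfolding pz(2) by (simp add: toqa)
 then show ?thesis using g i'(2)[OF oiVq[OF F(1)]] by simp
 next
 assume e1: "pz (- H) = - 1"
 obtain x where x: "oroot H (twist pz u) = tau (broot x) (oroot H u)" by (rule toqb[OF H(1) pz(1) e1]) blast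
 let ?t = "twist (pt x) t'"
 have ht: "hsec F ?t" by (rule htq[OF F(2) Bhpq])
 have "tau (oroot H u) (oroot F t) = tau (broot x) (tau (oroot H u) (oroot F ?t))"
 unfolding e' pz(2) x tiqa[OF cbq oiVq[OF H(1)] oiVq[OF F(2)]] tboq[OF F(2)] ..
 also have "tau (oroot H u) (oroot F ?t) = oroot F ?t \<star> oroot H u" by (rule stq(2)[OF ht H(1) c, symmetric])
 finally have a: "oroot F t \<star> oroot H u = oroot F (twist (pt x) ?t) \<star> oroot H (twist (pt x) u)"
 unfolding stq(2)[OF F(1) H(1) c, symmetric] csqb[OF cbq oiVq[OF ht] oiVq[OF H(1)]] tboq[OF ht] tboq[OF H(1)] .
 interpret S: osec C mult unit m1 bar \<omega> \<Omega> H u by (rule osIq[OF H(1)])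
 obtain y where y: "y ~: H" "oroot H (twist pz u) = tau (broot y) (oroot H u)" "tau (oroot H u) (oroot H (twist pz u)) = broot y"
 by (rule toqb[OF H(1) pz(1) e1]) blast
 have "oroot F t = tau (oroot H u) (tau (oroot H u') (oroot F t'))" unfolding e'[symmetric] by (rule i'(2)[OF oiVq[OF F(1)], symmetric])
 also have "oroot H u' = tau (oroot H u) (broot y)" unfolding pz(2) y(3)[symmetric] by (rule i'(2)[symmetric]) (use pz(2) oiVq[OF H(2)] in simp)
 also have "tau (tau (oroot H u) (broot y)) (oroot F t') = tau (oroot H u) (tau (broot y) (tau (oroot H u) (oroot F t')))"
 by (rule tiqa[OF S.cTq bVq oiVq[OF F(2)]])
 also have "tau (oroot H u) (tau (oroot H u) (tau (broot y) (tau (oroot H u) (oroot F t')))) = tau (broot y) (tau (oroot H u) (oroot F t'))"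
 by (rule i'(2)[OF tVq[OF bVq]])
 also have "... = oroot F (twist (pt y) t') \<star> oroot H (twist (pt y) u)"
 unfolding stq(2)[OF F(2) H(1) c, symmetric] csqb[OF cbq oiVq[OF F(2)] S.oVq] tboq[OF F(2)] tboq[OF H(1)] ..
 finally have d: "oroot F t = oroot F (twist (pt y) t') \<star> oroot H (twist (pt y) u)" .
 interpret T: osec C mult unit m1 bar \<omega> \<Omega> F t by (rule osIq[OF F(1)])
 have "herm (oroot F t) (broot i) = (if i : F Int H then 1 else 0)" for i
 unfolding d by (rule hsbq[OF htq[OF F(2) Bhpq] htq[OF H(1) Bhpq] c])
 then have "i : F \<longleftrightarrow> i : F Int H" for i using T.hobq[of i] by (auto split: if_splits)
 then have "F = F Int H" by blast
 then show ?thesis using c octadD(2)[OF o(2)] by simp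
 qed
qed
end

section \<open>Three-transposition groups from involutory self-distributive operations\<close>

text \<open>\<open>Y\<close> with \<open>d\<close> is a finite involutory quandle, and
  \<open>braid\<close> says that two elements either fix or braid one another. Transitivity reduces
  injectivity of \<open>d\<close> and the degrees to the base point \<open>xb\<close>; the degree of
  the diagram is what remains of \<open>n\<close> after removing the base point and the
  \<open>m\<close> fixed elements.\<close>

lemma ttqq:
 fixes Y :: "'y set" and d :: "'y => 'y => 'y"
 assumes fin: "finite Y" and xb: "xb : Y"
 and ext: "!!x. x : Y ==> d x : extensional Y"
 and cl: "!!x y. x : Y ==> y : Y ==> d x y : Y"
 and invol: "!!x y. x : Y ==> y : Y ==> d x (d x y) = y"
 and distr: "!!x y z. x : Y ==> y : Y ==> z : Y ==> d x (d y z) = d (d x y) (d x z)"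
 and braid: "!!x y. x : Y ==> y : Y ==> d x y = y | d x y = d y x"
 and inj0: "!!y. y : Y ==> d y = d xb ==> y = xb"
 and reach: "!!y. y : Y ==> EX ws. set ws <= Y & foldr d ws xb = y"
 and card: "card Y = n" "n = m + k + 1" "k ~= 0"
 and fixed0: "card {y : Y. y ~= xb & d xb y = y} = m"
 and G: "G = (BijGroup Y)\<lparr>carrier := generate (BijGroup Y) D\<rparr>" and D: "D = d ` Y"
 shows "finite (carrier G) & group_center G = {\<one>\<^bsub>G\<^esub>} & three_transposition_group G D
 & (EX d:carrier G. D = conjugacy_class G d) & card D = n
 & graph_has_degree D (diagram G D) k & graph_has_degree D (commuting_codiagram G D) m"
proof -
 interpret B: group "BijGroup Y" by (rule group_BijGroup)
 have dB: "d x : Bij Y" if "x : Y" for x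
 unfolding Bij_def using ext[OF that] cl[OF that] invol[OF that]
 by (auto intro!: bij_betw_byWitness[where f'="d x"])
 have car: "carrier (BijGroup Y) = Bij Y" by (simp add: BijGroup_def)
 have DB: "D <= carrier (BijGroup Y)" unfolding D car using dB by blast
 have sub: "subgroup (generate (BijGroup Y) D) (BijGroup Y)" by (rule B.generate_is_subgroup[OF DB])
 have cG: "carrier G = generate (BijGroup Y) D" by (simp add: G)
 have grp: "group G" unfolding G by (rule B.subgroup_imp_group[OF sub])
 interpret G: group G by (rule grp)
 have GB: "g : Bij Y" if "g : carrier G" for g
 using that subgroup.subset[OF sub] unfolding cG car by blast
 have mB: "(g \<otimes>\<^bsub>BijGroup Y\<^esub> h) = compose Y g h" if "g : Bij Y" "h : Bij Y" for g h
 using that by (simp add: BijGroup_def)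
 have mG: "g \<otimes>\<^bsub>G\<^esub> h = g \<otimes>\<^bsub>BijGroup Y\<^esub> h" for g h by (simp add: G)
 have app: "(g \<otimes>\<^bsub>G\<^esub> h) y = g (h y)" if "g : Bij Y" "h : Bij Y" "y : Y" for g h y
 using that by (simp add: mG mB compose_def)
 have one: "\<one>\<^bsub>G\<^esub> = (\<lambda>y\<in>Y. y)" by (simp add: G BijGroup_def)
 have im: "g y : Y" if "g : Bij Y" "y : Y" for g y using that by (auto simp: Bij_def bij_betw_def)
 have eqI: "g = h" if "g : Bij Y" "h : Bij Y" "!!y. y : Y ==> g y = h y" for g h
 using that by (intro extensionalityI[of _ Y]) (auto simp: Bij_def)
 have dG: "d x : carrier G" if "x : Y" for x unfolding cG D using that by (blast intro: generate.incl)
 have dd: "d x \<otimes>\<^bsub>G\<^esub> d x = \<one>\<^bsub>G\<^esub>" if x: "x : Y" for x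
 by (rule eqI) (use GB[OF G.m_closed[OF dG[OF x] dG[OF x]]] GB[OF G.one_closed] in \<open>auto simp: app dB x invol one\<close>)
 have act: "g (d x y) = d (g x) (g y)" if g: "g : carrier G" and "x : Y" "y : Y" for g x y
 proof -
 have dact: "ALL x:Y. ALL y:Y. h (d x y) = d (h x) (h y)" if "h : D" for h
 using that distr unfolding D by blast
 have "ALL x:Y. ALL y:Y. g (d x y) = d (g x) (g y)"
 using g[unfolded cG]
 proof (induction rule: generate.induct)
 case one then show ?case by (simp add: BijGroup_def cl)
 next
 case (incl h) then show ?case by (rule dact)
 next
 case (inv h)
 then obtain w where w: "w : Y" "h = d w" unfolding D by blast
 have "inv\<^bsub>BijGroup Y\<^esub> h = h"
 by (rule B.inv_equality) (use dd[OF w(1)] dB[OF w(1)] in \<open>simp_all add: w(2) car mG, simp add: G\<close>)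
 then show ?case using dact[OF inv] by simp
 next
 case (eng h1 h2)
 have h: "h1 : Bij Y" "h2 : Bij Y" using eng(1,2) GB unfolding cG by blast+
 have a: "(h1 \<otimes>\<^bsub>BijGroup Y\<^esub> h2) y = h1 (h2 y)" if "y : Y" for y using app[OF h that] by (simp add: mG)
 show ?case using eng(3,4) by (simp add: a cl im[OF h(2)])
 qed
 then show ?thesis using that by blast
 qed
 \<comment> \<open>Conjugation in the group corresponds to its action on \<open>Y\<close>. This
   turns commutation, conjugacy and, through injectivity of \<open>d\<close>, triviality of the
   center into statements about the action.\<close>
 have slide: "g \<otimes>\<^bsub>G\<^esub> d x = d (g x) \<otimes>\<^bsub>G\<^esub> g" if g: "g : carrier G" and x: "x : Y" for g x
 proof -
 have gx: "g x : Y" by (rule im[OF GB[OF g] x])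
 show ?thesis
 by (rule eqI[OF GB[OF G.m_closed[OF g dG[OF x]]] GB[OF G.m_closed[OF dG[OF gx] g]]])
 (simp add: app GB[OF g] dB x gx act[OF g x])
 qed
 have conj: "g \<otimes>\<^bsub>G\<^esub> d x \<otimes>\<^bsub>G\<^esub> inv\<^bsub>G\<^esub> g = d (g x)" if g: "g : carrier G" and x: "x : Y" for g x
 unfolding slide[OF g x] using dG[OF im[OF GB[OF g] x]] g by (simp add: G.m_assoc)
 have reachG: "EX g:carrier G. g xb = y" if y: "y : Y" for y
 proof -
 have "EX g:carrier G. g xb = foldr d ws xb" if "set ws <= Y" for ws
 using that
 proof (induction ws)
 case Nil then show ?case using xb by (intro bexI[OF _ G.one_closed]) (simp add: one)
 next
 case (Cons w ws)
 then obtain g where g: "g : carrier G" "g xb = foldr d ws xb" by auto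
 have w: "w : Y" using Cons by simp
 show ?case using app[OF dB[OF w] GB[OF g(1)] xb] g dG[OF w]
 by (intro bexI[of _ "d w \<otimes>\<^bsub>G\<^esub> g"]) auto
 qed
 then show ?thesis using reach[OF y] by blast
 qed
 have inj: "inj_on d Y"
 proof (rule inj_onI)
 fix x y assume x: "x : Y" and y: "y : Y" and e: "d x = d y"
 obtain g where g: "g : carrier G" "g xb = x" using reachG[OF x] by blast
 let ?i = "inv\<^bsub>G\<^esub> g"
 have i: "?i : carrier G" using g by simp
 have ii: "?i (g z) = z" "g (?i z) = z" if "z : Y" for z
 using app[OF GB[OF i] GB[OF g(1)] that] app[OF GB[OF g(1)] GB[OF i] that] g(1) that by (simp_all add: one)
 have "?i x = xb" using ii(1)[OF xb] g(2) by simp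
 then have "d (?i y) = d xb" using conj[OF i x] conj[OF i y] e by simp
 then have "?i y = xb" using inj0 im[OF GB[OF i] y] by blast
 then show "x = y" using ii(2)[OF y] g(2) by simp
 qed
 have comm: "d x \<otimes>\<^bsub>G\<^esub> d y = d y \<otimes>\<^bsub>G\<^esub> d x \<longleftrightarrow> d x y = y" if x: "x : Y" and y: "y : Y" for x y
 proof -
 have "d x \<otimes>\<^bsub>G\<^esub> d y = d y \<otimes>\<^bsub>G\<^esub> d x \<longleftrightarrow> d (d x y) = d y"
 unfolding slide[OF dG[OF x] y] using dG[OF cl[OF x y]] dG[OF y] dG[OF x] by simp
 also have "... \<longleftrightarrow> d x y = y" using inj cl[OF x y] y by (auto dest: inj_onD)
 finally show ?thesis .
 qed
 have neq1: "d x \<otimes>\<^bsub>G\<^esub> d y = \<one>\<^bsub>G\<^esub> \<longleftrightarrow> x = y" if x: "x : Y" and y: "y : Y" for x y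
 proof
 assume "d x \<otimes>\<^bsub>G\<^esub> d y = \<one>\<^bsub>G\<^esub>"
 then have "d x \<otimes>\<^bsub>G\<^esub> d y = d y \<otimes>\<^bsub>G\<^esub> d y" using dd[OF y] by simp
 then have "d x = d y" using dG[OF x] dG[OF y] by simp
 then show "x = y" using inj x y by (auto dest: inj_onD)
 qed (simp add: dd y)
 have dvd23: "a = 1 | a = 2" if "a dvd 2" and "a dvd 2" for a :: nat
 using that by (metis prime_nat_iff two_is_prime_nat)
 have dvd3: "a = 1 | a = 3" if "a dvd 3" for a :: nat
 proof -
 have "a <= 3" using that by (auto dest: dvd_imp_le)
 then have "a = 0 | a = 1 | a = 2 | a = 3" by auto
 then show ?thesis using that by auto
 qed
 have self: "d x x = x" if "x : Y" for x using comm[OF that that] by simp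
 have fixed: "card {y : Y. y ~= x & d x y = y} = m" if x: "x : Y" for x
 proof -
 obtain g where g: "g : carrier G" "g xb = x" using reachG[OF x] by blast
 have b: "inj_on g Y" "g ` Y = Y" using GB[OF g(1)] by (auto simp: Bij_def bij_betw_def)
 have e: "d x (g y) = g y \<longleftrightarrow> d xb y = y" "g y = x \<longleftrightarrow> y = xb" if y: "y : Y" for y
 using act[OF g(1) xb y] g(2) inj_on_eq_iff[OF b(1) cl[OF xb y] y] inj_on_eq_iff[OF b(1) y xb] by simp_all
 have "z : {y : Y. y ~= x & d x y = y} \<longleftrightarrow> z : g ` {y : Y. y ~= xb & d xb y = y}" for z
 using e b(2) by (auto simp: image_iff) (metis imageE)+
 then have "{y : Y. y ~= x & d x y = y} = g ` {y : Y. y ~= xb & d xb y = y}" by blast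
 then show ?thesis using card_image[OF inj_on_subset[OF b(1)], of "{y : Y. y ~= xb & d xb y = y}"] fixed0 by auto
 qed
 have moved: "card {y : Y. d x y ~= y} = k" if x: "x : Y" for x
 proof -
 have "Y = insert x ({y : Y. y ~= x & d x y = y} Un {y : Y. d x y ~= y})" using x by auto
 then have "card Y = card (insert x ({y : Y. y ~= x & d x y = y} Un {y : Y. d x y ~= y}))" by simp
 also have "... = Suc (card ({y : Y. y ~= x & d x y = y} Un {y : Y. d x y ~= y}))"
 using fin self[OF x] by (intro card_insert_disjoint) auto
 also have "... = Suc (m + card {y : Y. d x y ~= y})"
 unfolding fixed[OF x, symmetric] using fin by (subst card_Un_disjoint) auto
 finally show ?thesis using card by simp
 qed
 have fixord: "G.ord (d x \<otimes>\<^bsub>G\<^esub> d y) = 1 | G.ord (d x \<otimes>\<^bsub>G\<^esub> d y) = 2" if x: "x : Y" and y: "y : Y" and f: "d x y = y" for x y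
 proof -
 have c: "d x \<otimes>\<^bsub>G\<^esub> d y = d y \<otimes>\<^bsub>G\<^esub> d x" using comm[OF x y] f by simp
 have "(d x \<otimes>\<^bsub>G\<^esub> d y) [^]\<^bsub>G\<^esub> (2::nat) = (d x \<otimes>\<^bsub>G\<^esub> d y) \<otimes>\<^bsub>G\<^esub> (d y \<otimes>\<^bsub>G\<^esub> d x)"
 using dG[OF x] dG[OF y] c by (simp add: numeral_2_eq_2)
 also have "... = d x \<otimes>\<^bsub>G\<^esub> ((d y \<otimes>\<^bsub>G\<^esub> d y) \<otimes>\<^bsub>G\<^esub> d x)" using dG[OF x] dG[OF y] by (simp add: G.m_assoc)
 also have "... = \<one>\<^bsub>G\<^esub>" using dd x y dG by simp
 finally show ?thesis using G.pow_eq_id[of "d x \<otimes>\<^bsub>G\<^esub> d y" 2] dG[OF x] dG[OF y] dvd23 by simp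
 qed
 have movord: "G.ord (d x \<otimes>\<^bsub>G\<^esub> d y) = 3" if x: "x : Y" and y: "y : Y" and f: "d x y ~= y" for x y
 proof -
 have e: "d x y = d y x" using braid[OF x y] f by blast
 note c = dG[OF x] dG[OF y] dG[OF cl[OF x y]]
 have 1: "d x \<otimes>\<^bsub>G\<^esub> d y \<otimes>\<^bsub>G\<^esub> d x = d (d x y)"
 unfolding slide[OF dG[OF x] y] using c dd[OF x] by (simp add: G.m_assoc)
 have 2: "d y \<otimes>\<^bsub>G\<^esub> d x \<otimes>\<^bsub>G\<^esub> d y = d (d x y)"
 unfolding slide[OF dG[OF y] x] e using dG[OF cl[OF y x]] c dd[OF y] by (simp add: G.m_assoc)
 have "(d x \<otimes>\<^bsub>G\<^esub> d y) [^]\<^bsub>G\<^esub> (3::nat) = (d x \<otimes>\<^bsub>G\<^esub> d y \<otimes>\<^bsub>G\<^esub> d x) \<otimes>\<^bsub>G\<^esub> (d y \<otimes>\<^bsub>G\<^esub> d x \<otimes>\<^bsub>G\<^esub> d y)"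
 using c by (simp add: numeral_3_eq_3 G.m_assoc)
 also have "... = \<one>\<^bsub>G\<^esub>" unfolding 1 2 by (rule dd[OF cl[OF x y]])
 finally have "G.ord (d x \<otimes>\<^bsub>G\<^esub> d y) dvd 3" using G.pow_eq_id[of "d x \<otimes>\<^bsub>G\<^esub> d y" 3] c by simp
 moreover have "G.ord (d x \<otimes>\<^bsub>G\<^esub> d y) ~= 1"
 proof
 assume "G.ord (d x \<otimes>\<^bsub>G\<^esub> d y) = 1"
 then have "d x \<otimes>\<^bsub>G\<^esub> d y = \<one>\<^bsub>G\<^esub>" using G.pow_eq_id[of "d x \<otimes>\<^bsub>G\<^esub> d y" 1] c by simp
 then show False using neq1[OF x y] self[OF x] f by simp
 qed
 ultimately show ?thesis using dvd3 by blast
 qed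
 have ord2: "G.ord (d x) = 2" if x: "x : Y" for x
 proof -
 have "(d x) [^]\<^bsub>G\<^esub> (2::nat) = \<one>\<^bsub>G\<^esub>" using dd[OF x] dG[OF x] by (simp add: numeral_2_eq_2)
 then have "G.ord (d x) dvd 2" using G.pow_eq_id[of "d x" 2] dG[OF x] by simp
 moreover have "G.ord (d x) ~= 1"
 proof
 assume "G.ord (d x) = 1"
 then have o: "d x = \<one>\<^bsub>G\<^esub>" using G.pow_eq_id[of "d x" 1] dG[OF x] by simp
 have E: "{y : Y. d x y ~= y} = {}" unfolding o one by auto
 have "k = 0" using moved[OF x] unfolding E by simp
 then show False using card(3) by simp
 qed
 ultimately show ?thesis using dvd23 by blast
 qed
 have "finite (Bij Y)" by (rule finite_subset[OF _ finite_PiE[OF fin, of "%_. Y"]]) (use fin in \<open>auto simp: Bij_def bij_betw_def extensional_def\<close>)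
 then have F: "finite (carrier G)" by (rule rev_finite_subset) (use GB in blast)
 have center: "group_center G = {\<one>\<^bsub>G\<^esub>}"
 proof -
 have "z = \<one>\<^bsub>G\<^esub>" if z: "z : carrier G" and c: "ALL g:carrier G. z \<otimes>\<^bsub>G\<^esub> g = g \<otimes>\<^bsub>G\<^esub> z" for z
 proof (rule eqI[OF GB[OF z] GB[OF G.one_closed]])
 fix x assume x: "x : Y"
 have zx: "z x : Y" by (rule im[OF GB[OF z] x])
 have "d (z x) \<otimes>\<^bsub>G\<^esub> z = d x \<otimes>\<^bsub>G\<^esub> z" using c dG[OF x] slide[OF z x] by simp
 then have "d (z x) = d x" using dG[OF x] dG[OF zx] z by simp
 then show "z x = \<one>\<^bsub>G\<^esub> x" using inj zx x by (auto dest: inj_onD simp: one)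
 qed
 then show ?thesis unfolding group_center_def by auto
 qed
 have tt: "three_transposition_group G D"
 unfolding three_transposition_group_def
 proof (intro conjI ballI)
 show "group G" by (rule grp)
 show "D <= carrier G" using dG unfolding D by blast
 show "generate G D = carrier G"
 proof -
 have "generate (BijGroup Y\<lparr>carrier := generate (BijGroup Y) D\<rparr>) D = generate (BijGroup Y) D"
 by (rule B.generate_consistent[OF _ sub]) (blast intro: generate.incl)
 then show ?thesis unfolding cG by (simp add: G)
 qed
 next
 fix g e assume g: "g : carrier G" and e: "e : D"
 then obtain x where x: "x : Y" "e = d x" unfolding D by blast
 show "g \<otimes>\<^bsub>G\<^esub> e \<otimes>\<^bsub>G\<^esub> inv\<^bsub>G\<^esub> g : D" unfolding x(2) conj[OF g x(1)] D using im[OF GB[OF g] x(1)] by blast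
 next
 fix e assume "e : D" then show "G.ord e = 2" unfolding D using ord2 by blast
 next
 fix e f assume "e : D" "f : D"
 then obtain x y where "x : Y" "e = d x" "y : Y" "f = d y" unfolding D by blast
 then show "G.ord (e \<otimes>\<^bsub>G\<^esub> f) : {1, 2, 3}" using fixord[of x y] movord[of x y] by (cases "d x y = y") auto
 qed
 have cls: "D = conjugacy_class G (d xb)"
 proof (rule Set.set_eqI)
 fix e
 show "e : D \<longleftrightarrow> e : conjugacy_class G (d xb)"
 proof
 assume "e : D"
 then obtain y where y: "y : Y" "e = d y" unfolding D by blast
 obtain g where g: "g : carrier G" "g xb = y" using reachG[OF y(1)] by blast
 have "e = g \<otimes>\<^bsub>G\<^esub> d xb \<otimes>\<^bsub>G\<^esub> inv\<^bsub>G\<^esub> g" unfolding conj[OF g(1) xb] g(2) y(2) ..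
 then show "e : conjugacy_class G (d xb)" unfolding conjugacy_class_def using g(1) by blast
 next
 assume "e : conjugacy_class G (d xb)"
 then obtain g where g: "g : carrier G" "e = g \<otimes>\<^bsub>G\<^esub> d xb \<otimes>\<^bsub>G\<^esub> inv\<^bsub>G\<^esub> g" unfolding conjugacy_class_def by blast
 show "e : D" unfolding g(2) conj[OF g(1) xb] D using im[OF GB[OF g(1)] xb] by blast
 qed
 qed
 have cD: "card D = n" unfolding D using card_image[OF inj] card(1) by simp
 have deg: "graph_has_degree D E l" if E: "!!x e. x : Y ==> (d x, e) : E \<longleftrightarrow> (EX y:Y. e = d y & P x y)"
 and l: "!!x. x : Y ==> card {y : Y. P x y} = l" for E l P
 unfolding graph_has_degree_def
 proof
 fix e assume "e : D"
 then obtain x where x: "x : Y" "e = d x" unfolding D by blast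
 have "{w. (d x, w) : E} = d ` {y : Y. P x y}" using E[OF x(1)] by blast
 moreover have "card (d ` {y : Y. P x y}) = l"
 unfolding l[OF x(1), symmetric] by (rule card_image[OF inj_on_subset[OF inj]]) blast
 ultimately show "finite {w. (e, w) : E} & card {w. (e, w) : E} = l" using fin x(2) by simp
 qed
 have d1: "graph_has_degree D (diagram G D) k"
 proof (rule deg[where P="%x y. d x y ~= y", OF _ moved])
 fix x e assume x: "x : Y"
 have "G.ord (d x \<otimes>\<^bsub>G\<^esub> d y) = 3 \<longleftrightarrow> d x y ~= y" if "y : Y" for y
 using fixord[OF x that] movord[OF x that] by auto
 then show "(d x, e) : diagram G D \<longleftrightarrow> (EX y:Y. e = d y & d x y ~= y)"
 unfolding diagram_def D using x by auto
 qed
 have d2: "graph_has_degree D (commuting_codiagram G D) m"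
 proof (rule deg[where P="%x y. y ~= x & d x y = y", OF _ fixed])
 fix x e assume x: "x : Y"
 have "d x ~= d y & d x \<otimes>\<^bsub>G\<^esub> d y = d y \<otimes>\<^bsub>G\<^esub> d x \<longleftrightarrow> y ~= x & d x y = y" if "y : Y" for y
 using comm[OF x that] inj x that by (auto dest: inj_onD)
 then show "(d x, e) : commuting_codiagram G D \<longleftrightarrow> (EX y:Y. e = d y & (y ~= x & d x y = y))"
 unfolding commuting_codiagram_def D using x by auto
 qed
 show ?thesis using F center tt cls dG[OF xb] cD d1 d2 by blast
qed

section \<open>Field of definition, and rays modulo cube roots of unity\<close>

context parker_algebra begin
lemma bfrq: "of_rat a : base_field"
 unfolding base_field_def by (rule CollectI, rule exI[of _ a], rule exI[of _ 0]) simp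
lemma corq: "cnj (of_rat a) = of_rat a"
 by (cases a) (simp add: of_rat_rat)
lemma bfaq: assumes "x : base_field" "y : base_field" shows "x + y : base_field"
proof -
 obtain a b c d where "x = of_rat a + of_rat b*\<omega>" "y = of_rat c + of_rat d*\<omega>" using assms unfolding base_field_def by blast
 then have "x + y = of_rat (a + c) + of_rat (b + d)*\<omega>" by (simp add: of_rat_add algebra_simps)
 then show ?thesis unfolding base_field_def by blast
qed
lemma bfmq: assumes "x : base_field" "y : base_field" shows "x * y : base_field"
proof -
 obtain a b c d where x: "x = of_rat a + of_rat b*\<omega>" "y = of_rat c + of_rat d*\<omega>" using assms unfolding base_field_def by blast
 have w: "\<omega>*\<omega> = - 1 - \<omega>" using ofq(3) by (simp add: power2_eq_square)
 have "x * y = of_rat a * of_rat c + (of_rat a * of_rat d + of_rat b * of_rat c)*\<omega> + of_rat b * of_rat d*(\<omega>*\<omega>)"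
 unfolding x by (simp add: algebra_simps)
 also have "... = of_rat (a * c - b * d) + of_rat (a * d + b * c - b * d)*\<omega>"
 unfolding w by (simp add: of_rat_add of_rat_mult of_rat_diff algebra_simps)
 finally show ?thesis unfolding base_field_def by blast
qed
lemma bfcqa: assumes "x : base_field" shows "cnj x : base_field"
proof -
 obtain a b where x: "x = of_rat a + of_rat b*\<omega>" using assms unfolding base_field_def by blast
 have w: "cnj \<omega> = - 1 - \<omega>" using ofq(2,3) by simp
 have "cnj x = of_rat (a - b) + of_rat (- b)*\<omega>"
 unfolding x by (simp add: corq w of_rat_diff of_rat_minus algebra_simps)
 then show ?thesis unfolding base_field_def by blast
qed
lemma bfcq: "0 : base_field" "1 : base_field" "numeral n : base_field" "theta : base_field" "1/numeral n : base_field"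
 "- 1 : base_field" "- numeral n : base_field" "numeral m/numeral n : base_field" "- (numeral m/numeral n) : base_field" "theta/numeral n : base_field"
proof -
 show "0 : base_field" "1 : base_field" "numeral n : base_field" using bfrq[of 0] bfrq[of 1] bfrq[of "numeral n"] by simp_all
 show "1/numeral n : base_field" "- 1 : base_field" "- numeral n : base_field" "numeral m/numeral n : base_field" "- (numeral m/numeral n) : base_field"
 using bfrq[of "numeral m/numeral n"] bfrq[of "- (numeral m/numeral n)"] bfrq[of "1/numeral n"] bfrq[of "- 1"] bfrq[of "- numeral n"] by (simp_all add: of_rat_divide of_rat_minus)
 have "\<omega> : base_field" unfolding base_field_def by (rule CollectI, rule exI[of _ 0], rule exI[of _ 1]) simp
 then show t: "theta : base_field" unfolding toq
 using bfaq[OF bfmq[OF bfrq[of 2] \<open>\<omega> : base_field\<close>] bfrq[of 1]] by simp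
 show "theta/numeral n : base_field" using bfmq[OF t \<open>1/numeral n : base_field\<close>] by simp
qed
text \<open>The rationality condition in \<open>alg\<close> that was dropped in \<open>VV\<close>.
  It is restored for the roots because \<open>D_CP\<close> is indexed by vectors of
  \<open>alg\<close>.\<close>

definition bvec :: "complex ^ ('i + 'p) => bool" where "bvec v \<longleftrightarrow> (ALL k. v $ k : base_field)"
lemma baq: "bvec v ==> bvec w ==> bvec (v + w)"
 and bvec_scale: "c : base_field ==> bvec v ==> bvec (c *s v)"
 and bvec_0: "bvec 0"
 by (simp_all add: bvec_def bfaq bfmq bfcq)
lemma bmqa: "bvec v ==> bvec (- v)" using bvec_scale[of "- 1" v] bfcq(6) by (simp flip: smqa)
lemma bdq: "bvec v ==> bvec w ==> bvec (v - w)" using baq[OF _ bmqa] by fastforce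
lemma bsq: "(!!a. a : A ==> bvec (f a)) ==> bvec (sum f A)"
 by (induction A rule: infinite_finite_induct) (auto simp: bvec_0 baq)
lemma buq: "bvec (u_vec i)" by (auto simp: bvec_def u_vec_def axis_def bfcq)
lemma bxq: "bvec (x_vec d)" unfolding x_vec_def by (rule bdq) (auto simp: bvec_def axis_def bfcq)
lemma bpq: "bvec (prod_uu i j)" "bvec (prod_ux i d)" "bvec (prod_xx d f)"
 unfolding prod_uu_def prod_ux_def prod_xx_def
 by (auto intro!: bvec_scale baq bdq bmqa bsq buq bxq bvec_0 bfcq)
lemma bsqa: assumes "bvec v" "bvec w" shows "bvec (v \<star> w)"
proof -
 have b: "cnj (v $ k) : base_field" "cnj (w $ k) : base_field" for k using assms unfolding bvec_def by (simp_all add: bfcqa)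
 have h: "1/2 : base_field" "1/4 : base_field" by (rule bfcq)+
 show ?thesis unfolding star_def
 by (intro baq bsq bvec_scale bpq)
 (simp_all only: complex_cnj_mult complex_cnj_add bfmq bfaq b h)
qed
lemma bXq: "bvec (XV d)" unfolding XV_def by (simp add: bxq bvec_0 bvec_scale bfcq)
lemma boq: "bvec (oroot K s)" unfolding oroot_def
 by (intro bvec_scale baq bmqa bsq buq bXq bfcq)
lemma bbq: "bvec (broot i)" unfolding broot_def US_def
 by (auto intro!: bvec_scale bdq bsq buq bfcq)
lemma aiqa: "v : alg \<longleftrightarrow> v : VV & bvec v" by (auto simp: alg_def VV_def bvec_def)
lemma raqa: assumes "rt0 r" shows "r : alg"
proof -
 have "bvec r" using assms by (cases rule: rcq) (simp_all add: bbq boq bsqa)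
 then show ?thesis unfolding aiqa using isrootD(1)[OF irq[OF assms]] by simp
qed
lemma miqa: "mu3 c \<longleftrightarrow> c : {1, \<omega>, \<omega> ^ 2}"
proof
 have "(c - 1)*((c - \<omega>)*(c - \<omega>\<^sup>2)) = (c - 1)*(c * c - c*(\<omega> + \<omega>\<^sup>2) + \<omega>*\<omega>\<^sup>2)" by (simp add: algebra_simps)
 also have "\<omega> + \<omega>\<^sup>2 = - 1" using ofq(3) by simp
 also have "\<omega>*\<omega>\<^sup>2 = 1" using omega_root(1) by (simp add: power3_eq_cube power2_eq_square mult.assoc)
 also have "(c - 1)*(c * c - c * - 1 + 1) = c ^ 3 - 1" by (simp add: algebra_simps power3_eq_cube)
 finally have f: "(c - 1)*((c - \<omega>)*(c - \<omega>\<^sup>2)) = c ^ 3 - 1" .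
 assume "mu3 c"
 then have "(c - 1)*((c - \<omega>)*(c - \<omega>\<^sup>2)) = 0" unfolding f mu3_def by simp
 then show "c : {1, \<omega>, \<omega> ^ 2}" by auto
next
 assume "c : {1, \<omega>, \<omega> ^ 2}"
 moreover have "mu3 \<omega>" using omega_root(1) by (simp add: mu3_def)
 moreover have "mu3 (\<omega>\<^sup>2)" using mu3(3)[OF \<open>mu3 \<omega>\<close> \<open>mu3 \<omega>\<close>] by (simp add: power2_eq_square)
 ultimately show "mu3 c" using mu3(1) by auto
qed
lemma raq: "ray r = {c *s r | c. mu3 c}" unfolding ray_def miqa ..
lemma rsqd: "r : ray r" unfolding raq using mu3(1) by (metis (mono_tags, lifting) CollectI vector_smult_lid)
lemma miq: "mu3 c ==> cnj c * c = 1" "mu3 c ==> c * cnj c = 1"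
 using crq(1)[of c] by (simp_all add: mu3_def mult.commute)
lemma rsq: assumes "mu3 c" shows "ray (c *s r) = ray r"
proof -
 have "x : ray (c *s r) \<longleftrightarrow> x : ray r" for x
 proof
 assume "x : ray (c *s r)"
 then obtain e where "mu3 e" "x = (e * c) *s r" unfolding raq ssq by blast
 then show "x : ray r" unfolding raq using mu3(3) assms by blast
 next
 assume "x : ray r"
 then obtain e where e: "mu3 e" "x = e *s r" unfolding raq by blast
 have "x = (e * cnj c) *s (c *s r)" unfolding e(2) ssq using miq(1)[OF assms] by (simp add: mult.assoc)
 then show "x : ray (c *s r)" unfolding raq using mu3(3)[OF e(1) mu3(2)[OF assms]] by blast
 qed
 then show ?thesis by blast
qed
lemma req: assumes "ray r = ray s" obtains c where "mu3 c" "r = c *s s"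
 using rsqd[of r] unfolding assms unfolding raq by blast
lemma trq: "tau r ` ray s = ray (tau r s)"
proof -
 have "x : tau r ` ray s \<longleftrightarrow> x : ray (tau r s)" for x
 proof
 assume "x : tau r ` ray s"
 then obtain c where "mu3 c" "x = tau r (c *s s)" unfolding raq by blast
 then show "x : ray (tau r s)" unfolding raq tsq using mu3(2) by blast
 next
 assume "x : ray (tau r s)"
 then obtain c where c: "mu3 c" "x = c *s tau r s" unfolding raq by blast
 have "x = tau r (cnj c *s s)" unfolding c(2) tsq by simp
 then show "x : tau r ` ray s" unfolding raq using mu3(2)[OF c(1)] by blast
 qed
 then show ?thesis by blast
qed
lemma tmqb: assumes "mu3 c" shows "tau (c *s r) v = cnj c *s tau r v"
proof -
 have c: "c * c = cnj c" using crq(3)[of c] assms by (simp add: mu3_def)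
 show ?thesis unfolding trsqa c by (simp add: tau_def vec_eq_iff algebra_simps)
qed
lemma rmq: "rt r \<longleftrightarrow> (EX c r0. mu3 c & rt0 r0 & r = c *s r0)" unfolding rt_def mu3_def ..
lemma rt_E: assumes "rt r" obtains c r0 where "mu3 c" "rt0 r0" "r = c *s r0"
 using assms unfolding rmq by (elim exE conjE) (rule that)
lemma ehoq: assumes "rt0 s" shows "EX i. herm s (broot i) = 1"
 using assms
proof (cases rule: rcq)
 case (basic j)
 have "UNIV ~= {j}" using card_index by (metis One_nat_def card.empty card.insert empty_iff finite.emptyI numeral_One numeral_eq_iff semiring_norm(85) semiring_norm(86))
 then obtain i where "i ~= j" by blast
 then show ?thesis unfolding basic hbbq by (intro exI[of _ i]) simp
next
 case (octadic K t)
 interpret S: osec C mult unit m1 bar \<omega> \<Omega> K t by (rule osIq[OF octadic(1)])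
 have "K ~= {}" using octadD(2)[OF S.K] by auto
 then show ?thesis unfolding octadic(2) S.hobq by auto
next
 case (duadic K k H h)
 have "K Int H ~= {}" using duadic(3) by auto
 then show ?thesis unfolding duadic(4) hsbq[OF duadic(1-3)] by auto
qed
text \<open>Roots in \<open>rt0\<close> are normalised: each has inner product 1 with some basic
  root, and only 0, 1 and 9 occur with basic roots. A scalar that is a cube root of unity must
  therefore be 1.\<close>

lemma riqa: assumes r: "rt0 r" and s: "rt0 s" and e: "ray r = ray s" shows "r = s"
proof -
 obtain c where c: "mu3 c" "r = c *s s" by (rule req[OF e])
 obtain i where i: "herm s (broot i) = 1" using ehoq[OF s] by blast
 have h: "herm r (broot i) = c" unfolding c(2) hsq i by simp
 have "c ~= 9" using c(1) by (auto simp: mu3_def)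
 then have "c = 1" using hrbq[OF r, of i] h mu3(4)[OF c(1)] by (auto simp: hbbq)
 then show ?thesis using c(2) by simp
qed
lemma trsq: "rt0 s ==> tau s s = s"
 using isrootD(3,4)[OF irq] by (simp add: tau_def vec_eq_iff)
lemma triq: "rt0 r ==> v : VV ==> tau r (tau r v) = v"
 by (rule ciq[OF isrootD(2)[OF irq]])
lemma rVq: "rt0 r ==> r : VV" by (rule isrootD(1)[OF irq])
text \<open>For orthogonal roots \<open>tau r s\<close> and \<open>tau s r\<close> both equal the
  product. If this were a multiple of \<open>s\<close>, applying \<open>tau s\<close> again would
  make \<open>r\<close> a multiple of \<open>s\<close>, against orthogonality. The converse is the
  trichotomy \<open>orth\<close> with \<open>tcqa\<close>.\<close>

lemma fiq: assumes r: "rt0 r" and s: "rt0 s" shows "ray (tau r s) = ray s \<longleftrightarrow> herm r s ~= 0"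
proof
 assume e: "ray (tau r s) = ray s"
 show "herm r s ~= 0"
 proof
 assume 0: "herm r s = 0"
 obtain c where c: "mu3 c" "tau r s = c *s s" by (rule req[OF e])
 have "tau s r = c *s s" using tzq[OF 0] tzq[OF hzsq[OF 0]] c(2) by (simp add: star_commute)
 then have "r = tau s (c *s s)" using triq[OF s rVq[OF r]] by simp
 then have "r = cnj c *s s" unfolding tsq trsq[OF s] .
 then show False using 0 isrootD(3)[OF irq[OF s]] mu3(4)[OF c(1)] by (simp add: hsq)
 qed
next
 assume n: "herm r s ~= 0"
 have "mu3 (herm r s) | (EX c. mu3 c & r = c *s s)" using orqa[OF s] r n unfolding orth_def by blast
 then show "ray (tau r s) = ray s"
 proof (elim disjE exE conjE)
 assume m: "mu3 (herm r s)"
 show ?thesis unfolding tcqa[OF irq[OF r] irq[OF s] m[unfolded mu3_def]] by (rule rsq[OF mu3(2)[OF m]])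
 next
 fix c assume c: "mu3 c" "r = c *s s"
 show ?thesis unfolding c(2) tmqb[OF c(1)] trsq[OF s] by (rule rsq[OF mu3(2)[OF c(1)]])
 qed
qed
end

section \<open>The chosen representatives, the counts, and the group\<close>

context parker_roots begin
lemma brbq: "basic_root i = broot i"
 unfolding basic_root_def broot_def Umq by (simp add: vec_eq_iff)
lemma hqq: "octad K ==> hsec K (q K)"
 unfolding hsec_def using bar_q q_hom by (simp add: sd_def)
lemma oroq: assumes K: "octad K" and pz: "B_hom K pz"
 shows "octadic_root K pz = oroot K (twist pz (q K))"
proof -
 interpret S: osec C mult unit m1 bar \<omega> \<Omega> K "q K" by (rule osIq[OF hqq[OF K]])
 have "S.ow = lift K" unfolding S.ow_def q_compl[OF K] Ocqa by simp
 then show ?thesis unfolding octadic_root_def S.otaq[OF pz] by (simp add: mult.commute)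
qed
lemma dualD: "pz : dual K ==> B_hom K pz" by (simp add: diq)
lemma ohq: "octad K ==> pz : dual K ==> hsec K (twist pz (q K))"
 by (rule htq[OF hqq dualD])
lemma ooq: assumes s: "hsec K s" obtains pz where "pz : dual K" "oroot K s = octadic_root K pz"
proof -
 note K = hsecD(1)[OF s]
 obtain fz where fz: "B_hom K fz" "oroot K s = oroot K (twist fz (q K))" by (rule stqa[OF hqq[OF K] s])
 have h: "B_hom K (restrict fz (B K))" using fz(1) B_sd by (simp add: B_hom_def)
 have "oroot K s = oroot K (twist (restrict fz (B K)) (q K))" unfolding fz(2) by (rule otcq) simp
 then show ?thesis using that[of "restrict fz (B K)"] h oroq[OF K h] by (simp add: diq)
qed
lemma oiqa: assumes K: "octad K" and d: "pz : dual K" "fz : dual K" and e: "octadic_root K pz = octadic_root K fz"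
 shows "pz = fz"
proof (rule extensionalityI[of _ "B K"])
 show "pz : extensional (B K)" "fz : extensional (B K)" using d by (simp_all add: diq)
 fix b assume b: "b : B K"
 have "oroot K (twist pz (q K)) = 1 *s oroot K (twist fz (q K))" using e oroq[OF K dualD[OF d(1)]] oroq[OF K dualD[OF d(2)]] by simp
 from oiqc(1)[OF ohq[OF K d(1)] ohq[OF K d(2)] this b]
 show "pz b = fz b" using Bhq(1)[OF dualD[OF d(1)] b] Bhq(1)[OF dualD[OF d(2)] b] neg_neq[of "q K b"] unfolding twist_def by (metis one_neq_neg_one)
qed
definition octadics :: "'i set set => (complex ^ ('i + 'p)) set" where
 "octadics A = (%(K, pz). octadic_root K pz) ` (SIGMA K:A. dual K)"
definition duadics :: "'i set set => (complex ^ ('i + 'p)) set" where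
 "duadics A = (%(p, pz, pz'). octadic_root (F p) pz \<star> octadic_root (F' p) pz') ` (SIGMA p:A. dual (F p) \<times> dual (F' p))"
lemma oEq: assumes "r : octadics {K. octad K & P K}"
 obtains K s where "hsec K s" "P K" "r = oroot K s"
proof -
 obtain K pz where "octad K" "P K" "pz : dual K" "r = octadic_root K pz" using assms unfolding octadics_def by auto
 then show ?thesis using that ohq oroq[OF _ dualD] by metis
qed
lemma oIqb: assumes "hsec K s" "P K" shows "oroot K s : octadics {K. octad K & P K}"
proof -
 obtain pz where "pz : dual K" "oroot K s = octadic_root K pz" by (rule ooq[OF assms(1)])
 then show ?thesis unfolding octadics_def using assms hsecD(1)[OF assms(1)] by force
qed
lemma dEq: assumes "r : duadics {p. card p = 2 & P p}"
 obtains p s t where "card p = 2" "P p" "hsec (F p) s" "hsec (F' p) t" "F p Int F' p = p" "r = oroot (F p) s \<star> oroot (F' p) t"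
proof -
 obtain p pz fz where p: "card p = 2" "P p" "pz : dual (F p)" "fz : dual (F' p)" "r = octadic_root (F p) pz \<star> octadic_root (F' p) fz" using assms unfolding duadics_def by auto
 note o = octad_F[OF p(1)] octad_F'[OF p(1)]
 show ?thesis by (rule that[OF p(1,2) ohq[OF o(1) p(3)] ohq[OF o(2) p(4)] inter_F[OF p(1)]])
 (simp add: p(5) oroq[OF o(1) dualD[OF p(3)]] oroq[OF o(2) dualD[OF p(4)]])
qed
lemma dIq: assumes r: "rep K H r" and c: "card (K Int H) = 2" and P: "P (K Int H)" shows "r : duadics {p. card p = 2 & P p}"
proof -
 let ?p = "K Int H"
 obtain s t where st: "hsec (F ?p) s" "hsec (F' ?p) t" "r = oroot (F ?p) s \<star> oroot (F' ?p) t"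
 using pcqa[OF r c octad_F[OF c] octad_F'[OF c] inter_F[OF c]] unfolding rep_def by blast
 obtain pz where pz: "pz : dual (F ?p)" "oroot (F ?p) s = octadic_root (F ?p) pz" by (rule ooq[OF st(1)])
 obtain fz where fz: "fz : dual (F' ?p)" "oroot (F' ?p) t = octadic_root (F' ?p) fz" by (rule ooq[OF st(2)])
 have "(?p, pz, fz) : (SIGMA p:{p. card p = 2 & P p}. dual (F p) \<times> dual (F' p))" using c P pz fz by simp
 then show ?thesis unfolding duadics_def st(3) pz(2) fz(2) by (rule rev_image_eqI) simp
qed
text \<open>The predicate restricts the support of octadic and duadic roots, so that a single count
  yields both the number of all roots and the number of roots supported at a given point.\<close>

definition rootset :: "'i set => ('i set => bool) => (complex ^ ('i + 'p)) set" where
 "rootset A P = broot ` A Un octadics {K. octad K & P K} Un duadics {p. card p = 2 & P p}"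
lemma riq: "r : rootset A P \<longleftrightarrow> (EX i:A. r = broot i) | (EX K s. hsec K s & P K & r = oroot K s)
 | (EX K H. card (K Int H) = 2 & P (K Int H) & rep K H r)"
proof
 assume "r : rootset A P"
 then consider "r : broot ` A" | "r : octadics {K. octad K & P K}" | "r : duadics {p. card p = 2 & P p}" unfolding rootset_def by blast
 then show "(EX i:A. r = broot i) | (EX K s. hsec K s & P K & r = oroot K s) | (EX K H. card (K Int H) = 2 & P (K Int H) & rep K H r)"
 proof cases
 case 2 then show ?thesis by (rule oEq) blast
 next
 case 3 then show ?thesis
 proof (rule dEq)
 fix p s t assume a: "card p = 2" "P p" "hsec (F p) s" "hsec (F' p) t" "F p Int F' p = p" "r = oroot (F p) s \<star> oroot (F' p) t"
 have "rep (F p) (F' p) r" unfolding rep_def using a by blast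
 then show ?thesis using a(1,2,5) by metis
 qed
 qed blast
next
 assume "(EX i:A. r = broot i) | (EX K s. hsec K s & P K & r = oroot K s) | (EX K H. card (K Int H) = 2 & P (K Int H) & rep K H r)"
 then show "r : rootset A P"
 proof (elim disjE bexE exE conjE)
 fix i assume "i : A" "r = broot i" then show ?thesis unfolding rootset_def by simp
 next
 fix K s assume "hsec K s" "P K" "r = oroot K s" then show ?thesis unfolding rootset_def using oIqb[of K s P] by simp
 next
 fix K H assume "card (K Int H) = 2" "P (K Int H)" "rep K H r"
 then show ?thesis unfolding rootset_def using dIq[of K H r P] by simp
 qed
qed
lemma rsqa: assumes "r : rootset A P" shows "rt0 r"
 using assms unfolding riq rt0_def by (elim disjE bexE exE conjE) blast+
lemma rrqa: "r : rootset UNIV (%_. True) \<longleftrightarrow> rt0 r"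
 unfolding riq rt0_def by blast
lemma reqa: "roots = {r. rt0 r}"
proof -
 have "{octadic_root K pz | K pz. octad K & pz : dual K} = octadics {K. octad K & True}"
 unfolding octadics_def by (rule Set.set_eqI) (simp add: image_iff, blast)
 moreover have "{octadic_root (F p) pz \<star> octadic_root (F' p) pz' | p pz pz'. card p = 2 & pz : dual (F p) & pz' : dual (F' p)} = duadics {p. card p = 2 & True}"
 unfolding duadics_def by (rule Set.set_eqI) (simp add: image_iff, blast)
 moreover have "{basic_root i | i. True} = range broot" unfolding brbq by blast
 ultimately have "roots = rootset UNIV (%_. True)" unfolding roots_def rootset_def by simp
 then show ?thesis using rrqa by blast
qed
definition support :: "complex ^ ('i + 'p) => 'i set" where "support r = {i. herm r (broot i) ~= 0}"
lemma support: "support (broot i) = UNIV" "hsec K s ==> support (oroot K s) = K"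
 "hsec K s ==> hsec H t ==> card (K Int H) = 2 ==> support (oroot K s \<star> oroot H t) = K Int H"
proof -
 show "support (oroot K s) = K" if s: "hsec K s"
 unfolding support_def osec.hobq[OF osIq[OF s]] by simp
 show "support (oroot K s \<star> oroot H t) = K Int H" if "hsec K s" "hsec H t" "card (K Int H) = 2"
 unfolding support_def hsbq[OF that] by auto
qed (simp add: support_def hbbq)
lemma coqa: "card (octadics {K. octad K & P K}) = 32 * card {K. octad K & P K}"
proof -
 have "inj_on (%(K, pz). octadic_root K pz) (SIGMA K:{K. octad K & P K}. dual K)"
 proof (rule inj_onI, clarify)
 fix K pz K' pz' assume a: "octad K" "octad K'" "pz : dual K" "pz' : dual K'" and e: "octadic_root K pz = octadic_root K' pz'"
 have "support (octadic_root K pz) = K" "support (octadic_root K' pz') = K'"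
 unfolding oroq[OF a(1) dualD[OF a(3)]] oroq[OF a(2) dualD[OF a(4)]]
 by (rule support(2)[OF ohq[OF a(1,3)]], rule support(2)[OF ohq[OF a(2,4)]])
 then have k: "K = K'" using e by simp
 then show "K = K' & pz = pz'" using oiqa[OF a(1,3)] a(4) e by simp
 qed
 then have "card (octadics {K. octad K & P K}) = card (SIGMA K:{K. octad K & P K}. dual K)" unfolding octadics_def by (rule card_image)
 also have "... = (SUM K:{K. octad K & P K}. card (dual K))"
 proof (rule card_SigmaI)
 have "finite (dual K)" if "octad K" for K using cdq[OF that] card_ge_0_finite[of "dual K"] by simp
 then show "ALL K:{K. octad K & P K}. finite (dual K)" by simp
 qed simp
 also have "... = (SUM K:{K. octad K & P K}. 32)" by (rule sum.cong) (auto simp: cdq)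
 finally show ?thesis by simp
qed
lemma cdqa: "card (duadics {p. card p = 2 & P p}) = 1024 * card {p :: 'i set. card p = 2 & P p}"
proof -
 have "inj_on (%(p, pz, pz'). octadic_root (F p) pz \<star> octadic_root (F' p) pz') (SIGMA p:{p. card p = 2 & P p}. dual (F p) \<times> dual (F' p))"
 proof (rule inj_onI, clarify)
 fix p pz fz p' pz' fz'
 assume p: "card p = 2" "card p' = 2" and a: "pz : dual (F p)" "fz : dual (F' p)" "pz' : dual (F p')" "fz' : dual (F' p')"
 and e: "octadic_root (F p) pz \<star> octadic_root (F' p) fz = octadic_root (F p') pz' \<star> octadic_root (F' p') fz'"
 have or: "octadic_root (F p) pz = oroot (F p) (twist pz (q (F p)))" "octadic_root (F' p) fz = oroot (F' p) (twist fz (q (F' p)))"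
 if "card p = 2" "pz : dual (F p)" "fz : dual (F' p)" for p pz fz
 using oroq[OF octad_F[OF that(1)] dualD[OF that(2)]] oroq[OF octad_F'[OF that(1)] dualD[OF that(3)]] by simp_all
 have hs: "hsec (F p) (twist pz (q (F p)))" "hsec (F' p) (twist fz (q (F' p)))" if "card p = 2" "pz : dual (F p)" "fz : dual (F' p)" for p pz fz
 using ohq[OF octad_F[OF that(1)] that(2)] ohq[OF octad_F'[OF that(1)] that(3)] by simp_all
 have su: "support (octadic_root (F p) pz \<star> octadic_root (F' p) fz) = p" if "card p = 2" "pz : dual (F p)" "fz : dual (F' p)" for p pz fz
 using support(3)[OF hs[OF that]] unfolding or[OF that] inter_F[OF that(1)] using that(1) by simp
 have pp: "p = p'" using su[OF p(1) a(1,2)] su[OF p(2) a(3,4)] e by simp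
 note a' = a(3,4)[folded pp]
 have "octadic_root (F p) pz = octadic_root (F p) pz' & octadic_root (F' p) fz = octadic_root (F' p) fz'"
 using diqa[OF hs(1)[OF p(1) a(1,2)] hs(1)[OF p(1) a'] hs(2)[OF p(1) a(1,2)] hs(2)[OF p(1) a']] e
 unfolding or[OF p(1) a(1,2)] or[OF p(1) a'] inter_F[OF p(1)] pp[symmetric] or[OF p(1) a'] using p(1) by simp
 then show "p = p' & (pz, fz) = (pz', fz')"
 using pp oiqa[OF octad_F[OF p(1)] a(1) a'(1)] oiqa[OF octad_F'[OF p(1)] a(2) a'(2)] by simp
 qed
 then have "card (duadics {p. card p = 2 & P p}) = card (SIGMA p:{p. card p = 2 & P p}. dual (F p) \<times> dual (F' p))" unfolding duadics_def by (rule card_image)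
 also have "... = (SUM p:{p. card p = 2 & P p}. card (dual (F p) \<times> dual (F' p)))"
 proof (rule card_SigmaI)
 have "finite (dual K)" if "octad K" for K using cdq[OF that] card_ge_0_finite[of "dual K"] by simp
 then show "ALL p:{p. card p = 2 & P p}. finite (dual (F p) \<times> dual (F' p))" using octad_F octad_F' by simp
 qed simp
 also have "... = (SUM p:{p :: 'i set. card p = 2 & P p}. 1024)"
 by (rule sum.cong) (auto simp: card_cartesian_product cdq octad_F octad_F')
 finally show ?thesis by simp
qed
text \<open>The three families are disjoint because their supports have 24, 8 and 2 points. The
  factors are the 32 characters for an octad and 32 * 32 for a pair of octads.\<close>

lemma crqa: "card (rootset A P) = card A + 32 * card {K. octad K & P K} + 1024 * card {p :: 'i set. card p = 2 & P p}"
proof -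
 let ?O = "octadics {K. octad K & P K}" and ?U = "duadics {p. card p = 2 & P p}"
 have b: "card (support r) = 24" if "r : broot ` A" for r using that card_index by (auto simp: support)
 have o: "card (support r) = 8" if "r : ?O" for r
 using that by (rule oEq) (simp add: support(2) octadD(2)[OF hsecD(1)])
 have u: "card (support r) = 2" if "r : ?U" for r
 using that by (rule dEq) (simp add: support(3))
 have "inj_on broot A"
 proof (rule inj_onI)
 fix i j assume "broot i = broot j"
 then have "herm (broot i) (broot j) = 9" using hbbq[of j j] by simp
 then show "i = j" by (auto simp: hbbq split: if_splits)
 qed
 then have cb: "card (broot ` A) = card A" by (rule card_image)
 have fin: "finite (broot ` A)" "finite ?O" "finite ?U"
 proof -
 have d: "finite (dual K)" if "octad K" for K using cdq[OF that] card_ge_0_finite[of "dual K"] by simp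
 show "finite ?O" unfolding octadics_def by (rule finite_imageI, rule finite_SigmaI) (use d in auto)
 show "finite ?U" unfolding duadics_def by (rule finite_imageI, rule finite_SigmaI) (use d octad_F octad_F' in auto)
 qed simp
 have "r ~: ?O" if "r : broot ` A" for r using b[OF that] o[of r] by auto
 then have 1: "broot ` A Int ?O = {}" by blast
 have "r ~: ?U" if "r : broot ` A Un ?O" for r using that b[of r] o[of r] u[of r] by auto
 then have 2: "(broot ` A Un ?O) Int ?U = {}" by blast
 show ?thesis unfolding rootset_def card_Un_disjoint[OF finite_UnI[OF fin(1,2)] fin(3) 2] card_Un_disjoint[OF fin(1,2) 1]
 cb coqa cdqa ..
qed
text \<open>The total is 24 + 32 * 759 + 1024 * 276.\<close>

lemma crqb: "card {r. rt0 r} = 306936"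
proof -
 have "{p :: 'i set. card p = 2 & True} = {p. p <= UNIV & card p = 2}" by auto
 then have "card {p :: 'i set. card p = 2 & True} = 276" using n_subsets[of "UNIV :: 'i set" 2] card_index by (simp add: choose_two)
 moreover have "{r. rt0 r} = rootset UNIV (%_. True)" using rrqa by blast
 ultimately show ?thesis using crqa[of UNIV "%_. True"] card_index coqb by simp
qed
text \<open>Other basic roots, octads through \<open>i\<close> and pairs through \<open>i\<close>:
  23 + 32 * 253 + 1024 * 23.\<close>

lemma ccqa: "card (rootset (- {i}) (%A. i : A)) = 31671"
proof -
 have "p : {p. card p = 2 & i : p} \<longleftrightarrow> p : (%j. {i, j}) ` (- {i})" for p :: "'i set"
 by (auto simp: card_2_iff image_iff doubleton_eq_iff)
 then have e: "{p. card p = 2 & i : p} = (%j. {i, j}) ` (- {i})" by blast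
 have "inj_on (%j. {i, j}) (- {i})" by (auto simp: inj_on_def doubleton_eq_iff)
 then have "card {p. card p = 2 & i : p} = 23" unfolding e using card_image cCq[of "{i}"] card_index by fastforce
 moreover have "card (- {i}) = 23" using cCq[of "{i}"] card_index by simp
 ultimately show ?thesis unfolding crqa cocq by simp
qed
lemma rrrq: "root_rays = ray ` {r. rt0 r}" unfolding root_rays_def reqa ..
lemma rEq: assumes "y : root_rays" obtains r where "rt0 r" "y = ray r"
 using assms unfolding rrrq by (elim imageE CollectE) (rule that)
lemma rrqb: assumes "rt r" shows "ray r : root_rays"
proof -
 obtain c r0 where c: "mu3 c" "rt0 r0" "r = c *s r0" by (rule rt_E[OF assms])
 show ?thesis unfolding c(3) rsq[OF c(1)] rrrq using c(2) by blast
qed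
text \<open>Makes the permutation depend on a ray, as the abstract lemma requires. The
  representative chosen is immaterial by \<open>rpcq\<close>, since rescaling a root by a cube root
  of unity only rescales its map.\<close>

definition act :: "(complex ^ ('i + 'p)) set => (complex ^ ('i + 'p)) set => (complex ^ ('i + 'p)) set" where
 "act y = ray_perm (SOME r. rt0 r & ray r = y)"
lemma rpcq: assumes "ray r = ray s" shows "ray_perm r = ray_perm s"
proof -
 obtain c where c: "mu3 c" "r = c *s s" by (rule req[OF assms])
 have "tau r ` y = tau s ` y" if y: "y : root_rays" for y
 proof -
 obtain t where t: "y = ray t" by (rule rEq[OF y])
 show ?thesis unfolding t trq c(2) tmqb[OF c(1)] by (rule rsq[OF mu3(2)[OF c(1)]])
 qed
 then show ?thesis unfolding ray_perm_def by (rule restrict_ext)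
qed
lemma apq: assumes "rt0 r" shows "act (ray r) = ray_perm r"
 unfolding act_def
proof (rule rpcq)
 have "rt0 (SOME s. rt0 s & ray s = ray r) & ray (SOME s. rt0 s & ray s = ray r) = ray r"
 by (rule someI[of _ r]) (simp add: assms)
 then show "ray (SOME s. rt0 s & ray s = ray r) = ray r" by (rule conjunct2)
qed
lemma arq: assumes r: "rt r" and s: "rt s" shows "act (ray r) (ray s) = ray (tau r s)"
proof -
 obtain c r0 where c: "mu3 c" "rt0 r0" "r = c *s r0" by (rule rt_E[OF r])
 have "ray r = ray r0" unfolding c(3) by (rule rsq[OF c(1)])
 then have 1: "act (ray r) = ray_perm r0" by (simp only: apq[OF c(2)])
 have 2: "ray (tau r s) = ray (tau r0 s)" unfolding c(3) tmqb[OF c(1)] by (rule rsq[OF mu3(2)[OF c(1)]])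
 have 3: "ray_perm r0 (ray s) = tau r0 ` ray s" unfolding ray_perm_def by (rule restrict_apply'[OF rrqb[OF s]])
 show ?thesis unfolding 1 2 3 by (rule trq)
qed
lemma DCaq: "D_CP = act ` root_rays"
proof -
 have "x : D_CP \<longleftrightarrow> x : act ` root_rays" for x
 proof
 assume "x : D_CP"
 then obtain r where r: "ray r : root_rays" "x = ray_perm r" unfolding D_CP_def by (elim CollectE exE conjE) (rule that)
 obtain s where s: "rt0 s" "ray r = ray s" by (rule rEq[OF r(1)])
 have "x = act (ray r)" unfolding r(2) s(2) apq[OF s(1)] by (rule rpcq[OF s(2)])
 then show "x : act ` root_rays" using r(1) by blast
 next
 assume "x : act ` root_rays"
 then obtain y where y: "y : root_rays" "x = act y" by (rule imageE)
 obtain s' where s': "rt0 s'" "y = ray s'" by (rule rEq[OF y(1)])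
 note s = s'(1) y(2)[unfolded s'(2)]
 show "x : D_CP" unfolding D_CP_def s(2) apq[OF s(1)] using raqa[OF s(1)] rrqb[OF rrq[OF s(1)]] by blast
 qed
 then show ?thesis by blast
qed
text \<open>From the basic root at \<open>i\<close> one reaches an octadic root over any octad
  missing \<open>i\<close>, and from it the basic root at any other point off this octad; some octad
  misses any two given points. Octadic and then duadic roots follow.\<close>

lemma rrqc: fixes i :: 'i assumes "y : root_rays"
 shows "EX ws. set ws <= root_rays & foldr act ws (ray (broot i)) = y"
proof -
 define R where "R y \<longleftrightarrow> (EX ws. set ws <= root_rays & foldr act ws (ray (broot i)) = y)" for y
 have R0: "R (ray (broot i))" unfolding R_def by (rule exI[of _ "[]"]) simp
 have step: "R (ray (tau r s))" if rs: "rt0 r" "rt0 s" "R (ray s)" for r s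
 proof -
 obtain ws where "set ws <= root_rays" "foldr act ws (ray (broot i)) = ray s" using rs(3) unfolding R_def by blast
 then show ?thesis unfolding R_def using arq[OF rrq[OF rs(1)] rrq[OF rs(2)]] rrqb[OF rrq[OF rs(1)]]
 by (intro exI[of _ "ray r # ws"]) simp
 qed
 have up: "R (ray (oroot K s))" if s: "hsec K s" and x: "x ~: K" "R (ray (broot x))" for K s x
 using step[OF rt0_I(2)[OF htq[OF s Bhpq]] rt0_I(1) x(2), of x] unfolding ofbq(1)[OF s x(1)] .
 have b: "R (ray (broot j))" for j
 proof -
 obtain K where K: "octad K" "i ~: K" "j ~: K" by (rule oaqc)
 note s = hqq[OF K(1)]
 show ?thesis using step[OF rt0_I(2)[OF htq[OF s Bhpq]] rt0_I(2)[OF s] up[OF s K(2) R0], of j]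
 unfolding ofbq(2)[OF s K(3)] .
 qed
 have o: "R (ray (oroot K s))" if s: "hsec K s" for K s
 proof -
 obtain x where "x ~: K" by (rule enioq[OF hsecD(1)[OF s]])
 then show ?thesis using up[OF s _ b] by blast
 qed
 obtain r where r: "rt0 r" "y = ray r" by (rule rEq[OF assms])
 have "R (ray r)" using r(1)
 proof (cases rule: rcq)
 case (duadic K k H h)
 show ?thesis unfolding duadic(4) stq(1)[OF duadic(1-3)] by (rule step[OF rt0_I(2)[OF duadic(1)] rt0_I(2)[OF duadic(2)] o[OF duadic(2)]])
 qed (simp_all add: b o)
 then show ?thesis unfolding R_def r(2) .
qed
lemma hrq: assumes "rt0 r" shows "herm (broot i) r ~= 0 & r ~= broot i \<longleftrightarrow> r : rootset (- {i}) (%A. i : A)"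
proof -
 have h: "herm (broot i) r ~= 0 \<longleftrightarrow> i : support r" unfolding support_def using hzsq by blast
 have s8: "card (support (broot j)) = 24" for j using card_index by (simp add: support)
 show ?thesis
 proof
 assume a: "herm (broot i) r ~= 0 & r ~= broot i"
 show "r : rootset (- {i}) (%A. i : A)" using assms
 proof (cases rule: rcq)
 case (basic j)
 have "j ~= i" using a basic by auto
 then show ?thesis unfolding riq by (intro disjI1 bexI[of _ j]) (simp_all add: basic)
 next
 case (octadic K s)
 have "support r = K" unfolding octadic(2) by (rule support(2)[OF octadic(1)])
 then have "i : K" using a h by simp
 then show ?thesis using octadic unfolding riq by blast
 next
 case (duadic K s H t)
 have "support r = K Int H" unfolding duadic(4) by (rule support(3)[OF duadic(1-3)])
 then have "i : K Int H" using a h by simp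
 moreover have "rep K H r" unfolding rep_def using duadic(1,2,4) by blast
 ultimately show ?thesis using duadic(3) unfolding riq by blast
 qed
 next
 assume "r : rootset (- {i}) (%A. i : A)"
 then consider j where "j ~= i" "r = broot j" | K s where "hsec K s" "i : K" "r = oroot K s"
 | K H s t where "card (K Int H) = 2" "i : K Int H" "hsec K s" "hsec H t" "r = oroot K s \<star> oroot H t" unfolding riq rep_def by blast
 then show "herm (broot i) r ~= 0 & r ~= broot i"
 proof cases
 case 1
 have "broot j ~= broot i" using 1(1) hbbq[of j i] hbbq[of i i] by auto
 then show ?thesis using h unfolding 1(2) support(1) by simp
 next
 case 2
 have S: "support r = K" unfolding 2(3) by (rule support(2)[OF 2(1)])
 have "card (support r) = 8" "i : support r" unfolding S using 2(2) octadD(2)[OF hsecD(1)[OF 2(1)]] by simp_all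
 then show ?thesis using h s8[of i] by auto
 next
 case 3
 have S: "support r = K Int H" unfolding 3(5) by (rule support(3)[OF 3(3,4,1)])
 have "card (support r) = 2" "i : support r" unfolding S by (rule 3(1), rule 3(2))
 then show ?thesis using h s8[of i] by auto
 qed
 qed
qed
lemma afq: assumes "rt0 r" "rt0 s" shows "act (ray r) (ray s) = ray s \<longleftrightarrow> herm r s ~= 0"
 unfolding arq[OF rrq[OF assms(1)] rrq[OF assms(2)]] by (rule fiq[OF assms])
text \<open>Equal permutations have equal fixed rays, hence the same roots orthogonal to their axes.
  Nonorthogonality to every basic root forces full support, so the root is basic, and an octad
  through \<open>i\<close> that misses \<open>j\<close> separates two distinct basic roots.\<close>

lemma aiq: fixes i :: 'i assumes y: "y : root_rays" and e: "act y = act (ray (broot i))" shows "y = ray (broot i)"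
proof -
 obtain r where r: "rt0 r" "y = ray r" by (rule rEq[OF y])
 have iff: "herm r s ~= 0 \<longleftrightarrow> herm (broot i) s ~= 0" if "rt0 s" for s
 using afq[OF r(1) that] afq[OF rt0_I(1)[of i] that] e unfolding r(2) by simp
 have "herm r (broot j) ~= 0" for j using iff[OF rt0_I(1)] by (simp add: hbbq)
 then have sup: "support r = UNIV" unfolding support_def by simp
 show ?thesis using r(1)
 proof (cases rule: rcq)
 case (basic j)
 show ?thesis
 proof (cases "i = j")
 case False
 obtain K where K: "octad K" "i : K" "j ~: K" by (rule osq[OF False])
 interpret S: osec C mult unit m1 bar \<omega> \<Omega> K "q K" by (rule osIq[OF hqq[OF K(1)]])
 have "herm (broot j) (oroot K (q K)) = 0" using hzsq S.hobq[of j] K by simp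
 moreover have "herm (broot i) (oroot K (q K)) ~= 0" using hzsq[of "broot i"] S.hobq[of i] K by auto
 ultimately show ?thesis using iff[OF rt0_I(2)[OF S.hs]] basic by simp
 qed (simp add: r(2) basic)
 next
 case (octadic K s)
 then have "K = UNIV" using sup support(2)[OF octadic(1)] octadic(2) by simp
 then show ?thesis using octadD(2)[OF hsecD(1)[OF octadic(1)]] card_index by simp
 next
 case (duadic K s H t)
 then have "K Int H = UNIV" using sup support(3)[OF duadic(1-3)] duadic(4) by simp
 then show ?thesis using duadic(3) card_index by simp
 qed
qed
theorem conway_parker_group:
 "finite (carrier G_CP) & group_center G_CP = {\<one>\<^bsub>G_CP\<^esub>} & three_transposition_group G_CP D_CP
 & (EX d:carrier G_CP. D_CP = conjugacy_class G_CP d) & card D_CP = 306936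
 & graph_has_degree D_CP (diagram G_CP D_CP) 275264
 & graph_has_degree D_CP (commuting_codiagram G_CP D_CP) 31671"
\<comment> \<open>The base point is the ray of a basic root at an arbitrary point, here
  \<open>undefined\<close>.\<close>
proof (rule ttqq[where Y=root_rays and d=act and xb="ray (broot undefined)"])
 let ?b = "broot undefined"
 have inj: "inj_on ray {r. rt0 r}" by (rule inj_onI, rule riqa, simp_all)
 show c: "card root_rays = 306936" unfolding rrrq card_image[OF inj] by (rule crqb)
 show "finite root_rays" using c card_ge_0_finite[of root_rays] by simp
 show "ray ?b : root_rays" by (rule rrqb[OF rrq[OF rt0_I(1)]])
 have E: "EX r. rt0 r & x = ray r" if "x : root_rays" for x by (rule rEq[OF that]) blast
 show "act x : extensional root_rays" if "x : root_rays" for x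
 using E[OF that] apq by (auto simp: ray_perm_def)
 show "act x y : root_rays" if xy: "x : root_rays" "y : root_rays" for x y
 proof -
 obtain r where r: "rt0 r" "x = ray r" by (rule rEq[OF xy(1)])
 obtain s where s: "rt0 s" "y = ray s" by (rule rEq[OF xy(2)])
 note rs = r s
 show ?thesis unfolding rs(2,4) arq[OF rrq[OF rs(1)] rrq[OF rs(3)]] by (rule rrqb[OF rtq[OF rs(1) rrq[OF rs(3)]]])
 qed
 show "act x (act x y) = y" if xy: "x : root_rays" "y : root_rays" for x y
 proof -
 obtain r where r: "rt0 r" "x = ray r" by (rule rEq[OF xy(1)])
 obtain s where s: "rt0 s" "y = ray s" by (rule rEq[OF xy(2)])
 note rs = r s
 note t = rrq[OF rs(1)] rrq[OF rs(3)]
 show ?thesis unfolding rs(2,4) arq[OF t] arq[OF t(1) rtq[OF rs(1) t(2)]] triq[OF rs(1) rVq[OF rs(3)]] ..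
 qed
 show "act x (act y z) = act (act x y) (act x z)" if xy: "x : root_rays" "y : root_rays" "z : root_rays" for x y z
 proof -
 obtain r where r: "rt0 r" "x = ray r" by (rule rEq[OF xy(1)])
 obtain s where s: "rt0 s" "y = ray s" by (rule rEq[OF xy(2)])
 obtain v where v: "rt0 v" "z = ray v" by (rule rEq[OF xy(3)])
 note rs = r s v
 note t = rrq[OF rs(1)] rrq[OF rs(3)] rrq[OF rs(5)]
 show ?thesis unfolding rs(2,4,6) arq[OF t(1,2)] arq[OF t(2,3)] arq[OF t(1,3)] arq[OF t(1) rtq[OF rs(3) t(3)]]
 arq[OF rtq[OF rs(1) t(2)] rtq[OF rs(1) t(3)]]
 ccq[OF isrootD(2)[OF irq[OF rs(1)]] rVq[OF rs(3)] rVq[OF rs(5)]] ..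
 qed
 show "act x y = y | act x y = act y x" if xy: "x : root_rays" "y : root_rays" for x y
 proof -
 obtain r where r: "rt0 r" "x = ray r" by (rule rEq[OF xy(1)])
 obtain s where s: "rt0 s" "y = ray s" by (rule rEq[OF xy(2)])
 note rs = r s
 note t = rrq[OF rs(1)] rrq[OF rs(3)]
 show ?thesis
 proof (cases "herm r s = 0")
 case True
 have "tau r s = tau s r" using tzq[OF True] tzq[OF hzsq[OF True]] by (simp add: star_commute)
 then show ?thesis unfolding rs(2,4) arq[OF t] arq[OF t(2,1)] by simp
 next
 case False then show ?thesis using afq[OF rs(1,3)] rs(2,4) by simp
 qed
 qed
 show "y = ray ?b" if "y : root_rays" "act y = act (ray ?b)" for y by (rule aiq[OF that])
 show "EX ws. set ws <= root_rays & foldr act ws (ray ?b) = y" if "y : root_rays" for y by (rule rrqc[OF that])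
 have "y : {y : root_rays. y ~= ray ?b & act (ray ?b) y = y} \<longleftrightarrow> y : ray ` rootset (- {undefined}) (%A. undefined : A)" for y
 proof
 assume "y : {y : root_rays. y ~= ray ?b & act (ray ?b) y = y}"
 then have y: "y : root_rays" "y ~= ray ?b" "act (ray ?b) y = y" by simp_all
 obtain r where r: "rt0 r" "y = ray r" by (rule rEq[OF y(1)])
 have "herm ?b r ~= 0" using afq[OF rt0_I(1) r(1), of undefined] y(3) unfolding r(2) by simp
 moreover have "r ~= ?b" using y(2) unfolding r(2) by auto
 ultimately have "r : rootset (- {undefined}) (%A. undefined : A)" by (intro iffD1[OF hrq[OF r(1)]] conjI)
 then show "y : ray ` rootset (- {undefined}) (%A. undefined : A)" unfolding r(2) by (rule imageI)
 next
 assume "y : ray ` rootset (- {undefined}) (%A. undefined : A)"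
 then obtain r where r: "r : rootset (- {undefined}) (%A. undefined : A)" "y = ray r" by (elim imageE) (rule that)
 have r0: "rt0 r" by (rule rsqa[OF r(1)])
 have h: "herm ?b r ~= 0" "r ~= ?b" using hrq[OF r0, of undefined] r(1) by simp_all
 have "ray r ~= ray ?b" using riqa[OF r0 rt0_I(1)] h(2) by blast
 then show "y : {y : root_rays. y ~= ray ?b & act (ray ?b) y = y}"
 using afq[OF rt0_I(1) r0, of undefined] h(1) rrqb[OF rrq[OF r0]] r(2) by simp
 qed
 then have e: "{y : root_rays. y ~= ray ?b & act (ray ?b) y = y} = ray ` rootset (- {undefined}) (%A. undefined : A)" by blast
 have i: "inj_on ray (rootset (- {undefined}) (%A. undefined : A))"
 by (rule inj_on_subset[OF inj]) (use rsqa in blast)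
 show "card {y : root_rays. y ~= ray ?b & act (ray ?b) y = y} = 31671"
 unfolding e card_image[OF i] by (rule ccqa)
 show "G_CP = (BijGroup root_rays)\<lparr>carrier := generate (BijGroup root_rays) D_CP\<rparr>" by (rule G_CP_def)
 show "D_CP = act ` root_rays" by (rule DCaq)
qed simp_all
end
theorem theorem3p5:
  fixes C :: "'i::finite set set"
    and mult :: "'p::finite \<Rightarrow> 'p \<Rightarrow> 'p" and unit :: 'p
    and m1 :: 'p and bar :: "'p \<Rightarrow> 'i set"
    and \<omega> :: complex and \<Omega> :: 'p
    and lift :: "'i set \<Rightarrow> 'p" and q :: "'i set \<Rightarrow> 'i set \<Rightarrow> 'p"
    and F F' :: "'i set \<Rightarrow> 'i set"
  assumes choices: "parker_roots C mult unit m1 bar \<omega> \<Omega> lift q F F'"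
    and G: "G = parker_roots.G_CP C mult m1 bar \<omega> \<Omega> lift q F F'"
    and D: "D = parker_roots.D_CP C mult m1 bar \<omega> \<Omega> lift q F F'"
  shows "finite (carrier G)
    \<and> group_center G = {\<one>\<^bsub>G\<^esub>}
    \<and> three_transposition_group G D
    \<and> (\<exists>d\<in>carrier G. D = conjugacy_class G d)
    \<and> card D = 306936
    \<and> graph_has_degree D (diagram G D) 275264
    \<and> graph_has_degree D (commuting_codiagram G D) 31671"
    using parker_roots.conway_parker_group[OF choices] unfolding G D .

end
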